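(* Let $\mathcal H$ and $f$ satisfy the assumptions listed in the context. The solution operator $S:L^2(0,T;H^1(\Omega)^* )\to H^1_0(0,T;L^2(\Omega))\times L^2(0,T;H^1(\Omega))$, $\ell\mapsto(q,\varphi)$, of the state system is directionally differentiable. Its directional derivative $(\delta q,\delta\varphi):=S'(\ell;\delta\ell)$ at $\ell\in L^2(0,T;H^1(\Omega)^* )$ in direction $\delta\ell\in L^2(0,T;H^1(\Omega)^* )$ is the unique solution of $$\dot{\delta q}(t)=\tfrac1\epsilon\max{}'\big(z(t);-\beta(\delta q(t)-\delta\varphi(t))-f'(\mathcal H(q);\mathcal H'(q)(\delta q))(t)\big)\ \text{ in }L^2(\Omega),\qquad\delta q(0)=0,$$ $$-\alpha\Delta\delta\varphi(t)+\beta\,\delta\varphi(t)=\beta\,\delta q(t)+\delta\ell(t)\ \text{ in }H^1(\Omega)^*,$$ a.e. in $(0,T)$, where $(q,\varphi)=S(\ell)$ and $z(t):=-\beta(q(t)-\varphi(t))-(f\circ\mathcal H)(q)(t)$.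
   Context: Setting: $T>0$; $\Omega\subset\mathbb R^N$, $N\in\{2,3\}$, is a bounded Lipschitz domain; $\alpha,\beta,\epsilon>0$ are constants. $\Delta:H^1(\Omega)\to H^1(\Omega)^*$ is given by $\langle\Delta\eta,\psi\rangle=-\int_\Omega\nabla\eta\cdot\nabla\psi\,dx$. $\max(x):=\max\{x,0\}$, and $\max'(v;h)$, $f'(v;h)$ denote directional derivatives at $v$ in direction $h$ (so $\max'(v;h)=h$ if $v>0$, $\max\{h,0\}$ if $v=0$, $0$ if $v<0$). Scalar functions also denote their Nemytskii operators. $H^1_0(0,T;X)=\{z\in H^1(0,T;X):z(0)=0\}$. A dot is the time derivative. Assumptions: (a) $\mathcal H:L^2(0,T;L^2(\Omega))\to L^2(0,T;L^2(\Omega))$ and there is $L_{\mathcal H}>0$ with $\|\mathcal H(q_1)(t)-\mathcal H(q_2)(t)\|_{L^2(\Omega)}\le L_{\mathcal H}\int_0^t\|q_1(s)-q_2(s)\|_{L^2(\Omega)}ds$ a.e. in $(0,T)$ for all $q_1,q_2\in L^2(0,T;L^2(\Omega))$; $\mathcal H$ is Gâteaux differentiable on $L^2(0,T;L^2(\Omega))$, with derivative $q\mapsto\mathcal H'(q)$ continuous on $H^1(0,T;L^2(\Omega))$. (b) $f:\mathbb R\to\mathbb R$ is Lipschitz continuous with constant $L_f>0$ and directionally differentiable. State system: for every $\ell\in L^2(0,T;H^1(\Omega)^* )$ there is a unique $(q,\varphi)=:S(\ell)\in H^1_0(0,T;L^2(\Omega))\times L^2(0,T;H^1(\Omega))$ such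 that, a.e. in $(0,T)$, $\dot q(t)=\frac1\epsilon\max(-\beta(q(t)-\varphi(t))-(f\circ\mathcal H)(q)(t))$ in $L^2(\Omega)$, $q(0)=0$, and $-\alpha\Delta\varphi(t)+\beta\varphi(t)=\beta q(t)+\ell(t)$ in $H^1(\Omega)^*$. *)

theory Defs
  imports "HOL-Analysis.Analysis" "HOL-Library.Function_Algebras"
begin

instantiation "fun" :: (type, real_vector) real_vector
begin

definition scaleR_fun :: "real \<Rightarrow> ('a \<Rightarrow> 'b) \<Rightarrow> 'a \<Rightarrow> 'b"
  where "scaleR_fun c f = (\<lambda>x. c *\<^sub>R f x)"

instance
  by standard (auto simp: scaleR_fun_def fun_eq_iff scaleR_add_right scaleR_add_left)

end

section \<open>Normed spaces of representatives\<close>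

text \<open>
  The function spaces below depend on the domain \<open>\<Omega>\<close> and on \<open>T\<close>, so they are not types. A normed
  space is given by a linear subspace of an ambient vector space of representatives together with
  a seminorm on it; \<open>x\<close> and \<open>y\<close> represent the same element iff the seminorm of \<open>x - y\<close> vanishes.
  Values of the seminorm outside the carrier are irrelevant.
\<close>

record 'v nspace =
  car :: "'v set"
  nrm :: "'v \<Rightarrow> real"

definition eq_in :: "'v::real_vector nspace \<Rightarrow> 'v \<Rightarrow> 'v \<Rightarrow> bool"
  where "eq_in X x y \<longleftrightarrow> nrm X (x - y) = 0"

definition real_space :: "real nspace"
  where "real_space = \<lparr>car = UNIV, nrm = abs\<rparr>"

definition prod_space :: "'v nspace \<Rightarrow> 'w nspace \<Rightarrow> ('v \<times> 'w) nspace"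
  where "prod_space X Y =
    \<lparr>car = car X \<times> car Y, nrm = (\<lambda>(x, y). sqrt ((nrm X x)\<^sup>2 + (nrm Y y)\<^sup>2))\<rparr>"

text \<open>A map between the spaces of classes, given on representatives.\<close>

definition operator_between ::
    "'v::real_vector nspace \<Rightarrow> 'w::real_vector nspace \<Rightarrow> ('v \<Rightarrow> 'w) \<Rightarrow> bool"
  where "operator_between X Y F \<longleftrightarrow>
    F \<in> car X \<rightarrow> car Y \<and> (\<forall>x\<in>car X. \<forall>y\<in>car X. eq_in X x y \<longrightarrow> eq_in Y (F x) (F y))"

definition bounded_ops ::
    "'v::real_vector nspace \<Rightarrow> 'w::real_vector nspace \<Rightarrow> ('v \<Rightarrow> 'w) nspace"
  where "bounded_ops X Y =
    \<lparr>car = {A. A \<in> car X \<rightarrow> car Y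
        \<and> (\<forall>x\<in>car X. \<forall>y\<in>car X. eq_in Y (A (x + y)) (A x + A y))
        \<and> (\<forall>c. \<forall>x\<in>car X. eq_in Y (A (c *\<^sub>R x)) (c *\<^sub>R A x))
        \<and> (\<exists>C. \<forall>x\<in>car X. nrm Y (A x) \<le> C * nrm X x)},
     nrm = (\<lambda>A. Sup {nrm Y (A x) |x. x \<in> car X \<and> nrm X x \<le> 1})\<rparr>"

definition dual :: "'v::real_vector nspace \<Rightarrow> ('v \<Rightarrow> real) nspace"
  where "dual X = bounded_ops X real_space"

definition has_dir_derivative ::
    "'w::real_vector nspace \<Rightarrow> ('v::real_vector \<Rightarrow> 'w) \<Rightarrow> 'v \<Rightarrow> 'v \<Rightarrow> 'w \<Rightarrow> bool"
  where "has_dir_derivative Y F x h d \<longleftrightarrow>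
    d \<in> car Y \<and> ((\<lambda>\<tau>. nrm Y ((1 / \<tau>) *\<^sub>R (F (x + \<tau> *\<^sub>R h) - F x) - d)) \<longlongrightarrow> 0) (at_right 0)"

definition directionally_differentiable ::
    "'v::real_vector nspace \<Rightarrow> 'w::real_vector nspace \<Rightarrow> ('v \<Rightarrow> 'w) \<Rightarrow> bool"
  where "directionally_differentiable X Y F \<longleftrightarrow>
    (\<forall>x\<in>car X. \<forall>h\<in>car X. \<exists>d. has_dir_derivative Y F x h d)"

definition has_gateaux_derivative ::
    "'v::real_vector nspace \<Rightarrow> 'w::real_vector nspace \<Rightarrow> ('v \<Rightarrow> 'w) \<Rightarrow> ('v \<Rightarrow> 'v \<Rightarrow> 'w) \<Rightarrow> bool"
  where "has_gateaux_derivative X Y F F' \<longleftrightarrow>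
    (\<forall>x\<in>car X. F' x \<in> car (bounded_ops X Y)
      \<and> (\<forall>h\<in>car X.
          ((\<lambda>\<tau>. nrm Y ((1 / \<tau>) *\<^sub>R (F (x + \<tau> *\<^sub>R h) - F x) - F' x h)) \<longlongrightarrow> 0) (at 0)))"

definition continuous_between ::
    "'v::real_vector nspace \<Rightarrow> 'w::real_vector nspace \<Rightarrow> ('v \<Rightarrow> 'w) \<Rightarrow> bool"
  where "continuous_between X Y F \<longleftrightarrow>
    (\<forall>x\<in>car X. \<forall>e>0. \<exists>d>0. \<forall>y\<in>car X. nrm X (y - x) < d \<longrightarrow> nrm Y (F y - F x) < e)"

section \<open>Directional derivatives of real functions\<close>

definition dir_diff_real :: "(real \<Rightarrow> real) \<Rightarrow> bool"
  where "dir_diff_real f \<longleftrightarrow>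
    (\<forall>v h. \<exists>l. ((\<lambda>\<tau>. (f (v + \<tau> * h) - f v) / \<tau>) \<longlongrightarrow> l) (at_right 0))"

definition dir_deriv :: "(real \<Rightarrow> real) \<Rightarrow> real \<Rightarrow> real \<Rightarrow> real"
  where "dir_deriv f v h = Lim (at_right 0) (\<lambda>\<tau>. (f (v + \<tau> * h) - f v) / \<tau>)"

definition pos :: "real \<Rightarrow> real"
  where "pos x = max x 0"

section \<open>Test functions\<close>

text \<open>
  \<open>C\<^sup>\<infinity>\<close> functions: coinductively, a function is smooth iff it is differentiable everywhere and all
  its directional derivatives are smooth.
\<close>

coinductive smooth :: "('a::euclidean_space \<Rightarrow> real) \<Rightarrow> bool"
  where "(\<forall>x. (f has_derivative D x) (at x)) \<Longrightarrow> (\<forall>v. smooth (\<lambda>x. D x v)) \<Longrightarrow> smooth f"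

definition test_function :: "'a::euclidean_space set \<Rightarrow> ('a \<Rightarrow> real) \<Rightarrow> bool"
  where "test_function U \<phi> \<longleftrightarrow>
    smooth \<phi> \<and> compact (closure {x. \<phi> x \<noteq> 0}) \<and> closure {x. \<phi> x \<noteq> 0} \<subseteq> U"

section \<open>Spaces on the spatial domain\<close>

text \<open>
  Locally, after a rigid change of coordinates with last axis \<open>e\<close>, the domain lies on one side of
  the graph of a Lipschitz function \<open>\<gamma>\<close> on the hyperplane orthogonal to \<open>e\<close>.
\<close>

definition bounded_lipschitz_domain :: "'a::euclidean_space set \<Rightarrow> bool"
  where "bounded_lipschitz_domain \<Omega> \<longleftrightarrow>
    \<Omega> \<noteq> {} \<and> open \<Omega> \<and> connected \<Omega> \<and> bounded \<Omega>
    \<and> (\<forall>x0\<in>frontier \<Omega>. \<exists>r>0. \<exists>e. norm e = 1 \<and>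
         (\<exists>\<gamma> L. L-lipschitz_on {y. y \<bullet> e = 0} \<gamma> \<and>
           \<Omega> \<inter> ball x0 r = {x \<in> ball x0 r. x \<bullet> e > \<gamma> (x - (x \<bullet> e) *\<^sub>R e)}))"

definition L2 :: "(real^'n) set \<Rightarrow> (real^'n \<Rightarrow> real) nspace"
  where "L2 \<Omega> =
    \<lparr>car = {u \<in> borel_measurable (lebesgue_on \<Omega>). integrable (lebesgue_on \<Omega>) (\<lambda>x. (u x)\<^sup>2)},
     nrm = (\<lambda>u. sqrt (LINT x|lebesgue_on \<Omega>. (u x)\<^sup>2))\<rparr>"

definition weak_gradient :: "(real^'n) set \<Rightarrow> (real^'n \<Rightarrow> real) \<Rightarrow> (real^'n \<Rightarrow> real^'n) \<Rightarrow> bool"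
  where "weak_gradient \<Omega> u g \<longleftrightarrow>
    (\<forall>i. (\<lambda>x. g x $ i) \<in> car (L2 \<Omega>) \<and>
      (\<forall>\<phi>. test_function \<Omega> \<phi> \<longrightarrow>
        (LINT x|lebesgue_on \<Omega>. u x * frechet_derivative \<phi> (at x) (axis i 1))
          = - (LINT x|lebesgue_on \<Omega>. g x $ i * \<phi> x)))"

definition grad :: "(real^'n) set \<Rightarrow> (real^'n \<Rightarrow> real) \<Rightarrow> real^'n \<Rightarrow> real^'n"
  where "grad \<Omega> u = (SOME g. weak_gradient \<Omega> u g)"

definition H1 :: "(real^'n) set \<Rightarrow> (real^'n \<Rightarrow> real) nspace"
  where "H1 \<Omega> =
    \<lparr>car = {u \<in> car (L2 \<Omega>). \<exists>g. weak_gradient \<Omega> u g},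
     nrm = (\<lambda>u. sqrt ((nrm (L2 \<Omega>) u)\<^sup>2 + (\<Sum>i\<in>UNIV. (nrm (L2 \<Omega>) (\<lambda>x. grad \<Omega> u x $ i))\<^sup>2)))\<rparr>"

definition laplace :: "(real^'n) set \<Rightarrow> (real^'n \<Rightarrow> real) \<Rightarrow> (real^'n \<Rightarrow> real) \<Rightarrow> real"
  where "laplace \<Omega> \<eta> = (\<lambda>\<psi>. - (LINT x|lebesgue_on \<Omega>. grad \<Omega> \<eta> x \<bullet> grad \<Omega> \<psi> x))"

text \<open>The embedding of \<open>L\<^sup>2(\<Omega>)\<close> into the dual of \<open>H\<^sup>1(\<Omega>)\<close>.\<close>

definition L2_functional :: "(real^'n) set \<Rightarrow> (real^'n \<Rightarrow> real) \<Rightarrow> (real^'n \<Rightarrow> real) \<Rightarrow> real"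
  where "L2_functional \<Omega> w = (\<lambda>\<psi>. LINT x|lebesgue_on \<Omega>. w x * \<psi> x)"

section \<open>Bochner spaces on the time interval\<close>

abbreviation time :: "real \<Rightarrow> real measure"
  where "time T \<equiv> lebesgue_on {0<..<T}"

definition strongly_measurable ::
    "'a measure \<Rightarrow> 'v::real_vector nspace \<Rightarrow> ('a \<Rightarrow> 'v) \<Rightarrow> bool"
  where "strongly_measurable M X u \<longleftrightarrow>
    u \<in> space M \<rightarrow> car X \<and>
    (\<exists>s. (\<forall>n. simple_function M (s n) \<and> s n \<in> space M \<rightarrow> car X)
       \<and> (AE t in M. (\<lambda>n::nat. nrm X (s n t - u t)) \<longlonglongrightarrow> 0))"

text \<open>The analogue of \<^const>\<open>has_bochner_integral\<close> for values in \<open>X\<close>.\<close>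

definition has_bochner_integral_in ::
    "'a measure \<Rightarrow> 'v::real_vector nspace \<Rightarrow> ('a \<Rightarrow> 'v) \<Rightarrow> 'v \<Rightarrow> bool"
  where "has_bochner_integral_in M X u w \<longleftrightarrow>
    w \<in> car X \<and> strongly_measurable M X u \<and>
    (\<exists>s. (\<forall>n. Bochner_Integration.simple_bochner_integrable M (s n) \<and> s n \<in> space M \<rightarrow> car X)
       \<and> (\<lambda>n::nat. \<integral>\<^sup>+t. ennreal (nrm X (u t - s n t)) \<partial>M) \<longlonglongrightarrow> 0
       \<and> (\<lambda>n. nrm X (Bochner_Integration.simple_bochner_integral M (s n) - w)) \<longlonglongrightarrow> 0)"

definition bochner_L2 :: "real \<Rightarrow> 'v::real_vector nspace \<Rightarrow> (real \<Rightarrow> 'v) nspace"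
  where "bochner_L2 T X =
    \<lparr>car = {u. strongly_measurable (time T) X u \<and> integrable (time T) (\<lambda>t. (nrm X (u t))\<^sup>2)},
     nrm = (\<lambda>u. sqrt (LINT t|time T. (nrm X (u t))\<^sup>2))\<rparr>"

definition weak_time_derivative ::
    "real \<Rightarrow> 'v::real_vector nspace \<Rightarrow> (real \<Rightarrow> 'v) \<Rightarrow> (real \<Rightarrow> 'v) \<Rightarrow> bool"
  where "weak_time_derivative T X u v \<longleftrightarrow>
    v \<in> car (bochner_L2 T X) \<and>
    (\<forall>\<phi>. test_function {0<..<T} \<phi> \<longrightarrow>
      (\<exists>w. has_bochner_integral_in (time T) X (\<lambda>t. deriv \<phi> t *\<^sub>R u t) w
         \<and> has_bochner_integral_in (time T) X (\<lambda>t. \<phi> t *\<^sub>R v t) (- w)))"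

definition tderiv :: "real \<Rightarrow> 'v::real_vector nspace \<Rightarrow> (real \<Rightarrow> 'v) \<Rightarrow> real \<Rightarrow> 'v"
  where "tderiv T X u = (SOME v. weak_time_derivative T X u v)"

definition bochner_H1 :: "real \<Rightarrow> 'v::real_vector nspace \<Rightarrow> (real \<Rightarrow> 'v) nspace"
  where "bochner_H1 T X =
    \<lparr>car = {u \<in> car (bochner_L2 T X). \<exists>v. weak_time_derivative T X u v},
     nrm = (\<lambda>u. sqrt ((nrm (bochner_L2 T X) u)\<^sup>2 + (nrm (bochner_L2 T X) (tderiv T X u))\<^sup>2))\<rparr>"

text \<open>The value at time 0 is that of the representative that is continuous on \<open>[0, T]\<close>.\<close>

definition has_initial_value ::
    "real \<Rightarrow> 'v::real_vector nspace \<Rightarrow> (real \<Rightarrow> 'v) \<Rightarrow> 'v \<Rightarrow> bool"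
  where "has_initial_value T X u a \<longleftrightarrow>
    (\<exists>w. w \<in> {0..T} \<rightarrow> car X
       \<and> (AE t in time T. eq_in X (w t) (u t))
       \<and> (\<forall>t\<in>{0..T}. ((\<lambda>s. nrm X (w s - w t)) \<longlongrightarrow> 0) (at t within {0..T}))
       \<and> eq_in X (w 0) a)"

definition bochner_H10 :: "real \<Rightarrow> 'v::real_vector nspace \<Rightarrow> (real \<Rightarrow> 'v) nspace"
  where "bochner_H10 T X =
    \<lparr>car = {u \<in> car (bochner_H1 T X). has_initial_value T X u 0}, nrm = nrm (bochner_H1 T X)\<rparr>"

section \<open>The state system and its linearization\<close>

text \<open>Type of (representatives of) functions of time and space.\<close>

type_synonym 'n evol = "real \<Rightarrow> real^'n \<Rightarrow> real"

abbreviation load_space :: "real \<Rightarrow> (real^'n) set \<Rightarrow> (real \<Rightarrow> (real^'n \<Rightarrow> real) \<Rightarrow> real) nspace"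
  where "load_space T \<Omega> \<equiv> bochner_L2 T (dual (H1 \<Omega>))"

abbreviation state_space :: "real \<Rightarrow> (real^'n) set \<Rightarrow> ('n evol \<times> 'n evol) nspace"
  where "state_space T \<Omega> \<equiv> prod_space (bochner_H10 T (L2 \<Omega>)) (bochner_L2 T (H1 \<Omega>))"

text \<open>\<open>-\<alpha>\<Delta>\<phi> + \<beta>\<phi> = \<beta>q + l\<close> in the dual of \<open>H\<^sup>1(\<Omega>)\<close>, at a fixed time.\<close>

definition elliptic_eq ::
    "(real^'n) set \<Rightarrow> real \<Rightarrow> real \<Rightarrow> (real^'n \<Rightarrow> real) \<Rightarrow> (real^'n \<Rightarrow> real)
      \<Rightarrow> ((real^'n \<Rightarrow> real) \<Rightarrow> real) \<Rightarrow> bool"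
  where "elliptic_eq \<Omega> \<alpha> \<beta> q \<phi> l \<longleftrightarrow>
    (\<forall>\<psi>\<in>car (H1 \<Omega>).
      - \<alpha> * laplace \<Omega> \<phi> \<psi> + \<beta> * L2_functional \<Omega> \<phi> \<psi> = \<beta> * L2_functional \<Omega> q \<psi> + l \<psi>)"

definition driving_force ::
    "real \<Rightarrow> ('n evol \<Rightarrow> 'n evol) \<Rightarrow> (real \<Rightarrow> real) \<Rightarrow> 'n evol \<Rightarrow> 'n evol \<Rightarrow> 'n evol"
  where "driving_force \<beta> H f q \<phi> t x = - \<beta> * (q t x - \<phi> t x) - f (H q t x)"

text \<open>The initial conditions are part of the membership in \<^const>\<open>bochner_H10\<close>.\<close>

definition solves_state ::
    "real \<Rightarrow> (real^'n) set \<Rightarrow> real \<Rightarrow> real \<Rightarrow> real \<Rightarrow> ('n evol \<Rightarrow> 'n evol) \<Rightarrow> (real \<Rightarrow> real)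
      \<Rightarrow> (real \<Rightarrow> (real^'n \<Rightarrow> real) \<Rightarrow> real) \<Rightarrow> 'n evol \<times> 'n evol \<Rightarrow> bool"
  where "solves_state T \<Omega> \<alpha> \<beta> \<epsilon> H f l y \<longleftrightarrow>
    y \<in> car (state_space T \<Omega>) \<and>
    (case y of (q, \<phi>) \<Rightarrow>
      (AE t in time T. AE x in lebesgue_on \<Omega>.
        tderiv T (L2 \<Omega>) q t x = 1 / \<epsilon> * pos (driving_force \<beta> H f q \<phi> t x)) \<and>
      (AE t in time T. elliptic_eq \<Omega> \<alpha> \<beta> (q t) (\<phi> t) (l t)))"

definition solution_operator ::
    "real \<Rightarrow> (real^'n) set \<Rightarrow> real \<Rightarrow> real \<Rightarrow> real \<Rightarrow> ('n evol \<Rightarrow> 'n evol) \<Rightarrow> (real \<Rightarrow> real)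
      \<Rightarrow> (real \<Rightarrow> (real^'n \<Rightarrow> real) \<Rightarrow> real) \<Rightarrow> 'n evol \<times> 'n evol"
  where "solution_operator T \<Omega> \<alpha> \<beta> \<epsilon> H f l = (SOME y. solves_state T \<Omega> \<alpha> \<beta> \<epsilon> H f l y)"

definition solves_linearized ::
    "real \<Rightarrow> (real^'n) set \<Rightarrow> real \<Rightarrow> real \<Rightarrow> real \<Rightarrow> ('n evol \<Rightarrow> 'n evol)
      \<Rightarrow> ('n evol \<Rightarrow> 'n evol \<Rightarrow> 'n evol) \<Rightarrow> (real \<Rightarrow> real) \<Rightarrow> 'n evol \<times> 'n evol
      \<Rightarrow> (real \<Rightarrow> (real^'n \<Rightarrow> real) \<Rightarrow> real) \<Rightarrow> 'n evol \<times> 'n evol \<Rightarrow> bool"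
  where "solves_linearized T \<Omega> \<alpha> \<beta> \<epsilon> H H' f y \<delta>l \<delta>y \<longleftrightarrow>
    \<delta>y \<in> car (state_space T \<Omega>) \<and>
    (case (y, \<delta>y) of ((q, \<phi>), (\<delta>q, \<delta>\<phi>)) \<Rightarrow>
      (AE t in time T. AE x in lebesgue_on \<Omega>.
        tderiv T (L2 \<Omega>) \<delta>q t x =
          1 / \<epsilon> * dir_deriv pos (driving_force \<beta> H f q \<phi> t x)
                    (- \<beta> * (\<delta>q t x - \<delta>\<phi> t x) - dir_deriv f (H q t x) (H' q \<delta>q t x))) \<and>
      (AE t in time T. elliptic_eq \<Omega> \<alpha> \<beta> (\<delta>q t) (\<delta>\<phi> t) (\<delta>l t)))"

end

theory Submission
  imports Defs
begin

text \<open>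
  Bochner integrals are tested against vectors: in a Hilbert space, \<open>w\<close> is the integral of \<open>u\<close> iff
  \<open>\<langle>w, \<psi>\<rangle>\<close> is the integral of \<open>\<langle>u(t), \<psi>\<rangle>\<close> for all \<open>\<psi>\<close>. Weak time derivatives thereby reduce to
  scalar ones, and \<open>u\<close> with \<open>u(0) = 0\<close> is the primitive of its derivative.
  By Riesz, the elliptic equation is solvable, and its solution depends Lipschitz continuously on \<open>(q, l)\<close> at each
  time, so the state system is \<open>q' = R(q, \<phi>)\<close>, where \<open>R\<close> is Lipschitz continuous with a Volterra memory
  term; it is solved by a fixed point argument in an exponentially weighted norm, and Gronwall's
  inequality gives stability. The Volterra estimate for \<open>H\<close> passes to its Gateaux derivative, so
  the linearized system has the same structure. As \<open>R\<close> is directionally differentiable on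
  \<open>L\<^sup>2(0, T; L\<^sup>2)\<close> by dominated convergence, the stability estimate, applied to the difference
  quotients of the solutions minus the solution of the linearized system, yields the derivative of
  the solution operator.
\<close>

section \<open>Test functions\<close>

text \<open>In general \<open>pos\<close> and f have no linear derivative, so an implicit function
  theorem is out of reach. What replaces it: a Lipschitz map with directional derivatives can be
  differentiated along every sequence whose difference quotients converge, not only along rays. This
  gives the chain rule for \<open>pos\<close>, f and H. Likewise, the gap between a perturbed
  solution and the ray spanned by the linearized solution is \<tau> times the error of the
  difference quotient; the Lipschitz bound moves it to the Gronwall side, and what remains is the
  error of R along a fixed ray. A second obstacle shapes the statements: elements are
  representatives under a seminorm, and gradients, time derivatives, primitives and elliptic
  solutions are picked by \<open>SOME\<close>. Linearity and uniqueness hold only up to seminorm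
  zero. Estimates are therefore stated for arbitrary solutions, and equality is often shown by
  testing a difference with itself. A given directional derivative is known only up to seminorm
  zero, so the linearized system must be shown to be invariant under such changes.\<close>

lemma scaleR_fun_apply [simp]: "(c *\<^sub>R f) x = c *\<^sub>R f x"
  by (simp add: scaleR_fun_def)

lemma smoothE:
  assumes "smooth f"
  obtains D where "\<And>x. (f has_derivative D x) (at x)" "\<And>v. smooth (\<lambda>x. D x v)"
  using assms by (cases rule: smooth.cases) blast

lemma smooth_continuous_on: "smooth f \<Longrightarrow> continuous_on S f"
  by (metis smoothE has_derivative_continuous continuous_at_imp_continuous_on)

text \<open>For \<open>k = 0\<close> the classical function \<open>exp (- 1/x)\<close>; the powers of \<open>1/x\<close> make the family
  closed under differentiation.\<close>

definition flat :: "nat \<Rightarrow> real \<Rightarrow> real"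
  where "flat k x = (if x > 0 then (1 / x) ^ k * exp (- (1 / x)) else 0)"

text \<open>For positive x this is the product rule. At 0 the right difference quotient is
  \<open>(1/h) ^ (k+1) * exp (- (1/h))\<close>, and the exponential beats every power.\<close>

lemma flat_has_derivative:
  "(flat k has_real_derivative (flat (k + 2) x - real k * flat (k + 1) x)) (at x)"
proof -
  consider "x < 0" | "x > 0" | "x = 0" by linarith
  then show ?thesis
  proof cases
    case 1
    have "((\<lambda>x. 0) has_real_derivative 0) (at x)" by simp
    then have "(flat k has_real_derivative 0) (at x)"
      by (rule has_field_derivative_transform_within_open[where S="{..<0}"])
        (use 1 in \<open>auto simp: flat_def\<close>)
    then show ?thesis using 1 by (simp add: flat_def)
  next
    case 2
    \<comment> \<open>For k = 0 the exponent is truncated to 0, but then the factor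
      \<open>real k\<close> annihilates the term.\<close>
    have e: "real k * a ^ (k - Suc 0) * (- b) = - (real k * a ^ (k+1))" if "b = a * a" for a b :: real
      using that by (cases k) (auto simp: algebra_simps)
    have "((\<lambda>x. (1 / x) ^ k * exp (- (1 / x))) has_real_derivative
        (real k * (1/x) ^ (k - Suc 0) * (- (1 / (x * x)))) * exp (- (1/x))
         + (1/x)^k * (exp (- (1/x)) * (1 / (x*x)))) (at x)"
      using 2 by (auto intro!: derivative_eq_intros simp: power2_eq_square divide_inverse)
    then have "((\<lambda>x. (1 / x) ^ k * exp (- (1 / x))) has_real_derivative
        (flat (k + 2) x - real k * flat (k + 1) x)) (at x)"
      using 2 by (subst (asm) e) (simp_all add: flat_def field_simps)
    then show ?thesis
      by (rule has_field_derivative_transform_within_open[where S="{0<..}"])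
        (use 2 in \<open>auto simp: flat_def\<close>)
  next
    case 3
    have "((\<lambda>h. (1/h) ^ (k+1) / exp (1/h)) \<longlongrightarrow> 0) (at_right (0::real))"
      using filterlim_compose[OF tendsto_power_div_exp_0 filterlim_inverse_at_top_right, of "k+1"]
      by (simp add: inverse_eq_divide)
    then have R: "((\<lambda>h. flat k h / h) \<longlongrightarrow> 0) (at_right 0)"
      by (rule Lim_transform_eventually)
        (auto simp: eventually_at_filter flat_def exp_minus field_simps)
    have L: "((\<lambda>h. flat k h / h) \<longlongrightarrow> 0) (at_left 0)"
      by (rule Lim_transform_eventually[OF tendsto_const])
        (auto simp: eventually_at_filter flat_def)
    have "((\<lambda>h. flat k h / h) \<longlongrightarrow> 0) (at 0)"
      using L R filterlim_split_at by blast
    then show ?thesis using 3 by (simp add: DERIV_def flat_def)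
  qed
qed

text \<open>An algebra of functions that contains its own directional derivatives. It is the
  invariant for the coinductive definition of \<open>smooth\<close>, so that no higher derivative is
  ever computed.\<close>

inductive bump :: "('a::euclidean_space \<Rightarrow> real) \<Rightarrow> bool"
  where bump_flat: "bump (\<lambda>x. flat k (x \<bullet> a + c))"
  | bump_const: "bump (\<lambda>x. c)"
  | bump_add: "bump f \<Longrightarrow> bump g \<Longrightarrow> bump (\<lambda>x. f x + g x)"
  | bump_mult: "bump f \<Longrightarrow> bump g \<Longrightarrow> bump (\<lambda>x. f x * g x)"

lemma bump_derivative:
  assumes "bump f"
  shows "\<exists>D. (\<forall>x. (f has_derivative D x) (at x)) \<and> (\<forall>v. bump (\<lambda>x. D x v))"
  using assms
proof induction
  case (bump_flat k a c)
  let ?f' = "\<lambda>x. flat (k + 2) (x \<bullet> a + c) + (- real k) * flat (k + 1) (x \<bullet> a + c)"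
  have "((\<lambda>x. flat k (x \<bullet> a + c)) has_derivative (\<lambda>v. ?f' x * (v \<bullet> a))) (at x)" for x
  proof -
    have "((\<lambda>x. x \<bullet> a + c) has_derivative (\<lambda>v. v \<bullet> a)) (at x)"
      by (auto intro!: derivative_eq_intros)
    from has_derivative_compose[OF this flat_has_derivative[of k, unfolded has_field_derivative_def]]
    show ?thesis by simp
  qed
  moreover have "bump (\<lambda>x. ?f' x * (v \<bullet> a))" for v
    by (intro bump.intros)
  ultimately show ?case by (intro exI[of _ "\<lambda>x v. ?f' x * (v \<bullet> a)"]) blast
next
  case (bump_const c)
  show ?case by (intro exI[of _ "\<lambda>x v. 0"]) (auto intro: bump.intros)
next
  case (bump_add f g)
  then obtain D E where "\<And>x. (f has_derivative D x) (at x)" "\<And>v. bump (\<lambda>x. D x v)"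
    "\<And>x. (g has_derivative E x) (at x)" "\<And>v. bump (\<lambda>x. E x v)" by blast
  then show ?case
    by (intro exI[of _ "\<lambda>x v. D x v + E x v"]) (intro conjI allI bump.intros has_derivative_add; blast)
next
  case (bump_mult f g)
  then obtain D E where "\<And>x. (f has_derivative D x) (at x)" "\<And>v. bump (\<lambda>x. D x v)"
    "\<And>x. (g has_derivative E x) (at x)" "\<And>v. bump (\<lambda>x. E x v)" by blast
  with bump_mult show ?case
    by (intro exI[of _ "\<lambda>x v. f x * E x v + D x v * g x"]) (intro conjI allI bump.intros has_derivative_mult; blast)
qed

text \<open>Coinduction: by \<open>bump_derivative\<close> the bumps are differentiable with bumps
  as directional derivatives, which is the rule for \<open>smooth\<close>.\<close>

lemma smooth_bump: "bump f \<Longrightarrow> smooth f"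
proof (coinduction arbitrary: f)
  case smooth
  from bump_derivative[OF this] show ?case by blast
qed

lemma bump_prod: "finite I \<Longrightarrow> (\<And>i. i \<in> I \<Longrightarrow> bump (f i)) \<Longrightarrow> bump (\<lambda>x. \<Prod>i\<in>I. f i x)"
  by (induction I rule: finite_induct) (auto intro: bump.intros)

text \<open>For k > 0 it is positive exactly on the open box, and it tends to the indicator of the
  box as k grows. The parameter k takes the place of mollification.\<close>

definition box_bump :: "'a \<Rightarrow> 'a \<Rightarrow> nat \<Rightarrow> 'a::euclidean_space \<Rightarrow> real"
  where "box_bump a b k x =
    (\<Prod>i\<in>Basis. flat 0 (real k * (x \<bullet> i - a \<bullet> i)) * flat 0 (real k * (b \<bullet> i - x \<bullet> i)))"

lemma bump_box_bump: "bump (box_bump a b k)"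
proof -
  have "bump (\<lambda>x. \<Prod>i\<in>Basis. flat 0 (x \<bullet> (real k *\<^sub>R i) + - real k * (a \<bullet> i))
      * flat 0 (x \<bullet> (- real k *\<^sub>R i) + real k * (b \<bullet> i)))"
    by (intro bump_prod bump_mult bump_flat) auto
  also have "(\<lambda>x. \<Prod>i\<in>Basis. flat 0 (x \<bullet> (real k *\<^sub>R i) + - real k * (a \<bullet> i))
      * flat 0 (x \<bullet> (- real k *\<^sub>R i) + real k * (b \<bullet> i))) = box_bump a b k"
    by (auto simp: box_bump_def fun_eq_iff algebra_simps)
  finally show ?thesis .
qed

lemma flat0_bounds: "0 \<le> flat 0 x" "flat 0 x \<le> 1"
  by (auto simp: flat_def)

lemma box_bump_bounds: "0 \<le> box_bump a b k x" "box_bump a b k x \<le> 1"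
  unfolding box_bump_def by (auto intro!: prod_nonneg prod_le_1 mult_nonneg_nonneg mult_le_one flat0_bounds)

lemma box_bump_support: "x \<notin> box a b \<Longrightarrow> box_bump a b k x = 0"
proof -
  assume "x \<notin> box a b"
  then obtain i where "i \<in> Basis" "x \<bullet> i \<le> a \<bullet> i \<or> x \<bullet> i \<ge> b \<bullet> i"
    by (auto simp: mem_box not_less)
  then have "flat 0 (real k * (x \<bullet> i - a \<bullet> i)) * flat 0 (real k * (b \<bullet> i - x \<bullet> i)) = 0"
    by (auto simp: flat_def zero_less_mult_iff)
  with \<open>i \<in> Basis\<close> show ?thesis unfolding box_bump_def
    by (simp only: prod_zero_iff finite_Basis) blast
qed

lemma box_bump_limit: "(\<lambda>k. box_bump a b k x) \<longlonglongrightarrow> indicator (box a b) x"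
proof (cases "x \<in> box a b")
  case True
  have *: "(\<lambda>k. flat 0 (real k * c)) \<longlonglongrightarrow> 1" if "c > 0" for c
  proof -
    have "(\<lambda>k. exp (- (inverse (real k) * inverse c))) \<longlonglongrightarrow> exp (- (0 * inverse c))"
      by (intro tendsto_intros lim_inverse_n)
    moreover have "\<forall>\<^sub>F k in sequentially. exp (- (inverse (real k) * inverse c)) = flat 0 (real k * c)"
      using eventually_gt_at_top[of 0] by eventually_elim (use that in \<open>auto simp: flat_def divide_inverse\<close>)
    ultimately show ?thesis by (simp add: tendsto_cong)
  qed
  have "(\<lambda>k. box_bump a b k x) \<longlonglongrightarrow> (\<Prod>i\<in>(Basis::'a set). 1 * 1)"
    unfolding box_bump_def
    by (intro tendsto_prod tendsto_mult *) (use True in \<open>auto simp: mem_box\<close>)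
  then show ?thesis using True by simp
qed (simp add: box_bump_support)

lemma test_function_cbox:
  assumes "smooth \<phi>" "\<And>x. x \<notin> cbox a b \<Longrightarrow> \<phi> x = 0" "cbox a b \<subseteq> U"
  shows "test_function U \<phi>"
proof -
  have "closure {x. \<phi> x \<noteq> 0} \<subseteq> cbox a b"
    by (rule closure_minimal) (use assms(2) in auto)
  then show ?thesis using assms compact_closure[of "{x. \<phi> x \<noteq> 0}"] unfolding test_function_def
    by (meson bounded_cbox bounded_subset closure_subset order_trans)
qed

lemma test_function_box_bump: "cbox a b \<subseteq> U \<Longrightarrow> test_function U (box_bump a b k)"
  using box_subset_cbox
  by (intro test_function_cbox[where a=a and b=b] smooth_bump bump_box_bump box_bump_support) auto

lemma continuous_on_box_bump: "continuous_on S (box_bump a b k)"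
  by (intro smooth_continuous_on smooth_bump bump_box_bump)

section \<open>The fundamental lemma of the calculus of variations\<close>

lemma borel_measurable_lebesgue_on:
  fixes h :: "'a::euclidean_space \<Rightarrow> 'b::topological_space"
  assumes "h \<in> borel_measurable borel"
  shows "h \<in> borel_measurable (lebesgue_on S)"
  using assms by (simp add: measurable_completion measurable_restrict_space1)

text \<open>A Dynkin argument: open boxes form an intersection-stable generator of the Borel sets,
  and the sets with vanishing integral are closed under countable disjoint unions and, since the
  total integral vanishes, under complements.\<close>

lemma set_integral_borel_zero:
  fixes k :: "'a::euclidean_space \<Rightarrow> real"
  assumes ik: "integrable lebesgue k"
    and box: "\<And>a b. set_lebesgue_integral lebesgue (box a b) k = 0"
    and univ: "set_lebesgue_integral lebesgue UNIV k = 0"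
    and A: "A \<in> sets borel"
  shows "set_lebesgue_integral lebesgue A k = 0"
proof -
  have si: "set_integrable lebesgue B k" if "B \<in> sets lebesgue" for B
    using that ik unfolding set_integrable_def by (intro integrable_mult_indicator)
  have sb: "B \<in> sets lebesgue" if "B \<in> sigma_sets UNIV (range (\<lambda>(a, b). box a b))" for B :: "'a set"
    using that by (auto simp: borel_eq_box sets_measure_of_conv)
  have "Int_stable (range (\<lambda>(a, b). box a b :: 'a set))"
  proof (rule Int_stableI)
    fix X Y assume "X \<in> range (\<lambda>(a, b). box a b :: 'a set)" "Y \<in> range (\<lambda>(a, b). box a b :: 'a set)"
    then obtain a b c d where "X = box a b" "Y = box c d" by auto
    then show "X \<inter> Y \<in> range (\<lambda>(a, b). box a b :: 'a set)"
      unfolding \<open>X = _\<close> \<open>Y = _\<close> box_Int_box by (metis (mono_tags, lifting) case_prod_conv rangeI)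
  qed
  moreover have "range (\<lambda>(a, b). box a b :: 'a set) \<subseteq> Pow UNIV" by simp
  moreover have "A \<in> sigma_sets UNIV (range (\<lambda>(a, b). box a b))"
    using A by (simp add: borel_eq_box)
  ultimately show ?thesis
  proof (induction rule: sigma_sets_induct_disjoint)
    case (basic A) then show ?case using box by auto
  next
    case empty show ?case by (simp add: set_lebesgue_integral_def)
  next
    case (compl A)
    note A = sb[OF compl(1)]
    have "set_lebesgue_integral lebesgue (A \<union> (UNIV - A)) k =
      set_lebesgue_integral lebesgue A k + set_lebesgue_integral lebesgue (UNIV - A) k"
      using A by (intro set_integral_Un si) auto
    then show ?case using compl(2) univ by simp
  next
    case (union A)
    have A: "A i \<in> sets lebesgue" for i
      using union(2) sb by blast
    have "set_lebesgue_integral lebesgue (\<Union>i. A i) k = (\<Sum>i. set_lebesgue_integral lebesgue (A i) k)"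
      using union(1) A by (intro lebesgue_integral_countable_add si) (auto simp: disjoint_family_on_def)
    then show ?case using union(3) by simp
  qed
qed

text \<open>Every Lebesgue set is a Borel set up to a null set, so all set integrals of k
  vanish.\<close>

lemma AE_zero_if_box_integrals_zero:
  fixes k :: "'a::euclidean_space \<Rightarrow> real"
  assumes ik: "integrable lebesgue k"
    and box: "\<And>a b. set_lebesgue_integral lebesgue (box a b) k = 0"
    and univ: "set_lebesgue_integral lebesgue UNIV k = 0"
  shows "AE x in lebesgue. k x = 0"
proof -
  have leb: "set_lebesgue_integral lebesgue A k = 0" if A: "A \<in> sets lebesgue" for A
  proof -
    obtain B N where B: "B \<in> sets borel" "negligible N" "B \<union> N = A"
      using sets_lebesgue_almost_borel[OF A] .
    have "AE x in lebesgue. x \<notin> N"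
      using B(2) unfolding negligible_iff_null_sets by (rule AE_not_in)
    then have "AE x in lebesgue. indicat_real A x *\<^sub>R k x = indicat_real B x *\<^sub>R k x"
      by eventually_elim (use B(3) in \<open>auto simp: indicator_def\<close>)
    moreover have "(\<lambda>x. indicat_real A x *\<^sub>R k x) \<in> borel_measurable lebesgue"
      "(\<lambda>x. indicat_real B x *\<^sub>R k x) \<in> borel_measurable lebesgue"
      using A B(1) ik by (intro borel_measurable_scaleR borel_measurable_indicator; simp)+
    ultimately have "set_lebesgue_integral lebesgue A k = set_lebesgue_integral lebesgue B k"
      unfolding set_lebesgue_integral_def by (intro integral_cong_AE)
    then show ?thesis using set_integral_borel_zero[OF ik box univ B(1)] by simp
  qed
  interpret sigma_finite_measure "lebesgue :: 'a measure" 
  proof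
    obtain A :: "'a set set" where "countable A" "A \<subseteq> sets lborel" "\<Union>A = space lborel"
      "\<forall>a\<in>A. emeasure lborel a \<noteq> \<infinity>" using lborel.sigma_finite_countable by blast
    then show "\<exists>A. countable A \<and> A \<subseteq> sets (lebesgue :: 'a measure) \<and> \<Union> A = space lebesgue
        \<and> (\<forall>a\<in>A. emeasure lebesgue a \<noteq> \<infinity>)"
      by (intro exI[of _ A]) (auto simp: emeasure_completion subset_iff)
  qed
  show ?thesis by (rule density_zero[OF ik leb])
qed

lemma integral_box_zero:
  fixes g :: "'a::euclidean_space \<Rightarrow> real"
  assumes g: "integrable (lebesgue_on U) g"
    and orth: "\<And>k. (LINT x|lebesgue_on U. g x * box_bump a b k x) = 0"
  shows "(LINT x|lebesgue_on U. g x * indicator (box a b) x) = 0"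
proof -
  let ?M = "lebesgue_on U"
  have gm[measurable]: "g \<in> borel_measurable ?M" using g by auto
  have "(\<lambda>k. LINT x|?M. g x * box_bump a b k x) \<longlonglongrightarrow> (LINT x|?M. g x * indicator (box a b) x)"
  proof (rule integral_dominated_convergence[where w="\<lambda>x. \<bar>g x\<bar>"])
    have [measurable]: "box_bump a b k \<in> borel_measurable ?M" for k
      by (intro borel_measurable_lebesgue_on borel_measurable_continuous_onI continuous_on_box_bump)
    have [measurable]: "(indicator (box a b) :: 'a \<Rightarrow> real) \<in> borel_measurable ?M"
      by (intro borel_measurable_lebesgue_on) auto
    show "(\<lambda>x. g x * indicator (box a b) x) \<in> borel_measurable ?M" by measurable
    show "(\<lambda>x. g x * box_bump a b k x) \<in> borel_measurable ?M" for k by measurable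
    show "integrable ?M (\<lambda>x. \<bar>g x\<bar>)" using g by auto
    show "AE x in ?M. (\<lambda>k. g x * box_bump a b k x) \<longlonglongrightarrow> g x * indicator (box a b) x"
      by (intro AE_I2 tendsto_mult tendsto_const box_bump_limit)
    show "AE x in ?M. norm (g x * box_bump a b k x) \<le> \<bar>g x\<bar>" for k
      using box_bump_bounds[of a b k]
      by (intro AE_I2) (auto simp: abs_mult abs_of_nonneg intro!: mult_left_le)
  qed
  then show ?thesis by (simp add: orth LIMSEQ_const_iff)
qed

text \<open>Localization. Cutting g off to \<open>box c d\<close> and extending it by zero gives a
  function on the whole space; its integral over any box is an integral of g over a smaller box
  whose closure is still inside \<open>cbox c d\<close>, hence inside U. The boundary of the box is
  a null set.\<close>

lemma AE_cbox_zero: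
  fixes g :: "'a::euclidean_space \<Rightarrow> real"
  assumes U: "open U" and g: "integrable (lebesgue_on U) g"
    and box0: "\<And>a b. cbox a b \<subseteq> U \<Longrightarrow> (LINT x|lebesgue_on U. g x * indicator (box a b) x) = 0"
    and cd: "cbox c d \<subseteq> U"
  shows "AE x in lebesgue_on U. x \<in> cbox c d \<longrightarrow> g x = 0"
proof -
  have Us: "U \<in> sets lebesgue" using U by auto
  let ?M = "lebesgue_on U"
  define k where "k x = (if x \<in> U then g x * indicator (box c d) x else 0)" for x
  have gm[measurable]: "g \<in> borel_measurable ?M" using g by auto
  have [measurable]: "(indicator (box c d) :: 'a \<Rightarrow> real) \<in> borel_measurable ?M"
    by (intro borel_measurable_lebesgue_on) auto
  have ik: "integrable lebesgue k" unfolding k_def Lebesgue_Measure.integrable_restrict_UNIV[OF Us]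
    
    by (rule Bochner_Integration.integrable_bound[OF g])
      (intro borel_measurable_times gm, fact, intro AE_I2, simp add: indicator_def)
  have basic: "set_lebesgue_integral lebesgue (box a b) k = 0" for a b
  proof -
    obtain a' b' where ab: "box a b \<inter> box c d = box a' b'"
      using that[OF box_Int_box] .
    have "set_lebesgue_integral lebesgue (box a b) k
      = (LINT x|lebesgue. (if x \<in> U then g x * indicator (box a b \<inter> box c d) x else 0))"
      unfolding set_lebesgue_integral_def k_def
      by (intro Bochner_Integration.integral_cong) (auto simp: indicator_def)
    also have "\<dots> = (LINT x|?M. g x * indicator (box a' b') x)"
      unfolding ab by (rule Lebesgue_Measure.integral_restrict_UNIV[OF Us])
    also have "\<dots> = 0"
    proof (cases "box a' b' = {}")
      case False
      then have ne: "box c d \<noteq> {}" using ab by auto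
      have "closure (box a' b') \<subseteq> closure (box c d)" using ab by (intro closure_mono) auto
      then have "cbox a' b' \<subseteq> U" using cd closure_box[OF False] closure_box[OF ne] by auto
      then show ?thesis by (rule box0)
    qed simp
    finally show ?thesis .
  qed
  have "set_lebesgue_integral lebesgue UNIV k = set_lebesgue_integral lebesgue (box c d) k"
    unfolding set_lebesgue_integral_def k_def
    by (intro Bochner_Integration.integral_cong) (auto simp: indicator_def)
  then have "AE x in lebesgue. k x = 0"
    using basic by (intro AE_zero_if_box_integrals_zero[OF ik]) auto
  moreover have "AE x in lebesgue. x \<notin> cbox c d - box c d"
    using negligible_frontier_interval[of c d] unfolding negligible_iff_null_sets by (rule AE_not_in)
  ultimately have "AE x in lebesgue. x \<in> U \<longrightarrow> (x \<in> cbox c d \<longrightarrow> g x = 0)"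
    by eventually_elim (auto simp: k_def indicator_def)
  then show ?thesis using Us by (simp add: AE_restrict_space_iff)
qed

text \<open>An open set is a countable union of closed boxes, so the local statement
  \<open>AE_cbox_zero\<close> costs only countably many null sets.\<close>

lemma AE_zero_if_orthogonal_to_box_bumps:
  fixes g :: "'a::euclidean_space \<Rightarrow> real"
  assumes U: "open U" and g: "integrable (lebesgue_on U) g"
    and orth: "\<And>a b k. cbox a b \<subseteq> U \<Longrightarrow> (LINT x|lebesgue_on U. g x * box_bump a b k x) = 0"
  shows "AE x in lebesgue_on U. g x = 0"
proof -
  obtain \<D> where D: "countable \<D>" "\<D> \<subseteq> Pow U" "\<And>X. X \<in> \<D> \<Longrightarrow> \<exists>a b. X = cbox a b" "\<Union>\<D> = U"
    using open_countable_Union_open_cbox[OF U] by blast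
  have "AE x in lebesgue_on U. x \<in> X \<longrightarrow> g x = 0" if X: "X \<in> \<D>" for X
  proof -
    obtain a b where ab: "X = cbox a b" using D(3)[OF X] by blast
    have "cbox a b \<subseteq> U" using X D(2) ab by blast
    from AE_cbox_zero[OF U g integral_box_zero[OF g orth] this] show ?thesis unfolding ab .
  qed
  then have "AE x in lebesgue_on U. \<forall>X\<in>\<D>. x \<in> X \<longrightarrow> g x = 0"
    using D(1) by (subst AE_ball_countable) auto
  moreover have "AE x in lebesgue_on U. x \<in> U" by (rule AE_I2) simp
  ultimately show ?thesis by eventually_elim (use D(4) in blast)
qed

section \<open>Strong measurability in seminormed spaces\<close>

text \<open>Strong measurability prescribes the limit of simple functions only almost everywhere.
  Completeness is what makes norms and inner products of such limits measurable.\<close>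

lemma complete_measure_lebesgue_on:
  fixes S :: "'a::euclidean_space set"
  assumes "S \<in> sets lebesgue"
  shows "complete_measure (lebesgue_on S)"
proof
  fix A B :: "'a set" assume AB: "B \<subseteq> A" "A \<in> null_sets (lebesgue_on S)"
  then have "A \<in> null_sets lebesgue" "A \<subseteq> S"
    using assms by (auto simp: null_sets_restrict_space)
  then have "B \<in> null_sets lebesgue" using AB(1)
    by (meson completion.complete2)
  then show "B \<in> sets (lebesgue_on S)" using AB(1) \<open>A \<subseteq> S\<close> assms
    by (auto simp: sets_restrict_space_iff)
qed

lemma (in complete_measure) borel_measurable_AE_cong:
  fixes f g :: "'a \<Rightarrow> 'b::topological_space"
  assumes "g \<in> borel_measurable M" "AE x in M. f x = g x"
  shows "f \<in> borel_measurable M"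
proof (rule measurableI)
  fix A :: "'b set" assume A: "A \<in> sets borel"
  have "AE x in M. (x \<in> g -` A \<inter> space M) = (x \<in> f -` A \<inter> space M)"
    using assms(2) by eventually_elim auto
  then show "f -` A \<inter> space M \<in> sets M"
    by (rule in_sets_AE) (use assms(1) A in \<open>auto intro: measurable_sets\<close>)
qed simp

lemma (in complete_measure) borel_measurable_AE_LIMSEQ:
  fixes f :: "nat \<Rightarrow> 'a \<Rightarrow> real"
  assumes "\<And>i. f i \<in> borel_measurable M" "AE x in M. (\<lambda>i. f i x) \<longlonglongrightarrow> g x"
  shows "g \<in> borel_measurable M"
proof (rule borel_measurable_AE_cong)
  show "(\<lambda>x. lim (\<lambda>i. f i x)) \<in> borel_measurable M"
    using assms(1) by (rule borel_measurable_lim_metric)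
  show "AE x in M. g x = lim (\<lambda>i. f i x)"
    using assms(2) by eventually_elim (simp add: limI)
qed

locale seminormed =
  fixes X :: "'v::real_vector nspace"
  assumes subspace_car: "subspace (car X)"
    and nrm_triangle: "x \<in> car X \<Longrightarrow> y \<in> car X \<Longrightarrow> nrm X (x + y) \<le> nrm X x + nrm X y"
    and nrm_scale: "x \<in> car X \<Longrightarrow> nrm X (c *\<^sub>R x) = \<bar>c\<bar> * nrm X x"
begin

lemma add_car [simp, intro]: "x \<in> car X \<Longrightarrow> y \<in> car X \<Longrightarrow> x + y \<in> car X"
  and diff_car [simp, intro]: "x \<in> car X \<Longrightarrow> y \<in> car X \<Longrightarrow> x - y \<in> car X"
  and minus_car [simp, intro]: "x \<in> car X \<Longrightarrow> - x \<in> car X"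
  and scale_car [simp, intro]: "x \<in> car X \<Longrightarrow> c *\<^sub>R x \<in> car X"
  and zero_car [simp, intro]: "0 \<in> car X"
  using subspace_car
  by (auto simp: subspace_add subspace_diff subspace_neg subspace_scale subspace_0)

lemma nrm_zero [simp]: "nrm X 0 = 0"
  using nrm_scale[of 0 0] by simp

lemma nrm_minus: "x \<in> car X \<Longrightarrow> nrm X (- x) = nrm X x"
  using nrm_scale[of x "-1"] by simp

lemma nrm_nonneg: "x \<in> car X \<Longrightarrow> 0 \<le> nrm X x"
  using nrm_triangle[of x "- x"] nrm_minus[of x] by auto

lemma nrm_diff_commute: "x \<in> car X \<Longrightarrow> y \<in> car X \<Longrightarrow> nrm X (x - y) = nrm X (y - x)"
  using nrm_minus[of "x - y"] by simp

lemma nrm_diff_le: "x \<in> car X \<Longrightarrow> y \<in> car X \<Longrightarrow> nrm X (x - y) \<le> nrm X x + nrm X y"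
  using nrm_triangle[of x "- y"] nrm_minus[of y] by auto

lemma nrm_diff_trans:
  "x \<in> car X \<Longrightarrow> y \<in> car X \<Longrightarrow> z \<in> car X \<Longrightarrow> nrm X (x - z) \<le> nrm X (x - y) + nrm X (y - z)"
  using nrm_triangle[of "x - y" "y - z"] by auto

lemma nrm_le_diff: "x \<in> car X \<Longrightarrow> y \<in> car X \<Longrightarrow> nrm X x \<le> nrm X (x - y) + nrm X y"
  using nrm_triangle[of "x - y" y] by auto

lemma abs_nrm_diff: "x \<in> car X \<Longrightarrow> y \<in> car X \<Longrightarrow> \<bar>nrm X x - nrm X y\<bar> \<le> nrm X (x - y)"
  using nrm_le_diff[of x y] nrm_le_diff[of y x] nrm_diff_commute[of x y] by auto

lemma nrm_eq_if_diff_zero: "x \<in> car X \<Longrightarrow> y \<in> car X \<Longrightarrow> nrm X (x - y) = 0 \<Longrightarrow> nrm X x = nrm X y"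
  using abs_nrm_diff[of x y] by auto

lemma nrm_tendsto:
  assumes "\<And>n. A n \<in> car X" "a \<in> car X" "((\<lambda>n. nrm X (A n - a)) \<longlongrightarrow> 0) F"
  shows "((\<lambda>n. nrm X (A n)) \<longlongrightarrow> nrm X a) F"
  using tendsto_0_le[OF assms(3), of "\<lambda>n. nrm X (A n) - nrm X a" 1] abs_nrm_diff[OF assms(1,2)]
    nrm_nonneg assms(1,2) by (subst LIM_zero_iff[symmetric]) (auto simp: diff_car)

end

lemma strongly_measurable_car: "strongly_measurable M X u \<Longrightarrow> t \<in> space M \<Longrightarrow> u t \<in> car X"
  by (auto simp: strongly_measurable_def)

lemma strongly_measurableE:
  assumes "strongly_measurable M X u"
  obtains s where "\<And>n. simple_function M (s n)" "\<And>n t. t \<in> space M \<Longrightarrow> s n t \<in> car X"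
    "AE t in M. (\<lambda>n::nat. nrm X (s n t - u t)) \<longlonglongrightarrow> 0"
  using assms by (auto simp: strongly_measurable_def Pi_iff)

lemma strongly_measurableI:
  assumes "\<And>t. t \<in> space M \<Longrightarrow> u t \<in> car X"
    "\<And>n. simple_function M (s n)" "\<And>n t. t \<in> space M \<Longrightarrow> s n t \<in> car X"
    "AE t in M. (\<lambda>n::nat. nrm X (s n t - u t)) \<longlonglongrightarrow> 0"
  shows "strongly_measurable M X u"
  unfolding strongly_measurable_def Pi_iff using assms by (intro conjI exI[of _ s]) auto

lemma tendsto_zero_squeeze:
  fixes a b :: "'i \<Rightarrow> real"
  assumes "(b \<longlongrightarrow> 0) F" "\<And>n. 0 \<le> a n" "\<And>n. a n \<le> b n"
  shows "(a \<longlongrightarrow> 0) F"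
  by (rule tendsto_sandwich[OF _ _ tendsto_const assms(1)]) (use assms in auto)

text \<open>Applying F to the approximating simple functions yields simple functions again.
  Continuity is required in sequential form because the product of a scalar and a vector, one of the
  uses, is continuous but not Lipschitz.\<close>

lemma strongly_measurable_compose2_continuous:
  assumes u: "strongly_measurable M X u" and v: "strongly_measurable M Y v"
    and car: "\<And>a b. a \<in> car X \<Longrightarrow> b \<in> car Y \<Longrightarrow> F a b \<in> car Z"
    and cont: "\<And>A B a b. (\<And>n::nat. A n \<in> car X) \<Longrightarrow> (\<And>n. B n \<in> car Y) \<Longrightarrow> a \<in> car X \<Longrightarrow> b \<in> car Y \<Longrightarrow>
      (\<lambda>n. nrm X (A n - a)) \<longlonglongrightarrow> 0 \<Longrightarrow> (\<lambda>n. nrm Y (B n - b)) \<longlonglongrightarrow> 0 \<Longrightarrow>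
      (\<lambda>n. nrm Z (F (A n) (B n) - F a b)) \<longlonglongrightarrow> 0"
  shows "strongly_measurable M Z (\<lambda>t. F (u t) (v t))"
proof -
  obtain r where r: "\<And>n. simple_function M (r n)" "\<And>n t. t \<in> space M \<Longrightarrow> r n t \<in> car X"
    "AE t in M. (\<lambda>n::nat. nrm X (r n t - u t)) \<longlonglongrightarrow> 0" using strongly_measurableE[OF u] by blast
  obtain s where s: "\<And>n. simple_function M (s n)" "\<And>n t. t \<in> space M \<Longrightarrow> s n t \<in> car Y"
    "AE t in M. (\<lambda>n::nat. nrm Y (s n t - v t)) \<longlonglongrightarrow> 0" using strongly_measurableE[OF v] by blast
  show ?thesis
  proof (rule strongly_measurableI[where s="\<lambda>n t. F (r n t) (s n t)"])
    show "AE t in M. (\<lambda>n. nrm Z (F (r n t) (s n t) - F (u t) (v t))) \<longlonglongrightarrow> 0"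
      using r(3) s(3) AE_space
    proof eventually_elim
      case (elim t)
      show ?case
        by (rule cont) (use elim r(2) s(2) strongly_measurable_car[OF u] strongly_measurable_car[OF v] in auto)
    qed
  qed (use r s car strongly_measurable_car[OF u] strongly_measurable_car[OF v] in
      \<open>auto intro: simple_function_compose2\<close>)
qed

lemma strongly_measurable_compose2:
  assumes X: "seminormed X" and Y: "seminormed Y" and Z: "seminormed Z"
    and u: "strongly_measurable M X u" and v: "strongly_measurable M Y v"
    and car: "\<And>a b. a \<in> car X \<Longrightarrow> b \<in> car Y \<Longrightarrow> F a b \<in> car Z"
    and lip: "\<And>a b a' b'. a \<in> car X \<Longrightarrow> b \<in> car Y \<Longrightarrow> a' \<in> car X \<Longrightarrow> b' \<in> car Y \<Longrightarrow>
      nrm Z (F a' b' - F a b) \<le> C * (nrm X (a' - a) + nrm Y (b' - b))"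
  shows "strongly_measurable M Z (\<lambda>t. F (u t) (v t))"
proof (rule strongly_measurable_compose2_continuous[OF u v car])
  interpret X: seminormed X by fact
  interpret Y: seminormed Y by fact
  interpret Z: seminormed Z by fact
  fix A B a b
  assume *: "\<And>n::nat. A n \<in> car X" "\<And>n. B n \<in> car Y" "a \<in> car X" "b \<in> car Y"
    "(\<lambda>n. nrm X (A n - a)) \<longlonglongrightarrow> 0" "(\<lambda>n. nrm Y (B n - b)) \<longlonglongrightarrow> 0"
  have "(\<lambda>n. C * (nrm X (A n - a) + nrm Y (B n - b))) \<longlonglongrightarrow> C * (0 + 0)"
    by (intro tendsto_intros *)
  then have "(\<lambda>n. C * (nrm X (A n - a) + nrm Y (B n - b))) \<longlonglongrightarrow> 0" by simp
  then show "(\<lambda>n. nrm Z (F (A n) (B n) - F a b)) \<longlonglongrightarrow> 0"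
    by (rule tendsto_zero_squeeze) (use *(1-4) car lip in \<open>auto intro!: Z.nrm_nonneg\<close>)
qed

lemma strongly_measurable_compose:
  assumes X: "seminormed X" and Z: "seminormed Z"
    and u: "strongly_measurable M X u"
    and car: "\<And>a. a \<in> car X \<Longrightarrow> F a \<in> car Z"
    and lip: "\<And>a a'. a \<in> car X \<Longrightarrow> a' \<in> car X \<Longrightarrow> nrm Z (F a' - F a) \<le> C * nrm X (a' - a)"
  shows "strongly_measurable M Z (\<lambda>t. F (u t))"
proof (rule strongly_measurable_compose2[OF X X Z u u, where C="\<bar>C\<bar>" and F="\<lambda>a _. F a"])
  fix a b a' b' assume "a \<in> car X" "b \<in> car X" "a' \<in> car X" "b' \<in> car X"
  then have "C * nrm X (a' - a) \<le> \<bar>C\<bar> * (nrm X (a' - a) + nrm X (b' - b))"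
    using X by (intro mult_mono) (auto intro!: seminormed.nrm_nonneg seminormed.diff_car)
  then show "nrm Z (F a' - F a) \<le> \<bar>C\<bar> * (nrm X (a' - a) + nrm X (b' - b))"
    using lip[of a a'] \<open>a \<in> car X\<close> \<open>a' \<in> car X\<close> by linarith
qed (use car in auto)

lemma strongly_measurable_real:
  assumes "f \<in> borel_measurable M"
  shows "strongly_measurable M real_space f"
proof -
  obtain s where "\<And>i. simple_function M (s i)" "\<And>x. x \<in> space M \<Longrightarrow> (\<lambda>i::nat. s i x) \<longlonglongrightarrow> f x"
    using borel_measurable_implies_sequence_metric[OF assms, of 0] by blast
  then show ?thesis
    by (intro strongly_measurableI[where s=s])
      (auto simp: real_space_def tendsto_rabs_zero_iff LIM_zero_iff intro!: AE_I2)
qed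

context seminormed begin

lemma strongly_measurable_add:
  assumes "strongly_measurable M X u" "strongly_measurable M X v"
  shows "strongly_measurable M X (\<lambda>t. u t + v t)"
proof (rule strongly_measurable_compose2[where C=1, OF _ _ _ assms])
  fix a b a' b' assume "a \<in> car X" "b \<in> car X" "a' \<in> car X" "b' \<in> car X"
  then show "nrm X (a' + b' - (a + b)) \<le> 1 * (nrm X (a' - a) + nrm X (b' - b))"
    using nrm_triangle[of "a' - a" "b' - b"] by (auto simp: algebra_simps)
qed (auto intro: seminormed_axioms)

lemma strongly_measurable_scale:
  assumes "strongly_measurable M X u"
  shows "strongly_measurable M X (\<lambda>t. c *\<^sub>R u t)"
proof (rule strongly_measurable_compose[where C="\<bar>c\<bar>", OF _ _ assms])
  fix a a' assume "a \<in> car X" "a' \<in> car X"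
  then show "nrm X (c *\<^sub>R a' - c *\<^sub>R a) \<le> \<bar>c\<bar> * nrm X (a' - a)"
    by (simp add: nrm_scale flip: scaleR_diff_right)
qed (auto intro: seminormed_axioms)

lemma strongly_measurable_diff:
  assumes "strongly_measurable M X u" "strongly_measurable M X v"
  shows "strongly_measurable M X (\<lambda>t. u t - v t)"
  using strongly_measurable_add[OF assms(1) strongly_measurable_scale[OF assms(2), of "-1"]] by simp

lemma strongly_measurable_zero: "strongly_measurable M X (\<lambda>t. 0)"
  by (rule strongly_measurableI[where s="\<lambda>_ _. 0"]) auto

lemma strongly_measurable_mult:
  assumes f: "f \<in> borel_measurable M" and u: "strongly_measurable M X u"
  shows "strongly_measurable M X (\<lambda>t. f t *\<^sub>R u t)"
proof (rule strongly_measurable_compose2_continuous[OF strongly_measurable_real[OF f] u])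
  fix A B a b
  assume *: "\<And>n::nat. A n \<in> car real_space" "\<And>n. B n \<in> car X" "a \<in> car real_space" "b \<in> car X"
    "(\<lambda>n. nrm real_space (A n - a)) \<longlonglongrightarrow> 0" "(\<lambda>n. nrm X (B n - b)) \<longlonglongrightarrow> 0"
  have A: "A \<longlonglongrightarrow> a" using *(5) by (simp add: real_space_def tendsto_rabs_zero_iff LIM_zero_iff)
  have "(\<lambda>n. \<bar>A n\<bar> * nrm X (B n - b) + \<bar>A n - a\<bar> * nrm X b) \<longlonglongrightarrow> \<bar>a\<bar> * 0 + \<bar>a - a\<bar> * nrm X b"
    by (intro tendsto_intros A *)
  moreover have "nrm X (A n *\<^sub>R B n - a *\<^sub>R b) \<le> \<bar>A n\<bar> * nrm X (B n - b) + \<bar>A n - a\<bar> * nrm X b" for n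
  proof -
    have "A n *\<^sub>R B n - a *\<^sub>R b = A n *\<^sub>R (B n - b) + (A n - a) *\<^sub>R b"
      by (simp add: scaleR_diff_right scaleR_diff_left)
    then show ?thesis
      using nrm_triangle[of "A n *\<^sub>R (B n - b)" "(A n - a) *\<^sub>R b"] *(2,4) by (simp add: nrm_scale)
  qed
  ultimately show "(\<lambda>n. nrm X (A n *\<^sub>R B n - a *\<^sub>R b)) \<longlonglongrightarrow> 0"
    by (intro tendsto_zero_squeeze[where a="\<lambda>n. nrm X (A n *\<^sub>R B n - a *\<^sub>R b)"])
      (use *(2,4) in \<open>auto intro!: nrm_nonneg\<close>)
qed auto

lemma borel_measurable_nrm:
  assumes M: "complete_measure M" and u: "strongly_measurable M X u"
  shows "(\<lambda>t. nrm X (u t)) \<in> borel_measurable M"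
proof -
  obtain s where s: "\<And>n. simple_function M (s n)" "\<And>n t. t \<in> space M \<Longrightarrow> s n t \<in> car X"
    "AE t in M. (\<lambda>n::nat. nrm X (s n t - u t)) \<longlonglongrightarrow> 0" using strongly_measurableE[OF u] by blast
  show ?thesis
  proof (rule complete_measure.borel_measurable_AE_LIMSEQ[OF M])
    show "(\<lambda>t. nrm X (s n t)) \<in> borel_measurable M" for n
      by (rule borel_measurable_simple_function) (rule simple_function_compose1[OF s(1)])
    show "AE t in M. (\<lambda>n. nrm X (s n t)) \<longlonglongrightarrow> nrm X (u t)"
      using s(3) AE_space
      by eventually_elim (use s(2) strongly_measurable_car[OF u] in \<open>auto intro!: nrm_tendsto\<close>)
  qed
qed

lemma strongly_measurable_simple:
  assumes "simple_function M s" "\<And>t. t \<in> space M \<Longrightarrow> s t \<in> car X"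
  shows "strongly_measurable M X s"
  by (rule strongly_measurableI[where s="\<lambda>_. s"]) (use assms in auto)

text \<open>A diagonal argument. On a finite measure space the integral of
  \<open>min 1 (nrm X (s - u n))\<close> can be made smaller than 1/(n+1) by a simple s, whatever
  the growth of u n; convergence of these integrals to 0 yields a subsequence that converges almost
  everywhere, and the truncation at 1 is eventually inactive.\<close>

lemma strongly_measurable_limit:
  assumes M: "complete_measure M" "finite_measure M"
    and u: "\<And>n. strongly_measurable M X (u n)"
    and v: "\<And>t. t \<in> space M \<Longrightarrow> v t \<in> car X"
    and lim: "AE t in M. (\<lambda>n::nat. nrm X (u n t - v t)) \<longlonglongrightarrow> 0"
  shows "strongly_measurable M X v"
proof -
  interpret finite_measure M by fact
  have ucar: "u n t \<in> car X" if "t \<in> space M" for n t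
    by (rule strongly_measurable_car[OF u that])
  have "\<forall>n. \<exists>s. simple_function M s \<and> (\<forall>t\<in>space M. s t \<in> car X)
      \<and> (LINT t|M. min 1 (nrm X (s t - u n t))) < 1 / real (Suc n)"
  proof
    fix n
    obtain s where s: "\<And>k. simple_function M (s k)" "\<And>k t. t \<in> space M \<Longrightarrow> s k t \<in> car X"
      "AE t in M. (\<lambda>k::nat. nrm X (s k t - u n t)) \<longlonglongrightarrow> 0" using strongly_measurableE[OF u] by blast
    have "(\<lambda>k. LINT t|M. min 1 (nrm X (s k t - u n t))) \<longlonglongrightarrow> (LINT t|M. 0)"
    proof (rule integral_dominated_convergence[where w="\<lambda>_. 1"])
      show "(\<lambda>t. min 1 (nrm X (s k t - u n t))) \<in> borel_measurable M" for k
        by (intro borel_measurable_min borel_measurable_nrm[OF M(1)] strongly_measurable_diff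
            strongly_measurable_simple s u) auto
      show "AE t in M. (\<lambda>k. min 1 (nrm X (s k t - u n t))) \<longlonglongrightarrow> 0"
        using s(3)
      proof eventually_elim
        case (elim t)
        from tendsto_min[OF tendsto_const elim, of 1] show ?case by simp
      qed
      show "AE t in M. norm (min 1 (nrm X (s k t - u n t))) \<le> 1" for k
        using AE_space
      proof eventually_elim
        case (elim t)
        then have "0 \<le> nrm X (s k t - u n t)" using s(2) ucar by (intro nrm_nonneg) auto
        then show ?case by auto
      qed
    qed auto
    then have "\<forall>\<^sub>F k in sequentially. (LINT t|M. min 1 (nrm X (s k t - u n t))) < 1 / real (Suc n)"
      by (rule order_tendstoD) simp
    then obtain k where "(LINT t|M. min 1 (nrm X (s k t - u n t))) < 1 / real (Suc n)"
      by (auto simp: eventually_sequentially)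
    with s show "\<exists>s. simple_function M s \<and> (\<forall>t\<in>space M. s t \<in> car X)
      \<and> (LINT t|M. min 1 (nrm X (s t - u n t))) < 1 / real (Suc n)" by blast
  qed
  then obtain s where s: "\<And>n. simple_function M (s n)" "\<And>n t. t \<in> space M \<Longrightarrow> s n t \<in> car X"
    "\<And>n. (LINT t|M. min 1 (nrm X (s n t - u n t))) < 1 / real (Suc n)" by metis
  have meas: "(\<lambda>t. min 1 (nrm X (s n t - u n t))) \<in> borel_measurable M" for n
    by (intro borel_measurable_min borel_measurable_nrm[OF M(1)] strongly_measurable_diff
            strongly_measurable_simple s u) auto
  have nn: "AE t in M. 0 \<le> min 1 (nrm X (s n t - u n t))" for n
    using AE_space by eventually_elim (use s(2) ucar in \<open>auto intro!: nrm_nonneg\<close>)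
  have int: "integrable M (\<lambda>t. min 1 (nrm X (s n t - u n t)))" for n
    by (rule integrable_const_bound[where B=1]) (use nn[of n] in \<open>auto intro: meas elim!: eventually_mono\<close>)
  have "(\<lambda>n. LINT t|M. norm (min 1 (nrm X (s n t - u n t)))) \<longlonglongrightarrow> 0"
  proof (rule tendsto_sandwich[OF _ _ tendsto_const])
    show "(\<lambda>n. 1 / real (Suc n)) \<longlonglongrightarrow> 0" by (rule LIMSEQ_Suc[OF lim_1_over_n])
    have "(LINT t|M. norm (min 1 (nrm X (s n t - u n t)))) = (LINT t|M. min 1 (nrm X (s n t - u n t)))" for n
      using nn[of n] by (intro integral_cong_AE) (use meas in \<open>auto elim!: eventually_mono\<close>)
    then show "\<forall>\<^sub>F n in sequentially. (LINT t|M. norm (min 1 (nrm X (s n t - u n t)))) \<le> 1 / real (Suc n)"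
      using s(3) by (auto intro!: always_eventually less_imp_le)
  qed auto
  from tendsto_L1_AE_subseq[OF int this] obtain r :: "nat \<Rightarrow> nat" where r: "strict_mono r"
    "AE t in M. (\<lambda>n. min 1 (nrm X (s (r n) t - u (r n) t))) \<longlonglongrightarrow> 0" by auto
  show ?thesis
  proof (rule strongly_measurableI[where s="\<lambda>n. s (r n)"])
    show "AE t in M. (\<lambda>n. nrm X (s (r n) t - v t)) \<longlonglongrightarrow> 0"
      using r(2) lim AE_space
    proof eventually_elim
      case (elim t)
      have c: "s (r n) t \<in> car X" "u (r n) t \<in> car X" "v t \<in> car X" for n
        using elim s ucar v by auto
      have "\<forall>\<^sub>F n in sequentially. min 1 (nrm X (s (r n) t - u (r n) t)) < 1"
        using order_tendstoD(2)[OF elim(1), of 1] by simp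
      then have "\<forall>\<^sub>F n in sequentially. min 1 (nrm X (s (r n) t - u (r n) t)) = nrm X (s (r n) t - u (r n) t)"
        by eventually_elim auto
      with elim(1) have 1: "(\<lambda>n. nrm X (s (r n) t - u (r n) t)) \<longlonglongrightarrow> 0"
        by (rule Lim_transform_eventually)
      have 2: "(\<lambda>n. nrm X (u (r n) t - v t)) \<longlonglongrightarrow> 0"
        using LIMSEQ_subseq_LIMSEQ[OF elim(2) r(1)] by (simp add: o_def)
      show ?case
        by (rule tendsto_zero_squeeze[OF tendsto_add_zero[OF 1 2]])
          (use c in \<open>auto intro!: nrm_nonneg nrm_diff_trans\<close>)
    qed
  qed (use s v in auto)
qed

end

section \<open>Hilbert spaces of representatives\<close>

text \<open>Serves Cauchy-Schwarz, where the form is only semidefinite and c may vanish, and the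
  variational argument in \<open>riesz\<close>, where a = 0 forces b = 0.\<close>

lemma quadratic_nonneg_discriminant:
  fixes a b c :: real
  assumes "\<And>t. 0 \<le> a + 2 * t * b + t\<^sup>2 * c" "0 \<le> c"
  shows "b\<^sup>2 \<le> a * c"
proof (cases "c = 0")
  case True
  have "b = 0"
  proof (rule ccontr)
    assume "b \<noteq> 0"
    then have "a + 2 * (- (a + 1) / (2 * b)) * b = -1" by (simp add: field_simps)
    with assms(1)[of "- (a + 1) / (2 * b)"] True show False by simp
  qed
  then show ?thesis using True by simp
next
  case False
  have "a + 2 * (- b / c) * b + (- b / c)\<^sup>2 * c = a - b\<^sup>2 / c"
    using False by (simp add: power2_eq_square field_simps)
  then have "b\<^sup>2 / c \<le> a" using assms(1)[of "- b / c"] by linarith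
  then show ?thesis using False assms(2) by (simp add: divide_le_eq)
qed

text \<open>The form is only semidefinite, since different representatives of one element have a
  difference of seminorm zero. All uniqueness results are meant up to such vectors.\<close>

locale prehilbert =
  fixes X :: "'v::real_vector nspace" and ip :: "'v \<Rightarrow> 'v \<Rightarrow> real"
  assumes car_subspace: "subspace (car X)"
    and ip_add_left: "x \<in> car X \<Longrightarrow> y \<in> car X \<Longrightarrow> z \<in> car X \<Longrightarrow> ip (x + y) z = ip x z + ip y z"
    and ip_scale_left: "x \<in> car X \<Longrightarrow> y \<in> car X \<Longrightarrow> ip (c *\<^sub>R x) y = c * ip x y"
    and ip_commute: "x \<in> car X \<Longrightarrow> y \<in> car X \<Longrightarrow> ip x y = ip y x"
    and ip_nonneg: "x \<in> car X \<Longrightarrow> 0 \<le> ip x x"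
    and nrm_eq_ip: "x \<in> car X \<Longrightarrow> nrm X x = sqrt (ip x x)"
begin

lemma ip_add_right:
  assumes "x \<in> car X" "y \<in> car X" "z \<in> car X"
  shows "ip z (x + y) = ip z x + ip z y"
  using assms ip_add_left[of x y z] ip_commute[of _ z] car_subspace by (simp add: subspace_add)

lemma ip_scale_right:
  assumes "x \<in> car X" "y \<in> car X"
  shows "ip y (c *\<^sub>R x) = c * ip y x"
  using assms ip_scale_left[of x y] ip_commute[of _ y] car_subspace by (simp add: subspace_scale)

lemma ip_self: "x \<in> car X \<Longrightarrow> ip x x = (nrm X x)\<^sup>2"
  by (simp add: nrm_eq_ip ip_nonneg)

lemma ip_expand:
  assumes "x \<in> car X" "y \<in> car X"
  shows "ip (x + t *\<^sub>R y) (x + t *\<^sub>R y) = ip x x + 2 * t * ip x y + t\<^sup>2 * ip y y"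
proof -
  have *: "t *\<^sub>R y \<in> car X" "x + t *\<^sub>R y \<in> car X"
    using assms car_subspace by (auto simp: subspace_add subspace_scale)
  show ?thesis using assms *
    by (simp add: ip_add_left ip_add_right ip_scale_left ip_scale_right ip_commute[of y x]
        power2_eq_square algebra_simps)
qed

lemma Cauchy_Schwarz: "x \<in> car X \<Longrightarrow> y \<in> car X \<Longrightarrow> \<bar>ip x y\<bar> \<le> nrm X x * nrm X y"
proof -
  assume *: "x \<in> car X" "y \<in> car X"
  have "x + t *\<^sub>R y \<in> car X" for t
    using * car_subspace by (auto simp: subspace_add subspace_scale)
  then have "(ip x y)\<^sup>2 \<le> ip x x * ip y y"
    using ip_nonneg * by (intro quadratic_nonneg_discriminant) (auto simp: ip_expand[symmetric])
  then show ?thesis using *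
    by (simp add: nrm_eq_ip real_sqrt_mult[symmetric] real_le_rsqrt)
qed

sublocale seminormed X
proof
  show "subspace (car X)" by (rule car_subspace)
  fix x y assume *: "x \<in> car X" "y \<in> car X"
  then have xy: "x + y \<in> car X" using car_subspace by (simp add: subspace_add)
  have "0 \<le> nrm X x" "0 \<le> nrm X y" using * by (auto simp: nrm_eq_ip ip_nonneg)
  moreover have "(nrm X (x + y))\<^sup>2 \<le> (nrm X x + nrm X y)\<^sup>2"
    using ip_expand[OF *, of 1] Cauchy_Schwarz[OF *]
    by (simp add: ip_self[OF xy] ip_self[OF *(1)] ip_self[OF *(2)] power2_sum)
  ultimately show "nrm X (x + y) \<le> nrm X x + nrm X y"
    by (simp add: power2_le_iff_abs_le)
next
  fix x c assume "x \<in> car X"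
  then show "nrm X (c *\<^sub>R x) = \<bar>c\<bar> * nrm X x"
    using car_subspace
    by (simp add: nrm_eq_ip subspace_scale ip_scale_left ip_scale_right real_sqrt_mult[symmetric]
        flip: real_sqrt_abs2 mult.assoc)
qed

lemma ip_zero [simp]: "y \<in> car X \<Longrightarrow> ip 0 y = 0" "y \<in> car X \<Longrightarrow> ip y 0 = 0"
  using ip_scale_left[of 0 y 0] ip_scale_right[of 0 y 0] by auto

lemma ip_diff_left: "x \<in> car X \<Longrightarrow> y \<in> car X \<Longrightarrow> z \<in> car X \<Longrightarrow> ip (x - y) z = ip x z - ip y z"
  using ip_add_left[of x "(-1) *\<^sub>R y" z] ip_scale_left[of y z "-1"] by auto

lemma ip_diff_right: "x \<in> car X \<Longrightarrow> y \<in> car X \<Longrightarrow> z \<in> car X \<Longrightarrow> ip z (x - y) = ip z x - ip z y"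
  using ip_diff_left[of x y z] ip_commute[of z] by auto

lemma ip_minus_left: "x \<in> car X \<Longrightarrow> y \<in> car X \<Longrightarrow> ip (- x) y = - ip x y"
  using ip_scale_left[of x y "-1"] by auto

lemma ip_sum_left:
  assumes "finite I" "\<And>i. i \<in> I \<Longrightarrow> v i \<in> car X" "y \<in> car X"
  shows "(\<Sum>i\<in>I. c i *\<^sub>R v i) \<in> car X \<and> ip (\<Sum>i\<in>I. c i *\<^sub>R v i) y = (\<Sum>i\<in>I. c i * ip (v i) y)"
  using assms by (induction I rule: finite_induct) (auto simp: ip_add_left ip_scale_left)

lemma ip_eq_zero_if_nrm_zero: "x \<in> car X \<Longrightarrow> y \<in> car X \<Longrightarrow> nrm X x = 0 \<Longrightarrow> ip x y = 0"
  using Cauchy_Schwarz[of x y] by auto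

lemma nrm_zero_if_orthogonal: "x \<in> car X \<Longrightarrow> (\<And>y. y \<in> car X \<Longrightarrow> ip x y = 0) \<Longrightarrow> nrm X x = 0"
  by (simp add: nrm_eq_ip)

lemma nrm_le_if_ip_le:
  assumes "x \<in> car X" "0 \<le> C" "ip x x \<le> C * nrm X x"
  shows "nrm X x \<le> C"
proof (cases "nrm X x = 0")
  case False
  with assms nrm_nonneg[of x] show ?thesis by (auto simp: ip_self power2_eq_square)
qed (use assms in auto)

text \<open>Polarization reduces this to the measurability of norms.\<close>

lemma borel_measurable_ip:
  assumes M: "complete_measure M" and "strongly_measurable M X u" "strongly_measurable M X v"
  shows "(\<lambda>t. ip (u t) (v t)) \<in> borel_measurable M"
proof -
  have "(\<lambda>t. ((nrm X (u t + v t))\<^sup>2 - (nrm X (u t - v t))\<^sup>2) / 4) \<in> borel_measurable M"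
    using assms by (intro borel_measurable_divide borel_measurable_diff borel_measurable_power
        borel_measurable_nrm strongly_measurable_add strongly_measurable_diff) auto
  moreover have "ip x y = ((nrm X (x + y))\<^sup>2 - (nrm X (x - y))\<^sup>2) / 4" if "x \<in> car X" "y \<in> car X" for x y
    using that by (simp add: ip_self[symmetric] ip_add_left ip_add_right ip_diff_left ip_diff_right
        ip_commute[of y x])
  ultimately show ?thesis
    using strongly_measurable_car[OF assms(2)] strongly_measurable_car[OF assms(3)]
    by (subst measurable_cong) auto
qed

lemma strongly_measurable_const: "c \<in> car X \<Longrightarrow> strongly_measurable M X (\<lambda>_. c)"
  by (rule strongly_measurable_simple) auto

lemma integrable_ip:
  assumes "complete_measure M" "strongly_measurable M X u" "integrable M (\<lambda>t. nrm X (u t))" "\<psi> \<in> car X"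
  shows "integrable M (\<lambda>t. ip (u t) \<psi>)"
    and "\<bar>LINT t|M. ip (u t) \<psi>\<bar> \<le> nrm X \<psi> * (LINT t|M. nrm X (u t))"
proof -
  have b: "norm (ip (u t) \<psi>) \<le> nrm X \<psi> * nrm X (u t)" if "t \<in> space M" for t
    using Cauchy_Schwarz[OF strongly_measurable_car[OF assms(2) that] assms(4)] by (simp add: mult.commute)
  have i: "integrable M (\<lambda>t. nrm X \<psi> * nrm X (u t))" using assms(3) by simp
  show *: "integrable M (\<lambda>t. ip (u t) \<psi>)"
    using i
  proof (rule Bochner_Integration.integrable_bound)
    show "AE t in M. norm (ip (u t) \<psi>) \<le> norm (nrm X \<psi> * nrm X (u t))"
      
      by (intro AE_I2 order_trans[OF b]) auto
  qed (intro borel_measurable_ip strongly_measurable_const assms)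
  have "norm (LINT t|M. ip (u t) \<psi>) \<le> (LINT t|M. norm (ip (u t) \<psi>))"
    by (rule integral_norm_bound)
  also have "\<dots> \<le> (LINT t|M. nrm X \<psi> * nrm X (u t))"
    using * i b by (intro integral_mono_AE) auto
  finally show "\<bar>LINT t|M. ip (u t) \<psi>\<bar> \<le> nrm X \<psi> * (LINT t|M. nrm X (u t))"
    by simp
qed

end

locale hilbert = prehilbert +
  assumes complete: "(\<And>n::nat. s n \<in> car X) \<Longrightarrow>
      (\<And>e. e > 0 \<Longrightarrow> \<exists>N. \<forall>m\<ge>N. \<forall>n\<ge>N. nrm X (s m - s n) < e) \<Longrightarrow>
      \<exists>l\<in>car X. (\<lambda>n. nrm X (s n - l)) \<longlonglongrightarrow> 0"
begin

text \<open>The representer minimizes \<open>ip x x - 2 * f x\<close>; a minimizing sequence is Cauchy by the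
  parallelogram law.\<close>

theorem riesz:
  assumes add: "\<And>x y. x \<in> car X \<Longrightarrow> y \<in> car X \<Longrightarrow> f (x + y) = f x + f y"
    and scale: "\<And>c x. x \<in> car X \<Longrightarrow> f (c *\<^sub>R x) = c * f x"
    and bound: "\<And>x. x \<in> car X \<Longrightarrow> \<bar>f x\<bar> \<le> C * nrm X x"
  shows "\<exists>w\<in>car X. \<forall>\<psi>\<in>car X. ip w \<psi> = f \<psi>"
proof -
  define J where "J x = ip x x - 2 * f x" for x
  have lower: "- C\<^sup>2 \<le> J x" if "x \<in> car X" for x
  proof -
    have "0 \<le> (nrm X x - C)\<^sup>2" by simp
    then show ?thesis using bound[OF that] ip_self[OF that]
      by (simp add: J_def power2_diff algebra_simps abs_le_iff)
  qed
  have bdd: "bdd_below (J ` car X)" using lower by (auto simp: bdd_below_def)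
  define m where "m = Inf (J ` car X)"
  have m_le: "m \<le> J x" if "x \<in> car X" for x
    unfolding m_def using that bdd by (intro cInf_lower) auto
  have "\<exists>x\<in>car X. J x < m + 1 / real (Suc n)" for n
  proof -
    have "J ` car X \<noteq> {}" using zero_car by blast
    from cInf_lessD[OF this, of "m + 1 / real (Suc n)"] show ?thesis by (auto simp: m_def)
  qed
  then obtain x where x: "\<And>n. x n \<in> car X" "\<And>n. J (x n) < m + 1 / real (Suc n)" by metis
  have par: "(nrm X (x n - x k))\<^sup>2 \<le> 2 / real (Suc n) + 2 / real (Suc k)" for n k
  proof -
    let ?h = "(1/2) *\<^sub>R (x n + x k)"
    have "m \<le> J ?h" using x(1) by (intro m_le) auto
    moreover have "J ?h = (ip (x n) (x n) + 2 * ip (x n) (x k) + ip (x k) (x k)) / 4 - (f (x n) + f (x k))"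
      using x(1) by (simp add: J_def ip_scale_left ip_scale_right ip_add_left ip_add_right
          add scale ip_commute[of "x k" "x n"] field_simps)
    moreover have "(nrm X (x n - x k))\<^sup>2 = ip (x n) (x n) - 2 * ip (x n) (x k) + ip (x k) (x k)"
      using x(1) by (simp add: ip_self[symmetric] ip_diff_left ip_diff_right ip_commute[of "x k" "x n"])
    moreover have "2 / real (Suc i) = 2 * (1 / real (Suc i))" for i by simp
    ultimately show ?thesis using x(2)[of n] x(2)[of k] unfolding J_def by argo
  qed
  have "\<exists>w\<in>car X. (\<lambda>n. nrm X (x n - w)) \<longlonglongrightarrow> 0"
  proof (rule complete[OF x(1)])
    fix e :: real assume e: "e > 0"
    obtain N where N: "4 / e\<^sup>2 < real N" using reals_Archimedean2 by blast
    have "nrm X (x n - x k) < e" if "n \<ge> N" "k \<ge> N" for n k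
    proof -
      have "0 < 4 / e\<^sup>2" using e by simp
      then have "0 < real N" using N by linarith
      have "2 / real (Suc n) + 2 / real (Suc k) \<le> 2 / real (Suc N) + 2 / real (Suc N)"
        using that by (intro add_mono divide_left_mono) auto
      also have "\<dots> = 4 / real (Suc N)" by simp
      also have "\<dots> < 4 / real N" using \<open>0 < real N\<close> by (intro divide_strict_left_mono) auto
      also have "\<dots> < e\<^sup>2" using N e \<open>0 < real N\<close> by (simp add: field_simps)
      finally have "(nrm X (x n - x k))\<^sup>2 < e\<^sup>2" using par[of n k] by linarith
      then show ?thesis using e by (simp add: power2_less_imp_less)
    qed
    then show "\<exists>N. \<forall>m\<ge>N. \<forall>n\<ge>N. nrm X (x m - x n) < e" by blast
  qed
  then obtain w where w: "w \<in> car X" "(\<lambda>n. nrm X (x n - w)) \<longlonglongrightarrow> 0" by blast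
  have "(\<lambda>n. nrm X (x n)) \<longlonglongrightarrow> nrm X w" using x(1) w by (intro nrm_tendsto)
  moreover have "(\<lambda>n. f (x n)) \<longlonglongrightarrow> f w"
  proof -
    have "f (x n) - f w = f (x n - w)" for n
      using add[of "x n - w" w] x(1) w(1) by auto
    moreover have "(\<lambda>n. \<bar>f (x n - w)\<bar>) \<longlonglongrightarrow> 0"
      by (rule tendsto_zero_squeeze[OF tendsto_mult_right_zero[OF w(2), of C]])
        (use bound x(1) w(1) in auto)
    ultimately have "(\<lambda>n. f (x n) - f w) \<longlonglongrightarrow> 0" by (simp add: tendsto_rabs_zero_iff)
    then show ?thesis by (rule LIM_zero_cancel)
  qed
  ultimately have "(\<lambda>n. J (x n)) \<longlonglongrightarrow> J w"
    unfolding J_def using x(1) w(1) by (auto simp: ip_self intro!: tendsto_intros)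
  moreover have "(\<lambda>n. m + 1 / real (Suc n)) \<longlonglongrightarrow> m + 0"
    by (intro tendsto_add tendsto_const LIMSEQ_Suc[OF lim_1_over_n])
  ultimately have Jw: "J w \<le> m"
    using x(2) by (intro LIMSEQ_le[of "\<lambda>n. J (x n)" _ "\<lambda>n. m + 1 / real (Suc n)"]) (auto intro: less_imp_le)
  have "ip w \<psi> = f \<psi>" if \<psi>: "\<psi> \<in> car X" for \<psi>
  proof -
    \<comment> \<open>Minimality of w along the line through w in direction \<psi>. The constant
      term is zero, so the coefficient of t must vanish, which is the Euler equation.\<close>
    have "0 \<le> 0 + 2 * t * (ip w \<psi> - f \<psi>) + t\<^sup>2 * ip \<psi> \<psi>" for t
      using Jw m_le[of "w + t *\<^sub>R \<psi>"] w(1) \<psi>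
      by (simp add: J_def ip_expand add scale algebra_simps)
    then have "(ip w \<psi> - f \<psi>)\<^sup>2 \<le> 0 * ip \<psi> \<psi>"
      by (rule quadratic_nonneg_discriminant) (rule ip_nonneg[OF \<psi>])
    then show ?thesis by simp
  qed
  with w(1) show ?thesis by blast
qed

end

section \<open>Bochner integrals as weak integrals\<close>

lemma integrable_simple_real:
  fixes f :: "'a \<Rightarrow> real"
  assumes "finite_measure M" "simple_function M f"
  shows "integrable M f"
  using assms finite_measure.emeasure_finite by (intro integrable_simple_function) auto

context prehilbert begin

lemma simple_bochner_integral_weak:
  assumes M: "finite_measure M" and s: "simple_function M s" "\<And>t. t \<in> space M \<Longrightarrow> s t \<in> car X"
  shows "Bochner_Integration.simple_bochner_integral M s \<in> car X"
    and "\<psi> \<in> car X \<Longrightarrow> ip (Bochner_Integration.simple_bochner_integral M s) \<psi> = (LINT t|M. ip (s t) \<psi>)"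
proof -
  interpret finite_measure M by fact
  have fin: "finite (s ` space M)" using s(1) by (simp add: simple_function_def)
  let ?E = "\<lambda>y. {x \<in> space M. s x = y}"
  have E: "?E y \<in> sets M" for y
    using simple_functionD(2)[OF s(1), of "{y}"] by (simp add: vimage_def Int_def conj_commute)
  have im: "y \<in> car X" if "y \<in> s ` space M" for y using that s(2) by auto
  show "Bochner_Integration.simple_bochner_integral M s \<in> car X"
    unfolding simple_bochner_integral_def by (rule conjunct1[OF ip_sum_left[OF fin im zero_car]])
  assume \<psi>: "\<psi> \<in> car X"
  have "(LINT t|M. ip (s t) \<psi>) = (LINT t|M. (\<Sum>y\<in>s ` space M. indicator (?E y) t * ip y \<psi>))"
  proof (intro Bochner_Integration.integral_cong refl)
    fix t assume "t \<in> space M"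
    then have "(\<Sum>y\<in>s ` space M. indicator (?E y) t * ip y \<psi>) = (\<Sum>y\<in>s ` space M. if y = s t then ip y \<psi> else 0)"
      by (intro sum.cong) (auto simp: indicator_def)
    then show "ip (s t) \<psi> = (\<Sum>y\<in>s ` space M. indicator (?E y) t * ip y \<psi>)"
      using fin \<open>t \<in> space M\<close> by (simp add: sum.delta)
  qed
  also have "\<dots> = (\<Sum>y\<in>s ` space M. measure M (?E y) * ip y \<psi>)"
    using E emeasure_finite
    by (subst Bochner_Integration.integral_sum) (auto simp: less_top[symmetric])
  also have "\<dots> = ip (Bochner_Integration.simple_bochner_integral M s) \<psi>"
    unfolding simple_bochner_integral_def by (rule conjunct2[OF ip_sum_left[OF fin im \<psi>], symmetric])
  finally show "ip (Bochner_Integration.simple_bochner_integral M s) \<psi> = (LINT t|M. ip (s t) \<psi>)" by simp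
qed

text \<open>The approximants are replaced by 0 where their norm exceeds twice that of u. This
  provides the integrable majorant \<open>3 * nrm X (u t)\<close>; where u has nonzero norm the
  replacement stops eventually, and where the norm is 0 the majorant itself forces the error to be
  0.\<close>

lemma simple_approximation_L1:
  assumes M: "complete_measure M" "finite_measure M" and u: "strongly_measurable M X u"
    and int: "integrable M (\<lambda>t. nrm X (u t))"
  obtains s where "\<And>n::nat. simple_function M (s n)" "\<And>n t. t \<in> space M \<Longrightarrow> s n t \<in> car X"
    "(\<lambda>n. LINT t|M. nrm X (u t - s n t)) \<longlonglongrightarrow> 0"
proof -
  obtain r where r: "\<And>n. simple_function M (r n)" "\<And>n t. t \<in> space M \<Longrightarrow> r n t \<in> car X"
    "AE t in M. (\<lambda>n::nat. nrm X (r n t - u t)) \<longlonglongrightarrow> 0" using strongly_measurableE[OF u] by blast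
  note uc = strongly_measurable_car[OF u]
  have mr: "(\<lambda>t. nrm X (r n t)) \<in> borel_measurable M" for n
    by (intro borel_measurable_nrm M strongly_measurable_simple r)
  have mu: "(\<lambda>t. nrm X (u t)) \<in> borel_measurable M"
    by (intro borel_measurable_nrm M u)
  define s where "s n t = (if nrm X (r n t) \<le> 2 * nrm X (u t) then r n t else 0)" for n t
  have s: "simple_function M (s n)" for n
    unfolding s_def using mr[of n] mu by (intro simple_function_If r) (auto intro!: borel_measurable_le)
  have sc: "s n t \<in> car X" if "t \<in> space M" for n t using r(2)[OF that] by (simp add: s_def)
  have bd: "nrm X (u t - s n t) \<le> 3 * nrm X (u t)" if "t \<in> space M" for n t
    using nrm_diff_le[of "u t" "r n t"] r(2)[OF that] uc[OF that] nrm_nonneg[of "u t"] by (auto simp: s_def)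
  have "(\<lambda>n. LINT t|M. nrm X (u t - s n t)) \<longlonglongrightarrow> (LINT t|M. 0)"
  proof (rule integral_dominated_convergence[where w="\<lambda>t. 3 * nrm X (u t)"])
    show "(\<lambda>t. nrm X (u t - s n t)) \<in> borel_measurable M" for n
      by (intro borel_measurable_nrm M strongly_measurable_diff strongly_measurable_simple u s sc)
    show "AE t in M. norm (nrm X (u t - s n t)) \<le> 3 * nrm X (u t)" for n
      using bd sc uc by (intro AE_I2) (auto simp: nrm_nonneg)
    show "AE t in M. (\<lambda>n. nrm X (u t - s n t)) \<longlonglongrightarrow> 0"
      using r(3) AE_space
    proof eventually_elim
      case (elim t)
      have c: "r n t \<in> car X" "u t \<in> car X" "s n t \<in> car X" for n using elim r(2) uc sc by auto
      show ?case
      proof (cases "nrm X (u t) = 0")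
        case True
        then have "nrm X (u t - s n t) = 0" for n
          using bd[OF elim(2), of n] nrm_nonneg[of "u t - s n t"] c by auto
        then show ?thesis by simp
      next
        case False
        then have "nrm X (u t) < 2 * nrm X (u t)" using nrm_nonneg[OF c(2)] by simp
        moreover have "(\<lambda>n. nrm X (r n t)) \<longlonglongrightarrow> nrm X (u t)"
          using c elim(1) by (intro nrm_tendsto)
        ultimately have "\<forall>\<^sub>F n in sequentially. nrm X (r n t) < 2 * nrm X (u t)"
          by (rule order_tendstoD(2)[rotated])
        then have "\<forall>\<^sub>F n in sequentially. nrm X (r n t - u t) = nrm X (u t - s n t)"
          by eventually_elim (use c nrm_diff_commute in \<open>auto simp: s_def\<close>)
        then show ?thesis by (rule Lim_transform_eventually[OF elim(1)])
      qed
    qed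
  qed (use int in auto)
  then show thesis using that[of s] s sc by simp
qed

lemma integrable_nrm_simple_diff:
  assumes M: "complete_measure M" "finite_measure M" and u: "strongly_measurable M X u"
    and int: "integrable M (\<lambda>t. nrm X (u t))"
    and s: "simple_function M s" "\<And>t. t \<in> space M \<Longrightarrow> s t \<in> car X"
  shows "integrable M (\<lambda>t. nrm X (s t))" "integrable M (\<lambda>t. nrm X (u t - s t))"
proof -
  show *: "integrable M (\<lambda>t. nrm X (s t))"
    by (rule integrable_simple_real[OF M(2)], rule simple_function_compose1[OF s(1)])
  show "integrable M (\<lambda>t. nrm X (u t - s t))"
  proof (rule Bochner_Integration.integrable_bound)
    show "integrable M (\<lambda>t. nrm X (u t) + nrm X (s t))" using int * by auto
    show "AE t in M. norm (nrm X (u t - s t)) \<le> norm (nrm X (u t) + nrm X (s t))"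
      using AE_space
    proof eventually_elim
      case (elim t)
      then have c: "u t \<in> car X" "s t \<in> car X" using strongly_measurable_car[OF u] s by auto
      then have "0 \<le> nrm X (u t - s t)" by (intro nrm_nonneg) auto
      then show ?case using nrm_diff_le[OF c] by auto
    qed
  qed (intro borel_measurable_nrm M strongly_measurable_diff strongly_measurable_simple u s)
qed

text \<open>Both directions rest on \<open>key\<close>: pairing with \<psi> turns the error of a
  simple approximation into its L1 distance. In the converse direction \<psi> is chosen as the
  difference of the simple integral and w, which bounds the norm of this difference.\<close>

lemma has_bochner_integral_in_iff_weak:
  assumes M: "complete_measure M" "finite_measure M" and u: "strongly_measurable M X u"
    and int: "integrable M (\<lambda>t. nrm X (u t))" and w: "w \<in> car X"
  shows "has_bochner_integral_in M X u w \<longleftrightarrow> (\<forall>\<psi>\<in>car X. ip w \<psi> = (LINT t|M. ip (u t) \<psi>))"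
proof
  have key: "\<bar>(LINT t|M. ip (u t) \<psi>) - ip (Bochner_Integration.simple_bochner_integral M s) \<psi>\<bar>
      \<le> nrm X \<psi> * (LINT t|M. nrm X (u t - s t))"
    if s: "simple_function M s" "\<And>t. t \<in> space M \<Longrightarrow> s t \<in> car X" and \<psi>: "\<psi> \<in> car X" for s \<psi>
  proof -
    note i = integrable_nrm_simple_diff[OF M u int s]
    have ms: "strongly_measurable M X s" by (rule strongly_measurable_simple[OF s])
    have "(LINT t|M. ip (u t) \<psi>) - ip (Bochner_Integration.simple_bochner_integral M s) \<psi>
      = (LINT t|M. ip (u t) \<psi> - ip (s t) \<psi>)"
      using simple_bochner_integral_weak(2)[OF M(2) s \<psi>] integrable_ip(1)[OF M(1) u int \<psi>]
        integrable_ip(1)[OF M(1) ms i(1) \<psi>] by simp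
    also have "\<dots> = (LINT t|M. ip (u t - s t) \<psi>)"
      using s(2) \<psi> strongly_measurable_car[OF u]
      by (intro Bochner_Integration.integral_cong) (auto simp: ip_diff_left)
    finally show ?thesis
      using integrable_ip(2)[OF M(1) strongly_measurable_diff[OF u ms] i(2) \<psi>] by simp
  qed
  {
    assume "has_bochner_integral_in M X u w"
    then obtain s where s: "\<And>n::nat. Bochner_Integration.simple_bochner_integrable M (s n)"
      "\<And>n t. t \<in> space M \<Longrightarrow> s n t \<in> car X"
      "(\<lambda>n::nat. \<integral>\<^sup>+t. ennreal (nrm X (u t - s n t)) \<partial>M) \<longlonglongrightarrow> 0"
      "(\<lambda>n. nrm X (Bochner_Integration.simple_bochner_integral M (s n) - w)) \<longlonglongrightarrow> 0"
      by (auto simp: has_bochner_integral_in_def Pi_iff)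
    have sf: "simple_function M (s n)" for n using s(1)[of n] by (auto elim: simple_bochner_integrable.cases)
    note i = integrable_nrm_simple_diff[OF M u int sf s(2)]
    have "(\<integral>\<^sup>+t. ennreal (nrm X (u t - s n t)) \<partial>M) = ennreal (LINT t|M. nrm X (u t - s n t))" for n
      using s(2) strongly_measurable_car[OF u]
      by (intro nn_integral_eq_integral i(2) AE_I2) (auto intro!: nrm_nonneg)
    with s(3) have ln: "(\<lambda>n. ennreal (LINT t|M. nrm X (u t - s n t))) \<longlonglongrightarrow> ennreal 0" by simp
    have "0 \<le> (LINT t|M. nrm X (u t - s n t))" for n
      using s(2) strongly_measurable_car[OF u]
      by (intro Bochner_Integration.integral_nonneg nrm_nonneg diff_car) auto
    with ln have lim: "(\<lambda>n. LINT t|M. nrm X (u t - s n t)) \<longlonglongrightarrow> 0"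
      by (subst (asm) tendsto_ennreal_iff) auto
    show "\<forall>\<psi>\<in>car X. ip w \<psi> = (LINT t|M. ip (u t) \<psi>)"
    proof
      fix \<psi> assume \<psi>: "\<psi> \<in> car X"
      note sc = simple_bochner_integral_weak(1)[OF M(2) sf s(2)]
      have 1: "(\<lambda>n. ip (Bochner_Integration.simple_bochner_integral M (s n)) \<psi> - ip w \<psi>) \<longlonglongrightarrow> 0"
      proof (rule tendsto_rabs_zero_cancel, rule tendsto_zero_squeeze)
        show "(\<lambda>n. nrm X (Bochner_Integration.simple_bochner_integral M (s n) - w) * nrm X \<psi>) \<longlonglongrightarrow> 0"
          by (rule tendsto_mult_left_zero[OF s(4)])
        show "\<bar>ip (Bochner_Integration.simple_bochner_integral M (s n)) \<psi> - ip w \<psi>\<bar> \<le> nrm X (Bochner_Integration.simple_bochner_integral M (s n) - w) * nrm X \<psi>" for n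
          using Cauchy_Schwarz[of "Bochner_Integration.simple_bochner_integral M (s n) - w" \<psi>] sc w \<psi> by (simp add: ip_diff_left)
      qed simp
      have 2: "(\<lambda>n. (LINT t|M. ip (u t) \<psi>) - ip (Bochner_Integration.simple_bochner_integral M (s n)) \<psi>) \<longlonglongrightarrow> 0"
      proof (rule tendsto_rabs_zero_cancel, rule tendsto_zero_squeeze)
        show "(\<lambda>n. nrm X \<psi> * (LINT t|M. nrm X (u t - s n t))) \<longlonglongrightarrow> 0"
          by (rule tendsto_mult_right_zero[OF lim])
      qed (use key[OF sf s(2) \<psi>] in auto)
      from tendsto_add[OF 1 2] show "ip w \<psi> = (LINT t|M. ip (u t) \<psi>)"
        by (simp add: LIMSEQ_const_iff)
    qed
  }
  {
    assume weak: "\<forall>\<psi>\<in>car X. ip w \<psi> = (LINT t|M. ip (u t) \<psi>)"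
    obtain s where s: "\<And>n::nat. simple_function M (s n)" "\<And>n t. t \<in> space M \<Longrightarrow> s n t \<in> car X"
      "(\<lambda>n. LINT t|M. nrm X (u t - s n t)) \<longlonglongrightarrow> 0"
      using simple_approximation_L1[OF M u int] by blast
    note i = integrable_nrm_simple_diff[OF M u int s(1,2)]
    have sb: "Bochner_Integration.simple_bochner_integrable M (s n)" for n
      using s(1) finite_measure.emeasure_finite[OF M(2)] by (auto intro: simple_bochner_integrable.intros)
    have pos: "0 \<le> (LINT t|M. nrm X (u t - s n t))" for n
      using s(2) strongly_measurable_car[OF u]
      by (intro Bochner_Integration.integral_nonneg nrm_nonneg diff_car) auto
    have "(\<integral>\<^sup>+t. ennreal (nrm X (u t - s n t)) \<partial>M) = ennreal (LINT t|M. nrm X (u t - s n t))" for n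
      using s(2) strongly_measurable_car[OF u]
      by (intro nn_integral_eq_integral i(2) AE_I2) (auto intro!: nrm_nonneg)
    then have nn: "(\<lambda>n. \<integral>\<^sup>+t. ennreal (nrm X (u t - s n t)) \<partial>M) \<longlonglongrightarrow> 0"
      using tendsto_ennrealI[OF s(3)] by simp
    have le: "nrm X (Bochner_Integration.simple_bochner_integral M (s n) - w) \<le> (LINT t|M. nrm X (u t - s n t))" for n
    proof (rule nrm_le_if_ip_le)
      note sc = simple_bochner_integral_weak(1)[OF M(2) s(1,2), of n]
      let ?d = "Bochner_Integration.simple_bochner_integral M (s n) - w"
      show d: "?d \<in> car X" using sc w by auto
      have "ip ?d ?d = ip (Bochner_Integration.simple_bochner_integral M (s n)) ?d - (LINT t|M. ip (u t) ?d)"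
        using weak d sc w by (metis ip_diff_left)
      then show "ip ?d ?d \<le> (LINT t|M. nrm X (u t - s n t)) * nrm X ?d"
        using key[OF s(1,2) d, of n] by (simp add: abs_le_iff mult.commute)
    qed (rule pos)
    have "(\<lambda>n. nrm X (Bochner_Integration.simple_bochner_integral M (s n) - w)) \<longlonglongrightarrow> 0"
      by (rule tendsto_zero_squeeze[OF s(3) _ le])
        (use simple_bochner_integral_weak(1)[OF M(2) s(1,2)] w in \<open>auto intro!: nrm_nonneg\<close>)
    then show "has_bochner_integral_in M X u w"
      unfolding has_bochner_integral_in_def using w u sb s(2) nn by auto
  }
qed

end

section \<open>Scalar functions of time\<close>

lemma smooth_frechet_derivative:
  assumes "smooth \<phi>"
  shows "(\<phi> has_derivative frechet_derivative \<phi> (at x)) (at x)"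
    and "smooth (\<lambda>x. frechet_derivative \<phi> (at x) v)"
proof -
  obtain D where D: "\<And>x. (\<phi> has_derivative D x) (at x)" "\<And>v. smooth (\<lambda>x. D x v)"
    by (rule smoothE[OF assms]) (rule that)
  have "frechet_derivative \<phi> (at x) = D x" for x using frechet_derivative_at[OF D(1)] by simp
  then show "(\<phi> has_derivative frechet_derivative \<phi> (at x)) (at x)"
    "smooth (\<lambda>x. frechet_derivative \<phi> (at x) v)" using D by auto
qed

lemma test_function_frechet_derivative:
  assumes "test_function U \<phi>"
  shows "test_function U (\<lambda>x. frechet_derivative \<phi> (at x) v)"
proof -
  have s: "smooth \<phi>" and c: "compact (closure {x. \<phi> x \<noteq> 0})" and U: "closure {x. \<phi> x \<noteq> 0} \<subseteq> U"
    using assms by (auto simp: test_function_def)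
  have "frechet_derivative \<phi> (at x) v = 0" if "x \<notin> closure {x. \<phi> x \<noteq> 0}" for x
  proof -
    have "((\<lambda>_. 0) has_derivative (\<lambda>_. 0)) (at x)" by simp
    then have "(\<phi> has_derivative (\<lambda>_. 0)) (at x)"
      by (rule has_derivative_transform_within_open[where s="- closure {x. \<phi> x \<noteq> 0}"])
        (use that closure_subset[of "{x. \<phi> x \<noteq> 0}"] in \<open>auto simp: open_Compl\<close>)
    from frechet_derivative_at[OF this] show ?thesis by (metis)
  qed
  then have "closure {x. frechet_derivative \<phi> (at x) v \<noteq> 0} \<subseteq> closure {x. \<phi> x \<noteq> 0}"
    by (intro closure_minimal) auto
  moreover from this have "compact (closure {x. frechet_derivative \<phi> (at x) v \<noteq> 0})"
    using c by (meson closed_closure compact_closure bounded_subset compact_imp_bounded closure_subset order_trans)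
  ultimately show ?thesis using U smooth_frechet_derivative(2)[OF s] by (auto simp: test_function_def)
qed

lemma test_function_bounded:
  assumes "test_function U \<phi>"
  shows "\<exists>B\<ge>0. \<forall>x. \<bar>\<phi> x\<bar> \<le> B"
proof -
  have s: "smooth \<phi>" and c: "compact (closure {x. \<phi> x \<noteq> 0})"
    using assms by (auto simp: test_function_def)
  have "bounded (\<phi> ` closure {x. \<phi> x \<noteq> 0})"
    by (intro compact_imp_bounded compact_continuous_image smooth_continuous_on s c)
  then obtain B where B: "\<And>x. x \<in> closure {x. \<phi> x \<noteq> 0} \<Longrightarrow> \<bar>\<phi> x\<bar> \<le> B"
    by (auto simp: bounded_iff)
  have "\<bar>\<phi> x\<bar> \<le> max B 0" for x
    using B[of x] closure_subset[of "{x. \<phi> x \<noteq> 0}"] by (cases "\<phi> x = 0") auto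
  then show ?thesis by (intro exI[of _ "max B 0"]) auto
qed

lemma test_function_outside: "test_function U \<phi> \<Longrightarrow> x \<notin> U \<Longrightarrow> \<phi> x = 0"
  using closure_subset[of "{x. \<phi> x \<noteq> 0}"] by (auto simp: test_function_def)

lemma test_function_measurable: "test_function U \<phi> \<Longrightarrow> \<phi> \<in> borel_measurable (lebesgue_on S)"
  by (intro borel_measurable_lebesgue_on borel_measurable_continuous_onI smooth_continuous_on)
    (simp add: test_function_def)

lemma deriv_eq_frechet_derivative:
  fixes \<phi> :: "real \<Rightarrow> real"
  assumes "smooth \<phi>"
  shows "(\<phi> has_real_derivative frechet_derivative \<phi> (at t) 1) (at t)"
    and "deriv \<phi> t = frechet_derivative \<phi> (at t) 1"
proof -
  interpret D: bounded_linear "frechet_derivative \<phi> (at t)"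
    using smooth_frechet_derivative(1)[OF assms] by (rule has_derivative_bounded_linear)
  show "(\<phi> has_real_derivative frechet_derivative \<phi> (at t) 1) (at t)"
  proof (rule has_derivative_imp_has_field_derivative[OF smooth_frechet_derivative(1)[OF assms]])
    show "x * frechet_derivative \<phi> (at t) 1 = frechet_derivative \<phi> (at t) x" for x
      using D.scaleR[of x 1] by simp
  qed
  then show "deriv \<phi> t = frechet_derivative \<phi> (at t) 1" by (rule DERIV_imp_deriv)
qed

lemma test_function_deriv:
  fixes \<phi> :: "real \<Rightarrow> real"
  assumes "test_function U \<phi>"
  shows "test_function U (deriv \<phi>)"
proof -
  have "deriv \<phi> = (\<lambda>x. frechet_derivative \<phi> (at x) 1)"
    using assms by (auto simp: test_function_def deriv_eq_frechet_derivative(2))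
  then show ?thesis using test_function_frechet_derivative[OF assms, of 1] by simp
qed

lemma test_function_has_deriv:
  "test_function U \<phi> \<Longrightarrow> (\<phi> has_real_derivative deriv \<phi> t) (at t)" for \<phi> :: "real \<Rightarrow> real"
  using deriv_eq_frechet_derivative[of \<phi> t] by (simp add: test_function_def)

section \<open>Integrals over subintervals of the time interval\<close>

lemma complete_time: "complete_measure (time T)"
  by (rule complete_measure_lebesgue_on) auto

lemma finite_time: "finite_measure (time T)"
  by (rule finite_measure_lebesgue_on) (auto intro!: bounded_set_imp_lmeasurable)

lemma integrable_mult_bounded:
  fixes g p :: "'a \<Rightarrow> real"
  assumes "integrable M g" "p \<in> borel_measurable M" "\<And>x. x \<in> space M \<Longrightarrow> \<bar>p x\<bar> \<le> B"
  shows "integrable M (\<lambda>x. p x * g x)"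
proof (rule Bochner_Integration.integrable_bound)
  show "integrable M (\<lambda>x. B * g x)" using assms(1) by simp
  show "AE x in M. norm (p x * g x) \<le> norm (B * g x)"
  proof (rule AE_I2)
    fix x assume "x \<in> space M"
    from assms(3)[OF this] show "norm (p x * g x) \<le> norm (B * g x)"
      by (auto simp: abs_mult intro!: mult_right_mono)
  qed
qed (use assms in auto)

text \<open>Moves the varying domain of integration into the integrand, so that Fubini and dominated
  convergence act on one fixed measure space.\<close>

lemma prefix_integral_eq:
  assumes "t \<le> T"
  shows "(LINT s|time t. g s) = (LINT s|time T. (if s < t then g s else (0::real)))"
proof -
  have "(LINT s|time t. g s) = (LINT s|time T. (if s \<in> {0<..<t} then g s else 0))"
    using assms by (intro Lebesgue_Measure.integral_restrict[symmetric]) auto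
  also have "\<dots> = (LINT s|time T. (if s < t then g s else 0))"
    by (intro Bochner_Integration.integral_cong) auto
  finally show ?thesis .
qed

lemma suffix_integral_eq:
  assumes "0 \<le> s"
  shows "(LINT t|lebesgue_on {s<..<T}. g t) = (LINT t|time T. (if s < t then g t else (0::real)))"
proof -
  have "(LINT t|lebesgue_on {s<..<T}. g t) = (LINT t|time T. (if t \<in> {s<..<T} then g t else 0))"
    using assms by (intro Lebesgue_Measure.integral_restrict[symmetric]) auto
  also have "\<dots> = (LINT t|time T. (if s < t then g t else 0))"
    by (intro Bochner_Integration.integral_cong) auto
  finally show ?thesis .
qed

lemma integrable_time_mono:
  fixes g :: "real \<Rightarrow> real"
  assumes "integrable (time T) g" "t \<le> T"
  shows "integrable (time t) g"
proof -
  have "integrable lebesgue (\<lambda>x. indicat_real {0<..<t} x *\<^sub>R (if x \<in> {0<..<T} then g x else 0))"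
    using assms(1) by (intro integrable_mult_indicator) (auto simp: Lebesgue_Measure.integrable_restrict_UNIV simp del: greaterThanLessThan_iff)
  also have "(\<lambda>x. indicat_real {0<..<t} x *\<^sub>R (if x \<in> {0<..<T} then g x else 0)) = (\<lambda>x. if x \<in> {0<..<t} then g x else 0)"
    using assms(2) by (auto simp: fun_eq_iff)
  finally show ?thesis by (subst (asm) Lebesgue_Measure.integrable_restrict_UNIV) auto
qed

lemma strongly_measurable_time_mono:
  assumes "strongly_measurable (time T) X u" "t \<le> T"
  shows "strongly_measurable (time t) X u"
proof -
  have e: "{0<..<t} \<inter> {0<..<T} = {0<..<t}" using assms(2) by auto
  have r: "restrict_space (time T) {0<..<t} = time t"
    using assms(2) by (subst restrict_restrict_space) (auto intro!: arg_cong[where f="restrict_space lebesgue"])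
  have st: "{0<..<t} \<in> sets (time T)"
    using e by (auto simp: sets_restrict_space intro!: image_eqI[of _ _ "{0<..<t}"])
  have sf: "simple_function (time t) s" if "simple_function (time T) s" for s :: "real \<Rightarrow> 'b"
    unfolding simple_function_def
  proof (intro conjI ballI)
    show "finite (s ` space (time t))"
      by (rule finite_subset[OF _ simple_functionD(1)[OF that]]) (use assms(2) in auto)
    fix x
    have "s -` {x} \<inter> space (time T) \<in> sets (time T)" by (rule simple_functionD(2)[OF that])
    then have "s -` {x} \<inter> space (time T) \<inter> {0<..<t} \<in> sets (time T)" using st by auto
    moreover have "s -` {x} \<inter> space (time T) \<inter> {0<..<t} = s -` {x} \<inter> space (time t)" using e by auto
    ultimately show "s -` {x} \<inter> space (time t) \<in> sets (time t)"
      unfolding r[symmetric] using st assms(2) by (subst sets_restrict_space_iff) (auto simp: min_absorb1)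
  qed
  have ae: "AE t in time t. P t" if "AE t in time T. P t" for P
    using that st assms(2) unfolding r[symmetric]
    by (subst AE_restrict_space_iff) (auto simp: min_absorb1 elim: eventually_mono)
  obtain s where s: "\<And>n. simple_function (time T) (s n)" "\<And>n t. t \<in> space (time T) \<Longrightarrow> s n t \<in> car X"
    "AE t in time T. (\<lambda>n::nat. nrm X (s n t - u t)) \<longlonglongrightarrow> 0" using strongly_measurableE[OF assms(1)] by blast
  show ?thesis
    by (rule strongly_measurableI[where s=s])
      (use s sf ae strongly_measurable_car[OF assms(1)] assms(2) in auto)
qed

text \<open>Exchange of the order of integration on the triangle s < t. With p = 0 the first part is
  used on its own, for the integrability of primitives; the second part carries integration by parts
  and the exponentially weighted Volterra estimate.\<close>

lemma Fubini_time:
  fixes g p :: "real \<Rightarrow> real"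
  assumes g: "integrable (time T) g" and p: "p \<in> borel_measurable (time T)"
    and B: "\<And>t. t \<in> {0<..<T} \<Longrightarrow> \<bar>p t\<bar> \<le> B"
  shows "integrable (time T) (\<lambda>t. LINT s|time t. g s)"
    and "(LINT t|time T. p t * (LINT s|time t. g s))
      = (LINT s|time T. (LINT t|lebesgue_on {s<..<T}. p t) * g s)"
proof -
  let ?M = "time T"
  interpret finite_measure ?M by (rule finite_time)
  have sf: "sigma_finite_measure ?M" by (rule sigma_finite_measure_axioms)
  interpret pair_sigma_finite ?M ?M ..
  have id: "(\<lambda>x::real. x) \<in> borel_measurable ?M" by (rule borel_measurable_lebesgue_on) simp
  have gm: "g \<in> borel_measurable ?M" using g by auto
  have id1: "(\<lambda>z. fst z) \<in> borel_measurable (?M \<Otimes>\<^sub>M ?M)"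
    by (rule measurable_compose[OF measurable_fst id])
  have id2: "(\<lambda>z. snd z) \<in> borel_measurable (?M \<Otimes>\<^sub>M ?M)"
    by (rule measurable_compose[OF measurable_snd id])
  have pm: "(\<lambda>z. p (fst z)) \<in> borel_measurable (?M \<Otimes>\<^sub>M ?M)"
    by (rule measurable_compose[OF measurable_fst p])
  have m1: "(\<lambda>z. if snd z < fst z then g (snd z) else 0) \<in> borel_measurable (?M \<Otimes>\<^sub>M ?M)"
    by (rule measurable_If[OF measurable_compose[OF measurable_snd gm] _ borel_measurable_less[OF id2 id1]]) simp
  have ig: "integrable ?M (\<lambda>s. if s < t then g s else 0)" for t
  proof -
    have "integrable ?M (\<lambda>s. indicat_real {..<t} s * g s)"
      by (rule integrable_mult_bounded[OF g, where B=1]) (auto intro: borel_measurable_lebesgue_on simp: indicator_def)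
    also have "(\<lambda>s. indicat_real {..<t} s * g s) = (\<lambda>s. if s < t then g s else 0)"
      by (auto simp: fun_eq_iff)
    finally show ?thesis .
  qed
  have I1: "integrable (?M \<Otimes>\<^sub>M ?M) (\<lambda>(t, s). if s < t then g s else 0)"
  proof (rule Fubini_integrable)
    show "(\<lambda>(t, s). if s < t then g s else 0) \<in> borel_measurable (?M \<Otimes>\<^sub>M ?M)"
      using m1 by (simp add: case_prod_unfold)
    then have "(\<lambda>z. norm ((\<lambda>(t, s). if s < t then g s else 0) z)) \<in> borel_measurable (?M \<Otimes>\<^sub>M ?M)"
      by (rule measurable_compose[OF _ borel_measurable_continuous_onI[OF continuous_on_norm_id]])
    then have m: "(\<lambda>(t, s). norm (if s < t then g s else 0)) \<in> borel_measurable (?M \<Otimes>\<^sub>M ?M)"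
      by (simp add: case_prod_unfold)
    show "integrable ?M (\<lambda>t. LINT s|?M. norm ((\<lambda>(t, s). if s < t then g s else 0) (t, s)))"
    proof (rule integrable_const_bound[where B="LINT s|?M. \<bar>g s\<bar>"])
      show "AE t in ?M. norm (LINT s|?M. norm ((\<lambda>(t, s). if s < t then g s else 0) (t, s))) \<le> (LINT s|?M. \<bar>g s\<bar>)"
        using ig g by (intro AE_I2) (auto intro!: integral_mono)
    qed (use sigma_finite_measure.borel_measurable_lebesgue_integral[OF sf m] in simp)
    show "AE t in ?M. integrable ?M (\<lambda>s. (\<lambda>(t, s). if s < t then g s else 0) (t, s))"
      using ig by simp
  qed
  from integrable_fst[OF I1] show "integrable ?M (\<lambda>t. LINT s|time t. g s)"
    by (rule Bochner_Integration.integrable_cong[THEN iffD1, rotated -1]) 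
      (auto simp: prefix_integral_eq[where T=T, OF less_imp_le])
  have pb: "integrable (?M \<Otimes>\<^sub>M ?M) (\<lambda>z. p (fst z) * (\<lambda>(t, s). if s < t then g s else 0) z)"
    by (rule integrable_mult_bounded[OF I1, where B=B]) (use B pm in \<open>auto simp: space_pair_measure\<close>)
  then have I2: "integrable (?M \<Otimes>\<^sub>M ?M) (\<lambda>(t, s). p t * (if s < t then g s else 0))"
    by (simp add: case_prod_unfold)
  have "(LINT t|?M. p t * (LINT s|time t. g s)) = (LINT t|?M. LINT s|?M. p t * (if s < t then g s else 0))"
    by (intro Bochner_Integration.integral_cong refl)
      (simp add: prefix_integral_eq[where T=T, OF less_imp_le])
  also have "\<dots> = (LINT s|?M. LINT t|?M. p t * (if s < t then g s else 0))"
    by (rule Fubini_integral[symmetric, OF I2])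
  also have "\<dots> = (LINT s|?M. (LINT t|lebesgue_on {s<..<T}. p t) * g s)"
  proof (intro Bochner_Integration.integral_cong refl)
    fix s assume "s \<in> space ?M"
    then have s: "0 \<le> s" by simp
    have "(LINT t|?M. p t * (if s < t then g s else 0)) = (LINT t|?M. (if s < t then p t else 0) * g s)"
      by (intro Bochner_Integration.integral_cong) auto
    then show "(LINT t|?M. p t * (if s < t then g s else 0)) = (LINT t|lebesgue_on {s<..<T}. p t) * g s"
      by (simp add: suffix_integral_eq[OF s])
  qed
  finally show "(LINT t|?M. p t * (LINT s|time t. g s)) = (LINT s|?M. (LINT t|lebesgue_on {s<..<T}. p t) * g s)" .
qed

lemma integral_time_FTC:
  fixes F f :: "real \<Rightarrow> real"
  assumes "a \<le> b" "\<And>x. (F has_real_derivative f x) (at x)" "continuous_on UNIV f"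
  shows "(LINT t|lebesgue_on {a<..<b}. f t) = F b - F a"
proof -
  have hi: "(f has_integral (F b - F a)) {a..b}"
    using assms by (intro fundamental_theorem_of_calculus)
      (auto simp: has_real_derivative_iff_has_vector_derivative[symmetric] intro: has_field_derivative_at_within)
  have "compact (f ` {a..b})" by (intro compact_continuous_image continuous_on_subset[OF assms(3)]) auto
  then obtain B where "\<forall>y\<in>f ` {a..b}. norm y \<le> B" using compact_imp_bounded bounded_iff by metis
  then have B: "\<And>x. x \<in> {a..b} \<Longrightarrow> \<bar>f x\<bar> \<le> B" by auto
  have "finite_measure (lebesgue_on {a<..<b})"
    by (rule finite_measure_lebesgue_on) (auto intro!: bounded_set_imp_lmeasurable)
  then have "integrable (lebesgue_on {a<..<b}) f"
    by (rule finite_measure.integrable_const_bound[where B=B])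
      (use B assms(3) in \<open>auto intro!: AE_I2 borel_measurable_lebesgue_on borel_measurable_continuous_onI\<close>)
  then have "(LINT t|lebesgue_on {a<..<b}. f t) = integral {a<..<b} f"
    by (rule lebesgue_integral_eq_integral) auto
  also have "\<dots> = F b - F a" using hi integral_open_interval_real by (metis integral_unique)
  finally show ?thesis .
qed

text \<open>After the exchange of order the inner integral of \<open>deriv \<phi>\<close> over (s,
  T) is \<open>- \<phi> s\<close>, because \<phi> vanishes at T.\<close>

lemma integral_by_parts_primitive:
  fixes g :: "real \<Rightarrow> real"
  assumes \<phi>: "test_function {0<..<T} \<phi>" and g: "integrable (time T) g"
  shows "(LINT t|time T. deriv \<phi> t * (LINT s|time t. g s)) = - (LINT s|time T. \<phi> s * g s)"
proof -
  have d: "test_function {0<..<T} (deriv \<phi>)" by (rule test_function_deriv[OF \<phi>])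
  obtain B where B: "\<And>t. \<bar>deriv \<phi> t\<bar> \<le> B" using test_function_bounded[OF d] by blast
  have "(LINT t|time T. deriv \<phi> t * (LINT s|time t. g s))
      = (LINT s|time T. (LINT t|lebesgue_on {s<..<T}. deriv \<phi> t) * g s)"
    by (rule Fubini_time(2)[OF g test_function_measurable[OF d] B])
  also have "\<dots> = (LINT s|time T. - (\<phi> s * g s))"
  proof (intro Bochner_Integration.integral_cong refl)
    fix s assume "s \<in> space (time T)"
    then have "(LINT t|lebesgue_on {s<..<T}. deriv \<phi> t) = \<phi> T - \<phi> s"
      using d by (intro integral_time_FTC test_function_has_deriv[OF \<phi>] smooth_continuous_on)
        (auto simp: test_function_def)
    then show "(LINT t|lebesgue_on {s<..<T}. deriv \<phi> t) * g s = - (\<phi> s * g s)"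
      using test_function_outside[OF \<phi>, of T] by simp
  qed
  finally show ?thesis by simp
qed

section \<open>Scalar weak derivatives: the lemma of du Bois-Reymond\<close>

lemma abs_box_bump_le: "\<bar>box_bump a b k x\<bar> \<le> 1"
  using box_bump_bounds[of a b k x] by simp

text \<open>Otherwise the fundamental lemma would make the constant 1 vanish almost everywhere on a
  set of positive measure.\<close>

lemma nonzero_box_bump:
  assumes "0 < T"
  obtains a b k where "cbox a b \<subseteq> {0<..<T}" "(LINT t|time T. box_bump a b k t) \<noteq> 0"
proof (rule ccontr)
  assume n: "\<not> thesis"
  have *: "(LINT t|time T. 1 * box_bump a b k t) = 0" if "cbox a b \<subseteq> {0<..<T}" for a b k
    using n \<open>\<And>k b a. \<lbrakk>cbox a b \<subseteq> {0<..<T}; (LINT t|time T. box_bump a b k t) \<noteq> 0\<rbrakk> \<Longrightarrow> thesis\<close>[OF that, of k]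
    by (simp only: mult_1) blast
  have "AE t in time T. (1::real) = 0"
    by (rule AE_zero_if_orthogonal_to_box_bumps[OF _ _ *])
      (auto intro: finite_measure.integrable_const[OF finite_time])
  then have "ae_filter (time T) = bot" by (simp add: trivial_limit_def)
  then have "emeasure (time T) (space (time T)) = 0" by (simp add: ae_filter_eq_bot_iff)
  then show False using assms by (simp add: emeasure_restrict_space)
qed

text \<open>A primitive of g is constant on either side of the support, and the vanishing mean makes
  the two constants equal; subtracting that constant gives compact support. Smoothness needs a
  single unfolding, since the derivative is already a bump.\<close>

lemma test_function_primitive:
  fixes g :: "real \<Rightarrow> real"
  assumes g: "bump g" "\<And>x. x \<notin> {\<alpha>..\<beta>} \<Longrightarrow> g x = 0" and ab: "\<alpha> \<le> \<beta>" "{\<alpha>..\<beta>} \<subseteq> {0<..<T}"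
    and 0: "(LINT t|time T. g t) = 0"
  obtains \<phi> where "test_function {0<..<T} \<phi>" "deriv \<phi> = g"
proof -
  have cont: "continuous_on UNIV g" by (intro smooth_continuous_on smooth_bump g)
  then have "isCont g x" for x by (simp add: continuous_on_eq_continuous_at)
  then have "\<exists>F. \<forall>x::real. - \<infinity> < ereal x \<longrightarrow> ereal x < \<infinity> \<longrightarrow> (F has_vector_derivative g x) (at x)"
    by (intro einterval_antiderivative) auto
  then obtain F where F: "(F has_real_derivative g x) (at x)" for x
    by (auto simp: has_real_derivative_iff_has_vector_derivative)
  have "(LINT t|time T. g t) = F T - F 0"
    using ab by (intro integral_time_FTC F cont) auto
  then have FT: "F T = F 0" using 0 by simp
  have const: "F y = F x" if xy: "x < y" and gz: "\<And>z. x < z \<Longrightarrow> z < y \<Longrightarrow> g z = 0" for x y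
  proof -
    have "\<exists>z>x. z < y \<and> F y - F x = (y - x) * g z"
      by (rule MVT2[OF xy]) (rule F)
    then show ?thesis using gz by auto
  qed
  have ab0: "0 < \<alpha>" "\<beta> < T" using ab by auto
  define \<phi> where "\<phi> x = F x - F \<alpha>" for x
  have \<phi>': "(\<phi> has_real_derivative g x) (at x)" for x
    unfolding \<phi>_def using F[of x] by (auto intro!: derivative_eq_intros)
  have "F 0 = F \<alpha>" using const[of 0 \<alpha>] ab0 g(2) by auto
  moreover have "F T = F \<beta>" using const[of \<beta> T] ab0 g(2) by auto
  ultimately have "F \<beta> = F \<alpha>" using FT by simp
  have out: "\<phi> x = 0" if "x \<notin> cbox \<alpha> \<beta>" for x
  proof (cases "x < \<alpha>")
    case True
    then show ?thesis using const[of x \<alpha>] g(2) by (auto simp: \<phi>_def)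
  next
    case False
    then have "\<beta> < x" using that by auto
    then show ?thesis using const[of \<beta> x] g(2) \<open>F \<beta> = F \<alpha>\<close> by (auto simp: \<phi>_def)
  qed
  have "smooth \<phi>"
  proof (rule smooth.intros)
    show "\<forall>x. (\<phi> has_derivative (\<lambda>h. g x * h)) (at x)"
      using \<phi>' by (auto simp: has_field_derivative_def)
    show "\<forall>v. smooth (\<lambda>x. g x * v)" using g(1) by (auto intro!: smooth_bump bump.intros)
  qed
  then have "test_function {0<..<T} \<phi>" by (rule test_function_cbox) (use out ab in auto)
  moreover have "deriv \<phi> = g" using \<phi>' DERIV_imp_deriv by blast
  ultimately show thesis using that by blast
qed

text \<open>Subtracting from a box bump the right multiple r of a fixed bump
  \<open>?\<theta>\<close> leaves a function of mean zero, which is the derivative of a test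
  function. Orthogonality of G to all of these is orthogonality of \<open>G - c\<close> to all box
  bumps.\<close>

lemma AE_const_if_weak_derivative_zero:
  assumes T: "0 < T" and G: "integrable (time T) G"
    and 0: "\<And>\<phi>. test_function {0<..<T} \<phi> \<Longrightarrow> (LINT t|time T. deriv \<phi> t * G t) = 0"
  shows "\<exists>c. AE t in time T. G t = c"
proof -
  obtain a0 b0 k0 where \<theta>: "cbox a0 b0 \<subseteq> {0<..<T}" "(LINT t|time T. box_bump a0 b0 k0 t) \<noteq> 0"
    using nonzero_box_bump[OF T] .
  let ?\<theta> = "box_bump a0 b0 k0"
  have ib: "integrable (time T) (box_bump a b k)" for a b k
    by (rule finite_measure.integrable_const_bound[OF finite_time, where B=1])
      (use abs_box_bump_le in \<open>auto intro!: AE_I2 borel_measurable_lebesgue_on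
        borel_measurable_continuous_onI continuous_on_box_bump\<close>)
  have iGb: "integrable (time T) (\<lambda>t. box_bump a b k t * G t)" for a b k
    by (rule integrable_mult_bounded[OF G, where B=1])
      (use abs_box_bump_le in \<open>auto intro!: borel_measurable_lebesgue_on
        borel_measurable_continuous_onI continuous_on_box_bump\<close>)
  have ne: "a0 \<le> b0"
  proof (rule ccontr)
    assume "\<not> a0 \<le> b0"
    then have "?\<theta> t = 0" for t by (intro box_bump_support) auto
    then show False using \<theta>(2) by simp
  qed
  \<comment> \<open>The mean of G weighted by \<open>?\<theta>\<close>, the only constant for which
    \<open>G - c\<close> is orthogonal to \<open>?\<theta>\<close>.\<close>
  define c where "c = (LINT t|time T. ?\<theta> t * G t) / (LINT t|time T. ?\<theta> t)"
  have "AE t in time T. G t - c = 0"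
  proof (rule AE_zero_if_orthogonal_to_box_bumps)
    show "integrable (time T) (\<lambda>t. G t - c)"
      by (rule Bochner_Integration.integrable_diff[OF G finite_measure.integrable_const[OF finite_time]])
    fix a b :: real and k assume ab: "cbox a b \<subseteq> {0<..<T}"
    show "(LINT t|time T. (G t - c) * box_bump a b k t) = 0"
    proof (cases "a \<le> b")
      case False
      then have "box_bump a b k t = 0" for t by (intro box_bump_support) auto
      then show ?thesis by simp
    next
      case True
      define r where "r = (LINT t|time T. box_bump a b k t) / (LINT t|time T. ?\<theta> t)"
      define g where "g t = box_bump a b k t + (- r) * ?\<theta> t" for t
      have "bump g" unfolding g_def by (intro bump.intros bump_box_bump)
      moreover have "g x = 0" if "x \<notin> {min a a0..max b b0}" for x
        using that True ne unfolding g_def by (subst (1 2) box_bump_support) auto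
      moreover have "{min a a0..max b b0} \<subseteq> {0<..<T}"
        using ab \<theta>(1) True ne by (auto simp: subset_iff min_def max_def)
      moreover have "(LINT t|time T. g t) = 0"
        unfolding g_def using ib \<theta>(2) by (simp add: r_def)
      ultimately obtain \<phi> where "test_function {0<..<T} \<phi>" "deriv \<phi> = g"
        using True ne by (elim test_function_primitive[rotated 4]) auto
      from 0[OF this(1)] this(2) have "(LINT t|time T. g t * G t) = 0" by simp
      moreover have "g t * G t = box_bump a b k t * G t - r * (?\<theta> t * G t)" for t
        by (simp add: g_def algebra_simps)
      ultimately have 1: "(LINT t|time T. box_bump a b k t * G t) = r * (LINT t|time T. ?\<theta> t * G t)"
        using iGb by simp
      have "(G t - c) * box_bump a b k t = box_bump a b k t * G t - c * box_bump a b k t" for t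
        by (simp add: algebra_simps)
      then show ?thesis using iGb ib 1 \<theta>(2) by (simp add: r_def c_def)
    qed
  qed auto
  then show ?thesis by auto
qed

text \<open>The difference of g and the primitive of h has weak derivative zero.\<close>

lemma primitive_of_weak_derivative:
  fixes g h :: "real \<Rightarrow> real"
  assumes T: "0 < T" and g: "integrable (time T) g" and h: "integrable (time T) h"
    and w: "\<And>\<phi>. test_function {0<..<T} \<phi> \<Longrightarrow>
      (LINT t|time T. deriv \<phi> t * g t) = - (LINT t|time T. \<phi> t * h t)"
  shows "\<exists>c. AE t in time T. g t = c + (LINT s|time t. h s)"
proof -
  have ih: "integrable (time T) (\<lambda>t. LINT s|time t. h s)"
    by (rule Fubini_time(1)[OF h, of "\<lambda>_. 0" 0]) auto
  have "\<exists>c. AE t in time T. g t - (LINT s|time t. h s) = c"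
  proof (rule AE_const_if_weak_derivative_zero[OF T])
    fix \<phi> assume \<phi>: "test_function {0<..<T} \<phi>"
    obtain B where B: "\<And>t. \<bar>deriv \<phi> t\<bar> \<le> B"
      using test_function_bounded[OF test_function_deriv[OF \<phi>]] by blast
    have m: "deriv \<phi> \<in> borel_measurable (time T)"
      by (rule test_function_measurable[OF test_function_deriv[OF \<phi>]])
    show "(LINT t|time T. deriv \<phi> t * (g t - (LINT s|time t. h s))) = 0"
      using w[OF \<phi>] integral_by_parts_primitive[OF \<phi> h]
        integrable_mult_bounded[OF g m B] integrable_mult_bounded[OF ih m B]
      by (simp add: right_diff_distrib)
  qed (use g ih in auto)
  then obtain c where "AE t in time T. g t - (LINT s|time t. h s) = c" by blast
  then have "AE t in time T. g t = c + (LINT s|time t. h s)" by eventually_elim simp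
  then show ?thesis by blast
qed

section \<open>Square-integrable functions\<close>

text \<open>Square integrability over an arbitrary measure, so that \<open>L2 \<Omega>\<close> and
  the scalar functions of time share one theory.\<close>

definition L2_on :: "'a measure \<Rightarrow> ('a \<Rightarrow> real) nspace"
  where "L2_on M = \<lparr>car = {u \<in> borel_measurable M. integrable M (\<lambda>x. (u x)\<^sup>2)},
    nrm = (\<lambda>u. sqrt (LINT x|M. (u x)\<^sup>2))\<rparr>"

lemma L2_eq_L2_on: "L2 \<Omega> = L2_on (lebesgue_on \<Omega>)"
  by (simp add: L2_def L2_on_def)

lemma L2_onD: "u \<in> car (L2_on M) \<Longrightarrow> u \<in> borel_measurable M" "u \<in> car (L2_on M) \<Longrightarrow> integrable M (\<lambda>x. (u x)\<^sup>2)"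
  and L2_onI: "u \<in> borel_measurable M \<Longrightarrow> integrable M (\<lambda>x. (u x)\<^sup>2) \<Longrightarrow> u \<in> car (L2_on M)"
  and nrm_L2_on: "nrm (L2_on M) u = sqrt (LINT x|M. (u x)\<^sup>2)"
  by (auto simp: L2_on_def)

lemma nrm_L2_on_square: "(nrm (L2_on M) u)\<^sup>2 = (LINT x|M. (u x)\<^sup>2)"
  by (simp add: nrm_L2_on)

lemma L2_on_bound:
  assumes u: "u \<in> car (L2_on M)" and v: "v \<in> borel_measurable M" and b: "AE x in M. \<bar>v x\<bar> \<le> C * \<bar>u x\<bar>" and C: "0 \<le> C"
  shows "v \<in> car (L2_on M)" "nrm (L2_on M) v \<le> C * nrm (L2_on M) u"
proof -
  have b2: "AE x in M. (v x)\<^sup>2 \<le> C\<^sup>2 * (u x)\<^sup>2"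
    using b
  proof eventually_elim
    case (elim x)
    then have "\<bar>v x\<bar>\<^sup>2 \<le> (C * \<bar>u x\<bar>)\<^sup>2" by (intro power_mono) auto
    then show ?case by (simp add: power_mult_distrib)
  qed
  have i: "integrable M (\<lambda>x. C\<^sup>2 * (u x)\<^sup>2)" using L2_onD(2)[OF u] by simp
  have iv: "integrable M (\<lambda>x. (v x)\<^sup>2)"
    using i by (rule Bochner_Integration.integrable_bound) (use v b2 in \<open>auto simp: elim!: eventually_mono\<close>)
  then show "v \<in> car (L2_on M)" by (rule L2_onI[OF v])
  have "(LINT x|M. (v x)\<^sup>2) \<le> C\<^sup>2 * (LINT x|M. (u x)\<^sup>2)"
    using integral_mono_AE[OF iv i b2] by simp
  from real_sqrt_le_mono[OF this] show "nrm (L2_on M) v \<le> C * nrm (L2_on M) u"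
    using C by (simp add: nrm_L2_on real_sqrt_mult)
qed

lemma L2_on_mult_integrable:
  assumes "u \<in> car (L2_on M)" "v \<in> car (L2_on M)"
  shows "integrable M (\<lambda>x. u x * v x)"
proof (rule Bochner_Integration.integrable_bound)
  show "integrable M (\<lambda>x. (u x)\<^sup>2 + (v x)\<^sup>2)" using assms by (auto intro: L2_onD)
  show "AE x in M. norm (u x * v x) \<le> norm ((u x)\<^sup>2 + (v x)\<^sup>2)"
  proof (rule AE_I2)
    fix x
    have "0 \<le> (\<bar>u x\<bar> - \<bar>v x\<bar>)\<^sup>2" by simp
    then have "2 * (\<bar>u x\<bar> * \<bar>v x\<bar>) \<le> (u x)\<^sup>2 + (v x)\<^sup>2" by (simp add: power2_diff)
    then show "norm (u x * v x) \<le> norm ((u x)\<^sup>2 + (v x)\<^sup>2)" 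
      using mult_nonneg_nonneg[OF abs_ge_zero[of "u x"] abs_ge_zero[of "v x"]] by (simp add: abs_mult del: mult_nonneg_nonneg)
  qed
qed (intro borel_measurable_times L2_onD assms)

lemma subspace_L2_on: "subspace (car (L2_on M))"
proof (rule subspaceI)
  show "0 \<in> car (L2_on M)" by (auto intro!: L2_onI simp: zero_fun_def)
  fix u v assume uv: "u \<in> car (L2_on M)" "v \<in> car (L2_on M)"
  have "(\<lambda>x. (u x)\<^sup>2 + 2 * (u x * v x) + (v x)\<^sup>2) = (\<lambda>x. ((u + v) x)\<^sup>2)"
    by (auto simp: power2_sum)
  moreover have "integrable M (\<lambda>x. (u x)\<^sup>2 + 2 * (u x * v x) + (v x)\<^sup>2)"
    using uv L2_on_mult_integrable[OF uv]
    by (intro Bochner_Integration.integrable_add integrable_mult_right L2_onD)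
  moreover have "u + v \<in> borel_measurable M"
    using uv unfolding plus_fun_def by (intro borel_measurable_add L2_onD)
  ultimately show "u + v \<in> car (L2_on M)" by (intro L2_onI) auto
next
  fix c :: real and u assume u: "u \<in> car (L2_on M)"
  then have "c *\<^sub>R u \<in> borel_measurable M"
    unfolding scaleR_fun_def by (intro borel_measurable_scaleR borel_measurable_const L2_onD)
  then show "c *\<^sub>R u \<in> car (L2_on M)"
    using L2_onD(2)[OF u] by (intro L2_onI) (auto simp: power_mult_distrib)
qed

lemma prehilbert_L2_on: "prehilbert (L2_on M) (\<lambda>u v. LINT x|M. u x * v x)"
proof
  show "subspace (car (L2_on M))" by (rule subspace_L2_on)
  fix x y z assume *: "x \<in> car (L2_on M)" "y \<in> car (L2_on M)"
  show "(LINT t|M. (x + y) t * z t) = (LINT t|M. x t * z t) + (LINT t|M. y t * z t)" if "z \<in> car (L2_on M)"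
    using L2_on_mult_integrable[OF *(1) that] L2_on_mult_integrable[OF *(2) that]
    by (simp add: distrib_right)
  show "(LINT t|M. (c *\<^sub>R x) t * y t) = c * (LINT t|M. x t * y t)" for c
    by (simp add: mult.assoc)
  show "(LINT t|M. x t * y t) = (LINT t|M. y t * x t)" by (simp add: mult.commute)
  show "0 \<le> (LINT t|M. x t * x t)" by simp
  show "nrm (L2_on M) x = sqrt (LINT t|M. x t * x t)" by (simp add: nrm_L2_on power2_eq_square)
qed

lemma L2_on_subset_L1:
  assumes M: "finite_measure M" and u: "u \<in> car (L2_on M)"
  shows "integrable M u" "(LINT x|M. \<bar>u x\<bar>) \<le> sqrt (measure M (space M)) * nrm (L2_on M) u"
proof -
  interpret finite_measure M by fact
  interpret L: prehilbert "L2_on M" "\<lambda>u v. LINT x|M. u x * v x" by (rule prehilbert_L2_on)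
  have one: "(\<lambda>_. 1) \<in> car (L2_on M)" by (intro L2_onI) auto
  show i: "integrable M u" using L2_on_mult_integrable[OF u one] by simp
  have a: "(\<lambda>x. \<bar>u x\<bar>) \<in> car (L2_on M)"
    using L2_on_bound(1)[OF u, of "\<lambda>x. \<bar>u x\<bar>" 1] L2_onD(1)[OF u] by auto
  have "(LINT x|M. \<bar>u x\<bar>) \<le> nrm (L2_on M) (\<lambda>x. \<bar>u x\<bar>) * nrm (L2_on M) (\<lambda>_. 1)"
    using L.Cauchy_Schwarz[OF a one] by simp
  then show "(LINT x|M. \<bar>u x\<bar>) \<le> sqrt (measure M (space M)) * nrm (L2_on M) u"
    by (simp add: nrm_L2_on mult.commute)
qed

text \<open>Sum and integral commute for nonnegative functions, and a function with finite integral
  is finite almost everywhere.\<close>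

lemma summable_AE_if_L1_summable:
  fixes d :: "nat \<Rightarrow> 'a \<Rightarrow> real"
  assumes d: "\<And>n. integrable M (d n)" "\<And>n x. 0 \<le> d n x" and s: "summable (\<lambda>n. LINT x|M. d n x)"
  shows "AE x in M. summable (\<lambda>n. d n x)"
proof -
  have "(\<integral>\<^sup>+x. (\<Sum>n. ennreal (d n x)) \<partial>M) = (\<Sum>n. \<integral>\<^sup>+x. ennreal (d n x) \<partial>M)"
    using d by (intro nn_integral_suminf) auto
  also have "\<dots> = (\<Sum>n. ennreal (LINT x|M. d n x))"
    using d by (intro arg_cong[where f=suminf] ext nn_integral_eq_integral) auto
  also have "\<dots> < \<infinity>"
    using s d by (subst suminf_ennreal2) (auto intro!: integral_nonneg)
  finally have "AE x in M. (\<Sum>n. ennreal (d n x)) \<noteq> \<infinity>"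
    using d by (intro nn_integral_PInf_AE) auto
  then show ?thesis
    by eventually_elim (use d in \<open>auto intro!: summable_suminf_not_top simp: top_ennreal.rep_eq\<close>)
qed

lemma L2_on_Fatou:
  assumes w: "\<And>n. w n \<in> car (L2_on M)" and le: "\<And>n. n \<ge> N \<Longrightarrow> nrm (L2_on M) (w n) \<le> C" and C: "0 \<le> C"
    and v: "v \<in> borel_measurable M" and lim: "AE x in M. (\<lambda>n::nat. w n x) \<longlonglongrightarrow> v x"
  shows "v \<in> car (L2_on M)" "nrm (L2_on M) v \<le> C"
proof -
  have "(\<integral>\<^sup>+x. ennreal ((v x)\<^sup>2) \<partial>M) = (\<integral>\<^sup>+x. liminf (\<lambda>n. ennreal ((w n x)\<^sup>2)) \<partial>M)"
  proof (rule nn_integral_cong_AE)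
    show "AE x in M. ennreal ((v x)\<^sup>2) = liminf (\<lambda>n. ennreal ((w n x)\<^sup>2))"
      using lim
    proof eventually_elim
      case (elim x)
      then have "(\<lambda>n. ennreal ((w n x)\<^sup>2)) \<longlonglongrightarrow> ennreal ((v x)\<^sup>2)"
        by (intro tendsto_ennrealI tendsto_power)
      then show ?case using lim_imp_Liminf[of sequentially] by (metis trivial_limit_sequentially)
    qed
  qed
  also have "\<dots> \<le> liminf (\<lambda>n. \<integral>\<^sup>+x. ennreal ((w n x)\<^sup>2) \<partial>M)"
    by (intro nn_integral_liminf measurable_compose[OF _ measurable_ennreal] borel_measurable_power L2_onD w)
  also have "\<dots> \<le> ennreal (C\<^sup>2)"
  proof (rule Liminf_le)
    have "(\<integral>\<^sup>+x. ennreal ((w n x)\<^sup>2) \<partial>M) \<le> ennreal (C\<^sup>2)" if "n \<ge> N" for n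
    proof -
      have "(\<integral>\<^sup>+x. ennreal ((w n x)\<^sup>2) \<partial>M) = ennreal ((nrm (L2_on M) (w n))\<^sup>2)"
        unfolding nrm_L2_on_square by (intro nn_integral_eq_integral L2_onD w) auto
      also have "\<dots> \<le> ennreal (C\<^sup>2)"
        using le[OF that] by (intro ennreal_leI power_mono) (auto simp: nrm_L2_on)
      finally show ?thesis .
    qed
    then show "\<forall>\<^sub>F n in sequentially. (\<integral>\<^sup>+x. ennreal ((w n x)\<^sup>2) \<partial>M) \<le> ennreal (C\<^sup>2)"
      by (rule eventually_sequentiallyI)
  qed simp
  finally have le: "(\<integral>\<^sup>+x. ennreal ((v x)\<^sup>2) \<partial>M) \<le> ennreal (C\<^sup>2)" .
  then have i: "integrable M (\<lambda>x. (v x)\<^sup>2)"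
    using v by (intro integrableI_nonneg) (auto intro: le_less_trans)
  then show "v \<in> car (L2_on M)" by (rule L2_onI[OF v])
  have "(LINT x|M. (v x)\<^sup>2) \<le> C\<^sup>2"
    using le nn_integral_eq_integral[OF i] by (simp add: ennreal_le_iff)
  then show "nrm (L2_on M) v \<le> C" using C by (simp add: nrm_L2_on real_le_lsqrt)
qed

text \<open>The theorem of Riesz and Fischer. A subsequence with increments below
  \<open>(1/2) ^ n\<close> has summable increments in L1, as the measure is finite, and so converges
  almost everywhere. Fatou's lemma along that subsequence then turns the Cauchy property into both
  membership of the limit and the rate of convergence.\<close>

lemma hilbert_L2_on:
  assumes M: "finite_measure M"
  shows "hilbert (L2_on M) (\<lambda>u v. LINT x|M. u x * v x)"
proof -
  interpret L: prehilbert "L2_on M" "\<lambda>u v. LINT x|M. u x * v x" by (rule prehilbert_L2_on)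
  show ?thesis
  proof
    fix s :: "nat \<Rightarrow> 'a \<Rightarrow> real"
    assume s: "\<And>n. s n \<in> car (L2_on M)"
      and cauchy: "\<And>e. e > 0 \<Longrightarrow> \<exists>N. \<forall>m\<ge>N. \<forall>n\<ge>N. nrm (L2_on M) (s m - s n) < e"
    have "\<exists>R. \<forall>n. \<forall>m\<ge>R n. \<forall>k\<ge>R n. nrm (L2_on M) (s m - s k) < (1/2) ^ n"
      by (intro choice allI cauchy) simp
    then obtain R where R: "\<And>n m k. m \<ge> R n \<Longrightarrow> k \<ge> R n \<Longrightarrow> nrm (L2_on M) (s m - s k) < (1/2) ^ n"
      by blast
    \<comment> \<open>Partial sums of the thresholds dominate every earlier threshold, so one index
      meets all of the conditions up to n.\<close>
    define r where "r n = (\<Sum>i\<le>n. R i)" for n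
    have rR: "R n \<le> r m" if "n \<le> m" for n m
      unfolding r_def using that by (intro member_le_sum) auto
    define d where "d n x = \<bar>s (r (Suc n)) x - s (r n) x\<bar>" for n x
    have sd: "s m - s k \<in> car (L2_on M)" for m k using s by auto
    have dL: "integrable M (d n)" "(LINT x|M. d n x) \<le> sqrt (measure M (space M)) * (1/2) ^ n" for n
    proof -
      have "nrm (L2_on M) (s (r (Suc n)) - s (r n)) \<le> (1/2) ^ n"
        using R[of n] rR by (auto intro: less_imp_le)
      then show "(LINT x|M. d n x) \<le> sqrt (measure M (space M)) * (1/2) ^ n"
        using order_trans[OF L2_on_subset_L1(2)[OF M sd] mult_left_mono]
        by (simp add: d_def)
      show "integrable M (d n)"
        using integrable_abs[OF L2_on_subset_L1(1)[OF M sd]] by (simp add: d_def[abs_def])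
    qed
    have "summable (\<lambda>n. LINT x|M. d n x)"
    proof (rule summable_comparison_test')
      show "summable (\<lambda>n. sqrt (measure M (space M)) * (1/2) ^ n)"
        by (intro summable_mult summable_geometric) simp
      show "norm (LINT x|M. d n x) \<le> sqrt (measure M (space M)) * (1/2) ^ n" for n
        using dL(2)[of n] by (auto simp: d_def abs_of_nonneg intro!: integral_nonneg)
    qed
    from summable_AE_if_L1_summable[OF dL(1) _ this] have ae: "AE x in M. summable (\<lambda>n. d n x)"
      by (simp add: d_def)
    define u where "u x = lim (\<lambda>n. s (r n) x)" for x
    have um: "u \<in> borel_measurable M"
      unfolding u_def[abs_def] by (intro borel_measurable_lim_metric L2_onD s)
    have lim: "AE x in M. (\<lambda>n. s (r n) x) \<longlonglongrightarrow> u x"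
      using ae
    proof eventually_elim
      case (elim x)
      then have "summable (\<lambda>n. s (r (Suc n)) x - s (r n) x)"
        unfolding d_def by (rule summable_rabs_cancel)
      then have "convergent (\<lambda>n. \<Sum>i<n. s (r (Suc i)) x - s (r i) x)"
        by (simp add: summable_iff_convergent)
      then have "convergent (\<lambda>n. s (r n) x - s (r 0) x)" by (simp only: sum_lessThan_telescope[of "\<lambda>n. s (r n) x"])
      then have "convergent (\<lambda>n. s (r n) x)" by (simp add: convergent_diff_const_right_iff)
      then show ?case by (simp add: convergent_LIMSEQ_iff u_def)
    qed
    have est: "s m - u \<in> car (L2_on M) \<and> nrm (L2_on M) (s m - u) \<le> (1/2) ^ n" if "m \<ge> R n" for m n
    proof -
      have 1: "\<And>k. s m - s (r k) \<in> car (L2_on M)" by (rule sd)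
      have 2: "\<And>k. k \<ge> n \<Longrightarrow> nrm (L2_on M) (s m - s (r k)) \<le> (1/2) ^ n"
        using R[of n m] that rR[of n] by (auto intro: less_imp_le)
      have 3: "s m - u \<in> borel_measurable M"
        unfolding fun_diff_def by (intro borel_measurable_diff um L2_onD s)
      have 4: "AE x in M. (\<lambda>k. (s m - s (r k)) x) \<longlonglongrightarrow> (s m - u) x"
        using lim by eventually_elim (auto intro!: tendsto_intros)
      show ?thesis by (intro conjI L2_on_Fatou[OF 1 2 _ 3 4]) auto
    qed
    have "s (R 0) - (s (R 0) - u) \<in> car (L2_on M)" using est[where m="R 0" and n=0] s by blast
    then have uc: "u \<in> car (L2_on M)" by (simp only: diff_diff_eq2 add_diff_cancel_left')
    have "(\<lambda>n. nrm (L2_on M) (s n - u)) \<longlonglongrightarrow> 0"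
    proof (rule LIMSEQ_I)
      fix e :: real assume "e > 0"
      then obtain n where n: "(1/2) ^ n < e" using real_arch_pow_inv[of e "1/2"] by auto
      have "norm (nrm (L2_on M) (s m - u) - 0) < e" if "m \<ge> R n" for m
      proof -
        have "0 \<le> nrm (L2_on M) (s m - u)" using est[OF that] by (intro L.nrm_nonneg) (rule conjunct1)
        then show ?thesis using est[OF that] n
          unfolding real_norm_def diff_0_right by (subst abs_of_nonneg) linarith+
      qed
      then show "\<exists>N. \<forall>m\<ge>N. norm (nrm (L2_on M) (s m - u) - 0) < e" by blast
    qed
    with uc show "\<exists>l\<in>car (L2_on M). (\<lambda>n. nrm (L2_on M) (s n - l)) \<longlonglongrightarrow> 0" by blast
  qed
qed

section \<open>Bochner spaces\<close>

lemma bochner_L2_iff: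
  assumes "seminormed X"
  shows "u \<in> car (bochner_L2 T X) \<longleftrightarrow>
    strongly_measurable (time T) X u \<and> (\<lambda>t. nrm X (u t)) \<in> car (L2_on (time T))"
  using seminormed.borel_measurable_nrm[OF assms complete_time, of T u]
  by (auto simp: bochner_L2_def L2_on_def)

lemma nrm_bochner_L2: "nrm (bochner_L2 T X) u = nrm (L2_on (time T)) (\<lambda>t. nrm X (u t))"
  by (simp add: bochner_L2_def L2_on_def)

context seminormed begin

lemma bochner_L2D:
  assumes "u \<in> car (bochner_L2 T X)"
  shows "strongly_measurable (time T) X u" "(\<lambda>t. nrm X (u t)) \<in> car (L2_on (time T))"
    "integrable (time T) (\<lambda>t. nrm X (u t))" "\<And>t. 0 < t \<Longrightarrow> t < T \<Longrightarrow> u t \<in> car X"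
  using assms L2_on_subset_L1[OF finite_time, of _ T] strongly_measurable_car[of "time T" X u]
  by (auto simp: bochner_L2_iff[OF seminormed_axioms])

lemma bochner_L2_bound:
  assumes u: "strongly_measurable (time T) X u" and g: "g \<in> car (L2_on (time T))"
    and b: "AE t in time T. nrm X (u t) \<le> g t"
  shows "u \<in> car (bochner_L2 T X)" "nrm (bochner_L2 T X) u \<le> nrm (L2_on (time T)) g"
proof -
  have "AE t in time T. \<bar>nrm X (u t)\<bar> \<le> 1 * \<bar>g t\<bar>"
    using b AE_space
    by eventually_elim (use strongly_measurable_car[OF u] nrm_nonneg in auto)
  from L2_on_bound[OF g borel_measurable_nrm[OF complete_time u] this]
  show "u \<in> car (bochner_L2 T X)" "nrm (bochner_L2 T X) u \<le> nrm (L2_on (time T)) g"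
    using u by (auto simp: bochner_L2_iff[OF seminormed_axioms] nrm_bochner_L2)
qed

lemma seminormed_bochner_L2: "seminormed (bochner_L2 T X)"
proof -
  interpret L: prehilbert "L2_on (time T)" "\<lambda>u v. LINT x|time T. u x * v x" by (rule prehilbert_L2_on)
  have add: "u + v \<in> car (bochner_L2 T X) \<and> nrm (bochner_L2 T X) (u + v) \<le> nrm (bochner_L2 T X) u + nrm (bochner_L2 T X) v"
    if u: "u \<in> car (bochner_L2 T X)" and v: "v \<in> car (bochner_L2 T X)" for u v
  proof -
    let ?g = "(\<lambda>t. nrm X (u t)) + (\<lambda>t. nrm X (v t))"
    have g: "?g \<in> car (L2_on (time T))" using bochner_L2D(2)[OF u] bochner_L2D(2)[OF v] by auto
    have sm: "strongly_measurable (time T) X (u + v)"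
      using strongly_measurable_add[OF bochner_L2D(1)[OF u] bochner_L2D(1)[OF v]] by (simp add: plus_fun_def)
    have "AE t in time T. nrm X ((u + v) t) \<le> ?g t"
      using bochner_L2D(4)[OF u] bochner_L2D(4)[OF v] by (intro AE_I2) (auto intro!: nrm_triangle)
    from bochner_L2_bound[OF sm g this] show ?thesis
      using L.nrm_triangle[OF bochner_L2D(2)[OF u] bochner_L2D(2)[OF v]] by (auto simp: nrm_bochner_L2 plus_fun_def)
  qed
  have scale: "c *\<^sub>R u \<in> car (bochner_L2 T X) \<and> nrm (bochner_L2 T X) (c *\<^sub>R u) = \<bar>c\<bar> * nrm (bochner_L2 T X) u"
    if u: "u \<in> car (bochner_L2 T X)" for u c
  proof -
    have sm: "strongly_measurable (time T) X (c *\<^sub>R u)"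
      using strongly_measurable_scale[OF bochner_L2D(1)[OF u], of c] by (simp add: scaleR_fun_def)
    have e: "nrm X ((c *\<^sub>R u) t) = (\<bar>c\<bar> *\<^sub>R (\<lambda>t. nrm X (u t))) t" if "t \<in> space (time T)" for t
      using bochner_L2D(4)[OF u] that by (simp add: nrm_scale)
    have g: "\<bar>c\<bar> *\<^sub>R (\<lambda>t. nrm X (u t)) \<in> car (L2_on (time T))" using bochner_L2D(2)[OF u] by auto
    have "c *\<^sub>R u \<in> car (bochner_L2 T X)"
      by (rule bochner_L2_bound(1)[OF sm g]) (use e in \<open>auto intro!: AE_I2\<close>)
    moreover have "nrm (bochner_L2 T X) (c *\<^sub>R u) = nrm (L2_on (time T)) (\<bar>c\<bar> *\<^sub>R (\<lambda>t. nrm X (u t)))"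
      unfolding nrm_bochner_L2 nrm_L2_on using e
      by (intro arg_cong[where f=sqrt] Bochner_Integration.integral_cong) auto
    ultimately show ?thesis using L.nrm_scale[OF bochner_L2D(2)[OF u], of "\<bar>c\<bar>"]
      by (simp add: nrm_bochner_L2)
  qed
  have "0 \<in> car (bochner_L2 T X)"
    using strongly_measurable_zero[of "time T"] zero_car
    by (simp add: bochner_L2_iff[OF seminormed_axioms] L2_on_def zero_fun_def)
  then show ?thesis using add scale by unfold_locales (auto intro: subspaceI)
qed

lemma nrm_bochner_L2_eq_0_iff:
  assumes u: "u \<in> car (bochner_L2 T X)"
  shows "nrm (bochner_L2 T X) u = 0 \<longleftrightarrow> (AE t in time T. nrm X (u t) = 0)"
proof -
  have "(LINT t|time T. (nrm X (u t))\<^sup>2) = 0 \<longleftrightarrow> (AE t in time T. (nrm X (u t))\<^sup>2 = 0)"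
    by (rule integral_nonneg_eq_0_iff_AE) (use L2_onD(2)[OF bochner_L2D(2)[OF u]] in auto)
  then show ?thesis by (simp add: bochner_L2_def)
qed

end

section \<open>Weak time derivatives and primitives\<close>

lemma AE_time_mono:
  assumes "AE s in time T. P s" "t \<le> T"
  shows "AE s in time t. P s"
proof -
  have "AE s in lebesgue. s \<in> {0<..<T} \<longrightarrow> P s"
    using assms(1) by (subst (asm) AE_restrict_space_iff) auto
  then have "AE s in lebesgue. s \<in> {0<..<t} \<longrightarrow> P s"
    by eventually_elim (use assms(2) in auto)
  then show ?thesis by (subst AE_restrict_space_iff) auto
qed

lemma AE_time_ex:
  assumes "0 < T" "AE t in time T. P t"
  shows "\<exists>t. 0 < t \<and> t < T \<and> P t"
proof (rule ccontr)
  assume n: "\<not> (\<exists>t. 0 < t \<and> t < T \<and> P t)"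
  have "AE t in time T. False"
    using assms(2) AE_space by eventually_elim (use n in auto)
  then have "ae_filter (time T) = bot" by (simp add: trivial_limit_def)
  then have "emeasure (time T) (space (time T)) = 0" by (simp add: ae_filter_eq_bot_iff)
  then show False using assms(1) by (simp add: emeasure_restrict_space)
qed

lemma AE_time_neq: "AE s in time T. s \<noteq> c"
proof -
  have "AE s in lebesgue. s \<notin> {c}" by (intro AE_not_in) auto
  then show ?thesis by (subst AE_restrict_space_iff) (auto elim: eventually_mono)
qed

lemma integrable_prefix:
  fixes h :: "real \<Rightarrow> real"
  assumes "integrable (time T) h"
  shows "integrable (time T) (\<lambda>s. if s < t then h s else 0)"
proof -
  have "integrable (time T) (\<lambda>s. indicat_real {..<t} s * h s)"
    by (rule integrable_mult_bounded[OF assms, where B=1])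
      (auto intro: borel_measurable_lebesgue_on simp: indicator_def)
  also have "(\<lambda>s. indicat_real {..<t} s * h s) = (\<lambda>s. if s < t then h s else 0)"
    by (auto simp: fun_eq_iff)
  finally show ?thesis .
qed

text \<open>The difference is an integral over the part between s and t. With g = h the inequality
  says that the prefix integral of a nonnegative function is monotone.\<close>

lemma prefix_integral_increment:
  fixes g h :: "real \<Rightarrow> real"
  assumes g: "integrable (time T) g" and h: "integrable (time T) h"
    and le: "\<And>r. 0 < r \<Longrightarrow> r < T \<Longrightarrow> \<bar>g r\<bar> \<le> h r" and st: "s \<le> t" "t \<le> T"
  shows "\<bar>(LINT r|time t. g r) - (LINT r|time s. g r)\<bar> \<le> (LINT r|time t. h r) - (LINT r|time s. h r)"
proof -
  let ?c = "\<lambda>f t r. if r < t then f r else (0::real)"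
  have e: "(LINT r|time t. f r) - (LINT r|time s. f r) = (LINT r|time T. ?c f t r - ?c f s r)"
    if "integrable (time T) f" for f
    using st integrable_prefix[OF that] by (simp add: prefix_integral_eq[of t T] prefix_integral_eq[of s T])
  have "norm (LINT r|time T. ?c g t r - ?c g s r) \<le> (LINT r|time T. norm (?c g t r - ?c g s r))"
    by (rule integral_norm_bound)
  also have "\<dots> \<le> (LINT r|time T. ?c h t r - ?c h s r)"
  proof (rule integral_mono_AE)
    show "AE r in time T. norm (?c g t r - ?c g s r) \<le> ?c h t r - ?c h s r"
      using AE_space by eventually_elim (use le st in auto)
  qed (use g h integrable_prefix in auto)
  finally show ?thesis unfolding e[OF g] e[OF h] by simp
qed

text \<open>The truncated integrands converge except at s = t, a null set, and are dominated by the
  absolute value of h.\<close>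

lemma prefix_integral_tendsto:
  fixes h :: "real \<Rightarrow> real"
  assumes h: "integrable (time T) h" and t: "t \<le> T"
  shows "((\<lambda>r. LINT s|time r. h s) \<longlongrightarrow> (LINT s|time t. h s)) (at t within {0..T})"
proof (rule tendsto_at_iff_sequentially[THEN iffD2], intro allI impI)
  fix X assume X: "\<forall>i::nat. X i \<in> {0..T} - {t}" "X \<longlonglongrightarrow> t"
  have "(\<lambda>i. LINT s|time T. (if s < X i then h s else 0)) \<longlonglongrightarrow> (LINT s|time T. (if s < t then h s else 0))"
  proof (rule integral_dominated_convergence[where w="\<lambda>s. \<bar>h s\<bar>"])
    show "AE s in time T. (\<lambda>i. if s < X i then h s else 0) \<longlonglongrightarrow> (if s < t then h s else 0)"
      using AE_time_neq[of t T]
    proof eventually_elim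
      case (elim s)
      have "\<forall>\<^sub>F i in sequentially. (if s < X i then h s else 0) = (if s < t then h s else 0)"
      proof (cases "s < t")
        case True
        from order_tendstoD(1)[OF X(2) this] show ?thesis by eventually_elim (use True in auto)
      next
        case False
        then have "t < s" using elim by auto
        from order_tendstoD(2)[OF X(2) this] show ?thesis by eventually_elim (use False in auto)
      qed
      then show ?case by (rule tendsto_eventually)
    qed
  qed (use h integrable_prefix[OF h] in \<open>auto intro: borel_measurable_integrable\<close>)
  then show "((\<lambda>r. LINT s|time r. h s) \<circ> X) \<longlonglongrightarrow> (LINT s|time t. h s)"
    using X(1) t by (simp add: o_def prefix_integral_eq[symmetric])
qed

text \<open>Sampling w at the grid point of mesh 1/(n+1) just below t gives simple functions;
  rounding down keeps the sample in the interval where w is continuous, with 0 included.\<close>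

lemma (in seminormed) continuous_strongly_measurable:
  assumes w: "\<And>t. t \<in> {0..T} \<Longrightarrow> w t \<in> car X"
    and cont: "\<And>t. t \<in> {0..T} \<Longrightarrow> ((\<lambda>s. nrm X (w s - w t)) \<longlongrightarrow> 0) (at t within {0..T})"
  shows "strongly_measurable (time T) X w"
proof -
  define r where "r n t = real_of_int \<lfloor>real (Suc n) * t\<rfloor> / real (Suc n)" for n t
  have r0: "0 \<le> r n t" "r n t \<le> t" if "0 < t" for n t
    using that by (auto simp: r_def divide_le_eq mult.commute)
  have rT: "r n t \<le> T" if "0 < t" "t < T" for n t
    using r0(2)[OF that(1), of n] that by linarith
  have r1: "t - 1 / real (Suc n) \<le> r n t" for n t
  proof -
    have "real (Suc n) * t - 1 \<le> real_of_int \<lfloor>real (Suc n) * t\<rfloor>" by linarith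
    then have "(real (Suc n) * t - 1) / real (Suc n) \<le> r n t" unfolding r_def by (rule divide_right_mono) simp
    then show ?thesis by (simp add: diff_divide_distrib)
  qed
  have sf: "simple_function (time T) (r n)" for n
  proof (rule simple_function_borel_measurable)
    show "r n \<in> borel_measurable (time T)"
      unfolding r_def[abs_def] by (rule borel_measurable_lebesgue_on) measurable
    have "r n ` space (time T) \<subseteq> (\<lambda>k. real_of_int k / real (Suc n)) ` {0..\<lfloor>real (Suc n) * T\<rfloor>}"
      by (auto simp: r_def intro!: imageI floor_mono)
    then show "finite (r n ` space (time T))" by (rule finite_subset) simp
  qed
  show ?thesis
  proof (rule strongly_measurableI[where s="\<lambda>n t. w (r n t)"])
    show "simple_function (time T) (\<lambda>t. w (r n t))" for n by (rule simple_function_compose1[OF sf])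
    show "AE t in time T. (\<lambda>n. nrm X (w (r n t) - w t)) \<longlonglongrightarrow> 0"
    proof (rule AE_I2)
      fix t assume t: "t \<in> space (time T)"
      have "(\<lambda>n. t - 1 / real (Suc n)) \<longlonglongrightarrow> t - 0"
        by (intro tendsto_diff tendsto_const LIMSEQ_Suc[OF lim_1_over_n])
      then have l0: "(\<lambda>n. t - 1 / real (Suc n)) \<longlonglongrightarrow> t" by (simp only: diff_0_right)
      have lim: "(\<lambda>n. r n t) \<longlonglongrightarrow> t"
        by (rule real_tendsto_sandwich[OF _ _ l0 tendsto_const])
          (rule always_eventually, use r1 r0 t in auto)+
      have "((\<lambda>s. nrm X (w s - w t)) \<longlongrightarrow> nrm X (w t - w t)) (at t within {0..T})"
        using cont[of t] t by auto
      then have "continuous (at t within {0..T}) (\<lambda>s. nrm X (w s - w t))"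
        by (simp add: continuous_within)
      then have "(\<lambda>n. nrm X (w (r n t) - w t)) \<longlonglongrightarrow> nrm X (w t - w t)"
        by (rule continuous_within_tendsto_compose'[OF _ _ lim]) (use r0 rT t in auto)
      then show "(\<lambda>n. nrm X (w (r n t) - w t)) \<longlonglongrightarrow> 0" by simp
    qed
  qed (use w r0 rT in auto)
qed

text \<open>The null set in \<open>orth\<close> depends on \<psi>, and no separability of the space
  is assumed. The values of the approximating simple functions form a countable set of test vectors
  that comes arbitrarily close to v t itself.\<close>

lemma (in prehilbert) AE_nrm_zero_if_orthogonal:
  assumes v: "strongly_measurable M X v" and orth: "\<And>\<psi>. \<psi> \<in> car X \<Longrightarrow> AE t in M. ip (v t) \<psi> = 0"
  shows "AE t in M. nrm X (v t) = 0"
proof -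
  obtain s where s: "\<And>n. simple_function M (s n)" "\<And>n t. t \<in> space M \<Longrightarrow> s n t \<in> car X"
    "AE t in M. (\<lambda>n::nat. nrm X (s n t - v t)) \<longlonglongrightarrow> 0" using strongly_measurableE[OF v] by blast
  define D where "D = (\<Union>n. s n ` space M)"
  have "countable D" unfolding D_def
    by (rule countable_UN) (auto intro: countable_finite simple_functionD(1)[OF s(1)])
  moreover have D: "D \<subseteq> car X" using s(2) by (auto simp: D_def)
  ultimately have "AE t in M. \<forall>d\<in>D. ip (v t) d = 0"
    using orth by (subst AE_ball_countable) auto
  then show ?thesis
    using s(3) AE_space
  proof eventually_elim
    case (elim t)
    have c: "v t \<in> car X" "s n t \<in> car X" for n using strongly_measurable_car[OF v] s(2) elim(3) by auto
    have "ip (v t) (v t) \<le> nrm X (v t) * nrm X (s n t - v t)" for n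
    proof -
      have "ip (v t) (s n t) = 0" using elim by (auto simp: D_def)
      then have "ip (v t) (v t) = - ip (v t) (s n t - v t)" using c by (simp add: ip_diff_right)
      then show ?thesis using Cauchy_Schwarz[of "v t" "s n t - v t"] c by (auto simp: abs_le_iff)
    qed
    moreover have "(\<lambda>n. nrm X (v t) * nrm X (s n t - v t)) \<longlonglongrightarrow> 0"
      by (rule tendsto_mult_right_zero[OF elim(2)])
    ultimately have "ip (v t) (v t) \<le> 0" by (intro LIMSEQ_le_const) auto
    then show ?case using ip_nonneg[OF c(1)] nrm_eq_ip[OF c(1)] by simp
  qed
qed

section \<open>Weak derivatives and primitives with values in a Hilbert space\<close>

context hilbert begin

lemma bochner_L2_lincomb:
  assumes "u \<in> car (bochner_L2 T X)" "v \<in> car (bochner_L2 T X)"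
  shows "(\<lambda>t. a *\<^sub>R u t + b *\<^sub>R v t) \<in> car (bochner_L2 T X)"
proof -
  interpret B: seminormed "bochner_L2 T X" by (rule seminormed_bochner_L2)
  have "a *\<^sub>R u + b *\<^sub>R v \<in> car (bochner_L2 T X)" using assms by blast
  then show ?thesis by (simp add: plus_fun_def scaleR_fun_def)
qed

lemma bochner_L2_diff:
  assumes "u \<in> car (bochner_L2 T X)" "v \<in> car (bochner_L2 T X)"
  shows "(\<lambda>t. u t - v t) \<in> car (bochner_L2 T X)"
  using bochner_L2_lincomb[OF assms, of 1 "-1"] by simp

lemma integrable_ip_bochner_L2:
  assumes "u \<in> car (bochner_L2 T X)" "\<psi> \<in> car X"
  shows "integrable (time T) (\<lambda>t. ip (u t) \<psi>)"
  using integrable_ip(1)[OF complete_time bochner_L2D(1,3)[OF assms(1)] assms(2)] .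

lemma integrable_test_function_ip:
  assumes "test_function {0<..<T} \<phi>" "u \<in> car (bochner_L2 T X)" "\<psi> \<in> car X"
  shows "integrable (time T) (\<lambda>t. \<phi> t * ip (u t) \<psi>)"
proof -
  obtain B where "\<And>t. \<bar>\<phi> t\<bar> \<le> B" using test_function_bounded[OF assms(1)] by blast
  then show ?thesis
    by (intro integrable_mult_bounded[OF integrable_ip_bochner_L2[OF assms(2,3)] test_function_measurable[OF assms(1)]])
qed

lemma has_bochner_integral_test_function:
  assumes \<phi>: "test_function {0<..<T} \<phi>" and u: "u \<in> car (bochner_L2 T X)" and w: "w \<in> car X"
  shows "has_bochner_integral_in (time T) X (\<lambda>t. \<phi> t *\<^sub>R u t) w \<longleftrightarrow>
    (\<forall>\<psi>\<in>car X. ip w \<psi> = (LINT t|time T. \<phi> t * ip (u t) \<psi>))"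
proof -
  obtain B where B: "\<And>t. \<bar>\<phi> t\<bar> \<le> B" using test_function_bounded[OF \<phi>] by blast
  have m: "\<phi> \<in> borel_measurable (time T)" by (rule test_function_measurable[OF \<phi>])
  note uD = bochner_L2D[OF u]
  have sm: "strongly_measurable (time T) X (\<lambda>t. \<phi> t *\<^sub>R u t)" by (rule strongly_measurable_mult[OF m uD(1)])
  have "integrable (time T) (\<lambda>t. \<bar>\<phi> t\<bar> * nrm X (u t))"
    by (rule integrable_mult_bounded[OF uD(3), where B=B]) (use m B in auto)
  also have "integrable (time T) (\<lambda>t. \<bar>\<phi> t\<bar> * nrm X (u t)) \<longleftrightarrow> integrable (time T) (\<lambda>t. nrm X (\<phi> t *\<^sub>R u t))"
    using uD(4) by (intro Bochner_Integration.integrable_cong) (auto simp: nrm_scale)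
  finally have i: "integrable (time T) (\<lambda>t. nrm X (\<phi> t *\<^sub>R u t))" .
  have e: "(LINT t|time T. ip (\<phi> t *\<^sub>R u t) \<psi>) = (LINT t|time T. \<phi> t * ip (u t) \<psi>)" if "\<psi> \<in> car X" for \<psi>
    using uD(4) that by (intro Bochner_Integration.integral_cong) (auto simp: ip_scale_left)
  show ?thesis
    using has_bochner_integral_in_iff_weak[OF complete_time finite_time sm i w] e by auto
qed

text \<open>The definition asks for a vector w that is a Bochner integral. From the scalar
  identities it is obtained by \<open>riesz\<close>, since the scalar integrals are bounded linear
  in \<psi>.\<close>

lemma weak_time_derivative_iff:
  assumes u: "u \<in> car (bochner_L2 T X)"
  shows "weak_time_derivative T X u v \<longleftrightarrow> v \<in> car (bochner_L2 T X) \<and>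
    (\<forall>\<phi>. test_function {0<..<T} \<phi> \<longrightarrow> (\<forall>\<psi>\<in>car X.
      (LINT t|time T. deriv \<phi> t * ip (u t) \<psi>) = - (LINT t|time T. \<phi> t * ip (v t) \<psi>)))"
proof (cases "v \<in> car (bochner_L2 T X)")
  case v: True
  have "(\<exists>w. has_bochner_integral_in (time T) X (\<lambda>t. deriv \<phi> t *\<^sub>R u t) w
         \<and> has_bochner_integral_in (time T) X (\<lambda>t. \<phi> t *\<^sub>R v t) (- w)) \<longleftrightarrow>
      (\<forall>\<psi>\<in>car X. (LINT t|time T. deriv \<phi> t * ip (u t) \<psi>) = - (LINT t|time T. \<phi> t * ip (v t) \<psi>))"
    (is "?L \<longleftrightarrow> ?R") if \<phi>: "test_function {0<..<T} \<phi>" for \<phi>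
  proof
    note \<phi>' = test_function_deriv[OF \<phi>]
    {
      assume ?L
      then obtain w where w: "has_bochner_integral_in (time T) X (\<lambda>t. deriv \<phi> t *\<^sub>R u t) w"
        "has_bochner_integral_in (time T) X (\<lambda>t. \<phi> t *\<^sub>R v t) (- w)" by blast
      then have wc: "w \<in> car X" "- w \<in> car X" by (auto simp: has_bochner_integral_in_def)
      show ?R
        using w has_bochner_integral_test_function[OF \<phi>' u wc(1)] has_bochner_integral_test_function[OF \<phi> v wc(2)]
          ip_minus_left[OF wc(1)] by fastforce
    }
    {
      assume R: ?R
      obtain B where B: "0 \<le> B" "\<And>t. \<bar>deriv \<phi> t\<bar> \<le> B" using test_function_bounded[OF \<phi>'] by blast
      note iu = integrable_test_function_ip[OF \<phi>' u]
      have "\<exists>w\<in>car X. \<forall>\<psi>\<in>car X. ip w \<psi> = (LINT t|time T. deriv \<phi> t * ip (u t) \<psi>)"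
      proof (rule riesz)
        fix x y assume xy: "x \<in> car X" "y \<in> car X"
        have "(LINT t|time T. deriv \<phi> t * ip (u t) (x + y))
            = (LINT t|time T. deriv \<phi> t * ip (u t) x + deriv \<phi> t * ip (u t) y)"
          using bochner_L2D(4)[OF u] xy
          by (intro Bochner_Integration.integral_cong) (auto simp: ip_add_right distrib_left)
        then show "(LINT t|time T. deriv \<phi> t * ip (u t) (x + y))
            = (LINT t|time T. deriv \<phi> t * ip (u t) x) + (LINT t|time T. deriv \<phi> t * ip (u t) y)"
          using iu xy by simp
      next
        fix c x assume x: "x \<in> car X"
        have "(LINT t|time T. deriv \<phi> t * ip (u t) (c *\<^sub>R x)) = (LINT t|time T. c * (deriv \<phi> t * ip (u t) x))"
          using bochner_L2D(4)[OF u] x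
          by (intro Bochner_Integration.integral_cong) (auto simp: ip_scale_right)
        then show "(LINT t|time T. deriv \<phi> t * ip (u t) (c *\<^sub>R x)) = c * (LINT t|time T. deriv \<phi> t * ip (u t) x)"
          by simp
      next
        fix x assume x: "x \<in> car X"
        have "norm (LINT t|time T. deriv \<phi> t * ip (u t) x) \<le> (LINT t|time T. norm (deriv \<phi> t * ip (u t) x))"
          by (rule integral_norm_bound)
        also have "\<dots> \<le> (LINT t|time T. (B * nrm X x) * nrm X (u t))"
        proof (rule integral_mono_AE)
          show "AE t in time T. norm (deriv \<phi> t * ip (u t) x) \<le> (B * nrm X x) * nrm X (u t)"
          proof (rule AE_I2)
            fix t assume "t \<in> space (time T)"
            then have ut: "u t \<in> car X" using bochner_L2D(4)[OF u] by auto
            have "\<bar>deriv \<phi> t\<bar> * \<bar>ip (u t) x\<bar> \<le> B * (nrm X (u t) * nrm X x)"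
              by (intro mult_mono B Cauchy_Schwarz ut x) auto
            then show "norm (deriv \<phi> t * ip (u t) x) \<le> (B * nrm X x) * nrm X (u t)"
              by (simp add: abs_mult mult_ac)
          qed
        qed (use iu[OF x] bochner_L2D(3)[OF u] in auto)
        finally show "\<bar>LINT t|time T. deriv \<phi> t * ip (u t) x\<bar> \<le> (B * (LINT t|time T. nrm X (u t))) * nrm X x"
          by (simp add: mult_ac)
      qed
      then obtain w where wc: "w \<in> car X" and w: "\<And>\<psi>. \<psi> \<in> car X \<Longrightarrow> ip w \<psi> = (LINT t|time T. deriv \<phi> t * ip (u t) \<psi>)"
        by blast
      have "has_bochner_integral_in (time T) X (\<lambda>t. deriv \<phi> t *\<^sub>R u t) w"
        using w has_bochner_integral_test_function[OF \<phi>' u wc] by simp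
      moreover have "has_bochner_integral_in (time T) X (\<lambda>t. \<phi> t *\<^sub>R v t) (- w)"
        using w R has_bochner_integral_test_function[OF \<phi> v minus_car[OF wc]] ip_minus_left[OF wc] by simp
      ultimately show ?L by blast
    }
  qed
  then show ?thesis using v unfolding weak_time_derivative_def by blast
qed (simp add: weak_time_derivative_def)

text \<open>For a fixed \<psi> this is the scalar fundamental lemma;
  \<open>AE_nrm_zero_if_orthogonal\<close> then removes the dependence of the null set on
  \<psi>.\<close>

lemma weak_time_derivative_unique:
  assumes u: "u \<in> car (bochner_L2 T X)"
    and v: "weak_time_derivative T X u v" "weak_time_derivative T X u v'"
  shows "AE t in time T. nrm X (v t - v' t) = 0"
proof (rule AE_nrm_zero_if_orthogonal)
  note c = v[unfolded weak_time_derivative_iff[OF u], THEN conjunct1]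
  show "strongly_measurable (time T) X (\<lambda>t. v t - v' t)"
    using bochner_L2D(1)[OF bochner_L2_diff[OF c]] .
  fix \<psi> assume \<psi>: "\<psi> \<in> car X"
  have "AE t in time T. ip (v t) \<psi> - ip (v' t) \<psi> = 0"
  proof (rule AE_zero_if_orthogonal_to_box_bumps)
    show "integrable (time T) (\<lambda>t. ip (v t) \<psi> - ip (v' t) \<psi>)"
      using integrable_ip_bochner_L2[OF c(1) \<psi>] integrable_ip_bochner_L2[OF c(2) \<psi>] by simp
    fix a b :: real and k assume "cbox a b \<subseteq> {0<..<T}"
    then have t: "test_function {0<..<T} (box_bump a b k)" by (rule test_function_box_bump)
    let ?b = "box_bump a b k"
    have "(LINT t|time T. ?b t * ip (v t) \<psi>) = (LINT t|time T. ?b t * ip (v' t) \<psi>)"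
      using v(1)[unfolded weak_time_derivative_iff[OF u], THEN conjunct2, rule_format, OF t \<psi>]
        v(2)[unfolded weak_time_derivative_iff[OF u], THEN conjunct2, rule_format, OF t \<psi>] by linarith
    moreover have "(ip (v t) \<psi> - ip (v' t) \<psi>) * ?b t = ?b t * ip (v t) \<psi> - ?b t * ip (v' t) \<psi>" for t
      by (simp add: algebra_simps)
    ultimately show "(LINT t|time T. (ip (v t) \<psi> - ip (v' t) \<psi>) * ?b t) = 0"
      using integrable_test_function_ip[OF t c(1) \<psi>] integrable_test_function_ip[OF t c(2) \<psi>] by simp
  qed auto
  then show "AE t in time T. ip (v t - v' t) \<psi> = 0"
    using AE_space
    by eventually_elim (use bochner_L2D(4)[OF c(1)] bochner_L2D(4)[OF c(2)] \<psi> in \<open>auto simp: ip_diff_left\<close>)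
qed

lemma weak_time_derivative_lincomb:
  assumes u: "u \<in> car (bochner_L2 T X)" "weak_time_derivative T X u v"
    and u': "u' \<in> car (bochner_L2 T X)" "weak_time_derivative T X u' v'"
  shows "weak_time_derivative T X (\<lambda>t. a *\<^sub>R u t + b *\<^sub>R u' t) (\<lambda>t. a *\<^sub>R v t + b *\<^sub>R v' t)"
proof -
  note c = u(2)[unfolded weak_time_derivative_iff[OF u(1)], THEN conjunct1]
    u'(2)[unfolded weak_time_derivative_iff[OF u'(1)], THEN conjunct1]
  have e: "(LINT t|time T. \<phi> t * ip (a *\<^sub>R u t + b *\<^sub>R u' t) \<psi>)
      = a * (LINT t|time T. \<phi> t * ip (u t) \<psi>) + b * (LINT t|time T. \<phi> t * ip (u' t) \<psi>)"
    if \<phi>: "test_function {0<..<T} \<phi>" and \<psi>: "\<psi> \<in> car X"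
      and uu: "u \<in> car (bochner_L2 T X)" "u' \<in> car (bochner_L2 T X)" for \<phi> \<psi> u u'
  proof -
    have "(LINT t|time T. \<phi> t * ip (a *\<^sub>R u t + b *\<^sub>R u' t) \<psi>)
      = (LINT t|time T. a * (\<phi> t * ip (u t) \<psi>) + b * (\<phi> t * ip (u' t) \<psi>))"
      using bochner_L2D(4)[OF uu(1)] bochner_L2D(4)[OF uu(2)] \<psi>
      by (intro Bochner_Integration.integral_cong) (auto simp: ip_add_left ip_scale_left algebra_simps)
    then show ?thesis
      using integrable_test_function_ip[OF \<phi> uu(1) \<psi>] integrable_test_function_ip[OF \<phi> uu(2) \<psi>] by simp
  qed
  show ?thesis
    unfolding weak_time_derivative_iff[OF bochner_L2_lincomb[OF u(1) u'(1)]]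
  proof (intro conjI allI impI ballI)
    show "(\<lambda>t. a *\<^sub>R v t + b *\<^sub>R v' t) \<in> car (bochner_L2 T X)" by (rule bochner_L2_lincomb[OF c])
    fix \<phi> \<psi> assume \<phi>: "test_function {0<..<T} \<phi>" and \<psi>: "\<psi> \<in> car X"
    have "(LINT t|time T. deriv \<phi> t * ip (u t) \<psi>) = - (LINT t|time T. \<phi> t * ip (v t) \<psi>)"
      "(LINT t|time T. deriv \<phi> t * ip (u' t) \<psi>) = - (LINT t|time T. \<phi> t * ip (v' t) \<psi>)"
      using u(2)[unfolded weak_time_derivative_iff[OF u(1)]] u'(2)[unfolded weak_time_derivative_iff[OF u'(1)]] \<phi> \<psi>
      by auto
    then show "(LINT t|time T. deriv \<phi> t * ip (a *\<^sub>R u t + b *\<^sub>R u' t) \<psi>)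
        = - (LINT t|time T. \<phi> t * ip (a *\<^sub>R v t + b *\<^sub>R v' t) \<psi>)"
      by (simp add: e[OF test_function_deriv[OF \<phi>] \<psi> u(1) u'(1)] e[OF \<phi> \<psi> c])
  qed
qed

text \<open>The integral of v over (0, t), described weakly; for square-integrable v and t up to T
  it exists by \<open>riesz\<close>. It is a choice among vectors that differ by seminorm
  zero.\<close>

definition primitive
  where "primitive v t = (SOME w. w \<in> car X \<and> (\<forall>\<psi>\<in>car X. ip w \<psi> = (LINT s|time t. ip (v s) \<psi>)))"

lemma primitive_weak:
  assumes v: "v \<in> car (bochner_L2 T X)" and t: "t \<le> T"
  shows "primitive v t \<in> car X" "\<And>\<psi>. \<psi> \<in> car X \<Longrightarrow> ip (primitive v t) \<psi> = (LINT s|time t. ip (v s) \<psi>)"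
proof -
  have sm: "strongly_measurable (time t) X v" by (rule strongly_measurable_time_mono[OF bochner_L2D(1)[OF v] t])
  have i: "integrable (time t) (\<lambda>s. nrm X (v s))" by (rule integrable_time_mono[OF bochner_L2D(3)[OF v] t])
  note ii = integrable_ip[OF complete_time sm i]
  have vc: "v s \<in> car X" if "s \<in> space (time t)" for s using strongly_measurable_car[OF sm that] .
  have "\<exists>w\<in>car X. \<forall>\<psi>\<in>car X. ip w \<psi> = (LINT s|time t. ip (v s) \<psi>)"
  proof (rule riesz)
    fix x y assume xy: "x \<in> car X" "y \<in> car X"
    have "(LINT s|time t. ip (v s) (x + y)) = (LINT s|time t. ip (v s) x + ip (v s) y)"
      using vc xy by (intro Bochner_Integration.integral_cong) (auto simp: ip_add_right)
    then show "(LINT s|time t. ip (v s) (x + y)) = (LINT s|time t. ip (v s) x) + (LINT s|time t. ip (v s) y)"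
      using ii xy by simp
  next
    fix c x assume x: "x \<in> car X"
    have "(LINT s|time t. ip (v s) (c *\<^sub>R x)) = (LINT s|time t. c * ip (v s) x)"
      using vc x by (intro Bochner_Integration.integral_cong) (auto simp: ip_scale_right)
    then show "(LINT s|time t. ip (v s) (c *\<^sub>R x)) = c * (LINT s|time t. ip (v s) x)" by simp
  next
    fix x assume "x \<in> car X"
    from ii(2)[OF this] show "\<bar>LINT s|time t. ip (v s) x\<bar> \<le> (LINT s|time t. nrm X (v s)) * nrm X x"
      by (simp add: mult.commute)
  qed
  then have "\<exists>w. w \<in> car X \<and> (\<forall>\<psi>\<in>car X. ip w \<psi> = (LINT s|time t. ip (v s) \<psi>))" by blast
  from someI_ex[OF this] show "primitive v t \<in> car X"
    "\<And>\<psi>. \<psi> \<in> car X \<Longrightarrow> ip (primitive v t) \<psi> = (LINT s|time t. ip (v s) \<psi>)"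
    unfolding primitive_def by auto
qed

text \<open>Linearity of \<open>primitive\<close> holds only up to seminorm zero, so the difference
  of two primitives is tested with itself instead of being rewritten as one primitive.\<close>

lemma nrm_primitive_diff:
  assumes v: "v \<in> car (bochner_L2 T X)" "w \<in> car (bochner_L2 T X)" and t: "t \<le> T"
  shows "nrm X (primitive v t - primitive w t) \<le> (LINT s|time t. nrm X (v s - w s))"
proof (rule nrm_le_if_ip_le)
  let ?d = "primitive v t - primitive w t"
  note p = primitive_weak[OF v(1) t] primitive_weak[OF v(2) t]
  show d: "?d \<in> car X" using p(1,3) by auto
  note vw = bochner_L2_diff[OF v]
  have sm: "strongly_measurable (time t) X (\<lambda>s. v s - w s)"
    by (rule strongly_measurable_time_mono[OF bochner_L2D(1)[OF vw] t])
  have i: "integrable (time t) (\<lambda>s. nrm X (v s - w s))" by (rule integrable_time_mono[OF bochner_L2D(3)[OF vw] t])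
  show "0 \<le> (LINT s|time t. nrm X (v s - w s))"
    using strongly_measurable_car[OF sm] by (intro Bochner_Integration.integral_nonneg nrm_nonneg)
  have iv: "integrable (time t) (\<lambda>s. ip (u s) ?d)" if "u \<in> car (bochner_L2 T X)" for u
    by (rule integrable_time_mono[OF integrable_ip_bochner_L2[OF that d] t])
  have "ip ?d ?d = (LINT s|time t. ip (v s) ?d) - (LINT s|time t. ip (w s) ?d)"
    using p d by (simp add: ip_diff_left)
  also have "\<dots> = (LINT s|time t. ip (v s) ?d - ip (w s) ?d)" using iv v by simp
  also have "\<dots> = (LINT s|time t. ip (v s - w s) ?d)"
    using bochner_L2D(4)[OF v(1)] bochner_L2D(4)[OF v(2)] d t
    by (intro Bochner_Integration.integral_cong) (auto simp: ip_diff_left)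
  also have "\<dots> \<le> (LINT s|time t. nrm X (v s - w s)) * nrm X ?d"
    using integrable_ip(2)[OF complete_time sm i d] by (simp add: mult.commute)
  finally show "ip ?d ?d \<le> (LINT s|time t. nrm X (v s - w s)) * nrm X ?d" .
qed

lemma nrm_primitive_increment:
  assumes v: "v \<in> car (bochner_L2 T X)" and st: "s \<le> t" "t \<le> T"
  shows "nrm X (primitive v t - primitive v s) \<le> (LINT r|time t. nrm X (v r)) - (LINT r|time s. nrm X (v r))"
proof (rule nrm_le_if_ip_le)
  let ?d = "primitive v t - primitive v s"
  have sT: "s \<le> T" using st by simp
  note p = primitive_weak[OF v st(2)] primitive_weak[OF v sT]
  show d: "?d \<in> car X" using p(1,3) by auto
  note i = bochner_L2D(3)[OF v]
  have vc: "0 < r \<Longrightarrow> r < T \<Longrightarrow> v r \<in> car X" for r by (rule bochner_L2D(4)[OF v])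
  show "0 \<le> (LINT r|time t. nrm X (v r)) - (LINT r|time s. nrm X (v r))"
    using prefix_integral_increment[OF i i _ st] vc by (auto simp: nrm_nonneg)
  have "ip ?d ?d = (LINT r|time t. ip (v r) ?d) - (LINT r|time s. ip (v r) ?d)"
    using p d by (simp add: ip_diff_left)
  also have "\<dots> \<le> (LINT r|time t. nrm X (v r) * nrm X ?d) - (LINT r|time s. nrm X (v r) * nrm X ?d)"
  proof (rule order_trans[OF abs_ge_self prefix_integral_increment[OF integrable_ip_bochner_L2[OF v d] _ _ st]])
    show "integrable (time T) (\<lambda>r. nrm X (v r) * nrm X ?d)" using i by simp
    show "\<bar>ip (v r) ?d\<bar> \<le> nrm X (v r) * nrm X ?d" if "0 < r" "r < T" for r
      by (rule Cauchy_Schwarz[OF vc[OF that] d])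
  qed
  finally show "ip ?d ?d \<le> ((LINT r|time t. nrm X (v r)) - (LINT r|time s. nrm X (v r))) * nrm X ?d"
    by (simp add: left_diff_distrib)
qed

lemma primitive_zero:
  assumes "v \<in> car (bochner_L2 T X)" "0 < T"
  shows "nrm X (primitive v 0) = 0"
  using primitive_weak[OF assms(1), of 0] assms(2) by (auto intro: nrm_zero_if_orthogonal)

lemma primitive_continuous:
  assumes v: "v \<in> car (bochner_L2 T X)" and t: "t \<in> {0..T}"
  shows "((\<lambda>s. nrm X (primitive v s - primitive v t)) \<longlongrightarrow> 0) (at t within {0..T})"
proof -
  let ?A = "\<lambda>t. LINT r|time t. nrm X (v r)"
  have "(?A \<longlongrightarrow> ?A t) (at t within {0..T})"
    using t by (intro prefix_integral_tendsto[OF bochner_L2D(3)[OF v]]) auto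
  then have "((\<lambda>s. \<bar>?A s - ?A t\<bar>) \<longlongrightarrow> 0) (at t within {0..T})"
    by (intro tendsto_rabs_zero) (simp add: LIM_zero_iff)
  then show ?thesis
  proof (rule tendsto_sandwich[OF _ _ tendsto_const, rotated -1])
    have b: "0 \<le> nrm X (primitive v s - primitive v t) \<and> nrm X (primitive v s - primitive v t) \<le> \<bar>?A s - ?A t\<bar>"
      if s: "s \<in> {0..T}" for s
    proof -
      have c: "primitive v s \<in> car X" "primitive v t \<in> car X"
        using primitive_weak(1)[OF v] s t by auto
      have "nrm X (primitive v s - primitive v t) \<le> \<bar>?A s - ?A t\<bar>"
      proof (cases "s \<le> t")
        case True
        with nrm_primitive_increment[OF v True] t nrm_diff_commute[OF c] show ?thesis by auto
      next
        case False
        with nrm_primitive_increment[OF v, of t s] s show ?thesis by auto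
      qed
      then show ?thesis using c by (auto intro: nrm_nonneg)
    qed
    show "\<forall>\<^sub>F s in at t within {0..T}. 0 \<le> nrm X (primitive v s - primitive v t)"
      "\<forall>\<^sub>F s in at t within {0..T}. nrm X (primitive v s - primitive v t) \<le> \<bar>?A s - ?A t\<bar>"
      using b by (auto simp: eventually_at_filter)
  qed
qed

lemma nrm_primitive_le:
  assumes v: "v \<in> car (bochner_L2 T X)" and t: "t \<le> T"
  shows "nrm X (primitive v t) \<le> (LINT s|time t. nrm X (v s))"
proof (rule nrm_le_if_ip_le)
  show "0 \<le> (LINT s|time t. nrm X (v s))"
    using bochner_L2D(4)[OF v] t by (intro Bochner_Integration.integral_nonneg nrm_nonneg) auto
  show d: "primitive v t \<in> car X" by (rule primitive_weak(1)[OF v t])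
  show "ip (primitive v t) (primitive v t) \<le> (LINT s|time t. nrm X (v s)) * nrm X (primitive v t)"
    using integrable_ip(2)[OF complete_time strongly_measurable_time_mono[OF bochner_L2D(1)[OF v] t]
        integrable_time_mono[OF bochner_L2D(3)[OF v] t] d]
    by (simp add: primitive_weak(2)[OF v t d] mult.commute)
qed

lemma primitive_bochner_L2:
  assumes v: "v \<in> car (bochner_L2 T X)" and T: "0 < T"
  shows "primitive v \<in> car (bochner_L2 T X)"
proof (rule bochner_L2_bound(1))
  show "strongly_measurable (time T) X (primitive v)"
    by (rule continuous_strongly_measurable) (use primitive_weak(1)[OF v] primitive_continuous[OF v] in auto)
  show "(\<lambda>_. LINT s|time T. nrm X (v s)) \<in> car (L2_on (time T))"
    by (intro L2_onI finite_measure.integrable_const[OF finite_time]) auto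
  show "AE t in time T. nrm X (primitive v t) \<le> (LINT s|time T. nrm X (v s))"
    using AE_space
  proof eventually_elim
    case (elim t)
    then have t: "t \<le> T" by auto
    have "(LINT s|time t. nrm X (v s)) \<le> (LINT s|time T. nrm X (v s))"
      using prefix_integral_increment[OF bochner_L2D(3)[OF v] bochner_L2D(3)[OF v] _ t order_refl]
        bochner_L2D(4)[OF v] by (auto simp: nrm_nonneg)
    then show ?case using nrm_primitive_le[OF v t] by linarith
  qed
qed

lemma weak_time_derivative_primitive:
  assumes v: "v \<in> car (bochner_L2 T X)" and T: "0 < T"
  shows "weak_time_derivative T X (primitive v) v"
  unfolding weak_time_derivative_iff[OF primitive_bochner_L2[OF v T]]
proof (intro conjI allI impI ballI v)
  fix \<phi> \<psi> assume \<phi>: "test_function {0<..<T} \<phi>" and \<psi>: "\<psi> \<in> car X"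
  have "(LINT t|time T. deriv \<phi> t * ip (primitive v t) \<psi>) = (LINT t|time T. deriv \<phi> t * (LINT s|time t. ip (v s) \<psi>))"
    using primitive_weak(2)[OF v _ \<psi>] by (intro Bochner_Integration.integral_cong) auto
  also have "\<dots> = - (LINT t|time T. \<phi> t * ip (v t) \<psi>)"
    by (rule integral_by_parts_primitive[OF \<phi> integrable_ip_bochner_L2[OF v \<psi>]])
  finally show "(LINT t|time T. deriv \<phi> t * ip (primitive v t) \<psi>) = - (LINT t|time T. \<phi> t * ip (v t) \<psi>)" .
qed

lemma primitive_bochner_H10:
  assumes v: "v \<in> car (bochner_L2 T X)" and T: "0 < T"
  shows "primitive v \<in> car (bochner_H10 T X)"
proof -
  have "has_initial_value T X (primitive v) 0"
    unfolding has_initial_value_def eq_in_def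
    using primitive_weak(1)[OF v] primitive_continuous[OF v] primitive_zero[OF v T]
    by (intro exI[of _ "primitive v"]) auto
  then show ?thesis
    using primitive_bochner_L2[OF v T] weak_time_derivative_primitive[OF v T]
    by (auto simp: bochner_H10_def bochner_H1_def)
qed

text \<open>For a fixed \<psi> the scalar \<open>ip (u t) \<psi>\<close> is a constant plus the
  integral of \<open>ip (v s) \<psi>\<close>. The continuous representative w vanishes at 0, and
  this determines the constant.\<close>

lemma eq_primitive_if_initial_value:
  assumes T: "0 < T" and u: "u \<in> car (bochner_L2 T X)" and uv: "weak_time_derivative T X u v"
    and init: "has_initial_value T X u 0"
  shows "AE t in time T. nrm X (u t - primitive v t) = 0"
proof (rule AE_nrm_zero_if_orthogonal)
  have v: "v \<in> car (bochner_L2 T X)" using uv by (simp add: weak_time_derivative_def)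
  note J = primitive_bochner_L2[OF v T]
  show "strongly_measurable (time T) X (\<lambda>t. u t - primitive v t)"
    by (rule bochner_L2D(1)[OF bochner_L2_diff[OF u J]])
  fix \<psi> assume \<psi>: "\<psi> \<in> car X"
  let ?h = "\<lambda>t. LINT s|time t. ip (v s) \<psi>"
  have "\<exists>c. AE t in time T. ip (u t) \<psi> = c + ?h t"
    by (rule primitive_of_weak_derivative[OF T integrable_ip_bochner_L2[OF u \<psi>] integrable_ip_bochner_L2[OF v \<psi>]])
      (use uv[unfolded weak_time_derivative_iff[OF u]] \<psi> in auto)
  then obtain c where c: "AE t in time T. ip (u t) \<psi> = c + ?h t" by blast
  obtain w where w: "w \<in> {0..T} \<rightarrow> car X" "AE t in time T. eq_in X (w t) (u t)"
    "\<And>t. t \<in> {0..T} \<Longrightarrow> ((\<lambda>s. nrm X (w s - w t)) \<longlongrightarrow> 0) (at t within {0..T})" "eq_in X (w 0) 0"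
    using init by (auto simp: has_initial_value_def)
  have wc: "0 \<le> t \<Longrightarrow> t \<le> T \<Longrightarrow> w t \<in> car X" for t using w(1) by auto
  have w0: "ip (w 0) \<psi> = 0"
    using w(4) wc[of 0] T \<psi> by (intro ip_eq_zero_if_nrm_zero) (auto simp: eq_in_def)
  have k: "AE t in time T. ip (w t) \<psi> - ?h t = c"
    using c w(2) AE_space
  proof eventually_elim
    case (elim t)
    have "ip (w t - u t) \<psi> = 0"
      using elim wc bochner_L2D(4)[OF u] \<psi> by (intro ip_eq_zero_if_nrm_zero) (auto simp: eq_in_def)
    then show ?case using elim wc bochner_L2D(4)[OF u] \<psi> by (simp add: ip_diff_left)
  qed
  have "((\<lambda>t. ip (w t) \<psi> - ip (w 0) \<psi>) \<longlongrightarrow> 0) (at 0 within {0..T})"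
  proof (rule tendsto_rabs_zero_cancel, rule tendsto_sandwich[OF _ _ tendsto_const])
    show "((\<lambda>s. nrm X (w s - w 0) * nrm X \<psi>) \<longlongrightarrow> 0) (at 0 within {0..T})"
      using T by (intro tendsto_mult_left_zero w(3)) auto
    show "\<forall>\<^sub>F t in at 0 within {0..T}. \<bar>ip (w t) \<psi> - ip (w 0) \<psi>\<bar> \<le> nrm X (w t - w 0) * nrm X \<psi>"
      using Cauchy_Schwarz[of "w _ - w 0" \<psi>] wc T \<psi>
      by (auto simp: eventually_at_filter ip_diff_left[symmetric])
  qed auto
  moreover have "(?h \<longlongrightarrow> ?h 0) (at 0 within {0..T})"
    using T by (intro prefix_integral_tendsto integrable_ip_bochner_L2[OF v \<psi>]) auto
  ultimately have "((\<lambda>t. (ip (w t) \<psi> - ip (w 0) \<psi>) - ?h t) \<longlongrightarrow> 0 - ?h 0) (at 0 within {0..T})"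
    by (rule tendsto_diff)
  then have lim: "((\<lambda>t. ip (w t) \<psi> - ?h t) \<longlongrightarrow> 0) (at 0 within {0..T})" by (simp add: w0)
  \<comment> \<open>The expression has limit 0 at the left end but equals c almost everywhere, hence
    at some point of every interval (0, d).\<close>
  have c0: "c = 0"
  proof (rule ccontr)
    assume "c \<noteq> 0"
    then have "\<forall>\<^sub>F t in at 0 within {0..T}. \<bar>ip (w t) \<psi> - ?h t\<bar> < \<bar>c\<bar>"
      using order_tendstoD(2)[OF tendsto_rabs_zero[OF lim], of "\<bar>c\<bar>"] by simp
    then obtain d where d: "d > 0" "\<And>t. 0 \<le> t \<Longrightarrow> t \<le> T \<Longrightarrow> t \<noteq> 0 \<Longrightarrow> \<bar>t\<bar> < d \<Longrightarrow> \<bar>ip (w t) \<psi> - ?h t\<bar> < \<bar>c\<bar>"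
      by (auto simp: eventually_at dist_real_def)
    have "AE t in time (min d T). ip (w t) \<psi> - ?h t = c" by (rule AE_time_mono[OF k]) simp
    then obtain t where "0 < t" "t < min d T" "ip (w t) \<psi> - ?h t = c"
      using AE_time_ex[of "min d T"] d(1) T by auto
    with d(2)[of t] show False by auto
  qed
  show "AE t in time T. ip (u t - primitive v t) \<psi> = 0"
    using c AE_space
    by eventually_elim
      (use c0 bochner_L2D(4)[OF u] bochner_L2D(4)[OF J] primitive_weak(2)[OF v _ \<psi>] \<psi> in \<open>auto simp: ip_diff_left\<close>)
qed

end

section \<open>Volterra equations\<close>

lemma prefix_integral_le_total:
  fixes g :: "real \<Rightarrow> real"
  assumes g: "integrable (time T) g" and t: "t \<le> T" and nn: "\<And>s. 0 < s \<Longrightarrow> s < T \<Longrightarrow> 0 \<le> g s"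
  shows "0 \<le> (LINT s|time t. g s)" "(LINT s|time t. g s) \<le> (LINT s|time T. g s)"
  using prefix_integral_increment[OF g g _ t order_refl] nn t
  by (auto intro!: Bochner_Integration.integral_nonneg)

lemma measure_time: "0 \<le> T \<Longrightarrow> measure (time T) {0<..<T} = T"
  by (simp add: measure_restrict_space)

text \<open>Used to rewrite the memory term: once the unknown is the time derivative, an integral of
  the state becomes an iterated integral, and this collapses it to a single one at the cost of a
  factor T.\<close>

lemma iterated_prefix_integral_le:
  fixes a g :: "real \<Rightarrow> real"
  assumes a: "integrable (time T) a" and g: "integrable (time T) g" and t: "0 < t" "t < T"
    and nn: "\<And>s. 0 < s \<Longrightarrow> s < T \<Longrightarrow> 0 \<le> a s"
    and le: "AE s in time T. g s \<le> (LINT r|time s. a r)"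
  shows "(LINT s|time t. g s) \<le> T * (LINT s|time t. a s)"
proof -
  have at: "integrable (time t) a" by (rule integrable_time_mono[OF a]) (use t in simp)
  have nt: "0 \<le> (LINT r|time t. a r)" using prefix_integral_le_total(1)[OF at order_refl] nn t by auto
  have "(LINT s|time t. g s) \<le> (LINT s|time t. (LINT r|time t. a r))"
  proof (rule integral_mono_AE)
    show "integrable (time t) g" by (rule integrable_time_mono[OF g]) (use t in simp)
    show "integrable (time t) (\<lambda>s. LINT r|time t. a r)" by (rule finite_measure.integrable_const[OF finite_time])
    have "AE s in time t. g s \<le> (LINT r|time s. a r)" by (rule AE_time_mono[OF le]) (use t in simp)
    then show "AE s in time t. g s \<le> (LINT r|time t. a r)"
      using AE_space
    proof eventually_elim
      case (elim s)
      then have "s \<le> t" by simp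
      with elim(1) prefix_integral_le_total(2)[OF at this] nn t show ?case by force
    qed
  qed
  also have "\<dots> = t * (LINT r|time t. a r)" using t by (simp add: measure_time)
  also have "\<dots> \<le> T * (LINT r|time t. a r)" using t nt by (intro mult_right_mono) auto
  finally show ?thesis .
qed

text \<open>The exponential weight turns the Volterra operator into a contraction with constant \<open>1/2\<close>.\<close>

lemma Volterra_weighted:
  fixes a :: "real \<Rightarrow> real"
  assumes K: "0 < K" and a: "integrable (time T) a" and nn: "\<And>s. 0 < s \<Longrightarrow> s < T \<Longrightarrow> 0 \<le> a s"
  shows "(LINT t|time T. exp (- (2 * K * t)) * (K * (LINT s|time t. a s))) \<le> (LINT s|time T. exp (- (2 * K * s)) * a s) / 2"
    and "integrable (time T) (\<lambda>s. exp (- (2 * K * s)) * a s)"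
proof -
  let ?e = "\<lambda>t. exp (- (2 * K * t))"
  have e1: "0 \<le> ?e t" "0 < t \<Longrightarrow> ?e t \<le> 1" for t using K by auto
  have em: "?e \<in> borel_measurable (time T)"
    by (intro borel_measurable_lebesgue_on borel_measurable_continuous_onI continuous_intros)
  show ie: "integrable (time T) (\<lambda>s. ?e s * a s)"
    by (rule integrable_mult_bounded[OF a em, where B=1]) (use e1 in auto)
  have "(LINT t|time T. ?e t * (K * (LINT s|time t. a s))) = (LINT t|time T. (K * ?e t) * (LINT s|time t. a s))"
    by (simp add: mult_ac)
  also have "\<dots> = (LINT s|time T. (LINT t|lebesgue_on {s<..<T}. K * ?e t) * a s)"
    by (rule Fubini_time(2)[OF a, where B=K]) (use em K e1 in \<open>auto simp: abs_mult\<close>)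
  also have "\<dots> = (LINT s|time T. (?e s - ?e T) / 2 * a s)"
  proof (intro Bochner_Integration.integral_cong refl)
    fix s assume "s \<in> space (time T)"
    \<comment> \<open>The exponent 2K makes the inner integral half of the weight at s minus half of
      the weight at T; dropping the latter gives the factor 1/2.\<close>
    then have "(LINT t|lebesgue_on {s<..<T}. K * ?e t) = - (?e T / 2) - (- (?e s / 2))"
      using K by (intro integral_time_FTC) (auto intro!: derivative_eq_intros continuous_intros)
    moreover have "- (?e T / 2) - (- (?e s / 2)) = (?e s - ?e T) / 2" by (simp add: diff_divide_distrib)
    ultimately have "(LINT t|lebesgue_on {s<..<T}. K * ?e t) = (?e s - ?e T) / 2" by (rule trans)
    then show "(LINT t|lebesgue_on {s<..<T}. K * ?e t) * a s = (?e s - ?e T) / 2 * a s" by (simp only:)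
  qed
  also have "\<dots> \<le> (LINT s|time T. (1/2) * (?e s * a s))"
  proof (rule integral_mono_AE)
    have "(\<lambda>s. (?e s - ?e T) / 2 * a s) = (\<lambda>s. (1/2) * (?e s * a s) - (?e T / 2) * a s)"
      by (auto simp: fun_eq_iff field_simps)
    then show "integrable (time T) (\<lambda>s. (?e s - ?e T) / 2 * a s)" using ie a by simp
    show "integrable (time T) (\<lambda>s. (1/2) * (?e s * a s))" using ie by simp
    show "AE s in time T. (?e s - ?e T) / 2 * a s \<le> (1/2) * (?e s * a s)"
      using AE_space
    proof eventually_elim
      case (elim s)
      then have "0 \<le> a s" by (auto intro: nn)
      then have "(?e s - ?e T) * a s \<le> ?e s * a s" by (intro mult_right_mono) auto
      then show ?case by simp
    qed
  qed
  finally show "(LINT t|time T. ?e t * (K * (LINT s|time t. a s))) \<le> (LINT s|time T. ?e s * a s) / 2" by simp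
qed

text \<open>The weight is at least \<open>exp (- (2 * K * T))\<close> on the interval, so removing
  it costs the reciprocal.\<close>

lemma prefix_integral_le_weighted:
  fixes a :: "real \<Rightarrow> real"
  assumes K: "0 < K" and a: "integrable (time T) a" and nn: "\<And>s. 0 < s \<Longrightarrow> s < T \<Longrightarrow> 0 \<le> a s" and t: "t \<le> T"
  shows "(LINT s|time t. a s) \<le> exp (2 * K * T) * (LINT s|time T. exp (- (2 * K * s)) * a s)"
proof -
  note ie = Volterra_weighted(2)[OF K a nn]
  have "(LINT s|time t. a s) \<le> (LINT s|time T. a s)" by (rule prefix_integral_le_total(2)[OF a t nn])
  also have "\<dots> \<le> (LINT s|time T. exp (2 * K * T) * (exp (- (2 * K * s)) * a s))"
  proof (rule integral_mono_AE[OF a])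
    show "AE s in time T. a s \<le> exp (2 * K * T) * (exp (- (2 * K * s)) * a s)"
      using AE_space
    proof eventually_elim
      case (elim s)
      then have "1 * a s \<le> exp (2 * K * T - 2 * K * s) * a s"
        using K nn by (intro mult_right_mono) auto
      then show ?case by (simp add: exp_diff exp_minus field_simps)
    qed
  qed (use ie in simp)
  finally show ?thesis by simp
qed

text \<open>The weighted integral m of a satisfies m \<le> m/2 + \<open>sqrt T\<close> times the
  norm of r, so m can be absorbed. Inserting the bound for m into the inequality gives a \<le> c +
  |r| almost everywhere, and \<open>sqrt T * c\<close>, the norm of the constant c, is the first
  part of the final constant times the norm of r.\<close>

lemma Gronwall:
  fixes a r :: "real \<Rightarrow> real"
  assumes T: "0 < T" and K: "0 < K" and a: "a \<in> car (L2_on (time T))" and r: "r \<in> car (L2_on (time T))"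
    and nn: "\<And>s. 0 < s \<Longrightarrow> s < T \<Longrightarrow> 0 \<le> a s"
    and le: "AE t in time T. a t \<le> K * (LINT s|time t. a s) + r t"
  shows "nrm (L2_on (time T)) a \<le> (2 * K * T * exp (2 * K * T) + 1) * nrm (L2_on (time T)) r"
proof -
  interpret L: prehilbert "L2_on (time T)" "\<lambda>u v. LINT x|time T. u x * v x" by (rule prehilbert_L2_on)
  note ai = L2_on_subset_L1(1)[OF finite_time a]
  note ri = L2_on_subset_L1(1)[OF finite_time r]
  let ?e = "\<lambda>t. exp (- (2 * K * t))"
  have em: "?e \<in> borel_measurable (time T)"
    by (intro borel_measurable_lebesgue_on borel_measurable_continuous_onI continuous_intros)
  have e1: "\<bar>?e t\<bar> \<le> 1" if "t \<in> space (time T)" for t using that K by auto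
  have pi: "integrable (time T) (\<lambda>t. LINT s|time t. a s)"
    by (rule Fubini_time(1)[OF ai, of "\<lambda>_. 0" 0]) auto
  have ie: "integrable (time T) (\<lambda>t. ?e t * g t)" if "integrable (time T) g" for g
    by (rule integrable_mult_bounded[OF that em e1])
  have iK: "integrable (time T) (\<lambda>t. ?e t * (K * (LINT s|time t. a s)))" using pi by (intro ie) simp
  define m where "m = (LINT s|time T. ?e s * a s)"
  have "m \<le> (LINT t|time T. ?e t * (K * (LINT s|time t. a s)) + ?e t * r t)"
    unfolding m_def
  proof (rule integral_mono_AE)
    show "AE t in time T. ?e t * a t \<le> ?e t * (K * (LINT s|time t. a s)) + ?e t * r t"
      using le
    proof eventually_elim
      case (elim t)
      then have "?e t * a t \<le> ?e t * (K * (LINT s|time t. a s) + r t)" by (intro mult_left_mono) auto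
      then show ?case by (simp add: distrib_left)
    qed
  qed (use ie ai ri iK in auto)
  also have "\<dots> \<le> m / 2 + (LINT t|time T. ?e t * r t)"
    using Volterra_weighted(1)[OF K ai nn] iK ie[OF ri] by (simp add: m_def)
  also have "(LINT t|time T. ?e t * r t) \<le> (LINT t|time T. \<bar>r t\<bar>)"
  proof (rule integral_mono_AE[OF ie[OF ri]])
    show "AE t in time T. ?e t * r t \<le> \<bar>r t\<bar>"
      using AE_space
    proof eventually_elim
      case (elim t)
      have "?e t * r t \<le> \<bar>?e t\<bar> * \<bar>r t\<bar>" by (metis abs_ge_self abs_mult)
      also have "\<dots> \<le> 1 * \<bar>r t\<bar>" by (intro mult_right_mono e1 elim) auto
      finally show ?case by simp
    qed
  qed (use ri in auto)
  also have "(LINT t|time T. \<bar>r t\<bar>) \<le> sqrt T * nrm (L2_on (time T)) r"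
    using L2_on_subset_L1(2)[OF finite_time r] T by (simp add: measure_time)
  finally have m: "m \<le> 2 * sqrt T * nrm (L2_on (time T)) r" by simp
  define c where "c = 2 * K * exp (2 * K * T) * sqrt T * nrm (L2_on (time T)) r"
  have rn: "0 \<le> nrm (L2_on (time T)) r" by (rule L.nrm_nonneg[OF r])
  have c0: "0 \<le> c" using K T rn by (simp add: c_def)
  have "AE t in time T. \<bar>a t\<bar> \<le> 1 * \<bar>((\<lambda>_. c) + (\<lambda>t. \<bar>r t\<bar>)) t\<bar>"
    using le AE_space
  proof eventually_elim
    case (elim t)
    then have t: "t \<le> T" by simp
    have "K * (LINT s|time t. a s) \<le> K * (exp (2 * K * T) * m)"
      using prefix_integral_le_weighted[OF K ai nn t] K by (intro mult_left_mono) (auto simp: m_def)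
    also have "\<dots> \<le> K * (exp (2 * K * T) * (2 * sqrt T * nrm (L2_on (time T)) r))"
      using m K by (intro mult_left_mono) auto
    also have "\<dots> = c" by (simp add: c_def)
    finally have "a t \<le> c + \<bar>r t\<bar>" using elim(1) by linarith
    then show ?case using nn[of t] elim(2) c0 by simp
  qed
  moreover have cc: "(\<lambda>_. c) \<in> car (L2_on (time T))"
    by (intro L2_onI finite_measure.integrable_const[OF finite_time]) auto
  moreover have ra: "(\<lambda>t. \<bar>r t\<bar>) \<in> car (L2_on (time T))" "nrm (L2_on (time T)) (\<lambda>t. \<bar>r t\<bar>) \<le> nrm (L2_on (time T)) r"
    using L2_on_bound[OF r, of "\<lambda>t. \<bar>r t\<bar>" 1] L2_onD(1)[OF r] by auto
  ultimately have "nrm (L2_on (time T)) a \<le> 1 * nrm (L2_on (time T)) ((\<lambda>_. c) + (\<lambda>t. \<bar>r t\<bar>))"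
    by (intro L2_on_bound(2)) (auto intro: L2_onD a)
  also have "\<dots> \<le> nrm (L2_on (time T)) (\<lambda>_. c) + nrm (L2_on (time T)) r"
    using L.nrm_triangle[OF cc ra(1)] ra(2) by simp
  also have "nrm (L2_on (time T)) (\<lambda>_. c) = sqrt T * c"
    using T c0 by (simp add: nrm_L2_on measure_time real_sqrt_mult)
  also have "sqrt T * c + nrm (L2_on (time T)) r = (2 * K * T * exp (2 * K * T) + 1) * nrm (L2_on (time T)) r"
    using T by (simp add: c_def algebra_simps flip: mult.assoc[of "sqrt T" "sqrt T"])
  finally show ?thesis .
qed

section \<open>Existence and stability for evolution equations in a Hilbert space\<close>

context hilbert begin

lemma nrm_integral_nonneg:
  assumes "u \<in> car (bochner_L2 T X)" "t \<le> T"
  shows "0 \<le> (LINT s|time t. nrm X (u s))"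
  by (rule prefix_integral_le_total(1)[OF bochner_L2D(3)[OF assms(1)] assms(2)])
    (use bochner_L2D(4)[OF assms(1)] in \<open>auto simp: nrm_nonneg\<close>)

text \<open>Picard iteration. The weighted integrals \<open>m n\<close> of the increments are halved
  at each step, and the Volterra bound turns a small integral into a small value at almost every t.
  The iterates therefore converge for almost every t, and the limit is built pointwise from the
  completeness of X.\<close>

theorem Volterra_fixed_point:
  assumes T: "0 < T" and K: "0 < K"
    and G: "\<And>v. v \<in> car (bochner_L2 T X) \<Longrightarrow> G v \<in> car (bochner_L2 T X)"
    and lip: "\<And>v w. v \<in> car (bochner_L2 T X) \<Longrightarrow> w \<in> car (bochner_L2 T X) \<Longrightarrow>
      AE t in time T. nrm X (G v t - G w t) \<le> K * (LINT s|time t. nrm X (v s - w s))"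
  shows "\<exists>v\<in>car (bochner_L2 T X). AE t in time T. nrm X (v t - G v t) = 0"
proof -
  interpret B: seminormed "bochner_L2 T X" by (rule seminormed_bochner_L2)
  define V where "V n = (G ^^ n) 0" for n
  have VS: "V (Suc n) = G (V n)" for n by (simp add: V_def)
  have V: "V n \<in> car (bochner_L2 T X)" for n
  proof (induction n)
    case 0
    show ?case unfolding V_def funpow.simps(1) id_apply by (rule B.zero_car)
  qed (simp add: VS G)
  note Vc = bochner_L2D(4)[OF V]
  define D where "D n t = nrm X (V (Suc n) t - V n t)" for n t
  have Di: "integrable (time T) (D n)" for n
    unfolding D_def[abs_def] by (rule bochner_L2D(3)[OF bochner_L2_diff[OF V V]])
  have Dn: "0 \<le> D n t" if "0 < t" "t < T" for n t
    unfolding D_def using Vc that by (intro nrm_nonneg) auto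
  let ?e = "\<lambda>t. exp (- (2 * K * t))"
  have Dle: "AE t in time T. D (Suc n) t \<le> K * (LINT s|time t. D n s)" for n
    using lip[OF V[of "Suc n"] V[of n]] by (simp add: D_def VS)
  define m where "m n = (LINT s|time T. ?e s * D n s)" for n
  have m_half: "m (Suc n) \<le> m n / 2" for n
  proof -
    have em: "?e \<in> borel_measurable (time T)"
      by (intro borel_measurable_lebesgue_on borel_measurable_continuous_onI continuous_intros)
    have pi: "integrable (time T) (\<lambda>t. LINT s|time t. D n s)"
      by (rule Fubini_time(1)[OF Di, of "\<lambda>_. 0" 0]) auto
    have "m (Suc n) \<le> (LINT t|time T. ?e t * (K * (LINT s|time t. D n s)))"
      unfolding m_def
    proof (rule integral_mono_AE)
      show "integrable (time T) (\<lambda>t. ?e t * D (Suc n) t)" by (rule Volterra_weighted(2)[OF K Di Dn])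
      show "integrable (time T) (\<lambda>t. ?e t * (K * (LINT s|time t. D n s)))"
        by (rule integrable_mult_bounded[OF _ em, where B=1]) (use pi K in auto)
      show "AE t in time T. ?e t * D (Suc n) t \<le> ?e t * (K * (LINT s|time t. D n s))"
        using Dle[of n] by eventually_elim (intro mult_left_mono, auto)
    qed
    also have "\<dots> \<le> m n / 2" unfolding m_def by (rule Volterra_weighted(1)[OF K Di Dn])
    finally show ?thesis .
  qed
  have m_le: "m n \<le> m 0 * (1/2) ^ n" for n
  proof (induction n)
    case (Suc n)
    have "m (Suc n) \<le> m n / 2" by (rule m_half)
    also have "\<dots> \<le> m 0 * (1/2) ^ n / 2" using Suc by (intro divide_right_mono) auto
    finally show ?case by simp
  qed simp
  have m0: "0 \<le> m 0"
    unfolding m_def using Dn by (intro Bochner_Integration.integral_nonneg) (auto intro!: mult_nonneg_nonneg)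
  define c where "c = K * exp (2 * K * T) * m 0"
  have c0: "0 \<le> c" using K m0 by (simp add: c_def)
  \<comment> \<open>One application of the Volterra bound passes from integrals to values; this is
    why the index on the left is one ahead.\<close>
  have Dc: "AE t in time T. D (Suc n) t \<le> c * (1/2) ^ n" for n
    using Dle[of n] AE_space
  proof eventually_elim
    case (elim t)
    then have t: "t \<le> T" by simp
    have "D (Suc n) t \<le> K * (exp (2 * K * T) * m n)"
      using elim(1) mult_left_mono[OF prefix_integral_le_weighted[OF K Di Dn t], of K n] K
      unfolding m_def by linarith
    also have "\<dots> \<le> K * (exp (2 * K * T) * (m 0 * (1/2) ^ n))"
      using m_le[of n] K by (intro mult_left_mono) auto
    finally show ?case by (simp add: c_def mult_ac)
  qed
  then have Dall: "AE t in time T. \<forall>n. D (Suc n) t \<le> c * (1/2) ^ n" by (simp add: AE_all_countable)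
  \<comment> \<open>The geometric sum keeps its negative remainder so that the induction on j
    closes; \<open>step2\<close> drops the remainder.\<close>
  have step: "nrm X (V (Suc n + j) t - V (Suc n) t) \<le> 2 * c * (1/2) ^ n - 2 * c * (1/2) ^ (n + j)"
    if "\<forall>n. D (Suc n) t \<le> c * (1/2) ^ n" "0 < t" "t < T" for n j t
  proof (induction j)
    case 0 then show ?case by simp
  next
    case (Suc j)
    have "nrm X (V (Suc n + Suc j) t - V (Suc n) t) \<le> D (Suc (n + j)) t + nrm X (V (Suc n + j) t - V (Suc n) t)"
      unfolding D_def using nrm_diff_trans[of "V (Suc n + Suc j) t" "V (Suc n + j) t" "V (Suc n) t"] Vc that by simp
    also have "\<dots> \<le> c * (1/2) ^ (n + j) + (2 * c * (1/2) ^ n - 2 * c * (1/2) ^ (n + j))"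
      using that(1)[rule_format, of "n + j"] Suc by linarith
    also have "\<dots> = 2 * c * (1/2) ^ n - 2 * c * (1/2) ^ (n + Suc j)" by simp
    finally show ?case .
  qed
  have step2: "nrm X (V (Suc n + j) t - V (Suc n) t) \<le> 2 * c * (1/2) ^ n"
    if "\<forall>n. D (Suc n) t \<le> c * (1/2) ^ n" "0 < t" "t < T" for n j t
    using step[OF that, of n j] mult_nonneg_nonneg[OF c0, of "(1/2) ^ (n + j)"] by simp
  define P where "P t l \<longleftrightarrow> l \<in> car X \<and> (\<lambda>n. nrm X (V n t - l)) \<longlonglongrightarrow> 0" for t l
  \<comment> \<open>The default 0 on the exceptional set keeps v t in the carrier for every t, as
    strong measurability demands.\<close>
  define v where "v t = (if \<exists>l. P t l then SOME l. P t l else 0)" for t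
  have vc: "v t \<in> car X" for t
  proof (cases "\<exists>l. P t l")
    case True
    then have "P t (v t)" unfolding v_def by (simp add: someI_ex)
    then show ?thesis by (simp add: P_def)
  qed (simp add: v_def)
  have Pv: "P t (v t)" if a: "\<forall>n. D (Suc n) t \<le> c * (1/2) ^ n" "0 < t" "t < T" for t
  proof -
    have "\<exists>l\<in>car X. (\<lambda>n. nrm X (V n t - l)) \<longlonglongrightarrow> 0"
    proof (rule complete)
      show "V n t \<in> car X" for n using Vc a by auto
      fix e :: real assume "0 < e"
      have "(\<lambda>n. 4 * c * (1/2) ^ n) \<longlonglongrightarrow> 0" by (intro tendsto_mult_right_zero LIMSEQ_realpow_zero) auto
      then have "\<forall>\<^sub>F n in sequentially. 4 * c * (1/2) ^ n < e" using \<open>0 < e\<close> by (rule order_tendstoD)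
      then obtain n where n: "4 * c * (1/2) ^ n < e" by (auto simp: eventually_sequentially)
      have "nrm X (V k t - V l t) < e" if "k \<ge> Suc n" "l \<ge> Suc n" for k l
      proof -
        have "nrm X (V k t - V l t) \<le> nrm X (V k t - V (Suc n) t) + nrm X (V (Suc n) t - V l t)"
          using Vc a by (intro nrm_diff_trans) auto
        also have "nrm X (V (Suc n) t - V l t) = nrm X (V l t - V (Suc n) t)"
          using Vc a by (intro nrm_diff_commute) auto
        finally show ?thesis
          using step2[OF a, of n "k - Suc n"] step2[OF a, of n "l - Suc n"] that n by (simp add: mult.assoc)
      qed
      then show "\<exists>N. \<forall>m\<ge>N. \<forall>n\<ge>N. nrm X (V m t - V n t) < e" by blast
    qed
    then have "\<exists>l. P t l" by (auto simp: P_def)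
    then show ?thesis unfolding v_def using someI_ex[of "P t"] by simp
  qed
  have v_lim: "AE t in time T. (\<lambda>n. nrm X (V n t - v t)) \<longlonglongrightarrow> 0"
    using Dall AE_space by eventually_elim (use Pv in \<open>auto simp: P_def\<close>)
  have v_est: "AE t in time T. nrm X (v t - V (Suc n) t) \<le> 2 * c * (1/2) ^ n" for n
    using Dall v_lim AE_space
  proof eventually_elim
    case (elim t)
    then have t: "0 < t" "t < T" by auto
    have "(\<lambda>j. nrm X (V (Suc n + j) t - v t) + 2 * c * (1/2) ^ n) \<longlonglongrightarrow> 0 + 2 * c * (1/2) ^ n"
      using LIMSEQ_ignore_initial_segment[OF elim(2), of "Suc n"]
      by (intro tendsto_add tendsto_const) (simp add: add.commute)
    moreover have "nrm X (v t - V (Suc n) t) \<le> nrm X (V (Suc n + j) t - v t) + 2 * c * (1/2) ^ n" for j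
      using nrm_diff_trans[of "v t" "V (Suc n + j) t" "V (Suc n) t"] vc Vc[OF t] step2[OF elim(1) t, of n j]
        nrm_diff_commute[of "v t" "V (Suc n + j) t"] by auto
    ultimately have "nrm X (v t - V (Suc n) t) \<le> 0 + 2 * c * (1/2) ^ n"
      by (intro LIMSEQ_le_const) auto
    then show ?case by simp
  qed
  have v_sm: "strongly_measurable (time T) X v"
    by (rule strongly_measurable_limit[OF complete_time finite_time bochner_L2D(1)[OF V] vc v_lim])
  have vB: "v \<in> car (bochner_L2 T X)"
  proof (rule bochner_L2_bound(1)[OF v_sm])
    interpret L: prehilbert "L2_on (time T)" "\<lambda>u v. LINT x|time T. u x * v x" by (rule prehilbert_L2_on)
    have "(\<lambda>_. 2 * c) \<in> car (L2_on (time T))"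
      by (intro L2_onI finite_measure.integrable_const[OF finite_time]) auto
    then show "(\<lambda>t. nrm X (V (Suc 0) t)) + (\<lambda>_. 2 * c) \<in> car (L2_on (time T))"
      using bochner_L2D(2)[OF V] by (intro L.add_car)
    show "AE t in time T. nrm X (v t) \<le> ((\<lambda>t. nrm X (V (Suc 0) t)) + (\<lambda>_. 2 * c)) t"
      using v_est[of 0] AE_space
    proof eventually_elim
      case (elim t)
      have "nrm X (v t) \<le> nrm X (v t - V (Suc 0) t) + nrm X (V (Suc 0) t)"
        using vc Vc elim(2) by (intro nrm_le_diff) auto
      then show ?case using elim(1) by simp
    qed
  qed
  \<comment> \<open>Both v and G v are compared with the iterate of index n+2: for v by
    \<open>v_est\<close>, for G v because that iterate is G applied to the iterate of index
    n+1.\<close>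
  have "AE t in time T. nrm X (v t - G v t) \<le> (c + K * T * 2 * c) * (1/2) ^ n" for n
  proof -
    have i: "(LINT s|time t. nrm X (v s - V (Suc n) s)) \<le> T * (2 * c * (1/2) ^ n)" if "t \<le> T" for t
    proof -
      note vi = bochner_L2D(3)[OF bochner_L2_diff[OF vB V]]
      have "(LINT s|time t. nrm X (v s - V (Suc n) s)) \<le> (LINT s|time T. nrm X (v s - V (Suc n) s))"
        using vc Vc by (intro prefix_integral_le_total(2)[OF vi that]) (auto intro!: nrm_nonneg)
      also have "\<dots> \<le> (LINT s|time T. 2 * c * (1/2) ^ n)"
        by (rule integral_mono_AE[OF vi finite_measure.integrable_const[OF finite_time] v_est])
      finally show ?thesis using T by (simp add: measure_time)
    qed
    show ?thesis
      using v_est[of "Suc n"] lip[OF vB V[of "Suc n"]] AE_space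
    proof eventually_elim
      case (elim t)
      then have t: "t \<le> T" by simp
      have cs: "v t \<in> car X" "V (Suc (Suc n)) t \<in> car X" "G v t \<in> car X"
        using vc Vc bochner_L2D(4)[OF G[OF vB]] elim(3) by auto
      have "nrm X (v t - G v t) \<le> nrm X (v t - V (Suc (Suc n)) t) + nrm X (G v t - V (Suc (Suc n)) t)"
        using nrm_diff_trans[OF cs] nrm_diff_commute[OF cs(2,3)] by simp
      also have "\<dots> \<le> 2 * c * (1/2) ^ Suc n + K * (T * (2 * c * (1/2) ^ n))"
        using elim(1) elim(2)[folded VS] mult_left_mono[OF i[OF t] less_imp_le[OF K]] by linarith
      finally show ?case by (simp add: algebra_simps)
    qed
  qed
  then have "AE t in time T. \<forall>n. nrm X (v t - G v t) \<le> (c + K * T * 2 * c) * (1/2) ^ n"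
    by (simp add: AE_all_countable)
  then have "AE t in time T. nrm X (v t - G v t) = 0"
    using AE_space
  proof eventually_elim
    case (elim t)
    have "(\<lambda>n. (c + K * T * 2 * c) * (1/2) ^ n) \<longlonglongrightarrow> 0"
      by (intro tendsto_mult_right_zero LIMSEQ_realpow_zero) auto
    then have "nrm X (v t - G v t) \<le> 0" using elim(1) by (intro LIMSEQ_le_const) auto
    moreover have "0 \<le> nrm X (v t - G v t)"
      using vc bochner_L2D(4)[OF G[OF vB]] elim(2) by (intro nrm_nonneg) auto
    ultimately show ?case by simp
  qed
  with vB show ?thesis by blast
qed

text \<open>The unknown is the derivative v instead of the state. Writing the state as
  \<open>primitive v\<close> builds in the initial condition and bounds differences of states at
  time t by integrals up to t, so the equation becomes a Volterra fixed point problem.\<close>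

theorem ODE_existence:
  assumes T: "0 < T" and C: "0 \<le> C"
    and F: "\<And>q. q \<in> car (bochner_L2 T X) \<Longrightarrow> F q \<in> car (bochner_L2 T X)"
    and lip: "\<And>p q. p \<in> car (bochner_L2 T X) \<Longrightarrow> q \<in> car (bochner_L2 T X) \<Longrightarrow>
      AE t in time T. nrm X (F p t - F q t) \<le> C * (nrm X (p t - q t) + (LINT s|time t. nrm X (p s - q s)))"
  shows "\<exists>v\<in>car (bochner_L2 T X). AE t in time T. nrm X (v t - F (primitive v) t) = 0"
proof (rule Volterra_fixed_point[OF T])
  \<comment> \<open>The state contributes 1 and its memory integral contributes T; the final summand
    1 keeps the constant positive when C = 0.\<close>
  show "0 < C * (1 + T) + 1" using T C by (intro add_nonneg_pos mult_nonneg_nonneg) auto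
  show "F (primitive v) \<in> car (bochner_L2 T X)" if "v \<in> car (bochner_L2 T X)" for v
    by (intro F primitive_bochner_L2[OF that T])
  fix v w assume vw: "v \<in> car (bochner_L2 T X)" "w \<in> car (bochner_L2 T X)"
  note J = primitive_bochner_L2[OF vw(1) T] primitive_bochner_L2[OF vw(2) T]
  show "AE t in time T. nrm X (F (primitive v) t - F (primitive w) t) \<le> (C * (1 + T) + 1) * (LINT s|time t. nrm X (v s - w s))"
    using lip[OF J] AE_space
  proof eventually_elim
    case (elim t)
    then have t: "0 < t" "t < T" by auto
    let ?a = "LINT s|time t. nrm X (v s - w s)"
    have 1: "nrm X (primitive v t - primitive w t) \<le> ?a" using t by (intro nrm_primitive_diff[OF vw]) auto
    have 2: "(LINT s|time t. nrm X (primitive v s - primitive w s)) \<le> T * ?a"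
    proof (rule iterated_prefix_integral_le[OF bochner_L2D(3)[OF bochner_L2_diff[OF vw]] bochner_L2D(3)[OF bochner_L2_diff[OF J]] t])
      show "AE s in time T. nrm X (primitive v s - primitive w s) \<le> (LINT r|time s. nrm X (v r - w r))"
        using nrm_primitive_diff[OF vw] by (intro AE_I2) auto
    qed (use bochner_L2D(4)[OF vw(1)] bochner_L2D(4)[OF vw(2)] in \<open>auto intro!: nrm_nonneg\<close>)
    have a: "0 \<le> ?a" using nrm_integral_nonneg[OF bochner_L2_diff[OF vw]] t by auto
    have "nrm X (F (primitive v) t - F (primitive w) t) \<le> C * (?a + T * ?a)"
      using elim(1) mult_left_mono[OF add_mono[OF 1 2] C] by linarith
    then show ?case using a by (simp add: algebra_simps)
  qed
qed

text \<open>As u is the primitive of v, the hypothesis is a Volterra inequality for the norm of v,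
  and \<open>Gronwall\<close> applies. The factor T for u consists of \<open>sqrt T\<close> from the
  norm of a constant function and \<open>sqrt T\<close> from estimating an L1 norm by an L2
  norm.\<close>

theorem ODE_stability:
  assumes T: "0 < T" and C: "0 \<le> C" and u: "u \<in> car (bochner_L2 T X)" and uv: "weak_time_derivative T X u v"
    and init: "has_initial_value T X u 0" and r: "r \<in> car (L2_on (time T))"
    and le: "AE t in time T. nrm X (v t) \<le> C * (nrm X (u t) + (LINT s|time t. nrm X (u s))) + r t"
  defines "K \<equiv> C * (1 + T) + 1"
  shows "nrm (bochner_L2 T X) v \<le> (2 * K * T * exp (2 * K * T) + 1) * nrm (L2_on (time T)) r"
    and "nrm (bochner_L2 T X) u \<le> T * nrm (bochner_L2 T X) v"
proof -
  have v: "v \<in> car (bochner_L2 T X)" using uv by (simp add: weak_time_derivative_def)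
  note vc = bochner_L2D(4)[OF v] and vi = bochner_L2D(3)[OF v] and uc = bochner_L2D(4)[OF u]
  have vn: "0 < s \<Longrightarrow> s < T \<Longrightarrow> 0 \<le> nrm X (v s)" for s by (intro nrm_nonneg vc)
  have uJ: "AE t in time T. nrm X (u t) \<le> (LINT s|time t. nrm X (v s))"
    using eq_primitive_if_initial_value[OF T u uv init] AE_space
  proof eventually_elim
    case (elim t)
    then have t: "t \<le> T" by auto
    have "nrm X (u t) = nrm X (primitive v t)"
      using elim uc primitive_weak(1)[OF v t] by (intro nrm_eq_if_diff_zero) auto
    then show ?case using nrm_primitive_le[OF v t] by simp
  qed
  have "AE t in time T. nrm X (v t) \<le> K * (LINT s|time t. nrm X (v s)) + r t"
    using le uJ AE_space
  proof eventually_elim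
    case (elim t)
    then have t: "0 < t" "t < T" by auto
    let ?a = "LINT s|time t. nrm X (v s)"
    have 2: "(LINT s|time t. nrm X (u s)) \<le> T * ?a"
      by (rule iterated_prefix_integral_le[OF vi bochner_L2D(3)[OF u] t vn uJ])
    have a: "0 \<le> ?a" using nrm_integral_nonneg[OF v] t by auto
    have "nrm X (v t) \<le> C * (?a + T * ?a) + r t"
      using elim(1) mult_left_mono[OF add_mono[OF elim(2) 2] C] by linarith
    then show ?case using a by (simp add: K_def algebra_simps)
  qed
  moreover have "0 < K" unfolding K_def using T C by (intro add_nonneg_pos mult_nonneg_nonneg) auto
  ultimately show "nrm (bochner_L2 T X) v \<le> (2 * K * T * exp (2 * K * T) + 1) * nrm (L2_on (time T)) r"
    unfolding nrm_bochner_L2 by (intro Gronwall[OF T _ bochner_L2D(2)[OF v] r vn]) auto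
  let ?c = "LINT s|time T. nrm X (v s)"
  have cc: "(\<lambda>_. ?c) \<in> car (L2_on (time T))"
    by (intro L2_onI finite_measure.integrable_const[OF finite_time]) auto
  have "AE t in time T. nrm X (u t) \<le> ?c"
    using uJ AE_space
  proof eventually_elim
    case (elim t)
    then have "t \<le> T" by auto
    then show ?case using elim(1) prefix_integral_le_total(2)[OF vi _ vn] by force
  qed
  from bochner_L2_bound(2)[OF bochner_L2D(1)[OF u] cc this]
  have "nrm (bochner_L2 T X) u \<le> nrm (L2_on (time T)) (\<lambda>_. ?c)" .
  also have "\<dots> = sqrt T * ?c"
    using T nrm_integral_nonneg[OF v order_refl] by (simp add: nrm_L2_on measure_time real_sqrt_mult)
  also have "?c = (LINT s|time T. \<bar>nrm X (v s)\<bar>)"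
    using vn by (intro Bochner_Integration.integral_cong) auto
  also have "sqrt T * (LINT s|time T. \<bar>nrm X (v s)\<bar>) \<le> sqrt T * (sqrt T * nrm (bochner_L2 T X) v)"
    using L2_on_subset_L1(2)[OF finite_time bochner_L2D(2)[OF v]] T
    by (intro mult_left_mono) (auto simp: nrm_bochner_L2 measure_time)
  also have "\<dots> = T * nrm (bochner_L2 T X) v" using T by (simp flip: mult.assoc)
  finally show "nrm (bochner_L2 T X) u \<le> T * nrm (bochner_L2 T X) v" .
qed

end

section \<open>Sobolev space and its dual\<close>

lemma nrm_L2_on_cong_AE:
  assumes "u \<in> borel_measurable M" "v \<in> borel_measurable M" "AE x in M. u x = v x"
  shows "nrm (L2_on M) u = nrm (L2_on M) v"
  unfolding nrm_L2_on using assms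
  by (intro arg_cong[where f=sqrt] integral_cong_AE) auto

lemma seminormed_L2_on: "seminormed (L2_on M)"
proof -
  interpret prehilbert "L2_on M" "\<lambda>u v. LINT x|M. u x * v x" by (rule prehilbert_L2_on)
  show ?thesis by (rule seminormed_axioms)
qed

locale bounded_open =
  fixes \<Omega> :: "(real^'n) set"
  assumes open_domain: "open \<Omega>" and bounded_domain: "bounded \<Omega>"
begin

lemma domain_lebesgue: "\<Omega> \<in> sets lebesgue"
  using open_domain by (simp add: borel_open)

lemma finite_domain: "finite_measure (lebesgue_on \<Omega>)"
  using lmeasurable_open[OF bounded_domain open_domain] domain_lebesgue
  by (intro finite_measureI) (simp add: emeasure_restrict_space fmeasurable_def)

sublocale L: hilbert "L2_on (lebesgue_on \<Omega>)" "\<lambda>u v. LINT x|lebesgue_on \<Omega>. u x * v x"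
  by (rule hilbert_L2_on[OF finite_domain])

abbreviation M where "M \<equiv> lebesgue_on \<Omega>"
abbreviation D where "D i u \<equiv> (\<lambda>x. grad \<Omega> u x $ i)"

lemma test_function_L2: "test_function \<Omega> \<phi> \<Longrightarrow> \<phi> \<in> car (L2_on M)"
proof -
  assume \<phi>: "test_function \<Omega> \<phi>"
  then obtain B where B: "0 \<le> B" "\<And>x. \<bar>\<phi> x\<bar> \<le> B" using test_function_bounded by blast
  have "(\<lambda>_. B) \<in> car (L2_on M)"
    by (intro L2_onI finite_measure.integrable_const[OF finite_domain]) auto
  from L2_on_bound(1)[OF this test_function_measurable[OF \<phi>], of 1] B show ?thesis by simp
qed

text \<open>The fundamental lemma for each component. As \<open>grad\<close> is a choice, every
  identity between gradients below is an almost-everywhere identity that comes from here.\<close>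

lemma weak_gradient_unique:
  assumes "weak_gradient \<Omega> u g" "weak_gradient \<Omega> u h"
  shows "AE x in M. g x $ i = h x $ i"
proof -
  let ?g = "\<lambda>x. g x $ i" and ?h = "\<lambda>x. h x $ i"
  have gh: "?g \<in> car (L2_on M)" "?h \<in> car (L2_on M)"
    using assms by (auto simp: weak_gradient_def L2_eq_L2_on)
  have "AE x in M. (?g - ?h) x = 0"
  proof (rule AE_zero_if_orthogonal_to_box_bumps[OF open_domain])
    show "integrable M (?g - ?h)"
      using gh by (intro L2_on_subset_L1(1)[OF finite_domain]) auto
    fix a b k assume "cbox a b \<subseteq> \<Omega>"
    then have t: "test_function \<Omega> (box_bump a b k)" by (rule test_function_box_bump)
    have "(LINT x|M. ?g x * box_bump a b k x) = (LINT x|M. ?h x * box_bump a b k x)"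
      using assms t by (simp add: weak_gradient_def)
    then show "(LINT x|M. (?g - ?h) x * box_bump a b k x) = 0"
      by (simp only: L.ip_diff_left[OF gh test_function_L2[OF t]])
  qed
  then show ?thesis by simp
qed

lemma weak_gradient_lincomb:
  assumes u: "u \<in> car (L2_on M)" "weak_gradient \<Omega> u g" and v: "v \<in> car (L2_on M)" "weak_gradient \<Omega> v h"
  shows "weak_gradient \<Omega> (a *\<^sub>R u + b *\<^sub>R v) (a *\<^sub>R g + b *\<^sub>R h)"
  unfolding weak_gradient_def
proof (intro allI conjI impI)
  fix i
  let ?g = "\<lambda>x. g x $ i" and ?h = "\<lambda>x. h x $ i"
  have gh: "?g \<in> car (L2_on M)" "?h \<in> car (L2_on M)"
    using assms by (auto simp: weak_gradient_def L2_eq_L2_on)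
  have e: "(\<lambda>x. (a *\<^sub>R g + b *\<^sub>R h) x $ i) = a *\<^sub>R ?g + b *\<^sub>R ?h" by (auto simp: fun_eq_iff)
  show "(\<lambda>x. (a *\<^sub>R g + b *\<^sub>R h) x $ i) \<in> car (L2 \<Omega>)"
    unfolding e L2_eq_L2_on using gh by blast
  fix \<phi> assume \<phi>: "test_function \<Omega> \<phi>"
  let ?d = "\<lambda>x. frechet_derivative \<phi> (at x) (axis i 1)"
  have d: "?d \<in> car (L2_on M)" by (intro test_function_L2 test_function_frechet_derivative \<phi>)
  have "(LINT x|M. (a *\<^sub>R u + b *\<^sub>R v) x * ?d x) = a * (LINT x|M. u x * ?d x) + b * (LINT x|M. v x * ?d x)"
    using L.ip_add_left[of "a *\<^sub>R u" "b *\<^sub>R v" ?d] L.ip_scale_left[of u ?d a] L.ip_scale_left[of v ?d b] u v d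
    by auto
  also have "\<dots> = - (a * (LINT x|M. ?g x * \<phi> x) + b * (LINT x|M. ?h x * \<phi> x))"
    using u v \<phi> by (simp add: weak_gradient_def)
  also have "a * (LINT x|M. ?g x * \<phi> x) + b * (LINT x|M. ?h x * \<phi> x) = (LINT x|M. (a *\<^sub>R ?g + b *\<^sub>R ?h) x * \<phi> x)"
    using L.ip_add_left[of "a *\<^sub>R ?g" "b *\<^sub>R ?h" \<phi>] L.ip_scale_left[of ?g \<phi> a] L.ip_scale_left[of ?h \<phi> b] gh test_function_L2[OF \<phi>]
    by auto
  finally show "(LINT x|M. (a *\<^sub>R u + b *\<^sub>R v) x * ?d x) = - (LINT x|M. (a *\<^sub>R g + b *\<^sub>R h) x $ i * \<phi> x)"
    unfolding e[symmetric] .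
qed

lemma H1D:
  assumes "u \<in> car (H1 \<Omega>)"
  shows "u \<in> car (L2_on M)" "weak_gradient \<Omega> u (grad \<Omega> u)" "D i u \<in> car (L2_on M)"
proof -
  show "u \<in> car (L2_on M)" using assms by (simp add: H1_def L2_eq_L2_on)
  have "\<exists>g. weak_gradient \<Omega> u g" using assms by (simp add: H1_def)
  then show w: "weak_gradient \<Omega> u (grad \<Omega> u)" unfolding grad_def by (rule someI_ex)
  show "D i u \<in> car (L2_on M)" using w by (simp add: weak_gradient_def L2_eq_L2_on)
qed

lemma H1I: "u \<in> car (L2_on M) \<Longrightarrow> weak_gradient \<Omega> u g \<Longrightarrow> u \<in> car (H1 \<Omega>)"
  by (auto simp: H1_def L2_eq_L2_on)

lemma grad_AE_eq: "u \<in> car (H1 \<Omega>) \<Longrightarrow> weak_gradient \<Omega> u g \<Longrightarrow> AE x in M. D i u x = g x $ i"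
  by (rule weak_gradient_unique[OF H1D(2)])

lemma H1_lincomb:
  assumes "u \<in> car (H1 \<Omega>)" "v \<in> car (H1 \<Omega>)"
  shows "a *\<^sub>R u + b *\<^sub>R v \<in> car (H1 \<Omega>)"
    "AE x in M. D i (a *\<^sub>R u + b *\<^sub>R v) x = (a *\<^sub>R D i u + b *\<^sub>R D i v) x"
proof -
  note w = weak_gradient_lincomb[OF H1D(1,2)[OF assms(1)] H1D(1,2)[OF assms(2)], of a b]
  show c: "a *\<^sub>R u + b *\<^sub>R v \<in> car (H1 \<Omega>)"
    using H1D(1)[OF assms(1)] H1D(1)[OF assms(2)] by (intro H1I[OF _ w]) blast
  show "AE x in M. D i (a *\<^sub>R u + b *\<^sub>R v) x = (a *\<^sub>R D i u + b *\<^sub>R D i v) x"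
    using grad_AE_eq[OF c w, of i] by simp
qed

section \<open>Energy inner products on the Sobolev space\<close>

lemma ip_D_lincomb:
  assumes u: "u \<in> car (H1 \<Omega>)" and v: "v \<in> car (H1 \<Omega>)" and w: "w \<in> car (L2_on M)"
  shows "(LINT x|M. D i (a *\<^sub>R u + b *\<^sub>R v) x * w x) = a * (LINT x|M. D i u x * w x) + b * (LINT x|M. D i v x * w x)"
proof -
  note d = H1D(3)[OF u, of i] H1D(3)[OF v, of i]
  have "(LINT x|M. D i (a *\<^sub>R u + b *\<^sub>R v) x * w x) = (LINT x|M. (a *\<^sub>R D i u + b *\<^sub>R D i v) x * w x)"
  proof (rule integral_cong_AE)
    have c: "a *\<^sub>R D i u + b *\<^sub>R D i v \<in> car (L2_on M)" using d by blast
    show "(\<lambda>x. (a *\<^sub>R D i u + b *\<^sub>R D i v) x * w x) \<in> borel_measurable M"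
      using L2_onD(1)[OF c] L2_onD(1)[OF w] by (rule borel_measurable_times)
    show "(\<lambda>x. D i (a *\<^sub>R u + b *\<^sub>R v) x * w x) \<in> borel_measurable M"
      using L2_onD(1)[OF H1D(3)[OF H1_lincomb(1)[OF u v, of a b], of i]] L2_onD(1)[OF w] by (rule borel_measurable_times)
  qed (use H1_lincomb(2)[OF u v, where i=i and a=a and b=b] in \<open>auto elim: eventually_mono\<close>)
  also have "\<dots> = a * (LINT x|M. D i u x * w x) + b * (LINT x|M. D i v x * w x)"
    using L.ip_add_left[of "a *\<^sub>R D i u" "b *\<^sub>R D i v" w] L.ip_scale_left[of "D i u" w a] L.ip_scale_left[of "D i v" w b] d w
    by auto
  finally show ?thesis .
qed

text \<open>The bilinear form of -a\<Delta> + b. With a = b = 1 it is the inner product of H1, with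
  a = \<alpha> and b = \<beta> that of the elliptic equation, so that one completeness proof serves
  both.\<close>

definition energy :: "real \<Rightarrow> real \<Rightarrow> (real^'n \<Rightarrow> real) \<Rightarrow> (real^'n \<Rightarrow> real) \<Rightarrow> real"
  where "energy a b u v = b * (LINT x|M. u x * v x) + a * (\<Sum>i\<in>UNIV. LINT x|M. D i u x * D i v x)"

definition energy_space :: "real \<Rightarrow> real \<Rightarrow> (real^'n \<Rightarrow> real) nspace"
  where "energy_space a b = \<lparr>car = car (H1 \<Omega>), nrm = (\<lambda>u. sqrt (energy a b u u))\<rparr>"

lemma car_energy_space [simp]: "car (energy_space a b) = car (H1 \<Omega>)"
  by (simp add: energy_space_def)

lemma energy_self:
  "energy a b u u = b * (nrm (L2_on M) u)\<^sup>2 + a * (\<Sum>i\<in>UNIV. (nrm (L2_on M) (D i u))\<^sup>2)"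
  unfolding energy_def nrm_L2_on_square by (simp add: power2_eq_square)

lemma H1_eq_energy_space: "H1 \<Omega> = energy_space 1 1"
  unfolding energy_space_def energy_self H1_def L2_eq_L2_on by simp

lemma energy_lincomb:
  assumes "u \<in> car (H1 \<Omega>)" "v \<in> car (H1 \<Omega>)" "w \<in> car (H1 \<Omega>)"
  shows "energy a b (r *\<^sub>R u + s *\<^sub>R v) w = r * energy a b u w + s * energy a b v w"
proof -
  note c = H1D(1)[OF assms(1)] H1D(1)[OF assms(2)] H1D(1)[OF assms(3)]
  have "(LINT x|M. (r *\<^sub>R u + s *\<^sub>R v) x * w x) = r * (LINT x|M. u x * w x) + s * (LINT x|M. v x * w x)"
    using L.ip_add_left[of "r *\<^sub>R u" "s *\<^sub>R v" w] L.ip_scale_left[of u w r] L.ip_scale_left[of v w s] c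
    by auto
  then show ?thesis
    unfolding energy_def ip_D_lincomb[OF assms(1,2) H1D(3)[OF assms(3)]]
    by (simp add: sum.distrib sum_distrib_left algebra_simps)
qed

lemma prehilbert_energy_space:
  assumes "0 \<le> a" "0 \<le> b"
  shows "prehilbert (energy_space a b) (energy a b)"
proof
  show "subspace (car (energy_space a b))"
  proof (rule subspaceI)
    have "weak_gradient \<Omega> 0 0" using L.ip_zero(1)[OF test_function_L2] L.zero_car by (simp add: weak_gradient_def L2_eq_L2_on zero_fun_def)
    from H1I[OF _ this] show "0 \<in> car (energy_space a b)" by simp
  next
    fix u v assume "u \<in> car (energy_space a b)" "v \<in> car (energy_space a b)"
    then show "u + v \<in> car (energy_space a b)" using H1_lincomb(1)[of u v 1 1] by simp
  next
    fix c u assume "u \<in> car (energy_space a b)"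
    then show "c *\<^sub>R u \<in> car (energy_space a b)" using H1_lincomb(1)[of u u c 0] by simp
  qed
  fix u v w c assume u: "u \<in> car (energy_space a b)"
  show "0 \<le> energy a b u u"
    unfolding energy_self using assms by (intro add_nonneg_nonneg mult_nonneg_nonneg sum_nonneg) auto
  show "nrm (energy_space a b) u = sqrt (energy a b u u)" by (simp add: energy_space_def)
  assume v: "v \<in> car (energy_space a b)"
  show "energy a b u v = energy a b v u" by (simp add: energy_def mult.commute)
  show "energy a b (c *\<^sub>R u) v = c * energy a b u v"
    using energy_lincomb[of u u v a b c 0] u v by simp
  assume w: "w \<in> car (energy_space a b)"
  show "energy a b (u + v) w = energy a b u w + energy a b v w"
    using energy_lincomb[of u v w a b 1 1] u v w by simp
qed

lemma nrm_energy_space: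
  assumes "0 \<le> a" "0 \<le> b"
  shows "b * (nrm (L2_on M) u)\<^sup>2 + a * (\<Sum>i\<in>UNIV. (nrm (L2_on M) (D i u))\<^sup>2) = (nrm (energy_space a b) u)\<^sup>2"
proof -
  have "0 \<le> energy a b u u"
    unfolding energy_self using assms by (intro add_nonneg_nonneg mult_nonneg_nonneg sum_nonneg) auto
  then show ?thesis by (simp add: energy_space_def flip: energy_self)
qed

text \<open>The weak gradient is a closed operator: both sides of the integration-by-parts identity
  are continuous in L2 for a fixed test function.\<close>

lemma weak_gradient_limit:
  assumes s: "\<And>n. s n \<in> car (H1 \<Omega>)" and u: "u \<in> car (L2_on M)" "(\<lambda>n. nrm (L2_on M) (s n - u)) \<longlonglongrightarrow> 0"
    and g: "\<And>i. g i \<in> car (L2_on M)" "\<And>i. (\<lambda>n. nrm (L2_on M) (D i (s n) - g i)) \<longlonglongrightarrow> 0"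
  shows "weak_gradient \<Omega> u (\<lambda>x. \<chi> i. g i x)"
proof -
  have lim: "(\<lambda>n. LINT x|M. w n x * \<phi> x) \<longlonglongrightarrow> (LINT x|M. v x * \<phi> x)"
    if "\<And>n. w n \<in> car (L2_on M)" "v \<in> car (L2_on M)" "(\<lambda>n. nrm (L2_on M) (w n - v)) \<longlonglongrightarrow> 0" "\<phi> \<in> car (L2_on M)" for w v \<phi>
  proof (rule Lim_null[THEN iffD2])
    have "(\<lambda>n. nrm (L2_on M) (w n - v) * nrm (L2_on M) \<phi>) \<longlonglongrightarrow> 0 * nrm (L2_on M) \<phi>"
      by (intro tendsto_mult that tendsto_const)
    then show "(\<lambda>n. (LINT x|M. w n x * \<phi> x) - (LINT x|M. v x * \<phi> x)) \<longlonglongrightarrow> 0"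
    proof (rule Lim_null_comparison[rotated, OF tendsto_eq_rhs])
      have "norm ((LINT x|M. w n x * \<phi> x) - (LINT x|M. v x * \<phi> x)) \<le> nrm (L2_on M) (w n - v) * nrm (L2_on M) \<phi>" for n
        using L.Cauchy_Schwarz[OF L.diff_car[OF that(1)[of n] that(2)] that(4)]
        by (simp only: L.ip_diff_left[OF that(1,2,4)] real_norm_def)
      then show "\<forall>\<^sub>F n in sequentially. norm ((LINT x|M. w n x * \<phi> x) - (LINT x|M. v x * \<phi> x)) \<le> nrm (L2_on M) (w n - v) * nrm (L2_on M) \<phi>"
        by simp
    qed simp
  qed
  show ?thesis unfolding weak_gradient_def
  proof (intro allI conjI impI)
    fix i show "(\<lambda>x. (\<chi> i. g i x) $ i) \<in> car (L2 \<Omega>)" using g by (simp add: L2_eq_L2_on)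
    fix \<phi> assume \<phi>: "test_function \<Omega> \<phi>"
    let ?d = "\<lambda>x. frechet_derivative \<phi> (at x) (axis i 1)"
    have d: "?d \<in> car (L2_on M)" by (intro test_function_L2 test_function_frechet_derivative \<phi>)
    have "(\<lambda>n. LINT x|M. s n x * ?d x) \<longlonglongrightarrow> (LINT x|M. u x * ?d x)"
      by (intro lim H1D(1)[OF s] u d)
    moreover have "(LINT x|M. s n x * ?d x) = - (LINT x|M. D i (s n) x * \<phi> x)" for n
      using H1D(2)[OF s] \<phi> by (simp add: weak_gradient_def)
    moreover have "(\<lambda>n. - (LINT x|M. D i (s n) x * \<phi> x)) \<longlonglongrightarrow> - (LINT x|M. g i x * \<phi> x)"
      by (intro tendsto_minus lim H1D(3)[OF s] g test_function_L2 \<phi>)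
    ultimately show "(LINT x|M. u x * ?d x) = - (LINT x|M. (\<chi> i. g i x) $ i * \<phi> x)"
      using LIMSEQ_unique by fastforce
  qed
qed

lemma nrm_L2_le_energy:
  assumes "0 < a" "0 < b" "u \<in> car (H1 \<Omega>)"
  shows "sqrt b * nrm (L2_on M) u \<le> nrm (energy_space a b) u"
    "sqrt a * nrm (L2_on M) (D i u) \<le> nrm (energy_space a b) u"
proof -
  interpret E: prehilbert "energy_space a b" "energy a b" using assms by (intro prehilbert_energy_space) auto
  note e = nrm_energy_space[of a b u]
  have s: "(nrm (L2_on M) (D i u))\<^sup>2 \<le> (\<Sum>i\<in>UNIV. (nrm (L2_on M) (D i u))\<^sup>2)"
    by (rule member_le_sum) auto
  have "0 \<le> (\<Sum>i\<in>UNIV. (nrm (L2_on M) (D i u))\<^sup>2)" by (intro sum_nonneg) auto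
  then have "0 \<le> a * (\<Sum>i\<in>UNIV. (nrm (L2_on M) (D i u))\<^sup>2)" using assms by simp
  then have "b * (nrm (L2_on M) u)\<^sup>2 \<le> (nrm (energy_space a b) u)\<^sup>2" using e assms by linarith
  then show "sqrt b * nrm (L2_on M) u \<le> nrm (energy_space a b) u"
    using assms E.nrm_nonneg by - (rule power2_le_imp_le, auto simp: power_mult_distrib)
  have "0 \<le> b * (nrm (L2_on M) u)\<^sup>2" using assms by simp
  then have "a * (nrm (L2_on M) (D i u))\<^sup>2 \<le> (nrm (energy_space a b) u)\<^sup>2"
    using e mult_left_mono[OF s, of a] assms by linarith
  then show "sqrt a * nrm (L2_on M) (D i u) \<le> nrm (energy_space a b) u"
    using assms E.nrm_nonneg by - (rule power2_le_imp_le, auto simp: power_mult_distrib)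
qed

lemma nrm_D_diff:
  assumes "u \<in> car (H1 \<Omega>)" "v \<in> car (H1 \<Omega>)"
  shows "nrm (L2_on M) (D i (u - v)) = nrm (L2_on M) (D i u - D i v)"
proof -
  have c: "D i u - D i v \<in> car (L2_on M)" using assms H1D(3) by blast
  have "AE x in M. D i (u - v) x = (D i u - D i v) x"
    using H1_lincomb(2)[OF assms, where i=i and a=1 and b="-1"] by simp
  moreover have "u - v \<in> car (H1 \<Omega>)" using H1_lincomb(1)[OF assms, of 1 "-1"] by simp
  ultimately show ?thesis using L2_onD(1)[OF H1D(3)] L2_onD(1)[OF c] by (intro nrm_L2_on_cong_AE)
qed

text \<open>A Cauchy sequence has L2 limits of its values and of each partial derivative separately,
  and closedness of the weak gradient links these limits.\<close>

lemma hilbert_energy_space: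
  assumes ab: "0 < a" "0 < b"
  shows "hilbert (energy_space a b) (energy a b)"
proof -
  interpret E: prehilbert "energy_space a b" "energy a b" using ab by (intro prehilbert_energy_space) auto
  show ?thesis
  proof
    fix s assume s': "\<And>n::nat. s n \<in> car (energy_space a b)"
      and C: "\<And>e. e > 0 \<Longrightarrow> \<exists>N. \<forall>m\<ge>N. \<forall>n\<ge>N. nrm (energy_space a b) (s m - s n) < e"
    then have s: "s n \<in> car (H1 \<Omega>)" for n by simp
    have d: "s m - s n \<in> car (H1 \<Omega>)" for m n using H1_lincomb(1)[OF s s, of 1 m "-1" n] by simp
    have "\<exists>l\<in>car (L2_on M). (\<lambda>n. nrm (L2_on M) (s n - l)) \<longlonglongrightarrow> 0"
    proof (rule L.complete)
      fix e :: real assume e: "0 < e"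
      then obtain N where N: "\<forall>m\<ge>N. \<forall>n\<ge>N. nrm (energy_space a b) (s m - s n) < sqrt b * e" using C[of "sqrt b * e"] ab by auto
      have "nrm (L2_on M) (s m - s n) < e" if "m \<ge> N" "n \<ge> N" for m n
      proof -
        have "sqrt b * nrm (L2_on M) (s m - s n) < sqrt b * e"
          using nrm_L2_le_energy(1)[OF ab d[of m n]] N[rule_format, OF that] by linarith
        then show ?thesis using ab by simp
      qed
      then show "\<exists>N. \<forall>m\<ge>N. \<forall>n\<ge>N. nrm (L2_on M) (s m - s n) < e" by blast
    qed (rule H1D(1)[OF s])
    then obtain u where u: "u \<in> car (L2_on M)" "(\<lambda>n. nrm (L2_on M) (s n - u)) \<longlonglongrightarrow> 0" by blast
    have "\<exists>l\<in>car (L2_on M). (\<lambda>n. nrm (L2_on M) (D i (s n) - l)) \<longlonglongrightarrow> 0" for i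
    proof (rule L.complete)
      fix e :: real assume e: "0 < e"
      then obtain N where N: "\<forall>m\<ge>N. \<forall>n\<ge>N. nrm (energy_space a b) (s m - s n) < sqrt a * e" using C[of "sqrt a * e"] ab by auto
      have "nrm (L2_on M) (D i (s m) - D i (s n)) < e" if "m \<ge> N" "n \<ge> N" for m n
      proof -
        have "sqrt a * nrm (L2_on M) (D i (s m) - D i (s n)) < sqrt a * e"
          unfolding nrm_D_diff[OF s s, symmetric]
          using nrm_L2_le_energy(2)[OF ab d[of m n], of i] N[rule_format, OF that] by linarith
        then show ?thesis using ab by simp
      qed
      then show "\<exists>N. \<forall>m\<ge>N. \<forall>n\<ge>N. nrm (L2_on M) (D i (s m) - D i (s n)) < e" by blast
    qed (rule H1D(3)[OF s])
    then obtain g where g: "\<And>i. g i \<in> car (L2_on M)" "\<And>i. (\<lambda>n. nrm (L2_on M) (D i (s n) - g i)) \<longlonglongrightarrow> 0" by metis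
    note w = weak_gradient_limit[OF s u g]
    have uH: "u \<in> car (H1 \<Omega>)" by (rule H1I[OF u(1) w])
    have "nrm (L2_on M) (D i (s n - u)) = nrm (L2_on M) (D i (s n) - g i)" for i n
      unfolding nrm_D_diff[OF s uH]
    proof (rule nrm_L2_on_cong_AE)
      have c: "D i (s n) - D i u \<in> car (L2_on M)" "D i (s n) - g i \<in> car (L2_on M)"
        using H1D(3)[OF s] H1D(3)[OF uH] g(1) by blast+
      show "D i (s n) - D i u \<in> borel_measurable M" "D i (s n) - g i \<in> borel_measurable M"
        using c by (auto dest: L2_onD(1))
    qed (use grad_AE_eq[OF uH w, of i] in \<open>auto elim: eventually_mono\<close>)
    then have e: "(nrm (energy_space a b) (s n - u))\<^sup>2
        = b * (nrm (L2_on M) (s n - u))\<^sup>2 + a * (\<Sum>i\<in>UNIV. (nrm (L2_on M) (D i (s n) - g i))\<^sup>2)" for n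
      using ab by (subst nrm_energy_space[symmetric]) auto
    have "(\<lambda>n. (nrm (energy_space a b) (s n - u))\<^sup>2) \<longlonglongrightarrow> b * 0\<^sup>2 + a * (\<Sum>i\<in>(UNIV::'n set). 0\<^sup>2)"
      unfolding e by (intro tendsto_add tendsto_mult tendsto_const tendsto_sum tendsto_power u g)
    from tendsto_real_sqrt[OF this] have "(\<lambda>n. \<bar>nrm (energy_space a b) (s n - u)\<bar>) \<longlonglongrightarrow> 0"
      by (simp only: real_sqrt_abs) simp
    then have "(\<lambda>n. nrm (energy_space a b) (s n - u)) \<longlonglongrightarrow> 0" by (rule tendsto_rabs_zero_cancel)
    then show "\<exists>l\<in>car (energy_space a b). (\<lambda>n. nrm (energy_space a b) (s n - l)) \<longlonglongrightarrow> 0"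
      using uH by auto
  qed
qed

lemma hilbert_H1: "hilbert (H1 \<Omega>) (energy 1 1)"
  unfolding H1_eq_energy_space by (rule hilbert_energy_space) auto

end

section \<open>Dual spaces\<close>

context seminormed begin

lemma dual_iff:
  "l \<in> car (dual X) \<longleftrightarrow> (\<forall>x\<in>car X. \<forall>y\<in>car X. l (x + y) = l x + l y) \<and> (\<forall>c. \<forall>x\<in>car X. l (c *\<^sub>R x) = c * l x)
    \<and> (\<exists>C. \<forall>x\<in>car X. \<bar>l x\<bar> \<le> C * nrm X x)"
  by (auto simp: dual_def bounded_ops_def real_space_def eq_in_def)

lemma nrm_dual: "nrm (dual X) l = Sup {\<bar>l x\<bar> |x. x \<in> car X \<and> nrm X x \<le> 1}"
  by (simp add: dual_def bounded_ops_def real_space_def)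

lemma dual_unit_ball:
  assumes "l \<in> car (dual X)"
  shows "bdd_above {\<bar>l x\<bar> |x. x \<in> car X \<and> nrm X x \<le> 1}" "{\<bar>l x\<bar> |x. x \<in> car X \<and> nrm X x \<le> 1} \<noteq> {}"
proof -
  obtain C where C: "\<And>x. x \<in> car X \<Longrightarrow> \<bar>l x\<bar> \<le> C * nrm X x" using assms unfolding dual_iff by blast
  have "\<bar>l x\<bar> \<le> \<bar>C\<bar>" if x: "x \<in> car X" "nrm X x \<le> 1" for x
  proof -
    have "C * nrm X x \<le> \<bar>C\<bar> * 1" using x nrm_nonneg[OF x(1)] by (intro mult_mono) auto
    then show ?thesis using C[OF x(1)] by simp
  qed
  then show "bdd_above {\<bar>l x\<bar> |x. x \<in> car X \<and> nrm X x \<le> 1}" by (intro bdd_aboveI[of _ "\<bar>C\<bar>"]) auto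
  have "0 \<in> car X \<and> nrm X 0 \<le> 1" by simp
  then show "{\<bar>l x\<bar> |x. x \<in> car X \<and> nrm X x \<le> 1} \<noteq> {}" by blast
qed

text \<open>Normalizing x is impossible when its seminorm vanishes; then some bound for l gives
  \<open>l x = 0\<close> directly.\<close>

lemma dual_le:
  assumes l: "l \<in> car (dual X)" and x: "x \<in> car X"
  shows "\<bar>l x\<bar> \<le> nrm (dual X) l * nrm X x"
proof (cases "nrm X x = 0")
  case True
  obtain C where "\<And>x. x \<in> car X \<Longrightarrow> \<bar>l x\<bar> \<le> C * nrm X x" using l unfolding dual_iff by blast
  from this[OF x] True show ?thesis by simp
next
  case False
  then have n: "0 < nrm X x" using nrm_nonneg[OF x] by simp
  let ?y = "(1 / nrm X x) *\<^sub>R x"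
  have y: "?y \<in> car X" "nrm X ?y \<le> 1" using x n by (auto simp: nrm_scale)
  then have "\<bar>l ?y\<bar> \<le> nrm (dual X) l"
    unfolding nrm_dual by (intro cSup_upper dual_unit_ball l) blast
  moreover have "l ?y = (1 / nrm X x) * l x" using l x by (simp only: dual_iff)
  ultimately show ?thesis using n by (simp add: abs_mult field_simps)
qed

lemma nrm_dual_le:
  assumes l: "l \<in> car (dual X)" and C: "0 \<le> C" "\<And>x. x \<in> car X \<Longrightarrow> \<bar>l x\<bar> \<le> C * nrm X x"
  shows "nrm (dual X) l \<le> C"
  unfolding nrm_dual
proof (rule cSup_least[OF dual_unit_ball(2)[OF l]], clarify)
  fix x assume x: "x \<in> car X" "nrm X x \<le> 1"
  have "C * nrm X x \<le> C * 1" using x C(1) by (intro mult_left_mono) auto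
  then show "\<bar>l x\<bar> \<le> C" using C(2)[OF x(1)] by simp
qed

lemma nrm_dual_nonneg: "l \<in> car (dual X) \<Longrightarrow> 0 \<le> nrm (dual X) l"
  unfolding nrm_dual
  by (rule cSup_upper2[OF _ _ dual_unit_ball(1), of "\<bar>l 0\<bar>"]) (auto intro!: exI[of _ 0])

lemma seminormed_dual: "seminormed (dual X)"
proof -
  have add: "k + l \<in> car (dual X)" if kl: "k \<in> car (dual X)" "l \<in> car (dual X)" for k l
  proof -
    have "\<bar>(k + l) x\<bar> \<le> (nrm (dual X) k + nrm (dual X) l) * nrm X x" if "x \<in> car X" for x
      using dual_le[OF kl(1) that] dual_le[OF kl(2) that] by (auto simp: distrib_right)
    with kl show ?thesis unfolding dual_iff by (auto simp: distrib_left)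
  qed
  have scale: "c *\<^sub>R l \<in> car (dual X)" if l: "l \<in> car (dual X)" for c l
  proof -
    have "\<bar>(c *\<^sub>R l) x\<bar> \<le> (\<bar>c\<bar> * nrm (dual X) l) * nrm X x" if "x \<in> car X" for x
      using mult_left_mono[OF dual_le[OF l that], of "\<bar>c\<bar>"] by (auto simp: abs_mult mult.assoc)
    with l show ?thesis unfolding dual_iff by (auto simp: distrib_left)
  qed
  have scale_le: "nrm (dual X) (c *\<^sub>R l) \<le> \<bar>c\<bar> * nrm (dual X) l" if l: "l \<in> car (dual X)" for c l
    using mult_left_mono[OF dual_le[OF l], of _ "\<bar>c\<bar>"] nrm_dual_nonneg[OF l]
    by (intro nrm_dual_le scale l) (auto simp: abs_mult mult.assoc)
  have zero: "0 \<in> car (dual X)" by (auto simp: dual_iff intro!: exI[of _ 0])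
  show ?thesis
  proof
    show "subspace (car (dual X))" by (intro subspaceI add scale zero)
  next
    fix k l assume kl: "k \<in> car (dual X)" "l \<in> car (dual X)"
    show "nrm (dual X) (k + l) \<le> nrm (dual X) k + nrm (dual X) l"
    proof (rule nrm_dual_le[OF add[OF kl]])
      show "\<bar>(k + l) x\<bar> \<le> (nrm (dual X) k + nrm (dual X) l) * nrm X x" if "x \<in> car X" for x
        using dual_le[OF kl(1) that] dual_le[OF kl(2) that] by (auto simp: distrib_right)
    qed (use nrm_dual_nonneg kl in auto)
  next
    fix c l assume l: "l \<in> car (dual X)"
    show "nrm (dual X) (c *\<^sub>R l) = \<bar>c\<bar> * nrm (dual X) l"
    proof (cases "c = 0")
      case True
      then show ?thesis using scale_le[OF l, of 0] nrm_dual_nonneg[OF zero] by simp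
    next
      case False
      have "nrm (dual X) l = nrm (dual X) (inverse c *\<^sub>R c *\<^sub>R l)" using False by simp
      also have "\<dots> \<le> \<bar>inverse c\<bar> * nrm (dual X) (c *\<^sub>R l)" by (rule scale_le[OF scale[OF l]])
      finally have "\<bar>c\<bar> * nrm (dual X) l \<le> nrm (dual X) (c *\<^sub>R l)" using False by (simp add: field_simps)
      with scale_le[OF l, of c] show ?thesis by simp
    qed
  qed
qed

end

section \<open>Nemytskii operators\<close>

lemma L2_on_dominated_zero:
  assumes w: "\<And>n. w n \<in> car (L2_on M)" and b: "b \<in> car (L2_on M)"
    and le: "\<And>n. AE x in M. \<bar>w n x\<bar> \<le> C * \<bar>b x\<bar>" and lim: "AE x in M. (\<lambda>n::nat. w n x) \<longlonglongrightarrow> 0"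
  shows "(\<lambda>n. nrm (L2_on M) (w n)) \<longlonglongrightarrow> 0"
proof -
  have "(\<lambda>n. LINT x|M. (w n x)\<^sup>2) \<longlonglongrightarrow> (LINT x|M. 0)"
  proof (rule integral_dominated_convergence[where w="\<lambda>x. C\<^sup>2 * (b x)\<^sup>2"])
    show "(\<lambda>x. (w n x)\<^sup>2) \<in> borel_measurable M" for n using L2_onD(1)[OF w] by simp
    show "integrable M (\<lambda>x. C\<^sup>2 * (b x)\<^sup>2)" using L2_onD(2)[OF b] by simp
    show "AE x in M. (\<lambda>n. (w n x)\<^sup>2) \<longlonglongrightarrow> 0"
      using lim by eventually_elim (auto intro: tendsto_eq_intros)
    show "AE x in M. norm ((w n x)\<^sup>2) \<le> C\<^sup>2 * (b x)\<^sup>2" for n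
      using le[of n]
    proof eventually_elim
      case (elim x)
      then have "\<bar>w n x\<bar>\<^sup>2 \<le> (C * \<bar>b x\<bar>)\<^sup>2" by (intro power_mono) auto
      then show ?case by (simp add: power_mult_distrib)
    qed
  qed simp
  then have "(\<lambda>n. sqrt (LINT x|M. (w n x)\<^sup>2)) \<longlonglongrightarrow> sqrt 0" by (intro tendsto_real_sqrt) simp
  then show ?thesis by (simp add: nrm_L2_on)
qed

text \<open>Treats the given f and the function \<open>pos\<close> alike; the latter enters with
  constant 1.\<close>

locale lipschitz_dir_diff =
  fixes g :: "real \<Rightarrow> real" and L :: real
  assumes lipschitz: "L-lipschitz_on UNIV g" and dir_diff: "dir_diff_real g"
begin

lemma L_nonneg: "0 \<le> L"
  using lipschitz by (rule lipschitz_on_nonneg)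

lemma lipschitz_abs: "\<bar>g a - g b\<bar> \<le> L * \<bar>a - b\<bar>"
  using lipschitz_onD[OF lipschitz, of a b] by (simp add: dist_real_def)

lemma quotient_tendsto: "((\<lambda>\<tau>. (g (a + \<tau> * b) - g a) / \<tau>) \<longlongrightarrow> dir_deriv g a b) (at_right 0)"
proof -
  obtain l where l: "((\<lambda>\<tau>. (g (a + \<tau> * b) - g a) / \<tau>) \<longlongrightarrow> l) (at_right 0)"
    using dir_diff by (auto simp: dir_diff_real_def)
  then show ?thesis unfolding dir_deriv_def by (simp add: tendsto_Lim)
qed

lemma quotient_le: "\<tau> > 0 \<Longrightarrow> \<bar>(g (a + \<tau> * b) - g (a + \<tau> * c)) / \<tau>\<bar> \<le> L * \<bar>b - c\<bar>"
proof -
  assume \<tau>: "\<tau> > 0"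
  have "\<bar>a + \<tau> * b - (a + \<tau> * c)\<bar> = \<tau> * \<bar>b - c\<bar>"
    using \<tau> abs_mult[of \<tau> "b - c"] by (simp add: algebra_simps)
  then show ?thesis
    using lipschitz_abs[of "a + \<tau> * b" "a + \<tau> * c"] \<tau> by (simp add: pos_divide_le_eq mult_ac)
qed

text \<open>The bound on the quotients is uniform in \<tau> and passes to the limit. This takes the
  place of linearity in the direction and makes the linearized right-hand side Lipschitz.\<close>

lemma dir_deriv_lipschitz: "\<bar>dir_deriv g a b - dir_deriv g a c\<bar> \<le> L * \<bar>b - c\<bar>"
proof (rule tendsto_le[OF _ tendsto_const])
  show "((\<lambda>\<tau>. \<bar>(g (a + \<tau> * b) - g a) / \<tau> - (g (a + \<tau> * c) - g a) / \<tau>\<bar>) \<longlongrightarrow> \<bar>dir_deriv g a b - dir_deriv g a c\<bar>) (at_right 0)"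
    by (intro tendsto_intros quotient_tendsto)
  show "\<forall>\<^sub>F \<tau> in at_right 0. \<bar>(g (a + \<tau> * b) - g a) / \<tau> - (g (a + \<tau> * c) - g a) / \<tau>\<bar> \<le> L * \<bar>b - c\<bar>"
    using quotient_le[of _ a b c] by (auto simp: eventually_at_filter diff_divide_distrib)
qed simp

lemma dir_deriv_zero: "dir_deriv g a 0 = 0"
  unfolding dir_deriv_def by (simp add: tendsto_Lim)

lemma dir_deriv_le: "\<bar>dir_deriv g a b\<bar> \<le> L * \<bar>b\<bar>"
  using dir_deriv_lipschitz[of a b 0] by (simp add: dir_deriv_zero)

lemma quotient_diff_le: "\<tau> > 0 \<Longrightarrow> \<bar>(g (a + \<tau> * b) - g a) / \<tau> - dir_deriv g a b\<bar> \<le> 2 * L * \<bar>b\<bar>"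
  using quotient_le[of \<tau> a b 0] dir_deriv_le[of a b] abs_triangle_ineq4[of "(g (a + \<tau> * b) - g a) / \<tau>" "dir_deriv g a b"]
  by simp

lemma continuous_on: "continuous_on UNIV g"
  using lipschitz lipschitz_on_continuous_on by blast

lemma borel_measurable [measurable]: "g \<in> borel_measurable borel"
  using continuous_on by (rule borel_measurable_continuous_onI)

text \<open>As g need not vanish at 0, the constant \<open>g 0\<close> is split off; it is square
  integrable because the measure is finite.\<close>

lemma Nemytskii_L2_on:
  assumes M: "finite_measure M" and u: "u \<in> car (L2_on M)"
  shows "(\<lambda>x. g (u x)) \<in> car (L2_on M)"
proof -
  interpret prehilbert "L2_on M" "\<lambda>u v. LINT x|M. u x * v x" by (rule prehilbert_L2_on)
  have [measurable]: "u \<in> borel_measurable M" using L2_onD(1)[OF u] .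
  have 0: "(\<lambda>_. g 0) \<in> car (L2_on M)"
    by (intro L2_onI finite_measure.integrable_const[OF M]) auto
  have "(\<lambda>x. g (u x) - g 0) \<in> car (L2_on M)"
    by (rule L2_on_bound(1)[OF u _ _ L_nonneg]) (use lipschitz_abs[of _ 0] in auto)
  from add_car[OF this 0] show ?thesis by (simp add: plus_fun_def)
qed

lemma Nemytskii_lipschitz:
  assumes u: "u \<in> car (L2_on M)" and v: "v \<in> car (L2_on M)"
  shows "nrm (L2_on M) ((\<lambda>x. g (u x)) - (\<lambda>x. g (v x))) \<le> L * nrm (L2_on M) (u - v)"
proof (rule L2_on_bound(2)[OF _ _ _ L_nonneg])
  interpret prehilbert "L2_on M" "\<lambda>u v. LINT x|M. u x * v x" by (rule prehilbert_L2_on)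
  have [measurable]: "u \<in> borel_measurable M" "v \<in> borel_measurable M" using L2_onD(1) u v by auto
  show "u - v \<in> car (L2_on M)" using u v by blast
  show "(\<lambda>x. g (u x)) - (\<lambda>x. g (v x)) \<in> borel_measurable M" by (simp add: fun_diff_def)
qed (use lipschitz_abs in auto)

text \<open>The error of the difference quotient at a in direction b. Its bound by
  \<open>2 * L * \<bar>b\<bar>\<close> is uniform in \<tau> and provides the majorant for dominated
  convergence.\<close>

definition rem where "rem \<tau> a b = (g (a + \<tau> * b) - g a) / \<tau> - dir_deriv g a b"

lemma rem_le: "0 < \<tau> \<Longrightarrow> \<bar>rem \<tau> a b\<bar> \<le> 2 * L * \<bar>b\<bar>"
  using quotient_diff_le by (simp add: rem_def)

lemma rem_tendsto:
  assumes "\<tau> \<longlonglongrightarrow> 0" "\<And>n. 0 < \<tau> n"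
  shows "(\<lambda>n. rem (\<tau> n) a b) \<longlonglongrightarrow> 0"
proof -
  have "filterlim \<tau> (at_right 0) sequentially" using assms(1) by (simp add: filterlim_at assms(2) less_imp_neq[OF assms(2), symmetric])
  from filterlim_compose[OF quotient_tendsto this] show ?thesis
    unfolding rem_def by (auto intro!: LIM_zero)
qed

text \<open>A pointwise limit of measurable quotients along the sequence 1/(n+1).\<close>

lemma dir_deriv_measurable:
  assumes [measurable]: "a \<in> borel_measurable M" "b \<in> borel_measurable M"
  shows "(\<lambda>x. dir_deriv g (a x) (b x)) \<in> borel_measurable M"
proof (rule borel_measurable_LIMSEQ_real)
  let ?\<tau> = "\<lambda>n. inverse (real (Suc n))"
  show "(\<lambda>n. (g (a x + ?\<tau> n * b x) - g (a x)) / ?\<tau> n) \<longlonglongrightarrow> dir_deriv g (a x) (b x)" for x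
    by (rule LIM_zero_cancel[OF rem_tendsto[OF LIMSEQ_inverse_real_of_nat, unfolded rem_def]]) simp
qed measurable

lemma dir_deriv_L2_on:
  assumes a: "a \<in> borel_measurable M" and b: "b \<in> car (L2_on M)"
  shows "(\<lambda>x. dir_deriv g (a x) (b x)) \<in> car (L2_on M)"
    "nrm (L2_on M) (\<lambda>x. dir_deriv g (a x) (b x)) \<le> L * nrm (L2_on M) b"
  using L2_on_bound[OF b dir_deriv_measurable[OF a L2_onD(1)[OF b]] _ L_nonneg] dir_deriv_le by auto

lemma dir_deriv_L2_on_lipschitz:
  assumes a: "a \<in> borel_measurable M" and b: "b \<in> car (L2_on M)" and c: "c \<in> car (L2_on M)"
  shows "nrm (L2_on M) ((\<lambda>x. dir_deriv g (a x) (b x)) - (\<lambda>x. dir_deriv g (a x) (c x))) \<le> L * nrm (L2_on M) (b - c)"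
proof (rule L2_on_bound(2)[OF _ _ _ L_nonneg])
  interpret prehilbert "L2_on M" "\<lambda>u v. LINT x|M. u x * v x" by (rule prehilbert_L2_on)
  show "b - c \<in> car (L2_on M)" using b c by blast
  show "(\<lambda>x. dir_deriv g (a x) (b x)) - (\<lambda>x. dir_deriv g (a x) (c x)) \<in> borel_measurable M"
    unfolding fun_diff_def using a L2_onD(1)[OF b] L2_onD(1)[OF c] by (intro borel_measurable_diff dir_deriv_measurable)
qed (use dir_deriv_lipschitz in auto)

lemma rem_L2_on:
  assumes a: "a \<in> borel_measurable M" and b: "b \<in> car (L2_on M)" and \<tau>: "0 < \<tau>"
  shows "(\<lambda>x. rem \<tau> (a x) (b x)) \<in> car (L2_on M)"
    "nrm (L2_on M) (\<lambda>x. rem \<tau> (a x) (b x)) \<le> 2 * L * nrm (L2_on M) b"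
proof -
  have [measurable]: "a \<in> borel_measurable M" "b \<in> borel_measurable M" using a L2_onD(1)[OF b] by auto
  have [measurable]: "(\<lambda>x. dir_deriv g (a x) (b x)) \<in> borel_measurable M" by (rule dir_deriv_measurable) auto
  have "(\<lambda>x. rem \<tau> (a x) (b x)) \<in> borel_measurable M" unfolding rem_def by measurable
  from L2_on_bound[OF b this AE_I2[OF rem_le[OF \<tau>]]] L_nonneg
  show "(\<lambda>x. rem \<tau> (a x) (b x)) \<in> car (L2_on M)"
    "nrm (L2_on M) (\<lambda>x. rem \<tau> (a x) (b x)) \<le> 2 * L * nrm (L2_on M) b" by simp_all
qed

lemma rem_L2_on_tendsto:
  assumes a: "a \<in> borel_measurable M" and b: "b \<in> car (L2_on M)" and \<tau>: "\<tau> \<longlonglongrightarrow> 0" "\<And>n. 0 < \<tau> n"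
  shows "(\<lambda>n. nrm (L2_on M) (\<lambda>x. rem (\<tau> n) (a x) (b x))) \<longlonglongrightarrow> 0"
proof (rule L2_on_dominated_zero[where w="\<lambda>n x. rem (\<tau> n) (a x) (b x)" and b=b and C="2 * L"])
  show "(\<lambda>x. rem (\<tau> n) (a x) (b x)) \<in> car (L2_on M)" for n by (rule rem_L2_on(1)[OF a b \<tau>(2)])
  show "b \<in> car (L2_on M)" by (rule b)
  show "AE x in M. \<bar>rem (\<tau> n) (a x) (b x)\<bar> \<le> 2 * L * \<bar>b x\<bar>" for n
    by (rule AE_I2, rule rem_le, rule \<tau>)
  show "AE x in M. (\<lambda>n. rem (\<tau> n) (a x) (b x)) \<longlonglongrightarrow> 0"
    by (rule AE_I2, rule rem_tendsto, (rule \<tau>)+)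
qed

lemma Nemytskii_strongly_measurable:
  assumes M: "finite_measure M" and u: "strongly_measurable N (L2_on M) u"
  shows "strongly_measurable N (L2_on M) (\<lambda>t x. g (u t x))"
proof (rule strongly_measurable_compose[where F="\<lambda>u x. g (u x)", OF seminormed_L2_on seminormed_L2_on u])
  show "(\<lambda>x. g (a x)) \<in> car (L2_on M)" if "a \<in> car (L2_on M)" for a by (rule Nemytskii_L2_on[OF M that])
  show "nrm (L2_on M) ((\<lambda>x. g (a' x)) - (\<lambda>x. g (a x))) \<le> L * nrm (L2_on M) (a' - a)"
    if "a \<in> car (L2_on M)" "a' \<in> car (L2_on M)" for a a' by (rule Nemytskii_lipschitz[OF that(2,1)])
qed

text \<open>The derivative \<open>dir_deriv g a b\<close> need not be continuous in the base point
  a, so composition with a continuous map does not yield strong measurability. Instead it is a limit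
  of difference quotients, each of which is built from Lipschitz Nemytskii operators.\<close>

lemma dir_deriv_bochner_L2:
  assumes M: "finite_measure M" and a: "a \<in> car (bochner_L2 T (L2_on M))" and b: "b \<in> car (bochner_L2 T (L2_on M))"
  shows "(\<lambda>t x. dir_deriv g (a t x) (b t x)) \<in> car (bochner_L2 T (L2_on M))"
    and "0 < \<tau> \<Longrightarrow> (\<lambda>t x. rem \<tau> (a t x) (b t x)) \<in> car (bochner_L2 T (L2_on M))"
proof -
  interpret X: hilbert "L2_on M" "\<lambda>u v. LINT x|M. u x * v x" by (rule hilbert_L2_on[OF M])
  note ac = X.bochner_L2D(4)[OF a] and bc = X.bochner_L2D(4)[OF b]
  have q: "strongly_measurable (time T) (L2_on M) (\<lambda>t x. (g (a t x + \<tau> * b t x) - g (a t x)) / \<tau>)"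
    if \<tau>: "0 < \<tau>" for \<tau>
  proof -
    have "strongly_measurable (time T) (L2_on M) (\<lambda>t. a t + \<tau> *\<^sub>R b t)"
      by (intro X.strongly_measurable_add X.strongly_measurable_scale X.bochner_L2D a b)
    from Nemytskii_strongly_measurable[OF M this]
    have 1: "strongly_measurable (time T) (L2_on M) (\<lambda>t x. g (a t x + \<tau> * b t x))" by simp
    note 2 = Nemytskii_strongly_measurable[OF M X.bochner_L2D(1)[OF a]]
    show ?thesis
      using X.strongly_measurable_scale[OF X.strongly_measurable_diff[OF 1 2], of "1 / \<tau>"]
      by (simp add: fun_diff_def scaleR_fun_def)
  qed
  let ?\<tau> = "\<lambda>n. inverse (real (Suc n))"
  have d: "strongly_measurable (time T) (L2_on M) (\<lambda>t x. dir_deriv g (a t x) (b t x))"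
  proof (rule X.strongly_measurable_limit[OF complete_time finite_time q])
    show "(\<lambda>x. dir_deriv g (a t x) (b t x)) \<in> car (L2_on M)" if "t \<in> space (time T)" for t
      using that dir_deriv_L2_on(1)[OF L2_onD(1)[OF ac] bc] by auto
    show "AE t in time T. (\<lambda>n. nrm (L2_on M) ((\<lambda>x. (g (a t x + ?\<tau> n * b t x) - g (a t x)) / ?\<tau> n) - (\<lambda>x. dir_deriv g (a t x) (b t x)))) \<longlonglongrightarrow> 0"
    proof (intro AE_I2)
      fix t assume "t \<in> space (time T)"
      then have "(\<lambda>n. nrm (L2_on M) (\<lambda>x. rem (?\<tau> n) (a t x) (b t x))) \<longlonglongrightarrow> 0"
        by (intro rem_L2_on_tendsto[OF L2_onD(1)[OF ac] bc LIMSEQ_inverse_real_of_nat]) auto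
      then show "(\<lambda>n. nrm (L2_on M) ((\<lambda>x. (g (a t x + ?\<tau> n * b t x) - g (a t x)) / ?\<tau> n) - (\<lambda>x. dir_deriv g (a t x) (b t x)))) \<longlonglongrightarrow> 0"
        by (simp add: rem_def fun_diff_def)
    qed
  qed simp
  have Lb: "c *\<^sub>R (\<lambda>t. nrm (L2_on M) (b t)) \<in> car (L2_on (time T))" for c
    using subspace_scale[OF subspace_L2_on X.bochner_L2D(2)[OF b]] .
  show "(\<lambda>t x. dir_deriv g (a t x) (b t x)) \<in> car (bochner_L2 T (L2_on M))"
    by (rule X.bochner_L2_bound(1)[OF d Lb[of L]]) (use dir_deriv_L2_on(2)[OF L2_onD(1)[OF ac] bc] in auto)
  assume \<tau>: "0 < \<tau>"
  have r: "strongly_measurable (time T) (L2_on M) (\<lambda>t x. rem \<tau> (a t x) (b t x))"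
    using X.strongly_measurable_diff[OF q[OF \<tau>] d] by (simp add: rem_def fun_diff_def)
  show "(\<lambda>t x. rem \<tau> (a t x) (b t x)) \<in> car (bochner_L2 T (L2_on M))"
    by (rule X.bochner_L2_bound(1)[OF r Lb[of "2 * L"]]) (use rem_L2_on(2)[OF L2_onD(1)[OF ac] bc \<tau>] in auto)
qed

text \<open>Dominated convergence twice: in space for each t, then in time for the norms.\<close>

lemma rem_bochner_L2_tendsto:
  assumes M: "finite_measure M" and a: "a \<in> car (bochner_L2 T (L2_on M))" and b: "b \<in> car (bochner_L2 T (L2_on M))"
    and \<tau>: "\<tau> \<longlonglongrightarrow> 0" "\<And>n. 0 < \<tau> n"
  shows "(\<lambda>n. nrm (bochner_L2 T (L2_on M)) (\<lambda>t x. rem (\<tau> n) (a t x) (b t x))) \<longlonglongrightarrow> 0"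
proof -
  interpret X: hilbert "L2_on M" "\<lambda>u v. LINT x|M. u x * v x" by (rule hilbert_L2_on[OF M])
  note ac = X.bochner_L2D(4)[OF a] and bc = X.bochner_L2D(4)[OF b]
  note r = dir_deriv_bochner_L2(2)[OF M a b \<tau>(2)]
  show ?thesis unfolding nrm_bochner_L2
  proof (rule L2_on_dominated_zero[where w="\<lambda>n t. nrm (L2_on M) (\<lambda>x. rem (\<tau> n) (a t x) (b t x))"
        and b="\<lambda>t. nrm (L2_on M) (b t)" and C="2 * L"])
    show "(\<lambda>t. nrm (L2_on M) (\<lambda>x. rem (\<tau> n) (a t x) (b t x))) \<in> car (L2_on (time T))" for n
      by (rule X.bochner_L2D(2)[OF r])
    show "(\<lambda>t. nrm (L2_on M) (b t)) \<in> car (L2_on (time T))" by (rule X.bochner_L2D(2)[OF b])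
    show "AE t in time T. \<bar>nrm (L2_on M) (\<lambda>x. rem (\<tau> n) (a t x) (b t x))\<bar> \<le> 2 * L * \<bar>nrm (L2_on M) (b t)\<bar>" for n
    proof (rule AE_I2)
      fix t assume "t \<in> space (time T)"
      then have t: "0 < t" "t < T" by auto
      show "\<bar>nrm (L2_on M) (\<lambda>x. rem (\<tau> n) (a t x) (b t x))\<bar> \<le> 2 * L * \<bar>nrm (L2_on M) (b t)\<bar>"
        using rem_L2_on[OF L2_onD(1)[OF ac[OF t]] bc[OF t] \<tau>(2)] X.nrm_nonneg bc[OF t] by simp
    qed
    show "AE t in time T. (\<lambda>n. nrm (L2_on M) (\<lambda>x. rem (\<tau> n) (a t x) (b t x))) \<longlonglongrightarrow> 0"
      by (rule AE_I2, rule rem_L2_on_tendsto[OF L2_onD(1)[OF ac] bc \<tau>]) auto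
  qed
qed

lemma Nemytskii_bochner_L2:
  assumes M: "finite_measure M" and a: "a \<in> car (bochner_L2 T (L2_on M))"
  shows "(\<lambda>t x. g (a t x)) \<in> car (bochner_L2 T (L2_on M))"
proof -
  interpret X: hilbert "L2_on M" "\<lambda>u v. LINT x|M. u x * v x" by (rule hilbert_L2_on[OF M])
  interpret Y: prehilbert "L2_on (time T)" "\<lambda>u v. LINT x|time T. u x * v x" by (rule prehilbert_L2_on)
  note sm = Nemytskii_strongly_measurable[OF M X.bochner_L2D(1)[OF a]]
  have 0: "0 \<in> car (L2_on M)" and g0: "(\<lambda>x. g 0) \<in> car (L2_on M)"
    using X.zero_car Nemytskii_L2_on[OF M X.zero_car] by (simp_all add: zero_fun_def)
  let ?c = "nrm (L2_on M) (\<lambda>x. g 0)"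
  have "(\<lambda>_. ?c) \<in> car (L2_on (time T))"
    by (intro L2_onI finite_measure.integrable_const[OF finite_time]) auto
  then have b: "L *\<^sub>R (\<lambda>t. nrm (L2_on M) (a t)) + (\<lambda>_. ?c) \<in> car (L2_on (time T))"
    using X.bochner_L2D(2)[OF a] by (intro Y.add_car Y.scale_car)
  show ?thesis
  proof (rule X.bochner_L2_bound(1)[OF sm b], rule AE_I2)
    fix t assume "t \<in> space (time T)"
    then have t: "a t \<in> car (L2_on M)" using X.bochner_L2D(4)[OF a] by auto
    have "nrm (L2_on M) (\<lambda>x. g (a t x)) \<le> nrm (L2_on M) ((\<lambda>x. g (a t x)) - (\<lambda>x. g 0)) + ?c"
      using Nemytskii_L2_on[OF M t] g0 by (intro X.nrm_le_diff) auto
    also have "nrm (L2_on M) ((\<lambda>x. g (a t x)) - (\<lambda>x. g 0)) \<le> L * nrm (L2_on M) (a t)"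
      using Nemytskii_lipschitz[OF t 0] by simp
    finally show "nrm (L2_on M) (\<lambda>x. g (a t x)) \<le> (L *\<^sub>R (\<lambda>t. nrm (L2_on M) (a t)) + (\<lambda>_. ?c)) t" by simp
  qed
qed

end

text \<open>For v \<noteq> 0 the sign of v persists along the ray for small \<tau>; for v = 0
  positive homogeneity makes the quotient constant.\<close>

lemma pos_lipschitz_dir_diff: "lipschitz_dir_diff pos 1"
proof
  show "1-lipschitz_on UNIV pos" by (auto simp: lipschitz_on_def dist_real_def pos_def)
  show "dir_diff_real pos" unfolding dir_diff_real_def
  proof (intro allI)
    fix v h :: real
    consider "v > 0" | "v = 0" | "v < 0" by linarith
    then show "\<exists>l. ((\<lambda>\<tau>. (pos (v + \<tau> * h) - pos v) / \<tau>) \<longlongrightarrow> l) (at_right 0)"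
    proof cases
      case 1
      have "((\<lambda>\<tau>. v + \<tau> * h) \<longlongrightarrow> v + 0 * h) (at_right 0)" by (intro tendsto_intros)
      then have "\<forall>\<^sub>F \<tau> in at_right 0. 0 < v + \<tau> * h" using 1 by (auto dest: order_tendstoD)
      moreover have "\<forall>\<^sub>F \<tau>::real in at_right 0. 0 < \<tau>" by (rule eventually_at_right_less)
      ultimately have "\<forall>\<^sub>F \<tau> in at_right 0. h = (pos (v + \<tau> * h) - pos v) / \<tau>"
        by eventually_elim (use 1 in \<open>auto simp: pos_def\<close>)
      from Lim_transform_eventually[OF tendsto_const this] show ?thesis by blast
    next
      case 2
      have "\<forall>\<^sub>F \<tau> in at_right 0. max h 0 = (pos (v + \<tau> * h) - pos v) / \<tau>"
        using eventually_at_right_less[of "0::real"]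
      proof eventually_elim
        case (elim \<tau>)
        then show ?case using 2 by (auto simp: pos_def max_def mult_le_0_iff not_le)
      qed
      from Lim_transform_eventually[OF tendsto_const this] show ?thesis by blast
    next
      case 3
      have "((\<lambda>\<tau>. v + \<tau> * h) \<longlongrightarrow> v + 0 * h) (at_right 0)" by (intro tendsto_intros)
      then have "\<forall>\<^sub>F \<tau> in at_right 0. v + \<tau> * h < 0" using 3 by (auto dest: order_tendstoD)
      then have "\<forall>\<^sub>F \<tau> in at_right 0. 0 = (pos (v + \<tau> * h) - pos v) / \<tau>"
        by eventually_elim (use 3 in \<open>auto simp: pos_def\<close>)
      from Lim_transform_eventually[OF tendsto_const this] show ?thesis by blast
    qed
  qed
qed

section \<open>The state space\<close>

lemma seminormed_prod_space:
  assumes X: "seminormed X" and Y: "seminormed Y"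
  shows "seminormed (prod_space X Y)"
proof -
  interpret X: seminormed X by (rule X)
  interpret Y: seminormed Y by (rule Y)
  show ?thesis
  proof
    show "subspace (car (prod_space X Y))"
      unfolding prod_space_def using X.subspace_car Y.subspace_car by (simp add: subspace_Times)
  next
    fix x y assume "x \<in> car (prod_space X Y)" "y \<in> car (prod_space X Y)"
    then obtain a b c d where e: "x = (a, b)" "y = (c, d)"
      and c: "a \<in> car X" "b \<in> car Y" "c \<in> car X" "d \<in> car Y" by (auto simp: prod_space_def)
    have "sqrt ((nrm X (a + c))\<^sup>2 + (nrm Y (b + d))\<^sup>2) \<le> sqrt ((nrm X a + nrm X c)\<^sup>2 + (nrm Y b + nrm Y d)\<^sup>2)"
      using c by (intro real_sqrt_le_mono add_mono power_mono X.nrm_triangle Y.nrm_triangle X.nrm_nonneg Y.nrm_nonneg) auto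
    also have "\<dots> \<le> sqrt ((nrm X a)\<^sup>2 + (nrm Y b)\<^sup>2) + sqrt ((nrm X c)\<^sup>2 + (nrm Y d)\<^sup>2)"
      by (rule real_sqrt_sum_squares_triangle_ineq)
    finally show "nrm (prod_space X Y) (x + y) \<le> nrm (prod_space X Y) x + nrm (prod_space X Y) y"
      by (simp add: prod_space_def e)
  next
    fix x r assume "x \<in> car (prod_space X Y)"
    then obtain a b where e: "x = (a, b)" and c: "a \<in> car X" "b \<in> car Y" by (auto simp: prod_space_def)
    have "sqrt ((\<bar>r\<bar> * nrm X a)\<^sup>2 + (\<bar>r\<bar> * nrm Y b)\<^sup>2) = \<bar>r\<bar> * sqrt ((nrm X a)\<^sup>2 + (nrm Y b)\<^sup>2)"
      by (simp add: power_mult_distrib real_sqrt_mult flip: distrib_left)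
    then show "nrm (prod_space X Y) (r *\<^sub>R x) = \<bar>r\<bar> * nrm (prod_space X Y) x"
      using X.nrm_scale[OF c(1), of r] Y.nrm_scale[OF c(2), of r] by (simp add: prod_space_def e)
  qed
qed

context hilbert begin

lemma nrm_bochner_L2_cong:
  assumes u: "u \<in> car (bochner_L2 T X)" and v: "v \<in> car (bochner_L2 T X)"
    and eq: "AE t in time T. nrm X (u t - v t) = 0"
  shows "nrm (bochner_L2 T X) u = nrm (bochner_L2 T X) v"
proof -
  interpret B: seminormed "bochner_L2 T X" by (rule seminormed_bochner_L2)
  have "u - v \<in> car (bochner_L2 T X)" using u v by blast
  then have "nrm (bochner_L2 T X) (u - v) = 0" using eq by (subst nrm_bochner_L2_eq_0_iff) auto
  then show ?thesis by (rule B.nrm_eq_if_diff_zero[OF u v])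
qed

lemma bochner_H10D:
  assumes "u \<in> car (bochner_H10 T X)"
  shows "u \<in> car (bochner_L2 T X)" "weak_time_derivative T X u (tderiv T X u)" "has_initial_value T X u 0"
    "tderiv T X u \<in> car (bochner_L2 T X)"
proof -
  show "u \<in> car (bochner_L2 T X)" "has_initial_value T X u 0" using assms by (auto simp: bochner_H10_def bochner_H1_def)
  have "\<exists>v. weak_time_derivative T X u v" using assms by (auto simp: bochner_H10_def bochner_H1_def)
  then show w: "weak_time_derivative T X u (tderiv T X u)" unfolding tderiv_def by (rule someI_ex)
  then show "tderiv T X u \<in> car (bochner_L2 T X)" by (simp add: weak_time_derivative_def)
qed

lemma bochner_H10I:
  assumes "u \<in> car (bochner_L2 T X)" "weak_time_derivative T X u v" "has_initial_value T X u 0"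
  shows "u \<in> car (bochner_H10 T X)"
  using assms by (auto simp: bochner_H10_def bochner_H1_def)

lemma tderiv_eq:
  assumes "u \<in> car (bochner_H10 T X)" "weak_time_derivative T X u v"
  shows "AE t in time T. nrm X (tderiv T X u t - v t) = 0"
  by (rule weak_time_derivative_unique[OF bochner_H10D(1,2)[OF assms(1)] assms(2)])

lemma has_initial_value_lincomb:
  assumes u: "has_initial_value T X u 0" "u \<in> car (bochner_L2 T X)" and v: "has_initial_value T X v 0" "v \<in> car (bochner_L2 T X)"
    and T: "0 < T"
  shows "has_initial_value T X (\<lambda>t. a *\<^sub>R u t + b *\<^sub>R v t) 0"
proof -
  obtain y where y: "\<And>t. t \<in> {0..T} \<Longrightarrow> y t \<in> car X" "AE t in time T. eq_in X (y t) (u t)"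
    "\<And>t. t \<in> {0..T} \<Longrightarrow> ((\<lambda>s. nrm X (y s - y t)) \<longlongrightarrow> 0) (at t within {0..T})" "eq_in X (y 0) 0"
    using u(1) unfolding has_initial_value_def by blast
  obtain z where z: "\<And>t. t \<in> {0..T} \<Longrightarrow> z t \<in> car X" "AE t in time T. eq_in X (z t) (v t)"
    "\<And>t. t \<in> {0..T} \<Longrightarrow> ((\<lambda>s. nrm X (z s - z t)) \<longlongrightarrow> 0) (at t within {0..T})" "eq_in X (z 0) 0"
    using v(1) unfolding has_initial_value_def by blast
  have le: "nrm X (a *\<^sub>R p + b *\<^sub>R q - (a *\<^sub>R p' + b *\<^sub>R q')) \<le> \<bar>a\<bar> * nrm X (p - p') + \<bar>b\<bar> * nrm X (q - q')"
    if "p \<in> car X" "q \<in> car X" "p' \<in> car X" "q' \<in> car X" for p q p' q'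
  proof -
    have "a *\<^sub>R p + b *\<^sub>R q - (a *\<^sub>R p' + b *\<^sub>R q') = a *\<^sub>R (p - p') + b *\<^sub>R (q - q')" by (simp add: algebra_simps)
    then show ?thesis using nrm_triangle[of "a *\<^sub>R (p - p')" "b *\<^sub>R (q - q')"] that nrm_scale[of "p - p'" a] nrm_scale[of "q - q'" b]
      by (simp add: scale_car diff_car)
  qed
  have c: "a *\<^sub>R y t + b *\<^sub>R z t \<in> car X" if "t \<in> {0..T}" for t using y(1) z(1) that by blast
  have "AE t in time T. eq_in X (a *\<^sub>R y t + b *\<^sub>R z t) (a *\<^sub>R u t + b *\<^sub>R v t)"
    using y(2) z(2) AE_space
  proof eventually_elim
    case (elim t)
    then have t: "t \<in> {0..T}" "u t \<in> car X" "v t \<in> car X"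
      using bochner_L2D(4)[OF u(2)] bochner_L2D(4)[OF v(2)] by auto
    have "nrm X (a *\<^sub>R y t + b *\<^sub>R z t - (a *\<^sub>R u t + b *\<^sub>R v t)) \<le> 0"
      using le[OF y(1)[OF t(1)] z(1)[OF t(1)] t(2,3)] elim(1,2) by (simp add: eq_in_def)
    moreover have "0 \<le> nrm X (a *\<^sub>R y t + b *\<^sub>R z t - (a *\<^sub>R u t + b *\<^sub>R v t))"
      by (intro nrm_nonneg diff_car add_car scale_car y z t)
    ultimately show ?case by (simp add: eq_in_def)
  qed
  moreover have "((\<lambda>s. nrm X (a *\<^sub>R y s + b *\<^sub>R z s - (a *\<^sub>R y t + b *\<^sub>R z t))) \<longlongrightarrow> 0) (at t within {0..T})"
    if t: "t \<in> {0..T}" for t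
  proof (rule tendsto_sandwich[of "\<lambda>_. 0"])
    have "((\<lambda>s. \<bar>a\<bar> * nrm X (y s - y t) + \<bar>b\<bar> * nrm X (z s - z t)) \<longlongrightarrow> \<bar>a\<bar> * 0 + \<bar>b\<bar> * 0) (at t within {0..T})"
      by (intro tendsto_add tendsto_mult tendsto_const y z t)
    then show "((\<lambda>s. \<bar>a\<bar> * nrm X (y s - y t) + \<bar>b\<bar> * nrm X (z s - z t)) \<longlongrightarrow> 0) (at t within {0..T})" by simp
    show "\<forall>\<^sub>F s in at t within {0..T}. 0 \<le> nrm X (a *\<^sub>R y s + b *\<^sub>R z s - (a *\<^sub>R y t + b *\<^sub>R z t))"
      unfolding eventually_at_filter using c t by (auto intro!: always_eventually nrm_nonneg)
    show "\<forall>\<^sub>F s in at t within {0..T}. nrm X (a *\<^sub>R y s + b *\<^sub>R z s - (a *\<^sub>R y t + b *\<^sub>R z t))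
        \<le> \<bar>a\<bar> * nrm X (y s - y t) + \<bar>b\<bar> * nrm X (z s - z t)"
      unfolding eventually_at_filter using y(1) z(1) t by (auto intro!: always_eventually le)
  qed simp
  moreover have "eq_in X (a *\<^sub>R y 0 + b *\<^sub>R z 0) 0"
  proof -
    have 0: "0 \<in> {0..T}" using T by simp
    show ?thesis using le[OF y(1)[OF 0] z(1)[OF 0] zero_car zero_car] y(4) z(4) nrm_nonneg[OF c[OF 0]] by (simp add: eq_in_def)
  qed
  ultimately show ?thesis
    unfolding has_initial_value_def using c by (intro exI[of _ "\<lambda>t. a *\<^sub>R y t + b *\<^sub>R z t"]) auto
qed

text \<open>\<open>tderiv\<close> picks one of many weak derivatives, so its linearity is available
  only almost everywhere and up to seminorm zero.\<close>

lemma bochner_H10_lincomb: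
  assumes u: "u \<in> car (bochner_H10 T X)" and v: "v \<in> car (bochner_H10 T X)" and T: "0 < T"
  shows "a *\<^sub>R u + b *\<^sub>R v \<in> car (bochner_H10 T X)"
    "AE t in time T. nrm X (tderiv T X (a *\<^sub>R u + b *\<^sub>R v) t - (a *\<^sub>R tderiv T X u t + b *\<^sub>R tderiv T X v t)) = 0"
proof -
  have e: "a *\<^sub>R u + b *\<^sub>R v = (\<lambda>t. a *\<^sub>R u t + b *\<^sub>R v t)" by (simp add: fun_eq_iff)
  note uD = bochner_H10D[OF u] and vD = bochner_H10D[OF v]
  have w: "weak_time_derivative T X (a *\<^sub>R u + b *\<^sub>R v) (\<lambda>t. a *\<^sub>R tderiv T X u t + b *\<^sub>R tderiv T X v t)"
    unfolding e by (rule weak_time_derivative_lincomb[OF uD(1,2) vD(1,2)])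
  show c: "a *\<^sub>R u + b *\<^sub>R v \<in> car (bochner_H10 T X)"
  proof (rule bochner_H10I[OF _ w])
    show "a *\<^sub>R u + b *\<^sub>R v \<in> car (bochner_L2 T X)" unfolding e by (rule bochner_L2_lincomb[OF uD(1) vD(1)])
    show "has_initial_value T X (a *\<^sub>R u + b *\<^sub>R v) 0" unfolding e by (rule has_initial_value_lincomb[OF uD(3,1) vD(3,1) T])
  qed
  show "AE t in time T. nrm X (tderiv T X (a *\<^sub>R u + b *\<^sub>R v) t - (a *\<^sub>R tderiv T X u t + b *\<^sub>R tderiv T X v t)) = 0"
    by (rule tderiv_eq[OF c w])
qed

lemma nrm_bochner_H10:
  "nrm (bochner_H10 T X) u = sqrt ((nrm (bochner_L2 T X) u)\<^sup>2 + (nrm (bochner_L2 T X) (tderiv T X u))\<^sup>2)"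
  by (simp add: bochner_H10_def bochner_H1_def)

lemma nrm_tderiv_lincomb:
  assumes u: "u \<in> car (bochner_H10 T X)" and v: "v \<in> car (bochner_H10 T X)" and T: "0 < T"
  shows "nrm (bochner_L2 T X) (tderiv T X (a *\<^sub>R u + b *\<^sub>R v)) = nrm (bochner_L2 T X) (a *\<^sub>R tderiv T X u + b *\<^sub>R tderiv T X v)"
proof (rule nrm_bochner_L2_cong)
  show "tderiv T X (a *\<^sub>R u + b *\<^sub>R v) \<in> car (bochner_L2 T X)"
    by (rule bochner_H10D(4)[OF bochner_H10_lincomb(1)[OF assms]])
  show "a *\<^sub>R tderiv T X u + b *\<^sub>R tderiv T X v \<in> car (bochner_L2 T X)"
    using bochner_L2_lincomb[OF bochner_H10D(4)[OF u] bochner_H10D(4)[OF v], of a b] by (simp add: plus_fun_def scaleR_fun_def)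
qed (use bochner_H10_lincomb(2)[OF assms, of a b] in simp)

text \<open>The norm is that of the pair (u, \<open>tderiv\<close> u) in a product space, and
  passing to the pair is linear up to seminorm zero.\<close>

lemma seminormed_bochner_H10:
  assumes T: "0 < T"
  shows "seminormed (bochner_H10 T X)"
proof -
  interpret B: seminormed "bochner_L2 T X" by (rule seminormed_bochner_L2)
  interpret P: seminormed "prod_space (bochner_L2 T X) (bochner_L2 T X)"
    by (rule seminormed_prod_space[OF seminormed_bochner_L2 seminormed_bochner_L2])
  have n: "nrm (bochner_H10 T X) u = nrm (prod_space (bochner_L2 T X) (bochner_L2 T X)) (u, tderiv T X u)" for u
    by (simp add: nrm_bochner_H10 prod_space_def)
  have l: "nrm (bochner_H10 T X) (a *\<^sub>R u + b *\<^sub>R v)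
      = nrm (prod_space (bochner_L2 T X) (bochner_L2 T X)) (a *\<^sub>R (u, tderiv T X u) + b *\<^sub>R (v, tderiv T X v))"
    if "u \<in> car (bochner_H10 T X)" "v \<in> car (bochner_H10 T X)" for u v a b
    unfolding n using nrm_tderiv_lincomb[OF that T, of a b] by (simp add: prod_space_def)
  have c: "(u, tderiv T X u) \<in> car (prod_space (bochner_L2 T X) (bochner_L2 T X))" if "u \<in> car (bochner_H10 T X)" for u
    using bochner_H10D(1,4)[OF that] by (simp add: prod_space_def)
  have z: "(\<lambda>t. 0) \<in> car (bochner_L2 T X)" using B.zero_car by (simp add: zero_fun_def)
  show ?thesis
  proof
    have "0 \<in> car (bochner_H10 T X)"
    proof (rule bochner_H10I)
      show "0 \<in> car (bochner_L2 T X)" by simp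
      then show "weak_time_derivative T X 0 0" by (subst weak_time_derivative_iff) auto
      show "has_initial_value T X 0 0" unfolding has_initial_value_def
        by (intro exI[of _ "\<lambda>_. 0"]) (auto simp: eq_in_def)
    qed
    then show "subspace (car (bochner_H10 T X))"
      using bochner_H10_lincomb(1)[OF _ _ T, where a=1 and b=1] bochner_H10_lincomb(1)[OF _ _ T, where b=0]
      by (intro subspaceI) (force+)
  next
    fix u v assume uv: "u \<in> car (bochner_H10 T X)" "v \<in> car (bochner_H10 T X)"
    show "nrm (bochner_H10 T X) (u + v) \<le> nrm (bochner_H10 T X) u + nrm (bochner_H10 T X) v"
      using l[OF uv, of 1 1] P.nrm_triangle[OF c[OF uv(1)] c[OF uv(2)]] by (simp add: n)
  next
    fix u a assume u: "u \<in> car (bochner_H10 T X)"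
    show "nrm (bochner_H10 T X) (a *\<^sub>R u) = \<bar>a\<bar> * nrm (bochner_H10 T X) u"
      using l[OF u u, of a 0] P.nrm_scale[OF c[OF u], of a] by (simp add: n scaleR_zero_left)
  qed
qed

end

section \<open>The elliptic equation\<close>

context bounded_open begin

lemma laplace_eq:
  assumes "u \<in> car (H1 \<Omega>)" "v \<in> car (H1 \<Omega>)"
  shows "laplace \<Omega> u v = - (\<Sum>i\<in>UNIV. LINT x|M. D i u x * D i v x)"
  unfolding laplace_def inner_vec_def
  using L2_on_mult_integrable[OF H1D(3)[OF assms(1)] H1D(3)[OF assms(2)]]
  by (simp add: Bochner_Integration.integral_sum)

lemma elliptic_iff:
  assumes "\<phi> \<in> car (H1 \<Omega>)"
  shows "elliptic_eq \<Omega> \<alpha> \<beta> q \<phi> l \<longleftrightarrow> (\<forall>\<psi>\<in>car (H1 \<Omega>). energy \<alpha> \<beta> \<phi> \<psi> = \<beta> * (LINT x|M. q x * \<psi> x) + l \<psi>)"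
proof -
  have "- \<alpha> * laplace \<Omega> \<phi> \<psi> + \<beta> * L2_functional \<Omega> \<phi> \<psi> = energy \<alpha> \<beta> \<phi> \<psi>" if "\<psi> \<in> car (H1 \<Omega>)" for \<psi>
    by (simp add: laplace_eq[OF assms that] energy_def L2_functional_def)
  then show ?thesis unfolding elliptic_eq_def by (simp add: L2_functional_def cong: ball_cong)
qed

sublocale V: hilbert "H1 \<Omega>" "energy 1 1"
  by (rule hilbert_H1)

lemma nrm_L2_le_H1: "u \<in> car (H1 \<Omega>) \<Longrightarrow> nrm (L2_on M) u \<le> nrm (H1 \<Omega>) u"
  using nrm_L2_le_energy(1)[of 1 1 u] by (simp flip: H1_eq_energy_space)

lemma energy_coercive:
  assumes "0 < \<alpha>" "0 < \<beta>"
  shows "min \<alpha> \<beta> * (nrm (H1 \<Omega>) u)\<^sup>2 \<le> energy \<alpha> \<beta> u u"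
proof -
  let ?a = "(nrm (L2_on M) u)\<^sup>2" and ?b = "\<Sum>i\<in>UNIV. (nrm (L2_on M) (D i u))\<^sup>2"
  have "(nrm (H1 \<Omega>) u)\<^sup>2 = ?a + ?b"
    using nrm_energy_space[of 1 1 u] by (simp flip: H1_eq_energy_space)
  moreover have "0 \<le> ?b" by (intro sum_nonneg) auto
  ultimately show ?thesis unfolding energy_self
    using mult_right_mono[of "min \<alpha> \<beta>" \<beta> ?a] mult_right_mono[of "min \<alpha> \<beta>" \<alpha> ?b] by (simp add: distrib_left)
qed

text \<open>The left-hand side is itself an inner product, so the equation asks for a Riesz
  representer in the energy space. Coercivity converts the bound of the functional in the H1 norm
  into one in the energy norm, with the factor
  \<open>1 / sqrt (min \<alpha> \<beta>)\<close>.\<close>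

lemma elliptic_ex:
  assumes ab: "0 < \<alpha>" "0 < \<beta>" and q: "q \<in> car (L2_on M)" and l: "l \<in> car (dual (H1 \<Omega>))"
  shows "\<exists>\<phi>\<in>car (H1 \<Omega>). elliptic_eq \<Omega> \<alpha> \<beta> q \<phi> l"
proof -
  interpret E: hilbert "energy_space \<alpha> \<beta>" "energy \<alpha> \<beta>" using ab by (rule hilbert_energy_space)
  let ?f = "\<lambda>\<psi>. \<beta> * (LINT x|M. q x * \<psi> x) + l \<psi>"
  let ?C = "(\<beta> * nrm (L2_on M) q + nrm (dual (H1 \<Omega>)) l) * (1 / sqrt (min \<alpha> \<beta>))"
  have "\<exists>w\<in>car (energy_space \<alpha> \<beta>). \<forall>\<psi>\<in>car (energy_space \<alpha> \<beta>). energy \<alpha> \<beta> w \<psi> = ?f \<psi>"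
  proof (rule E.riesz)
    fix x y assume xy: "x \<in> car (energy_space \<alpha> \<beta>)" "y \<in> car (energy_space \<alpha> \<beta>)"
    then show "?f (x + y) = ?f x + ?f y"
      using L.ip_add_right[OF H1D(1) H1D(1) q, of x y] l by (simp add: V.dual_iff algebra_simps)
  next
    fix c x assume x: "x \<in> car (energy_space \<alpha> \<beta>)"
    then show "?f (c *\<^sub>R x) = c * ?f x"
      using L.ip_scale_right[OF H1D(1) q, of x c] l by (simp add: V.dual_iff algebra_simps)
  next
    fix x assume "x \<in> car (energy_space \<alpha> \<beta>)"
    then have x: "x \<in> car (H1 \<Omega>)" by simp
    have n: "0 \<le> nrm (H1 \<Omega>) x" by (rule V.nrm_nonneg[OF x])
    have "\<bar>LINT x'|M. q x' * x x'\<bar> \<le> nrm (L2_on M) q * nrm (H1 \<Omega>) x"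
      using L.Cauchy_Schwarz[OF q H1D(1)[OF x]] mult_left_mono[OF nrm_L2_le_H1[OF x] L.nrm_nonneg[OF q]] by linarith
    then have "\<beta> * \<bar>LINT x'|M. q x' * x x'\<bar> \<le> \<beta> * (nrm (L2_on M) q * nrm (H1 \<Omega>) x)"
      using ab by (intro mult_left_mono) auto
    moreover have "\<bar>?f x\<bar> \<le> \<beta> * \<bar>LINT x'|M. q x' * x x'\<bar> + \<bar>l x\<bar>"
      using ab by (simp add: abs_mult order_trans[OF abs_triangle_ineq])
    ultimately have 1: "\<bar>?f x\<bar> \<le> (\<beta> * nrm (L2_on M) q + nrm (dual (H1 \<Omega>)) l) * nrm (H1 \<Omega>) x"
      using V.dual_le[OF l x] by (simp add: algebra_simps)
    have "sqrt (min \<alpha> \<beta>) * nrm (H1 \<Omega>) x \<le> sqrt (energy \<alpha> \<beta> x x)"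
      using energy_coercive[OF ab, of x] n ab by (intro real_le_rsqrt) (simp add: power_mult_distrib)
    then have "nrm (H1 \<Omega>) x \<le> 1 / sqrt (min \<alpha> \<beta>) * nrm (energy_space \<alpha> \<beta>) x"
      using ab by (simp add: energy_space_def field_simps)
    from mult_left_mono[OF this, of "\<beta> * nrm (L2_on M) q + nrm (dual (H1 \<Omega>)) l"]
    have 2: "(\<beta> * nrm (L2_on M) q + nrm (dual (H1 \<Omega>)) l) * nrm (H1 \<Omega>) x \<le> ?C * nrm (energy_space \<alpha> \<beta>) x"
      using ab L.nrm_nonneg[OF q] V.nrm_dual_nonneg[OF l] by (simp add: mult.assoc)
    from 1 2 show "\<bar>?f x\<bar> \<le> ?C * nrm (energy_space \<alpha> \<beta>) x" by linarith
  qed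
  then show ?thesis using elliptic_iff by auto
qed

lemma elliptic_diff:
  assumes "q \<in> car (L2_on M)" "q' \<in> car (L2_on M)" "\<phi> \<in> car (H1 \<Omega>)" "\<phi>' \<in> car (H1 \<Omega>)"
    and "elliptic_eq \<Omega> \<alpha> \<beta> q \<phi> l" "elliptic_eq \<Omega> \<alpha> \<beta> q' \<phi>' l'"
  shows "elliptic_eq \<Omega> \<alpha> \<beta> (q - q') (\<phi> - \<phi>') (l - l')"
proof -
  have "energy \<alpha> \<beta> (\<phi> - \<phi>') \<psi> = \<beta> * (LINT x|M. (q - q') x * \<psi> x) + (l - l') \<psi>" if \<psi>: "\<psi> \<in> car (H1 \<Omega>)" for \<psi>
  proof -
    have "energy \<alpha> \<beta> (\<phi> - \<phi>') \<psi> = energy \<alpha> \<beta> \<phi> \<psi> - energy \<alpha> \<beta> \<phi>' \<psi>"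
      using energy_lincomb[OF assms(3,4) \<psi>, of \<alpha> \<beta> 1 "-1"] by simp
    moreover have "energy \<alpha> \<beta> \<phi> \<psi> = \<beta> * (LINT x|M. q x * \<psi> x) + l \<psi>"
      "energy \<alpha> \<beta> \<phi>' \<psi> = \<beta> * (LINT x|M. q' x * \<psi> x) + l' \<psi>"
      using assms \<psi> by (simp_all add: elliptic_iff)
    ultimately show ?thesis unfolding L.ip_diff_left[OF assms(1,2) H1D(1)[OF \<psi>]]
      by (simp add: right_diff_distrib)
  qed
  then show ?thesis using assms by (subst elliptic_iff) auto
qed

lemma elliptic_scale:
  assumes "q \<in> car (L2_on M)" "\<phi> \<in> car (H1 \<Omega>)" "elliptic_eq \<Omega> \<alpha> \<beta> q \<phi> l"
  shows "elliptic_eq \<Omega> \<alpha> \<beta> (c *\<^sub>R q) (c *\<^sub>R \<phi>) (c *\<^sub>R l)"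
proof -
  have "energy \<alpha> \<beta> (c *\<^sub>R \<phi>) \<psi> = \<beta> * (LINT x|M. (c *\<^sub>R q) x * \<psi> x) + (c *\<^sub>R l) \<psi>" if \<psi>: "\<psi> \<in> car (H1 \<Omega>)" for \<psi>
  proof -
    have "energy \<alpha> \<beta> (c *\<^sub>R \<phi>) \<psi> = c * energy \<alpha> \<beta> \<phi> \<psi>"
      using energy_lincomb[OF assms(2,2) \<psi>, of \<alpha> \<beta> c 0] by simp
    moreover have "energy \<alpha> \<beta> \<phi> \<psi> = \<beta> * (LINT x|M. q x * \<psi> x) + l \<psi>"
      using assms \<psi> by (simp add: elliptic_iff)
    ultimately show ?thesis unfolding L.ip_scale_left[OF assms(1) H1D(1)[OF \<psi>], of c]
      by (simp add: distrib_left)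
  qed
  then show ?thesis using assms by (subst elliptic_iff) auto
qed

text \<open>The equation is tested with \<phi>, and one factor of its norm is cancelled; \<beta> + 1
  dominates both the factor \<beta> of q and the factor 1 of l.\<close>

lemma elliptic_bound:
  assumes ab: "0 < \<alpha>" "0 < \<beta>" and q: "q \<in> car (L2_on M)" and l: "l \<in> car (dual (H1 \<Omega>))"
    and \<phi>: "\<phi> \<in> car (H1 \<Omega>)" "elliptic_eq \<Omega> \<alpha> \<beta> q \<phi> l"
  shows "nrm (H1 \<Omega>) \<phi> \<le> (\<beta> + 1) / min \<alpha> \<beta> * (nrm (L2_on M) q + nrm (dual (H1 \<Omega>)) l)"
proof -
  let ?m = "min \<alpha> \<beta>" and ?n = "nrm (H1 \<Omega>) \<phi>" and ?k = "nrm (L2_on M) q" and ?d = "nrm (dual (H1 \<Omega>)) l"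
  have n: "0 \<le> ?n" "0 \<le> ?k" "0 \<le> ?d" using V.nrm_nonneg \<phi> L.nrm_nonneg q V.nrm_dual_nonneg l by auto
  have m: "0 < ?m" using ab by simp
  have "?m * ?n\<^sup>2 \<le> \<beta> * (LINT x|M. q x * \<phi> x) + l \<phi>"
    using energy_coercive[OF ab, of \<phi>] \<phi> by (simp add: elliptic_iff)
  also have "\<dots> \<le> \<beta> * (?k * ?n) + ?d * ?n"
  proof (rule add_mono[OF mult_left_mono])
    show "(LINT x|M. q x * \<phi> x) \<le> ?k * ?n"
      using L.Cauchy_Schwarz[OF q H1D(1)[OF \<phi>(1)]] mult_left_mono[OF nrm_L2_le_H1[OF \<phi>(1)] n(2)] by linarith
    show "l \<phi> \<le> ?d * ?n" using V.dual_le[OF l \<phi>(1)] by linarith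
  qed (use ab in simp)
  also have "\<dots> \<le> (\<beta> + 1) * (?k + ?d) * ?n"
    using ab n by (simp add: algebra_simps)
  finally have "?n * (?m * ?n) \<le> ?n * ((\<beta> + 1) * (?k + ?d))" by (simp add: power2_eq_square mult_ac)
  then have "?m * ?n \<le> (\<beta> + 1) * (?k + ?d)"
    using n ab by (cases "?n = 0") auto
  then show ?thesis using m by (simp add: pos_le_divide_eq mult_ac)
qed

definition elliptic_solution
  where "elliptic_solution \<alpha> \<beta> q l = (SOME \<phi>. \<phi> \<in> car (H1 \<Omega>) \<and> elliptic_eq \<Omega> \<alpha> \<beta> q \<phi> l)"

lemma elliptic_solution:
  assumes "0 < \<alpha>" "0 < \<beta>" "q \<in> car (L2_on M)" "l \<in> car (dual (H1 \<Omega>))"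
  shows "elliptic_solution \<alpha> \<beta> q l \<in> car (H1 \<Omega>)" "elliptic_eq \<Omega> \<alpha> \<beta> q (elliptic_solution \<alpha> \<beta> q l) l"
proof -
  have "\<exists>\<phi>. \<phi> \<in> car (H1 \<Omega>) \<and> elliptic_eq \<Omega> \<alpha> \<beta> q \<phi> l" using elliptic_ex[OF assms] by blast
  from someI_ex[OF this] show "elliptic_solution \<alpha> \<beta> q l \<in> car (H1 \<Omega>)" "elliptic_eq \<Omega> \<alpha> \<beta> q (elliptic_solution \<alpha> \<beta> q l) l"
    by (simp_all add: elliptic_solution_def)
qed

lemma elliptic_stability:
  assumes ab: "0 < \<alpha>" "0 < \<beta>"
    and q: "q \<in> car (L2_on M)" "q' \<in> car (L2_on M)" and l: "l \<in> car (dual (H1 \<Omega>))" "l' \<in> car (dual (H1 \<Omega>))"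
    and \<phi>: "\<phi> \<in> car (H1 \<Omega>)" "elliptic_eq \<Omega> \<alpha> \<beta> q \<phi> l" "\<phi>' \<in> car (H1 \<Omega>)" "elliptic_eq \<Omega> \<alpha> \<beta> q' \<phi>' l'"
  shows "nrm (H1 \<Omega>) (\<phi> - \<phi>') \<le> (\<beta> + 1) / min \<alpha> \<beta> * (nrm (L2_on M) (q - q') + nrm (dual (H1 \<Omega>)) (l - l'))"
proof -
  interpret dual: seminormed "dual (H1 \<Omega>)" by (rule V.seminormed_dual)
  show ?thesis using assms by (intro elliptic_bound elliptic_diff) auto
qed

text \<open>The solutions are chosen independently at each time, yet they depend Lipschitz
  continuously on the data whatever the choice, and this gives strong measurability in time.\<close>

lemma elliptic_solution_bochner:
  assumes ab: "0 < \<alpha>" "0 < \<beta>" and q: "q \<in> car (bochner_L2 T (L2_on M))" and l: "l \<in> car (bochner_L2 T (dual (H1 \<Omega>)))"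
  shows "(\<lambda>t. elliptic_solution \<alpha> \<beta> (q t) (l t)) \<in> car (bochner_L2 T (H1 \<Omega>))"
proof -
  interpret dual: seminormed "dual (H1 \<Omega>)" by (rule V.seminormed_dual)
  interpret Y: prehilbert "L2_on (time T)" "\<lambda>u v. LINT x|time T. u x * v x" by (rule prehilbert_L2_on)
  note s = elliptic_solution[OF ab]
  let ?C = "(\<beta> + 1) / min \<alpha> \<beta>"
  have sm: "strongly_measurable (time T) (H1 \<Omega>) (\<lambda>t. elliptic_solution \<alpha> \<beta> (q t) (l t))"
  proof (rule strongly_measurable_compose2[where F="elliptic_solution \<alpha> \<beta>" and C="?C",
        OF L.seminormed_axioms V.seminormed_dual V.seminormed_axioms L.bochner_L2D(1)[OF q] dual.bochner_L2D(1)[OF l]])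
    fix a b a' b' assume c: "a \<in> car (L2_on M)" "b \<in> car (dual (H1 \<Omega>))" "a' \<in> car (L2_on M)" "b' \<in> car (dual (H1 \<Omega>))"
    show "nrm (H1 \<Omega>) (elliptic_solution \<alpha> \<beta> a' b' - elliptic_solution \<alpha> \<beta> a b) \<le> ?C * (nrm (L2_on M) (a' - a) + nrm (dual (H1 \<Omega>)) (b' - b))"
      by (rule elliptic_stability[OF ab c(3,1,4,2) s(1,2)[OF c(3,4)] s(1,2)[OF c(1,2)]])
  qed (rule s(1))
  let ?g = "?C *\<^sub>R ((\<lambda>t. nrm (L2_on M) (q t)) + (\<lambda>t. nrm (dual (H1 \<Omega>)) (l t)))"
  have g: "?g \<in> car (L2_on (time T))"
    using L.bochner_L2D(2)[OF q] dual.bochner_L2D(2)[OF l] by (intro Y.scale_car Y.add_car)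
  show ?thesis
  proof (rule V.bochner_L2_bound(1)[OF sm g], rule AE_I2)
    fix t assume "t \<in> space (time T)"
    then have "q t \<in> car (L2_on M)" "l t \<in> car (dual (H1 \<Omega>))"
      using L.bochner_L2D(4)[OF q] dual.bochner_L2D(4)[OF l] by auto
    from elliptic_bound[OF ab this s[OF this]]
    show "nrm (H1 \<Omega>) (elliptic_solution \<alpha> \<beta> (q t) (l t)) \<le> ?g t" by simp
  qed
qed

end

section \<open>Evolution equations coupled to the elliptic equation\<close>

context bounded_open begin

lemma H1_bochner_L2:
  assumes w: "w \<in> car (bochner_L2 T (H1 \<Omega>))"
  shows "w \<in> car (bochner_L2 T (L2_on M))"
proof (rule L.bochner_L2_bound(1)[OF _ V.bochner_L2D(2)[OF w]])
  show "strongly_measurable (time T) (L2_on M) w"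
  proof (rule strongly_measurable_compose[where F="\<lambda>u. u" and C=1, OF V.seminormed_axioms L.seminormed_axioms V.bochner_L2D(1)[OF w]])
    show "a \<in> car (L2_on M)" if "a \<in> car (H1 \<Omega>)" for a by (rule H1D(1)[OF that])
    show "nrm (L2_on M) (a' - a) \<le> 1 * nrm (H1 \<Omega>) (a' - a)" if "a \<in> car (H1 \<Omega>)" "a' \<in> car (H1 \<Omega>)" for a a'
      using nrm_L2_le_H1[OF V.diff_car[OF that(2,1)]] by simp
  qed
  show "AE t in time T. nrm (L2_on M) (w t) \<le> nrm (H1 \<Omega>) (w t)"
    by (rule AE_I2, rule nrm_L2_le_H1, rule V.bochner_L2D(4)[OF w]) auto
qed

definition coupled_space
  where "coupled_space T = prod_space (bochner_H10 T (L2_on M)) (bochner_L2 T (H1 \<Omega>))"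

lemma car_coupled_space: "(u, w) \<in> car (coupled_space T) \<longleftrightarrow> u \<in> car (bochner_H10 T (L2_on M)) \<and> w \<in> car (bochner_L2 T (H1 \<Omega>))"
  by (simp add: coupled_space_def prod_space_def)

lemma seminormed_coupled_space: "0 < T \<Longrightarrow> seminormed (coupled_space T)"
  unfolding coupled_space_def by (intro seminormed_prod_space L.seminormed_bochner_H10 V.seminormed_bochner_L2)

definition elliptic_const where "elliptic_const \<alpha> \<beta> = (\<beta> + 1) / min \<alpha> \<beta>"

text \<open>Here c bounds w by u and the load k. \<open>K\<close> and \<open>K1\<close> are the
  constants of \<open>ODE_stability\<close> for the Lipschitz constant \<open>A * (1 + c)\<close>;
  \<open>1 + A * c\<close> comes from moving the load into the residual; \<open>T\<close>,
  \<open>1\<close> and \<open>c * T\<close> bound u, its derivative and the part of w caused by u in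
  terms of the derivative; the last c is the part of w caused by k.\<close>

definition coupled_const where
  "coupled_const T \<alpha> \<beta> A = (let c = elliptic_const \<alpha> \<beta>; K = A * (1 + c) * (1 + T) + 1; K1 = 2 * K * T * exp (2 * K * T) + 1
    in (T + 1 + c * T) * K1 * (1 + A * c) + c)"

text \<open>The a priori estimate behind uniqueness, stability and differentiability: differences of
  solutions and errors of difference quotients both satisfy its hypotheses. The elliptic bound
  eliminates w at each time, after which \<open>ODE_stability\<close> applies to u.\<close>

lemma coupled_estimate:
  assumes T: "0 < T" and ab: "0 < \<alpha>" "0 < \<beta>" and A: "0 \<le> A"
    and u: "u \<in> car (bochner_H10 T (L2_on M))" and w: "w \<in> car (bochner_L2 T (H1 \<Omega>))"
    and k: "k \<in> car (bochner_L2 T (dual (H1 \<Omega>)))" and r: "r \<in> car (L2_on (time T))"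
    and ell: "AE t in time T. elliptic_eq \<Omega> \<alpha> \<beta> (u t) (w t) (k t)"
    and le: "AE t in time T. nrm (L2_on M) (tderiv T (L2_on M) u t)
      \<le> A * (nrm (L2_on M) (u t) + nrm (L2_on M) (w t) + (LINT s|time t. nrm (L2_on M) (u s))) + r t"
  shows "nrm (coupled_space T) (u, w) \<le> coupled_const T \<alpha> \<beta> A * (nrm (L2_on (time T)) r + nrm (bochner_L2 T (dual (H1 \<Omega>))) k)"
proof -
  interpret dual: seminormed "dual (H1 \<Omega>)" by (rule V.seminormed_dual)
  interpret Y: prehilbert "L2_on (time T)" "\<lambda>u v. LINT x|time T. u x * v x" by (rule prehilbert_L2_on)
  interpret B: seminormed "bochner_L2 T (L2_on M)" by (rule L.seminormed_bochner_L2)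
  interpret VB: seminormed "bochner_L2 T (H1 \<Omega>)" by (rule V.seminormed_bochner_L2)
  interpret W: seminormed "bochner_L2 T (dual (H1 \<Omega>))" by (rule dual.seminormed_bochner_L2)
  let ?c = "elliptic_const \<alpha> \<beta>" and ?v = "tderiv T (L2_on M) u"
  have c: "0 < ?c" using ab by (simp add: elliptic_const_def)
  note uD = L.bochner_H10D[OF u]
  let ?kn = "\<lambda>t. nrm (dual (H1 \<Omega>)) (k t)" and ?un = "\<lambda>t. nrm (L2_on M) (u t)"
  have kn: "?kn \<in> car (L2_on (time T))" and un: "?un \<in> car (L2_on (time T))"
    using dual.bochner_L2D(2)[OF k] L.bochner_L2D(2)[OF uD(1)] .
  have wle: "AE t in time T. nrm (H1 \<Omega>) (w t) \<le> ?c * (?un t + ?kn t)"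
    using ell AE_space
  proof eventually_elim
    case (elim t)
    then have t: "0 < t" "t < T" by auto
    show ?case unfolding elliptic_const_def
      by (rule elliptic_bound[OF ab L.bochner_L2D(4)[OF uD(1) t] dual.bochner_L2D(4)[OF k t] V.bochner_L2D(4)[OF w t] elim(1)])
  qed
  let ?r = "r + (A * ?c) *\<^sub>R ?kn"
  have rc: "?r \<in> car (L2_on (time T))" using r kn by (intro Y.add_car Y.scale_car)
  have "AE t in time T. nrm (L2_on M) (?v t) \<le> A * (1 + ?c) * (?un t + (LINT s|time t. ?un s)) + ?r t"
    using le wle AE_space
  proof eventually_elim
    case (elim t)
    then have t: "0 < t" "t < T" by auto
    have i: "0 \<le> (LINT s|time t. ?un s)" using t by (intro L.nrm_integral_nonneg[OF uD(1)]) auto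
    have "nrm (L2_on M) (w t) \<le> ?c * (?un t + ?kn t)"
      using nrm_L2_le_H1[OF V.bochner_L2D(4)[OF w t]] elim(2) by linarith
    \<comment> \<open>The memory integral is enlarged by the factor 1 + c so that
      \<open>A * (1 + c)\<close> can be taken out of both terms.\<close>
    then have "A * (?un t + nrm (L2_on M) (w t) + (LINT s|time t. ?un s)) \<le> A * (?un t + ?c * (?un t + ?kn t) + (1 + ?c) * (LINT s|time t. ?un s))"
      using A c i by (intro mult_left_mono add_mono) (auto simp: mult_le_cancel_right1 algebra_simps)
    then show ?case using elim(1) by (simp add: algebra_simps)
  qed
  note st = L.ODE_stability[OF T _ uD(1,2,3) rc this]
  define K where "K = A * (1 + ?c) * (1 + T) + 1"
  define K1 where "K1 = 2 * K * T * exp (2 * K * T) + 1"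
  have Ac: "0 \<le> A * (1 + ?c)" using A c by simp
  then have K0: "0 \<le> K" unfolding K_def using T by simp
  then have K1: "0 \<le> K1" unfolding K1_def using T by simp
  let ?s = "nrm (L2_on (time T)) r + nrm (bochner_L2 T (dual (H1 \<Omega>))) k"
  have kk: "nrm (L2_on (time T)) ?kn = nrm (bochner_L2 T (dual (H1 \<Omega>))) k" by (simp add: nrm_bochner_L2)
  have n0: "0 \<le> nrm (L2_on (time T)) r" "0 \<le> nrm (bochner_L2 T (dual (H1 \<Omega>))) k" using Y.nrm_nonneg[OF r] W.nrm_nonneg[OF k] .
  have "nrm (L2_on (time T)) ?r \<le> nrm (L2_on (time T)) r + nrm (L2_on (time T)) ((A * ?c) *\<^sub>R ?kn)"
    by (rule Y.nrm_triangle[OF r Y.scale_car[OF kn]])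
  also have "nrm (L2_on (time T)) ((A * ?c) *\<^sub>R ?kn) = A * ?c * nrm (bochner_L2 T (dual (H1 \<Omega>))) k"
    using Y.nrm_scale[OF kn, of "A * ?c"] A c kk by simp
  also have "nrm (L2_on (time T)) r + A * ?c * nrm (bochner_L2 T (dual (H1 \<Omega>))) k \<le> (1 + A * ?c) * ?s"
    using n0 A c by (simp add: algebra_simps)
  finally have rn: "nrm (L2_on (time T)) ?r \<le> (1 + A * ?c) * ?s" .
  have v: "nrm (bochner_L2 T (L2_on M)) ?v \<le> K1 * ((1 + A * ?c) * ?s)"
    using st(1)[OF Ac] mult_left_mono[OF rn K1] unfolding K1_def K_def by linarith
  have u1: "nrm (bochner_L2 T (L2_on M)) u \<le> T * nrm (bochner_L2 T (L2_on M)) ?v" by (rule st(2)[OF Ac])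
  have "nrm (bochner_L2 T (H1 \<Omega>)) w \<le> nrm (L2_on (time T)) (?c *\<^sub>R (?un + ?kn))"
    by (rule V.bochner_L2_bound(2)[OF V.bochner_L2D(1)[OF w] Y.scale_car[OF Y.add_car[OF un kn]]]) (use wle in simp)
  also have "\<dots> = ?c * nrm (L2_on (time T)) (?un + ?kn)" using Y.nrm_scale[OF Y.add_car[OF un kn], of ?c] c by simp
  also have "\<dots> \<le> ?c * (nrm (bochner_L2 T (L2_on M)) u + nrm (bochner_L2 T (dual (H1 \<Omega>))) k)"
    using Y.nrm_triangle[OF un kn] c by (intro mult_left_mono) (simp_all add: nrm_bochner_L2)
  finally have w1: "nrm (bochner_L2 T (H1 \<Omega>)) w \<le> ?c * (nrm (bochner_L2 T (L2_on M)) u + nrm (bochner_L2 T (dual (H1 \<Omega>))) k)" .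
  have "nrm (coupled_space T) (u, w) = sqrt ((nrm (bochner_L2 T (L2_on M)) u)\<^sup>2 + (nrm (bochner_L2 T (L2_on M)) ?v)\<^sup>2 + (nrm (bochner_L2 T (H1 \<Omega>)) w)\<^sup>2)"
    by (simp add: coupled_space_def prod_space_def L.nrm_bochner_H10)
  also have "\<dots> \<le> sqrt ((nrm (bochner_L2 T (L2_on M)) u)\<^sup>2 + (nrm (bochner_L2 T (L2_on M)) ?v)\<^sup>2) + nrm (bochner_L2 T (H1 \<Omega>)) w"
    using sqrt_add_le_add_sqrt[of "(nrm (bochner_L2 T (L2_on M)) u)\<^sup>2 + (nrm (bochner_L2 T (L2_on M)) ?v)\<^sup>2" "(nrm (bochner_L2 T (H1 \<Omega>)) w)\<^sup>2"]
      VB.nrm_nonneg[OF w] by simp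
  also have "\<dots> \<le> nrm (bochner_L2 T (L2_on M)) u + nrm (bochner_L2 T (L2_on M)) ?v + nrm (bochner_L2 T (H1 \<Omega>)) w"
    using sqrt_add_le_add_sqrt[of "(nrm (bochner_L2 T (L2_on M)) u)\<^sup>2" "(nrm (bochner_L2 T (L2_on M)) ?v)\<^sup>2"]
      B.nrm_nonneg[OF uD(1)] B.nrm_nonneg[OF uD(4)] by simp
  also have "\<dots> \<le> (T + 1 + ?c * T) * nrm (bochner_L2 T (L2_on M)) ?v + ?c * ?s"
    using u1 w1 mult_left_mono[OF u1, of ?c] mult_nonneg_nonneg[OF less_imp_le[OF c] n0(1)] c
    unfolding ring_distribs by linarith
  also have "\<dots> \<le> (T + 1 + ?c * T) * (K1 * ((1 + A * ?c) * ?s)) + ?c * ?s"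
    using mult_left_mono[OF v, of "T + 1 + ?c * T"] T c by simp
  also have "\<dots> = coupled_const T \<alpha> \<beta> A * ?s"
    by (simp add: coupled_const_def Let_def K1_def K_def algebra_simps)
  finally show ?thesis .
qed

text \<open>The structure shared by the state equation and its linearization: Lipschitz at almost
  every time, with memory in the first argument only and with \<phi> measured merely in L2.\<close>

definition lipschitz_rhs where
  "lipschitz_rhs T A R \<longleftrightarrow> 0 \<le> A
    \<and> (\<forall>p\<in>car (bochner_L2 T (L2_on M)). \<forall>\<phi>\<in>car (bochner_L2 T (L2_on M)). R p \<phi> \<in> car (bochner_L2 T (L2_on M)))
    \<and> (\<forall>p\<in>car (bochner_L2 T (L2_on M)). \<forall>\<phi>\<in>car (bochner_L2 T (L2_on M)).
       \<forall>p'\<in>car (bochner_L2 T (L2_on M)). \<forall>\<phi>'\<in>car (bochner_L2 T (L2_on M)).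
        AE t in time T. nrm (L2_on M) (R p \<phi> t - R p' \<phi>' t)
          \<le> A * (nrm (L2_on M) (p t - p' t) + nrm (L2_on M) (\<phi> t - \<phi>' t) + (LINT s|time t. nrm (L2_on M) (p s - p' s))))"

definition coupled_solution where
  "coupled_solution T \<alpha> \<beta> R l y \<longleftrightarrow> y \<in> car (coupled_space T) \<and>
    (case y of (u, w) \<Rightarrow> (AE t in time T. nrm (L2_on M) (tderiv T (L2_on M) u t - R u w t) = 0)
      \<and> (AE t in time T. elliptic_eq \<Omega> \<alpha> \<beta> (u t) (w t) (l t)))"

lemma lipschitz_rhsD:
  assumes "lipschitz_rhs T A R"
  shows "0 \<le> A"
    "p \<in> car (bochner_L2 T (L2_on M)) \<Longrightarrow> \<phi> \<in> car (bochner_L2 T (L2_on M)) \<Longrightarrow> R p \<phi> \<in> car (bochner_L2 T (L2_on M))"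
    "p \<in> car (bochner_L2 T (L2_on M)) \<Longrightarrow> \<phi> \<in> car (bochner_L2 T (L2_on M)) \<Longrightarrow>
      p' \<in> car (bochner_L2 T (L2_on M)) \<Longrightarrow> \<phi>' \<in> car (bochner_L2 T (L2_on M)) \<Longrightarrow>
        AE t in time T. nrm (L2_on M) (R p \<phi> t - R p' \<phi>' t)
          \<le> A * (nrm (L2_on M) (p t - p' t) + nrm (L2_on M) (\<phi> t - \<phi>' t) + (LINT s|time t. nrm (L2_on M) (p s - p' s)))"
  using assms unfolding lipschitz_rhs_def by blast+

text \<open>The elliptic equation contains no time derivative, so \<phi> is eliminated as a function
  of q at each time; the reduced right-hand side keeps its Lipschitz and memory structure, and
  \<open>ODE_existence\<close> applies.\<close>

theorem coupled_existence:
  assumes T: "0 < T" and ab: "0 < \<alpha>" "0 < \<beta>" and R: "lipschitz_rhs T A R"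
    and l: "l \<in> car (bochner_L2 T (dual (H1 \<Omega>)))"
  shows "\<exists>y. coupled_solution T \<alpha> \<beta> R l y"
proof -
  interpret dual: seminormed "dual (H1 \<Omega>)" by (rule V.seminormed_dual)
  note RD = lipschitz_rhsD[OF R]
  define \<Phi> where "\<Phi> q t = elliptic_solution \<alpha> \<beta> (q t) (l t)" for q :: "real \<Rightarrow> real^'n \<Rightarrow> real" and t
  have \<Phi>V: "\<Phi> q \<in> car (bochner_L2 T (H1 \<Omega>))" if "q \<in> car (bochner_L2 T (L2_on M))" for q
    using elliptic_solution_bochner[OF ab that l] unfolding \<Phi>_def .
  note \<Phi>B = H1_bochner_L2[OF \<Phi>V]
  let ?c = "elliptic_const \<alpha> \<beta>"
  have c: "0 < ?c" using ab by (simp add: elliptic_const_def)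
  have "\<exists>v\<in>car (bochner_L2 T (L2_on M)). AE t in time T. nrm (L2_on M) (v t - R (L.primitive v) (\<Phi> (L.primitive v)) t) = 0"
  proof (rule L.ODE_existence[OF T])
    show "0 \<le> A * (1 + ?c)" using RD(1) c by simp
    show "R q (\<Phi> q) \<in> car (bochner_L2 T (L2_on M))" if "q \<in> car (bochner_L2 T (L2_on M))" for q
      by (rule RD(2)[OF that \<Phi>B[OF that]])
    fix p q assume p: "p \<in> car (bochner_L2 T (L2_on M))" and q: "q \<in> car (bochner_L2 T (L2_on M))"
    show "AE t in time T. nrm (L2_on M) (R p (\<Phi> p) t - R q (\<Phi> q) t)
        \<le> A * (1 + ?c) * (nrm (L2_on M) (p t - q t) + (LINT s|time t. nrm (L2_on M) (p s - q s)))"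
      using RD(3)[OF p \<Phi>B[OF p] q \<Phi>B[OF q]] AE_space
    proof eventually_elim
      case (elim t)
      then have t: "0 < t" "t < T" by auto
      note pt = L.bochner_L2D(4)[OF p t] and qt = L.bochner_L2D(4)[OF q t] and lt = dual.bochner_L2D(4)[OF l t]
      note sp = elliptic_solution[OF ab pt lt] and sq = elliptic_solution[OF ab qt lt]
      have i: "0 \<le> (LINT s|time t. nrm (L2_on M) (p s - q s))"
        using t L.nrm_integral_nonneg[OF L.bochner_L2_diff[OF p q]] by auto
      have "nrm (L2_on M) (\<Phi> p t - \<Phi> q t) \<le> nrm (H1 \<Omega>) (\<Phi> p t - \<Phi> q t)"
        unfolding \<Phi>_def using sp(1) sq(1) by (intro nrm_L2_le_H1 V.diff_car)
      also have "\<dots> \<le> ?c * nrm (L2_on M) (p t - q t)"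
        using elliptic_stability[OF ab pt qt lt lt sp sq] unfolding \<Phi>_def elliptic_const_def by simp
      finally have "A * (nrm (L2_on M) (p t - q t) + nrm (L2_on M) (\<Phi> p t - \<Phi> q t) + (LINT s|time t. nrm (L2_on M) (p s - q s)))
        \<le> A * (nrm (L2_on M) (p t - q t) + ?c * nrm (L2_on M) (p t - q t) + (1 + ?c) * (LINT s|time t. nrm (L2_on M) (p s - q s)))"
        using RD(1) c i by (intro mult_left_mono add_mono) (auto simp: algebra_simps)
      then show ?case using elim(1) by (simp add: algebra_simps)
    qed
  qed
  then obtain v where v: "v \<in> car (bochner_L2 T (L2_on M))"
    and eq: "AE t in time T. nrm (L2_on M) (v t - R (L.primitive v) (\<Phi> (L.primitive v)) t) = 0" by blast
  let ?u = "L.primitive v"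
  have u: "?u \<in> car (bochner_L2 T (L2_on M))" by (rule L.primitive_bochner_L2[OF v T])
  have uH: "?u \<in> car (bochner_H10 T (L2_on M))" by (rule L.primitive_bochner_H10[OF v T])
  have "AE t in time T. nrm (L2_on M) (tderiv T (L2_on M) ?u t - R ?u (\<Phi> ?u) t) = 0"
    using eq L.tderiv_eq[OF uH L.weak_time_derivative_primitive[OF v T]] AE_space
  proof eventually_elim
    case (elim t)
    then have t: "0 < t" "t < T" by auto
    note cs = L.bochner_L2D(4)[OF L.bochner_H10D(4)[OF uH] t] L.bochner_L2D(4)[OF v t] L.bochner_L2D(4)[OF RD(2)[OF u \<Phi>B[OF u]] t]
    from L.nrm_diff_trans[OF cs] elim(1,2) L.nrm_nonneg[OF L.diff_car[OF cs(1,3)]] show ?case by simp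
  qed
  moreover have "AE t in time T. elliptic_eq \<Omega> \<alpha> \<beta> (?u t) (\<Phi> ?u t) (l t)"
  proof (rule AE_I2)
    fix t assume "t \<in> space (time T)"
    then have t: "0 < t" "t < T" by auto
    show "elliptic_eq \<Omega> \<alpha> \<beta> (?u t) (\<Phi> ?u t) (l t)"
      unfolding \<Phi>_def by (rule elliptic_solution(2)[OF ab L.bochner_L2D(4)[OF u t] dual.bochner_L2D(4)[OF l t]])
  qed
  ultimately have "coupled_solution T \<alpha> \<beta> R l (?u, \<Phi> ?u)"
    unfolding coupled_solution_def car_coupled_space using uH \<Phi>V[OF u] by simp
  then show ?thesis by blast
qed

lemma coupled_solutionD:
  assumes "coupled_solution T \<alpha> \<beta> R l (u, w)"
  shows "u \<in> car (bochner_H10 T (L2_on M))" "w \<in> car (bochner_L2 T (H1 \<Omega>))"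
    "AE t in time T. nrm (L2_on M) (tderiv T (L2_on M) u t - R u w t) = 0"
    "AE t in time T. elliptic_eq \<Omega> \<alpha> \<beta> (u t) (w t) (l t)"
  using assms by (auto simp: coupled_solution_def car_coupled_space)

text \<open>The difference of two solutions satisfies the hypotheses of
  \<open>coupled_estimate\<close> with zero residual; the loads enter only through the elliptic
  equation.\<close>

theorem coupled_stability:
  assumes T: "0 < T" and ab: "0 < \<alpha>" "0 < \<beta>" and R: "lipschitz_rhs T A R"
    and l: "l \<in> car (bochner_L2 T (dual (H1 \<Omega>)))" "l' \<in> car (bochner_L2 T (dual (H1 \<Omega>)))"
    and y: "coupled_solution T \<alpha> \<beta> R l y" and y': "coupled_solution T \<alpha> \<beta> R l' y'"
  shows "nrm (coupled_space T) (y - y') \<le> coupled_const T \<alpha> \<beta> A * nrm (bochner_L2 T (dual (H1 \<Omega>))) (l - l')"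
proof -
  interpret dual: seminormed "dual (H1 \<Omega>)" by (rule V.seminormed_dual)
  interpret Y: prehilbert "L2_on (time T)" "\<lambda>u v. LINT x|time T. u x * v x" by (rule prehilbert_L2_on)
  interpret H: seminormed "bochner_H10 T (L2_on M)" by (rule L.seminormed_bochner_H10[OF T])
  interpret VB: seminormed "bochner_L2 T (H1 \<Omega>)" by (rule V.seminormed_bochner_L2)
  interpret W: seminormed "bochner_L2 T (dual (H1 \<Omega>))" by (rule dual.seminormed_bochner_L2)
  obtain u w u' w' where e: "y = (u, w)" "y' = (u', w')" by (metis surj_pair)
  note D = coupled_solutionD[OF y[unfolded e]] and D' = coupled_solutionD[OF y'[unfolded e]]
  note RD = lipschitz_rhsD[OF R]
  note uB = L.bochner_H10D(1)[OF D(1)] and uB' = L.bochner_H10D(1)[OF D'(1)]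
  note wB = H1_bochner_L2[OF D(2)] and wB' = H1_bochner_L2[OF D'(2)]
  have "nrm (coupled_space T) (u - u', w - w')
      \<le> coupled_const T \<alpha> \<beta> A * (nrm (L2_on (time T)) 0 + nrm (bochner_L2 T (dual (H1 \<Omega>))) (l - l'))"
  proof (rule coupled_estimate[OF T ab RD(1)])
    show "AE t in time T. elliptic_eq \<Omega> \<alpha> \<beta> ((u - u') t) ((w - w') t) ((l - l') t)"
      using D(4) D'(4) AE_space
    proof eventually_elim
      case (elim t)
      then have t: "0 < t" "t < T" by auto
      show ?case using elliptic_diff[OF L.bochner_L2D(4)[OF uB t] L.bochner_L2D(4)[OF uB' t]
            V.bochner_L2D(4)[OF D(2) t] V.bochner_L2D(4)[OF D'(2) t] elim(1,2)] by simp
    qed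
    show "AE t in time T. nrm (L2_on M) (tderiv T (L2_on M) (u - u') t)
      \<le> A * (nrm (L2_on M) ((u - u') t) + nrm (L2_on M) ((w - w') t) + (LINT s|time t. nrm (L2_on M) ((u - u') s))) + 0 t"
      using L.bochner_H10_lincomb(2)[OF D(1) D'(1) T, of 1 "-1"] D(3) D'(3) RD(3)[OF uB wB uB' wB'] AE_space
    proof eventually_elim
      case (elim t)
      then have t: "0 < t" "t < T" by auto
      let ?v = "tderiv T (L2_on M) u t" and ?v' = "tderiv T (L2_on M) u' t" and ?d = "tderiv T (L2_on M) (u - u') t"
      let ?R = "R u w t" and ?R' = "R u' w' t"
      have c: "?v \<in> car (L2_on M)" "?v' \<in> car (L2_on M)" "?d \<in> car (L2_on M)" "?R \<in> car (L2_on M)" "?R' \<in> car (L2_on M)"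
        using L.bochner_L2D(4)[OF L.bochner_H10D(4)[OF D(1)] t] L.bochner_L2D(4)[OF L.bochner_H10D(4)[OF D'(1)] t]
          L.bochner_L2D(4)[OF L.bochner_H10D(4)[OF H.diff_car[OF D(1) D'(1)]] t]
          L.bochner_L2D(4)[OF RD(2)[OF uB wB] t] L.bochner_L2D(4)[OF RD(2)[OF uB' wB'] t] .
      have "nrm (L2_on M) ?d = nrm (L2_on M) (?v - ?v')"
        using elim(1) c by (intro L.nrm_eq_if_diff_zero) auto
      also have "\<dots> \<le> nrm (L2_on M) (?v - ?R) + nrm (L2_on M) (?R - ?v')"
        using c by (intro L.nrm_diff_trans)
      also have "nrm (L2_on M) (?R - ?v') \<le> nrm (L2_on M) (?R - ?R') + nrm (L2_on M) (?R' - ?v')"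
        using c by (intro L.nrm_diff_trans)
      also have "nrm (L2_on M) (?R' - ?v') = 0" using L.nrm_diff_commute[OF c(5,2)] elim(3) by simp
      finally have "nrm (L2_on M) ?d \<le> nrm (L2_on M) (?R - ?R')" using elim(2) by linarith
      then show ?case using elim(4) by simp
    qed
  qed (use D D' l in \<open>auto intro: Y.zero_car\<close>)
  then show ?thesis by (simp add: e)
qed

end

section \<open>Differentiability of the solution map\<close>

context seminormed begin

lemma nrm_zero_trans:
  assumes "x \<in> car X" "y \<in> car X" "z \<in> car X" "nrm X (x - y) = 0" "nrm X (y - z) = 0"
  shows "nrm X (x - z) = 0"
  using nrm_diff_trans[OF assms(1-3)] nrm_nonneg[OF diff_car[OF assms(1,3)]] assms(4,5) by simp

lemma nrm_zero_lincomb: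
  assumes "x \<in> car X" "x' \<in> car X" "y \<in> car X" "y' \<in> car X" "nrm X (x - x') = 0" "nrm X (y - y') = 0"
  shows "nrm X ((a *\<^sub>R x - b *\<^sub>R y) - (a *\<^sub>R x' - b *\<^sub>R y')) = 0"
proof -
  have e: "(a *\<^sub>R x - b *\<^sub>R y) - (a *\<^sub>R x' - b *\<^sub>R y') = a *\<^sub>R (x - x') - b *\<^sub>R (y - y')"
    by (simp add: algebra_simps)
  have c: "a *\<^sub>R (x - x') \<in> car X" "b *\<^sub>R (y - y') \<in> car X" using assms by blast+
  have "nrm X (a *\<^sub>R (x - x')) = 0" "nrm X (b *\<^sub>R (y - y')) = 0"
    using nrm_scale[OF diff_car[OF assms(1,2)], of a] nrm_scale[OF diff_car[OF assms(3,4)], of b] assms(5,6) by simp_all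
  then show ?thesis unfolding e using nrm_diff_le[OF c] nrm_nonneg[OF diff_car[OF c]] by simp
qed

lemma bochner_L2_mono:
  assumes u: "u \<in> car (bochner_L2 T X)" and v: "v \<in> car (bochner_L2 T X)" and C: "0 \<le> C"
    and le: "AE t in time T. nrm X (u t) \<le> C * nrm X (v t)"
  shows "nrm (bochner_L2 T X) u \<le> C * nrm (bochner_L2 T X) v"
  unfolding nrm_bochner_L2
proof (rule L2_on_bound(2)[OF bochner_L2D(2)[OF v] L2_onD(1)[OF bochner_L2D(2)[OF u]] _ C])
  show "AE t in time T. \<bar>nrm X (u t)\<bar> \<le> C * \<bar>nrm X (v t)\<bar>"
    using le AE_space
  proof eventually_elim
    case (elim t)
    then have "0 \<le> nrm X (u t)" "0 \<le> nrm X (v t)" using bochner_L2D(4)[OF u] bochner_L2D(4)[OF v] by (auto intro!: nrm_nonneg)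
    then show ?case using elim(1) by simp
  qed
qed

text \<open>The excess of the norm of v over g is at most the norm of \<open>w n - v\<close> for
  every n, so its L2 norm is zero. No pointwise convergent subsequence has to be extracted.\<close>

lemma bochner_L2_limit_bound:
  assumes w: "\<And>n. w n \<in> car (bochner_L2 T X)" and v: "v \<in> car (bochner_L2 T X)"
    and lim: "(\<lambda>n::nat. nrm (bochner_L2 T X) (w n - v)) \<longlonglongrightarrow> 0"
    and g: "g \<in> borel_measurable (time T)" and le: "\<And>n. AE t in time T. nrm X (w n t) \<le> g t"
  shows "AE t in time T. nrm X (v t) \<le> g t"
proof -
  interpret B: seminormed "bochner_L2 T X" by (rule seminormed_bochner_L2)
  define d where "d t = max 0 (nrm X (v t) - g t)" for t
  have [measurable]: "(\<lambda>t. nrm X (v t)) \<in> borel_measurable (time T)" "g \<in> borel_measurable (time T)"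
    using L2_onD(1)[OF bochner_L2D(2)[OF v]] g .
  have dm: "d \<in> borel_measurable (time T)" unfolding d_def by measurable
  have le': "AE t in time T. \<bar>d t\<bar> \<le> 1 * \<bar>nrm X ((w n - v) t)\<bar>" for n
    using le[of n] AE_space
  proof eventually_elim
    case (elim t)
    then have c: "w n t \<in> car X" "v t \<in> car X" using bochner_L2D(4)[OF v] bochner_L2D(4)[OF w] by auto
    show ?case using nrm_le_diff[OF c(2,1)] nrm_diff_commute[OF c] elim(1) nrm_nonneg[OF diff_car[OF c]] by (auto simp: d_def)
  qed
  have dL: "d \<in> car (L2_on (time T))" "nrm (L2_on (time T)) d \<le> nrm (bochner_L2 T X) (w n - v)" for n
    using L2_on_bound[OF bochner_L2D(2)[OF B.diff_car[OF w v]] dm le'] by (simp_all add: nrm_bochner_L2)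
  have "nrm (L2_on (time T)) d \<le> 0" using dL(2) by (intro LIMSEQ_le_const[OF lim]) auto
  then have "(LINT t|time T. (d t)\<^sup>2) = 0" by (simp add: nrm_L2_on antisym integral_nonneg_AE)
  then have "AE t in time T. (d t)\<^sup>2 = 0"
    using integral_nonneg_eq_0_iff_AE[OF L2_onD(2)[OF dL(1)]] by simp
  then show ?thesis by eventually_elim (auto simp: d_def max_def split: if_splits)
qed

end

context lipschitz_dir_diff begin

text \<open>The points y n need not lie on a ray. Replacing them by
  \<open>x + \<tau> n *\<^sub>R b\<close> causes an error e n that Lipschitz continuity bounds by L
  times the error of the inner quotient; on the ray itself only the remainder r n is left.\<close>

theorem chain_rule:
  assumes M: "finite_measure M" and x: "x \<in> car (bochner_L2 T (L2_on M))" and b: "b \<in> car (bochner_L2 T (L2_on M))"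
    and y: "\<And>n. y n \<in> car (bochner_L2 T (L2_on M))" and \<tau>: "\<tau> \<longlonglongrightarrow> 0" "\<And>n. 0 < \<tau> n"
    and lim: "(\<lambda>n. nrm (bochner_L2 T (L2_on M)) ((1 / \<tau> n) *\<^sub>R (y n - x) - b)) \<longlonglongrightarrow> 0"
  shows "(\<lambda>n. nrm (bochner_L2 T (L2_on M))
    ((1 / \<tau> n) *\<^sub>R ((\<lambda>t s. g (y n t s)) - (\<lambda>t s. g (x t s))) - (\<lambda>t s. dir_deriv g (x t s) (b t s)))) \<longlonglongrightarrow> 0"
proof -
  interpret X: hilbert "L2_on M" "\<lambda>u v. LINT x|M. u x * v x" by (rule hilbert_L2_on[OF M])
  interpret B: seminormed "bochner_L2 T (L2_on M)" by (rule X.seminormed_bochner_L2)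
  let ?B = "bochner_L2 T (L2_on M)"
  define e where "e n = (1 / \<tau> n) *\<^sub>R ((\<lambda>t s. g (y n t s)) - (\<lambda>t s. g ((x + \<tau> n *\<^sub>R b) t s)))" for n
  define r where "r n = (\<lambda>t s. rem (\<tau> n) (x t s) (b t s))" for n
  have xb: "x + \<tau> n *\<^sub>R b \<in> car ?B" for n using x b by blast
  have ec: "e n \<in> car ?B" for n
    unfolding e_def using Nemytskii_bochner_L2[OF M y] Nemytskii_bochner_L2[OF M xb] by blast
  have rc: "r n \<in> car ?B" for n unfolding r_def by (rule dir_deriv_bochner_L2(2)[OF M x b \<tau>(2)])
  have dc: "(1 / \<tau> n) *\<^sub>R (y n - x) - b \<in> car ?B" for n using x y b by blast
  have eq: "(1 / \<tau> n) *\<^sub>R ((\<lambda>t s. g (y n t s)) - (\<lambda>t s. g (x t s))) - (\<lambda>t s. dir_deriv g (x t s) (b t s)) = e n + r n" for n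
    by (auto simp: e_def r_def rem_def fun_eq_iff diff_divide_distrib)
  have en: "nrm ?B (e n) \<le> L * nrm ?B ((1 / \<tau> n) *\<^sub>R (y n - x) - b)" for n
  proof (rule X.bochner_L2_mono[OF ec dc L_nonneg], rule AE_I2)
    fix t assume "t \<in> space (time T)"
    then have t: "0 < t" "t < T" by auto
    note c = X.bochner_L2D(4)[OF ec t] X.bochner_L2D(4)[OF dc t]
    show "nrm (L2_on M) (e n t) \<le> L * nrm (L2_on M) (((1 / \<tau> n) *\<^sub>R (y n - x) - b) t)"
    proof (rule L2_on_bound(2)[OF c(2) L2_onD(1)[OF c(1)] _ L_nonneg], rule AE_I2)
      fix s
      have "\<bar>e n t s\<bar> = \<bar>g (y n t s) - g (x t s + \<tau> n * b t s)\<bar> / \<tau> n"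
        using \<tau>(2)[of n] by (simp add: e_def)
      also have "\<dots> \<le> (L * \<bar>y n t s - (x t s + \<tau> n * b t s)\<bar>) / \<tau> n"
        by (intro divide_right_mono lipschitz_abs less_imp_le[OF \<tau>(2)])
      also have "\<dots> = L * \<bar>(y n t s - (x t s + \<tau> n * b t s)) / \<tau> n\<bar>" using \<tau>(2)[of n] by simp
      also have "(y n t s - (x t s + \<tau> n * b t s)) / \<tau> n = ((1 / \<tau> n) *\<^sub>R (y n - x) - b) t s"
        using \<tau>(2)[of n] by (simp add: field_simps)
      finally show "\<bar>e n t s\<bar> \<le> L * \<bar>((1 / \<tau> n) *\<^sub>R (y n - x) - b) t s\<bar>" .
    qed
  qed
  show ?thesis unfolding eq
  proof (rule tendsto_zero_squeeze)
    show "(\<lambda>n. L * nrm ?B ((1 / \<tau> n) *\<^sub>R (y n - x) - b) + nrm ?B (r n)) \<longlonglongrightarrow> 0"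
      using tendsto_add[OF tendsto_mult_right_zero[OF lim, of L] rem_bochner_L2_tendsto[OF M x b \<tau>]] by (simp add: r_def)
    show "0 \<le> nrm ?B (e n + r n)" for n by (rule B.nrm_nonneg[OF B.add_car[OF ec rc]])
    show "nrm ?B (e n + r n) \<le> L * nrm ?B ((1 / \<tau> n) *\<^sub>R (y n - x) - b) + nrm ?B (r n)" for n
      using B.nrm_triangle[OF ec rc, of n n] en[of n] by linarith
  qed
qed

end

context bounded_open begin

text \<open>The increment of R is split at the point on the ray. From the perturbed solution to the
  ray the distance is \<tau> times the error of the quotient, so after division by \<tau> the
  Lipschitz bound has exactly the form that \<open>coupled_estimate\<close> absorbs. The rest is the
  quotient error of R along the ray, which no longer involves the perturbed solution.\<close>

lemma coupled_quotient_estimate: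
  assumes T: "0 < T" and ab: "0 < \<alpha>" "0 < \<beta>" and R: "lipschitz_rhs T A R" and \<tau>: "0 < \<tau>"
    and l: "l \<in> car (bochner_L2 T (dual (H1 \<Omega>)))" "\<delta>l \<in> car (bochner_L2 T (dual (H1 \<Omega>)))"
    and y: "coupled_solution T \<alpha> \<beta> R l (u, w)" and y\<tau>: "coupled_solution T \<alpha> \<beta> R (l + \<tau> *\<^sub>R \<delta>l) (u\<tau>, w\<tau>)"
    and \<delta>y: "coupled_solution T \<alpha> \<beta> R' \<delta>l (\<delta>u, \<delta>w)" and R': "R' \<delta>u \<delta>w \<in> car (bochner_L2 T (L2_on M))"
  shows "nrm (coupled_space T) ((1 / \<tau>) *\<^sub>R ((u\<tau>, w\<tau>) - (u, w)) - (\<delta>u, \<delta>w)) \<le> coupled_const T \<alpha> \<beta> A *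
    nrm (bochner_L2 T (L2_on M)) ((1 / \<tau>) *\<^sub>R (R (u + \<tau> *\<^sub>R \<delta>u) (w + \<tau> *\<^sub>R \<delta>w) - R u w) - R' \<delta>u \<delta>w)"
proof -
  interpret dual: seminormed "dual (H1 \<Omega>)" by (rule V.seminormed_dual)
  interpret H: seminormed "bochner_H10 T (L2_on M)" by (rule L.seminormed_bochner_H10[OF T])
  interpret B: seminormed "bochner_L2 T (L2_on M)" by (rule L.seminormed_bochner_L2)
  interpret VB: seminormed "bochner_L2 T (H1 \<Omega>)" by (rule V.seminormed_bochner_L2)
  note D = coupled_solutionD[OF y] and D\<tau> = coupled_solutionD[OF y\<tau>] and \<delta>D = coupled_solutionD[OF \<delta>y]
  note RD = lipschitz_rhsD[OF R]
  note uB = L.bochner_H10D(1)[OF D(1)] and u\<tau>B = L.bochner_H10D(1)[OF D\<tau>(1)] and \<delta>uB = L.bochner_H10D(1)[OF \<delta>D(1)]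
  note wB = H1_bochner_L2[OF D(2)] and w\<tau>B = H1_bochner_L2[OF D\<tau>(2)] and \<delta>wB = H1_bochner_L2[OF \<delta>D(2)]
  let ?e = "(1 / \<tau>) *\<^sub>R (u\<tau> - u) - \<delta>u" and ?f = "(1 / \<tau>) *\<^sub>R (w\<tau> - w) - \<delta>w"
  let ?u = "u + \<tau> *\<^sub>R \<delta>u" and ?w = "w + \<tau> *\<^sub>R \<delta>w"
  let ?r = "(1 / \<tau>) *\<^sub>R (R ?u ?w - R u w) - R' \<delta>u \<delta>w"
  have uB2: "?u \<in> car (bochner_L2 T (L2_on M))" and wB2: "?w \<in> car (bochner_L2 T (L2_on M))"
    using uB \<delta>uB wB \<delta>wB by blast+
  have d: "u\<tau> - u \<in> car (bochner_H10 T (L2_on M))" using D(1) D\<tau>(1) by blast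
  have e: "?e \<in> car (bochner_H10 T (L2_on M))" using d \<delta>D(1) by blast
  have eB: "?e \<in> car (bochner_L2 T (L2_on M))" by (rule L.bochner_H10D(1)[OF e])
  have f: "?f \<in> car (bochner_L2 T (H1 \<Omega>))" using D(2) D\<tau>(2) \<delta>D(2) by blast
  have rB: "?r \<in> car (bochner_L2 T (L2_on M))"
    using RD(2)[OF uB2 wB2] RD(2)[OF uB wB] R' by blast
  have "nrm (coupled_space T) (?e, ?f)
      \<le> coupled_const T \<alpha> \<beta> A * (nrm (L2_on (time T)) (\<lambda>t. nrm (L2_on M) (?r t)) + nrm (bochner_L2 T (dual (H1 \<Omega>))) 0)"
  proof (rule coupled_estimate[OF T ab RD(1) e f])
    show "0 \<in> car (bochner_L2 T (dual (H1 \<Omega>)))"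
      using seminormed.zero_car[OF dual.seminormed_bochner_L2] .
    show "(\<lambda>t. nrm (L2_on M) (?r t)) \<in> car (L2_on (time T))" by (rule L.bochner_L2D(2)[OF rB])
    show "AE t in time T. elliptic_eq \<Omega> \<alpha> \<beta> (?e t) (?f t) (0 t)"
      using D(4) D\<tau>(4) \<delta>D(4) AE_space
    proof eventually_elim
      case (elim t)
      then have t: "0 < t" "t < T" by auto
      note c = L.bochner_L2D(4)[OF uB t] L.bochner_L2D(4)[OF u\<tau>B t] L.bochner_L2D(4)[OF \<delta>uB t]
        V.bochner_L2D(4)[OF D(2) t] V.bochner_L2D(4)[OF D\<tau>(2) t] V.bochner_L2D(4)[OF \<delta>D(2) t]
      note 1 = elliptic_diff[OF c(2,1,5,4) elim(2,1)]
      note 2 = elliptic_scale[OF L.diff_car[OF c(2,1)] V.diff_car[OF c(5,4)] 1, of "1 / \<tau>"]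
      note 3 = elliptic_diff[OF L.scale_car[OF L.diff_car[OF c(2,1)]] c(3) V.scale_car[OF V.diff_car[OF c(5,4)]] c(6) 2 elim(3)]
      \<comment> \<open>The elliptic equation is linear, so the loads cancel exactly and the
        estimate is applied with zero load.\<close>
      have "(1 / \<tau>) *\<^sub>R ((l + \<tau> *\<^sub>R \<delta>l) t - l t) - \<delta>l t = 0 t" using \<tau> by simp
      with 3 show ?case by simp
    qed
    show "AE t in time T. nrm (L2_on M) (tderiv T (L2_on M) ?e t)
      \<le> A * (nrm (L2_on M) (?e t) + nrm (L2_on M) (?f t) + (LINT s|time t. nrm (L2_on M) (?e s))) + nrm (L2_on M) (?r t)"
      using L.bochner_H10_lincomb(2)[OF D\<tau>(1) D(1) T, of 1 "-1"] L.bochner_H10_lincomb(2)[OF d \<delta>D(1) T, of "1 / \<tau>" "-1"]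
        D(3) D\<tau>(3) \<delta>D(3) RD(3)[OF u\<tau>B w\<tau>B uB2 wB2] AE_space
    proof eventually_elim
      case (elim t)
      then have t: "0 < t" "t < T" by auto
      let ?v = "tderiv T (L2_on M) u t" and ?v\<tau> = "tderiv T (L2_on M) u\<tau> t" and ?\<delta>v = "tderiv T (L2_on M) \<delta>u t"
      let ?dv = "tderiv T (L2_on M) (u\<tau> - u) t" and ?ev = "tderiv T (L2_on M) ?e t"
      let ?R = "R u w t" and ?R\<tau> = "R u\<tau> w\<tau> t" and ?R2 = "R ?u ?w t" and ?R' = "R' \<delta>u \<delta>w t"
      have c: "?v \<in> car (L2_on M)" "?v\<tau> \<in> car (L2_on M)" "?\<delta>v \<in> car (L2_on M)" "?dv \<in> car (L2_on M)" "?ev \<in> car (L2_on M)"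
        "?R \<in> car (L2_on M)" "?R\<tau> \<in> car (L2_on M)" "?R2 \<in> car (L2_on M)" "?R' \<in> car (L2_on M)"
        using L.bochner_L2D(4)[OF L.bochner_H10D(4)[OF D(1)] t] L.bochner_L2D(4)[OF L.bochner_H10D(4)[OF D\<tau>(1)] t]
          L.bochner_L2D(4)[OF L.bochner_H10D(4)[OF \<delta>D(1)] t] L.bochner_L2D(4)[OF L.bochner_H10D(4)[OF d] t]
          L.bochner_L2D(4)[OF L.bochner_H10D(4)[OF e] t]
          L.bochner_L2D(4)[OF RD(2)[OF uB wB] t] L.bochner_L2D(4)[OF RD(2)[OF u\<tau>B w\<tau>B] t]
          L.bochner_L2D(4)[OF RD(2)[OF uB2 wB2] t] L.bochner_L2D(4)[OF R' t] .
      \<comment> \<open>Chosen time derivatives are now replaced by right-hand sides. Each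
        replacement is exact only up to seminorm zero, so they are chained by
        \<open>nrm_zero_lincomb\<close> and \<open>nrm_zero_trans\<close>; the factors 1 fit the
        shape of the former.\<close>
      have z1: "nrm (L2_on M) (?dv - (1 *\<^sub>R ?v\<tau> - 1 *\<^sub>R ?v)) = 0" using elim(1) by simp
      have z2: "nrm (L2_on M) ((1 *\<^sub>R ?v\<tau> - 1 *\<^sub>R ?v) - (1 *\<^sub>R ?R\<tau> - 1 *\<^sub>R ?R)) = 0"
        by (rule L.nrm_zero_lincomb[OF c(2,7,1,6) elim(4,3)])
      have m: "1 *\<^sub>R ?v\<tau> - 1 *\<^sub>R ?v \<in> car (L2_on M)" "1 *\<^sub>R ?R\<tau> - 1 *\<^sub>R ?R \<in> car (L2_on M)"
        using c by blast+
      note z3 = L.nrm_zero_trans[OF c(4) m z1 z2]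
      note z4 = L.nrm_zero_lincomb[OF c(4) m(2) c(3,9) z3 elim(5), of "1 / \<tau>" 1]
      have z5: "nrm (L2_on M) (?ev - ((1 / \<tau>) *\<^sub>R ?dv - 1 *\<^sub>R ?\<delta>v)) = 0" using elim(2) by simp
      have m2: "(1 / \<tau>) *\<^sub>R ?dv - 1 *\<^sub>R ?\<delta>v \<in> car (L2_on M)" "(1 / \<tau>) *\<^sub>R (1 *\<^sub>R ?R\<tau> - 1 *\<^sub>R ?R) - 1 *\<^sub>R ?R' \<in> car (L2_on M)"
        using c m by blast+
      note z6 = L.nrm_zero_trans[OF c(5) m2 z5 z4]
      have q: "(1 / \<tau>) *\<^sub>R (?R\<tau> - ?R2) \<in> car (L2_on M)" "?r t \<in> car (L2_on M)"
        using c L.bochner_L2D(4)[OF rB t] by blast+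
      have "nrm (L2_on M) ?ev = nrm (L2_on M) ((1 / \<tau>) *\<^sub>R (1 *\<^sub>R ?R\<tau> - 1 *\<^sub>R ?R) - 1 *\<^sub>R ?R')"
        by (rule L.nrm_eq_if_diff_zero[OF c(5) m2(2) z6])
      also have "(1 / \<tau>) *\<^sub>R (1 *\<^sub>R ?R\<tau> - 1 *\<^sub>R ?R) - 1 *\<^sub>R ?R' = (1 / \<tau>) *\<^sub>R (?R\<tau> - ?R2) + ?r t"
        by (auto simp: fun_eq_iff diff_divide_distrib)
      also have "nrm (L2_on M) \<dots> \<le> nrm (L2_on M) ((1 / \<tau>) *\<^sub>R (?R\<tau> - ?R2)) + nrm (L2_on M) (?r t)"
        by (rule L.nrm_triangle[OF q])
      also have "nrm (L2_on M) ((1 / \<tau>) *\<^sub>R (?R\<tau> - ?R2)) = (1 / \<tau>) * nrm (L2_on M) (?R\<tau> - ?R2)"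
        using L.nrm_scale[OF L.diff_car[OF c(7,8)], of "1 / \<tau>"] \<tau> by simp
      finally have ev: "nrm (L2_on M) ?ev \<le> (1 / \<tau>) * nrm (L2_on M) (?R\<tau> - ?R2) + nrm (L2_on M) (?r t)" .
      have ue: "nrm (L2_on M) (u\<tau> s - ?u s) = \<tau> * nrm (L2_on M) (?e s)" if s: "0 < s" "s < T" for s
      proof -
        have "u\<tau> s - ?u s = \<tau> *\<^sub>R ?e s" using \<tau> by (auto simp: fun_eq_iff field_simps)
        then show ?thesis using L.nrm_scale[OF L.bochner_L2D(4)[OF eB s], of \<tau>] \<tau> by simp
      qed
      have we: "nrm (L2_on M) (w\<tau> t - ?w t) = \<tau> * nrm (L2_on M) (?f t)"
      proof -
        have "w\<tau> t - ?w t = \<tau> *\<^sub>R ?f t" using \<tau> by (auto simp: fun_eq_iff field_simps)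
        then show ?thesis using L.nrm_scale[OF L.bochner_L2D(4)[OF H1_bochner_L2[OF f] t], of \<tau>] \<tau> by simp
      qed
      have ie: "(LINT s|time t. nrm (L2_on M) (u\<tau> s - ?u s)) = \<tau> * (LINT s|time t. nrm (L2_on M) (?e s))"
      proof -
        have "(LINT s|time t. nrm (L2_on M) (u\<tau> s - ?u s)) = (LINT s|time t. \<tau> * nrm (L2_on M) (?e s))"
          using t by (intro Bochner_Integration.integral_cong ue) auto
        then show ?thesis by simp
      qed
      have "(1 / \<tau>) * nrm (L2_on M) (?R\<tau> - ?R2) \<le> (1 / \<tau>) * (A * (\<tau> * nrm (L2_on M) (?e t) + \<tau> * nrm (L2_on M) (?f t)
          + \<tau> * (LINT s|time t. nrm (L2_on M) (?e s))))"
        using elim(6) \<tau> unfolding ue[OF t] we ie by (intro mult_left_mono) auto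
      also have "\<dots> = A * (nrm (L2_on M) (?e t) + nrm (L2_on M) (?f t) + (LINT s|time t. nrm (L2_on M) (?e s)))"
        using \<tau> by (simp add: field_simps)
      finally show ?case using ev by linarith
    qed
  qed
  moreover have "nrm (bochner_L2 T (dual (H1 \<Omega>))) 0 = 0"
    by (rule seminormed.nrm_zero[OF dual.seminormed_bochner_L2])
  ultimately show ?thesis by (simp add: nrm_bochner_L2)
qed

text \<open>The one-sided limit is tested on sequences, the form in which dominated convergence
  provides the derivative of R.\<close>

theorem coupled_differentiability:
  assumes T: "0 < T" and ab: "0 < \<alpha>" "0 < \<beta>" and R: "lipschitz_rhs T A R"
    and l: "l \<in> car (bochner_L2 T (dual (H1 \<Omega>)))" "\<delta>l \<in> car (bochner_L2 T (dual (H1 \<Omega>)))"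
    and y: "coupled_solution T \<alpha> \<beta> R l (u, w)" and S: "\<And>\<tau>. 0 < \<tau> \<Longrightarrow> coupled_solution T \<alpha> \<beta> R (l + \<tau> *\<^sub>R \<delta>l) (S \<tau>)"
    and \<delta>y: "coupled_solution T \<alpha> \<beta> R' \<delta>l (\<delta>u, \<delta>w)" and R': "R' \<delta>u \<delta>w \<in> car (bochner_L2 T (L2_on M))"
    and diff: "\<And>\<tau>. \<tau> \<longlonglongrightarrow> 0 \<Longrightarrow> (\<And>n::nat. 0 < \<tau> n) \<Longrightarrow>
      (\<lambda>n. nrm (bochner_L2 T (L2_on M)) ((1 / \<tau> n) *\<^sub>R (R (u + \<tau> n *\<^sub>R \<delta>u) (w + \<tau> n *\<^sub>R \<delta>w) - R u w) - R' \<delta>u \<delta>w)) \<longlonglongrightarrow> 0"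
  shows "((\<lambda>\<tau>. nrm (coupled_space T) ((1 / \<tau>) *\<^sub>R (S \<tau> - (u, w)) - (\<delta>u, \<delta>w))) \<longlongrightarrow> 0) (at_right 0)"
  unfolding tendsto_at_iff_sequentially comp_def
proof (intro allI impI)
  interpret Z: seminormed "coupled_space T" by (rule seminormed_coupled_space[OF T])
  fix \<tau> :: "nat \<Rightarrow> real" assume "\<forall>n. \<tau> n \<in> {0<..} - {0}" and \<tau>0: "\<tau> \<longlonglongrightarrow> 0"
  then have \<tau>: "0 < \<tau> n" for n by auto
  have c: "S \<tau> \<in> car (coupled_space T)" if "0 < \<tau>" for \<tau> using S[OF that] by (simp add: coupled_solution_def)
  have c2: "(u, w) \<in> car (coupled_space T)" "(\<delta>u, \<delta>w) \<in> car (coupled_space T)" using y \<delta>y by (simp_all add: coupled_solution_def)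
  show "(\<lambda>n. nrm (coupled_space T) ((1 / \<tau> n) *\<^sub>R (S (\<tau> n) - (u, w)) - (\<delta>u, \<delta>w))) \<longlonglongrightarrow> 0"
  proof (rule tendsto_zero_squeeze[OF tendsto_mult_right_zero[OF diff[OF \<tau>0 \<tau>], of "coupled_const T \<alpha> \<beta> A"]])
    fix n
    show "0 \<le> nrm (coupled_space T) ((1 / \<tau> n) *\<^sub>R (S (\<tau> n) - (u, w)) - (\<delta>u, \<delta>w))"
      by (intro Z.nrm_nonneg Z.diff_car Z.scale_car c \<tau> c2)
    obtain a b where ab': "S (\<tau> n) = (a, b)" by force
    show "nrm (coupled_space T) ((1 / \<tau> n) *\<^sub>R (S (\<tau> n) - (u, w)) - (\<delta>u, \<delta>w)) \<le> coupled_const T \<alpha> \<beta> A *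
        nrm (bochner_L2 T (L2_on M)) ((1 / \<tau> n) *\<^sub>R (R (u + \<tau> n *\<^sub>R \<delta>u) (w + \<tau> n *\<^sub>R \<delta>w) - R u w) - R' \<delta>u \<delta>w)"
      using S[OF \<tau>[of n]] unfolding ab'
      by (intro coupled_quotient_estimate[where R'=R' and l=l and \<delta>l=\<delta>l] T ab R \<tau> l y \<delta>y R')
  qed
qed

end

lemma nrm_L2_on_eq_0_iff:
  assumes "u \<in> car (L2_on M)"
  shows "nrm (L2_on M) u = 0 \<longleftrightarrow> (AE x in M. u x = 0)"
  using integral_nonneg_eq_0_iff_AE[OF L2_onD(2)[OF assms]] by (simp add: nrm_L2_on)

context bounded_open begin

text \<open>A vanishing H1 seminorm kills both parts of the energy, so \<open>w - w'\<close> is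
  orthogonal to every \<psi> in the energy inner product.\<close>

lemma elliptic_cong:
  assumes c: "u \<in> car (L2_on M)" "u' \<in> car (L2_on M)" "w \<in> car (H1 \<Omega>)" "w' \<in> car (H1 \<Omega>)"
    and u: "nrm (L2_on M) (u - u') = 0" and w: "nrm (H1 \<Omega>) (w - w') = 0"
    and ab: "0 < \<alpha>" "0 < \<beta>" and ell: "elliptic_eq \<Omega> \<alpha> \<beta> u w l"
  shows "elliptic_eq \<Omega> \<alpha> \<beta> u' w' l"
proof -
  interpret E: hilbert "energy_space \<alpha> \<beta>" "energy \<alpha> \<beta>" using ab by (rule hilbert_energy_space)
  have d: "u - u' \<in> car (L2_on M)" "w - w' \<in> car (H1 \<Omega>)" using c by blast+
  let ?a = "(nrm (L2_on M) (w - w'))\<^sup>2" and ?b = "\<Sum>i\<in>UNIV. (nrm (L2_on M) (D i (w - w')))\<^sup>2"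
  have "?a + ?b = 0" using nrm_energy_space[of 1 1 "w - w'"] w by (simp flip: H1_eq_energy_space)
  moreover have "0 \<le> ?b" by (intro sum_nonneg) auto
  moreover have "0 \<le> ?a" by simp
  ultimately have ab0: "?a = 0" "?b = 0" by linarith+
  have "nrm (energy_space \<alpha> \<beta>) (w - w') = 0"
    using nrm_energy_space[of \<alpha> \<beta> "w - w'", unfolded ab0] ab by simp
  then have "energy \<alpha> \<beta> (w - w') \<psi> = 0" if "\<psi> \<in> car (H1 \<Omega>)" for \<psi>
    using E.ip_eq_zero_if_nrm_zero[of "w - w'" \<psi>] d(2) that by simp
  moreover have "(LINT x|M. (u - u') x * \<psi> x) = 0" if "\<psi> \<in> car (H1 \<Omega>)" for \<psi>
    by (rule L.ip_eq_zero_if_nrm_zero[OF d(1) H1D(1)[OF that] u])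
  ultimately have "elliptic_eq \<Omega> \<alpha> \<beta> (u - u') (w - w') 0"
    unfolding elliptic_iff[OF d(2)] by simp
  from elliptic_diff[OF c(1) d(1) c(3) d(2) ell this] show ?thesis by simp
qed

text \<open>A directional derivative is determined only up to seminorm zero. This transfers the
  linearized system from the constructed derivative to any other one.\<close>

lemma coupled_solution_cong:
  assumes T: "0 < T" and ab: "0 < \<alpha>" "0 < \<beta>" and R: "lipschitz_rhs T A R"
    and y: "coupled_solution T \<alpha> \<beta> R l y" and y': "y' \<in> car (coupled_space T)" and eq: "nrm (coupled_space T) (y' - y) = 0"
  shows "coupled_solution T \<alpha> \<beta> R l y'"
proof -
  interpret H: seminormed "bochner_H10 T (L2_on M)" by (rule L.seminormed_bochner_H10[OF T])
  interpret B: seminormed "bochner_L2 T (L2_on M)" by (rule L.seminormed_bochner_L2)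
  interpret VB: seminormed "bochner_L2 T (H1 \<Omega>)" by (rule V.seminormed_bochner_L2)
  obtain u w u' w' where e: "y = (u, w)" "y' = (u', w')" by (metis surj_pair)
  note D = coupled_solutionD[OF y[unfolded e]]
  have D': "u' \<in> car (bochner_H10 T (L2_on M))" "w' \<in> car (bochner_L2 T (H1 \<Omega>))"
    using y' by (simp_all add: e car_coupled_space)
  note RD = lipschitz_rhsD[OF R]
  note uB = L.bochner_H10D(1)[OF D(1)] and uB' = L.bochner_H10D(1)[OF D'(1)]
  note wB = H1_bochner_L2[OF D(2)] and wB' = H1_bochner_L2[OF D'(2)]
  note du = H.diff_car[OF D(1) D'(1)] and dw = VB.diff_car[OF D(2) D'(2)]
  have "nrm (coupled_space T) (y - y') = 0"
  proof -
    interpret Z: seminormed "coupled_space T" by (rule seminormed_coupled_space[OF T])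
    show ?thesis using eq Z.nrm_diff_commute[OF y'] y by (simp add: coupled_solution_def)
  qed
  then have z: "nrm (bochner_L2 T (L2_on M)) (u - u') = 0" "nrm (bochner_L2 T (L2_on M)) (tderiv T (L2_on M) (u - u')) = 0"
    "nrm (bochner_L2 T (H1 \<Omega>)) (w - w') = 0"
    by (simp_all add: e coupled_space_def prod_space_def L.nrm_bochner_H10 sum_power2_eq_zero_iff add_nonneg_eq_0_iff)
  have u0: "AE t in time T. nrm (L2_on M) ((u - u') t) = 0"
    using z(1) L.nrm_bochner_L2_eq_0_iff[OF L.bochner_H10D(1)[OF du]] by simp
  have v0: "AE t in time T. nrm (L2_on M) (tderiv T (L2_on M) (u - u') t) = 0"
    using z(2) L.nrm_bochner_L2_eq_0_iff[OF L.bochner_H10D(4)[OF du]] by simp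
  have w0: "AE t in time T. nrm (H1 \<Omega>) ((w - w') t) = 0"
    using z(3) V.nrm_bochner_L2_eq_0_iff[OF dw] by simp
  have "AE t in time T. nrm (L2_on M) (tderiv T (L2_on M) u' t - R u' w' t) = 0"
    using u0 v0 w0 L.bochner_H10_lincomb(2)[OF D(1) D'(1) T, of 1 "-1"] D(3) RD(3)[OF uB wB uB' wB'] AE_space
  proof eventually_elim
    case (elim t)
    then have t: "0 < t" "t < T" by auto
    let ?v = "tderiv T (L2_on M) u t" and ?v' = "tderiv T (L2_on M) u' t" and ?d = "tderiv T (L2_on M) (u - u') t"
    let ?R = "R u w t" and ?R' = "R u' w' t"
    have c: "?v \<in> car (L2_on M)" "?v' \<in> car (L2_on M)" "?d \<in> car (L2_on M)" "?R \<in> car (L2_on M)" "?R' \<in> car (L2_on M)"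
      using L.bochner_L2D(4)[OF L.bochner_H10D(4)[OF D(1)] t] L.bochner_L2D(4)[OF L.bochner_H10D(4)[OF D'(1)] t]
        L.bochner_L2D(4)[OF L.bochner_H10D(4)[OF du] t]
        L.bochner_L2D(4)[OF RD(2)[OF uB wB] t] L.bochner_L2D(4)[OF RD(2)[OF uB' wB'] t] .
    have "nrm (L2_on M) (?v - ?v') = nrm (L2_on M) ?d"
      using elim(4) L.nrm_eq_if_diff_zero[OF c(3) L.diff_car[OF c(1,2)]] by simp
    then have vv: "nrm (L2_on M) (?v' - ?v) = 0" using elim(2) L.nrm_diff_commute[OF c(1,2)] by simp
    have i: "(LINT s|time t. nrm (L2_on M) (u s - u' s)) = 0"
      by (rule integral_eq_zero_AE, rule AE_time_mono[where T=T]) (use u0 t in auto)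
    have "nrm (L2_on M) (w t - w' t) = 0"
      using nrm_L2_le_H1[OF V.bochner_L2D(4)[OF dw t]] L.nrm_nonneg[OF H1D(1)[OF V.bochner_L2D(4)[OF dw t]]] elim(3) by simp
    then have "nrm (L2_on M) (?R - ?R') \<le> 0" using elim(1,6) i by simp
    then have RR: "nrm (L2_on M) (?R - ?R') = 0" using L.nrm_nonneg[OF L.diff_car[OF c(4,5)]] by simp
    show ?case by (rule L.nrm_zero_trans[OF c(2,1,5) vv L.nrm_zero_trans[OF c(1,4,5) elim(5) RR]])
  qed
  moreover have "AE t in time T. elliptic_eq \<Omega> \<alpha> \<beta> (u' t) (w' t) (l t)"
    using u0 w0 D(4) AE_space
  proof eventually_elim
    case (elim t)
    then have t: "0 < t" "t < T" by auto
    show ?case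
      by (rule elliptic_cong[OF L.bochner_L2D(4)[OF uB t] L.bochner_L2D(4)[OF uB' t]
          V.bochner_L2D(4)[OF D(2) t] V.bochner_L2D(4)[OF D'(2) t] _ _ ab elim(3)]) (use elim(1,2) in simp_all)
  qed
  ultimately show ?thesis using D' by (simp add: coupled_solution_def e car_coupled_space)
qed

lemma coupled_uniqueness:
  assumes T: "0 < T" and ab: "0 < \<alpha>" "0 < \<beta>" and R: "lipschitz_rhs T A R"
    and l: "l \<in> car (bochner_L2 T (dual (H1 \<Omega>)))" "l' \<in> car (bochner_L2 T (dual (H1 \<Omega>)))"
    and eq: "eq_in (bochner_L2 T (dual (H1 \<Omega>))) l l'"
    and y: "coupled_solution T \<alpha> \<beta> R l y" and y': "coupled_solution T \<alpha> \<beta> R l' y'"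
  shows "eq_in (coupled_space T) y y'"
proof -
  interpret Z: seminormed "coupled_space T" by (rule seminormed_coupled_space[OF T])
  have "nrm (coupled_space T) (y - y') \<le> 0"
    using coupled_stability[OF T ab R l y y'] eq by (simp add: eq_in_def)
  moreover have "0 \<le> nrm (coupled_space T) (y - y')"
    using y y' by (intro Z.nrm_nonneg Z.diff_car) (simp_all add: coupled_solution_def)
  ultimately show ?thesis by (simp add: eq_in_def)
qed

end

section \<open>The state system\<close>

locale state_system = bounded_open \<Omega> + F: lipschitz_dir_diff f L\<^sub>f
  for \<Omega> :: "(real^'n) set" and f L\<^sub>f +
  fixes T \<beta> \<epsilon> L\<^sub>H :: real and H :: "'n evol \<Rightarrow> 'n evol" and H' :: "'n evol \<Rightarrow> 'n evol \<Rightarrow> 'n evol"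
  assumes T: "0 < T" and \<beta>: "0 < \<beta>" and \<epsilon>: "0 < \<epsilon>" and L\<^sub>H: "0 < L\<^sub>H"
    and H_car: "H \<in> car (bochner_L2 T (L2_on (lebesgue_on \<Omega>))) \<rightarrow> car (bochner_L2 T (L2_on (lebesgue_on \<Omega>)))"
    and H_lip: "\<And>q1 q2. q1 \<in> car (bochner_L2 T (L2_on (lebesgue_on \<Omega>))) \<Longrightarrow> q2 \<in> car (bochner_L2 T (L2_on (lebesgue_on \<Omega>))) \<Longrightarrow>
      AE t in time T. nrm (L2_on (lebesgue_on \<Omega>)) (H q1 t - H q2 t)
        \<le> L\<^sub>H * (LINT s|time t. nrm (L2_on (lebesgue_on \<Omega>)) (q1 s - q2 s))"
    and H_diff: "has_gateaux_derivative (bochner_L2 T (L2_on (lebesgue_on \<Omega>))) (bochner_L2 T (L2_on (lebesgue_on \<Omega>))) H H'"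
begin

abbreviation X where "X \<equiv> L2_on M"
abbreviation B where "B \<equiv> bochner_L2 T X"

sublocale P: lipschitz_dir_diff pos 1
  by (rule pos_lipschitz_dir_diff)

sublocale B: seminormed B
  by (rule L.seminormed_bochner_L2)

lemma H_B: "q \<in> car B \<Longrightarrow> H q \<in> car B"
  using H_car by blast

lemma H'_B: "q \<in> car B \<Longrightarrow> p \<in> car B \<Longrightarrow> H' q p \<in> car B"
  using H_diff by (auto simp: has_gateaux_derivative_def bounded_ops_def)

lemma H'_quotient:
  assumes "q \<in> car B" "p \<in> car B" and \<tau>: "\<tau> \<longlonglongrightarrow> 0" "\<And>n. 0 < \<tau> n"
  shows "(\<lambda>n. nrm B ((1 / \<tau> n) *\<^sub>R (H (q + \<tau> n *\<^sub>R p) - H q) - H' q p)) \<longlonglongrightarrow> 0"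
proof -
  have "((\<lambda>\<tau>. nrm B ((1 / \<tau>) *\<^sub>R (H (q + \<tau> *\<^sub>R p) - H q) - H' q p)) \<longlongrightarrow> 0) (at 0)"
    using H_diff assms(1,2) by (auto simp: has_gateaux_derivative_def)
  moreover have "filterlim \<tau> (at 0) sequentially"
    using \<tau>(1) by (simp add: filterlim_at less_imp_neq[OF \<tau>(2), symmetric])
  ultimately show ?thesis by (rule filterlim_compose)
qed

text \<open>The Volterra estimate of \<open>H\<close> passes to the derivative, so the linearized equation is of the
  same type as the state equation.\<close>

lemma H'_Volterra:
  assumes q: "q \<in> car B" and p: "p \<in> car B" "p' \<in> car B"
  shows "AE t in time T. nrm X (H' q p t - H' q p' t) \<le> L\<^sub>H * (LINT s|time t. nrm X (p s - p' s))"
proof -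
  let ?\<tau> = "\<lambda>n. inverse (real (Suc n))"
  \<comment> \<open>The base value \<open>H q\<close> cancels in the difference of the two
    quotients, so the Volterra estimate of H applies to \<open>?w\<close> and the factors \<tau>
    cancel.\<close>
  let ?w = "\<lambda>n. (1 / ?\<tau> n) *\<^sub>R (H (q + ?\<tau> n *\<^sub>R p) - H (q + ?\<tau> n *\<^sub>R p'))"
  let ?E = "\<lambda>p n. (1 / ?\<tau> n) *\<^sub>R (H (q + ?\<tau> n *\<^sub>R p) - H q) - H' q p"
  have qp: "q + c *\<^sub>R r \<in> car B" if "r \<in> car B" for c r using q that by blast
  have w: "?w n \<in> car B" for n by (intro B.scale_car B.diff_car H_B qp p)
  have E: "?E r n \<in> car B" if "r \<in> car B" for r n by (intro B.scale_car B.diff_car H_B H'_B qp that q)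
  have "AE t in time T. nrm X ((H' q p - H' q p') t) \<le> L\<^sub>H * (LINT s|time t. nrm X (p s - p' s))"
  proof (rule L.bochner_L2_limit_bound[OF w])
    show "H' q p - H' q p' \<in> car B" using H'_B[OF q p(1)] H'_B[OF q p(2)] by blast
    show "(\<lambda>n. nrm B (?w n - (H' q p - H' q p'))) \<longlonglongrightarrow> 0"
    proof (rule tendsto_zero_squeeze)
      show "(\<lambda>n. nrm B (?E p n) + nrm B (?E p' n)) \<longlonglongrightarrow> 0"
        using tendsto_add[OF H'_quotient[OF q p(1) LIMSEQ_inverse_real_of_nat] H'_quotient[OF q p(2) LIMSEQ_inverse_real_of_nat]] by simp
      show "0 \<le> nrm B (?w n - (H' q p - H' q p'))" for n
        by (intro B.nrm_nonneg B.diff_car w H'_B q p)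
      have eq: "?w n - (H' q p - H' q p') = ?E p n - ?E p' n" for n by (simp add: algebra_simps)
      show "nrm B (?w n - (H' q p - H' q p')) \<le> nrm B (?E p n) + nrm B (?E p' n)" for n
        unfolding eq by (rule B.nrm_diff_le[OF E[OF p(1)] E[OF p(2)]])
    qed
    note pi = L.bochner_L2D(3)[OF L.bochner_L2_diff[OF p]]
    show "(\<lambda>t. L\<^sub>H * (LINT s|time t. nrm X (p s - p' s))) \<in> borel_measurable (time T)"
      using borel_measurable_integrable[OF Fubini_time(1)[OF pi, of "\<lambda>_. 0" 0]] by simp
    show "AE t in time T. nrm X (?w n t) \<le> L\<^sub>H * (LINT s|time t. nrm X (p s - p' s))" for n
      using H_lip[OF qp[OF p(1), of "?\<tau> n"] qp[OF p(2), of "?\<tau> n"]] AE_space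
    proof eventually_elim
      case (elim t)
      then have t: "0 < t" "t < T" by auto
      have "nrm X ((q + ?\<tau> n *\<^sub>R p) s - (q + ?\<tau> n *\<^sub>R p') s) = ?\<tau> n * nrm X (p s - p' s)" if s: "0 < s" "s < T" for s
      proof -
        have "(q + ?\<tau> n *\<^sub>R p) s - (q + ?\<tau> n *\<^sub>R p') s = ?\<tau> n *\<^sub>R (p s - p' s)" by (simp add: algebra_simps)
        then show ?thesis
          using L.nrm_scale[OF L.diff_car[OF L.bochner_L2D(4)[OF p(1) s] L.bochner_L2D(4)[OF p(2) s]], of "?\<tau> n"] by simp
      qed
      then have "(LINT s|time t. nrm X ((q + ?\<tau> n *\<^sub>R p) s - (q + ?\<tau> n *\<^sub>R p') s)) = (LINT s|time t. ?\<tau> n * nrm X (p s - p' s))"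
        using t by (intro Bochner_Integration.integral_cong) auto
      then have i: "(LINT s|time t. nrm X ((q + ?\<tau> n *\<^sub>R p) s - (q + ?\<tau> n *\<^sub>R p') s)) = ?\<tau> n * (LINT s|time t. nrm X (p s - p' s))"
        by simp
      have c: "H (q + ?\<tau> n *\<^sub>R p) t - H (q + ?\<tau> n *\<^sub>R p') t \<in> car X"
        by (intro L.diff_car L.bochner_L2D(4)[OF H_B[OF qp[OF p(1)]] t] L.bochner_L2D(4)[OF H_B[OF qp[OF p(2)]] t])
      have "nrm X (?w n t) = (1 / ?\<tau> n) * nrm X (H (q + ?\<tau> n *\<^sub>R p) t - H (q + ?\<tau> n *\<^sub>R p') t)"
        using L.nrm_scale[OF c, of "1 / ?\<tau> n"] by simp
      also have "\<dots> \<le> (1 / ?\<tau> n) * (L\<^sub>H * (?\<tau> n * (LINT s|time t. nrm X (p s - p' s))))"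
        using elim(1) unfolding i by (intro mult_left_mono) auto
      also have "\<dots> = L\<^sub>H * (LINT s|time t. nrm X (p s - p' s))" by simp
      finally show ?case .
    qed
  qed
  then show ?thesis by simp
qed

section \<open>Right-hand sides of the state equation and of its linearization\<close>

definition state_rhs where
  "state_rhs q \<phi> = (\<lambda>t x. 1 / \<epsilon> * pos (driving_force \<beta> H f q \<phi> t x))"

definition force_derivative where
  "force_derivative q p \<psi> = (\<lambda>t x. - \<beta> * (p t x - \<psi> t x) - dir_deriv f (H q t x) (H' q p t x))"

definition linearized_rhs where
  "linearized_rhs q \<phi> p \<psi> = (\<lambda>t x. 1 / \<epsilon> * dir_deriv pos (driving_force \<beta> H f q \<phi> t x) (force_derivative q p \<psi> t x))"

definition rhs_const where "rhs_const = (\<beta> + L\<^sub>f * L\<^sub>H) / \<epsilon>"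

lemma rhs_const_nonneg: "0 \<le> rhs_const"
  unfolding rhs_const_def using \<beta> \<epsilon> L\<^sub>H F.L_nonneg by simp

lemma driving_force_eq: "driving_force \<beta> H f q \<phi> = (- \<beta>) *\<^sub>R (q - \<phi>) - (\<lambda>t x. f (H q t x))"
  by (simp add: fun_eq_iff driving_force_def)

lemma force_derivative_eq:
  "force_derivative q p \<psi> = (- \<beta>) *\<^sub>R (p - \<psi>) - (\<lambda>t x. dir_deriv f (H q t x) (H' q p t x))"
  by (simp add: fun_eq_iff force_derivative_def)

lemma driving_force_B: "q \<in> car B \<Longrightarrow> \<phi> \<in> car B \<Longrightarrow> driving_force \<beta> H f q \<phi> \<in> car B"
  unfolding driving_force_eq
  by (intro B.diff_car B.scale_car F.Nemytskii_bochner_L2[OF finite_domain] H_B)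

lemma force_derivative_B: "q \<in> car B \<Longrightarrow> p \<in> car B \<Longrightarrow> \<psi> \<in> car B \<Longrightarrow> force_derivative q p \<psi> \<in> car B"
  unfolding force_derivative_eq
  by (intro B.diff_car B.scale_car F.dir_deriv_bochner_L2(1)[OF finite_domain] H_B H'_B)

lemma state_rhs_eq: "state_rhs q \<phi> = (1 / \<epsilon>) *\<^sub>R (\<lambda>t x. pos (driving_force \<beta> H f q \<phi> t x))"
  by (simp add: fun_eq_iff state_rhs_def)

lemma linearized_rhs_eq: "linearized_rhs q \<phi> p \<psi> =
    (1 / \<epsilon>) *\<^sub>R (\<lambda>t x. dir_deriv pos (driving_force \<beta> H f q \<phi> t x) (force_derivative q p \<psi> t x))"
  by (simp add: fun_eq_iff linearized_rhs_def)

lemma state_rhs_B: "q \<in> car B \<Longrightarrow> \<phi> \<in> car B \<Longrightarrow> state_rhs q \<phi> \<in> car B"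
  unfolding state_rhs_eq
  by (intro B.scale_car P.Nemytskii_bochner_L2[OF finite_domain] driving_force_B)

lemma linearized_rhs_B:
  "q \<in> car B \<Longrightarrow> \<phi> \<in> car B \<Longrightarrow> p \<in> car B \<Longrightarrow> \<psi> \<in> car B \<Longrightarrow> linearized_rhs q \<phi> p \<psi> \<in> car B"
  unfolding linearized_rhs_eq
  by (intro B.scale_car P.dir_deriv_bochner_L2(1)[OF finite_domain] driving_force_B force_derivative_B)

text \<open>One estimate for both right-hand sides. Here g and g' stand for the Nemytskii terms with
  f or with its directional derivative, i for the memory integral, and r for the difference after
  \<open>pos\<close> or its directional derivative, both 1-Lipschitz, has been applied.\<close>

lemma nrm_force_diff:
  assumes c: "p \<in> car X" "p' \<in> car X" "\<phi> \<in> car X" "\<phi>' \<in> car X" "g \<in> car X" "g' \<in> car X"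
    and g: "nrm X (g - g') \<le> L\<^sub>f * (L\<^sub>H * i)" and i: "0 \<le> i"
    and r: "r \<in> car X" and le: "nrm X r \<le> nrm X (((- \<beta>) *\<^sub>R (p - \<phi>) - g) - ((- \<beta>) *\<^sub>R (p' - \<phi>') - g'))"
  shows "nrm X ((1 / \<epsilon>) *\<^sub>R r) \<le> rhs_const * (nrm X (p - p') + nrm X (\<phi> - \<phi>') + i)"
proof -
  let ?a = "nrm X (p - p')" and ?b = "nrm X (\<phi> - \<phi>')"
  have d: "p - p' \<in> car X" "\<phi> - \<phi>' \<in> car X" "g - g' \<in> car X" using c by blast+
  have m: "(p - p') - (\<phi> - \<phi>') \<in> car X" using d by blast
  have eq: "((- \<beta>) *\<^sub>R (p - \<phi>) - g) - ((- \<beta>) *\<^sub>R (p' - \<phi>') - g') = (- \<beta>) *\<^sub>R ((p - p') - (\<phi> - \<phi>')) - (g - g')"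
    by (simp add: algebra_simps)
  have "nrm X r \<le> nrm X ((- \<beta>) *\<^sub>R ((p - p') - (\<phi> - \<phi>'))) + nrm X (g - g')"
    using le[unfolded eq] L.nrm_diff_le[OF L.scale_car[OF m] d(3), of "- \<beta>"] by linarith
  also have "nrm X ((- \<beta>) *\<^sub>R ((p - p') - (\<phi> - \<phi>'))) = \<beta> * nrm X ((p - p') - (\<phi> - \<phi>'))"
    using L.nrm_scale[OF m, of "- \<beta>"] \<beta> by simp
  also have "\<beta> * nrm X ((p - p') - (\<phi> - \<phi>')) \<le> \<beta> * (?a + ?b)"
    using L.nrm_diff_le[OF d(1,2)] \<beta> by (intro mult_left_mono) auto
  finally have "nrm X r \<le> \<beta> * (?a + ?b) + L\<^sub>f * (L\<^sub>H * i)" using g by linarith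
  moreover have "0 \<le> \<beta> * i" "0 \<le> L\<^sub>f * L\<^sub>H * (?a + ?b)"
    using \<beta> i L\<^sub>H F.L_nonneg L.nrm_nonneg[OF d(1)] L.nrm_nonneg[OF d(2)] by auto
  ultimately have "nrm X r \<le> (\<beta> + L\<^sub>f * L\<^sub>H) * (?a + ?b + i)" unfolding ring_distribs mult.assoc by linarith
  then have "1 / \<epsilon> * nrm X r \<le> 1 / \<epsilon> * ((\<beta> + L\<^sub>f * L\<^sub>H) * (?a + ?b + i))" using \<epsilon> by (intro mult_left_mono) auto
  then show ?thesis using L.nrm_scale[OF r, of "1 / \<epsilon>"] \<epsilon> by (simp add: rhs_const_def)
qed

lemma lipschitz_state_rhs: "lipschitz_rhs T rhs_const state_rhs"
  unfolding lipschitz_rhs_def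
proof (intro conjI ballI rhs_const_nonneg state_rhs_B; assumption?)
  fix p \<phi> p' \<phi>' assume c: "p \<in> car B" "\<phi> \<in> car B" "p' \<in> car B" "\<phi>' \<in> car B"
  show "AE t in time T. nrm X (state_rhs p \<phi> t - state_rhs p' \<phi>' t)
    \<le> rhs_const * (nrm X (p t - p' t) + nrm X (\<phi> t - \<phi>' t) + (LINT s|time t. nrm X (p s - p' s)))"
    using H_lip[OF c(1,3)] AE_space
  proof eventually_elim
    case (elim t)
    then have t: "0 < t" "t < T" by auto
    note ct = L.bochner_L2D(4)[OF c(1) t] L.bochner_L2D(4)[OF c(3) t] L.bochner_L2D(4)[OF c(2) t] L.bochner_L2D(4)[OF c(4) t]
    note Ht = L.bochner_L2D(4)[OF H_B[OF c(1)] t] L.bochner_L2D(4)[OF H_B[OF c(3)] t]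
    note N = F.Nemytskii_L2_on[OF finite_domain]
    note dt = L.bochner_L2D(4)[OF driving_force_B[OF c(1,2)] t] L.bochner_L2D(4)[OF driving_force_B[OF c(3,4)] t]
    let ?r = "(\<lambda>x. pos (driving_force \<beta> H f p \<phi> t x)) - (\<lambda>x. pos (driving_force \<beta> H f p' \<phi>' t x))"
    have e: "state_rhs p \<phi> t - state_rhs p' \<phi>' t = (1 / \<epsilon>) *\<^sub>R ?r"
      by (simp add: fun_eq_iff state_rhs_def right_diff_distrib diff_divide_distrib)
    have d: "driving_force \<beta> H f q \<psi> t = (- \<beta>) *\<^sub>R (q t - \<psi> t) - (\<lambda>x. f (H q t x))" for q \<psi>
      by (simp add: driving_force_eq)
    show ?case unfolding e
    proof (rule nrm_force_diff[OF ct N[OF Ht(1)] N[OF Ht(2)]])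
      show "nrm X ((\<lambda>x. f (H p t x)) - (\<lambda>x. f (H p' t x))) \<le> L\<^sub>f * (L\<^sub>H * (LINT s|time t. nrm X (p s - p' s)))"
        using F.Nemytskii_lipschitz[OF Ht] mult_left_mono[OF elim(1) F.L_nonneg] by linarith
      show "0 \<le> (LINT s|time t. nrm X (p s - p' s))"
        using t L.nrm_integral_nonneg[OF L.bochner_L2_diff[OF c(1,3)]] by auto
      show "?r \<in> car X" by (intro L.diff_car P.Nemytskii_L2_on[OF finite_domain] dt)
      show "nrm X ?r \<le> nrm X ((- \<beta>) *\<^sub>R (p t - \<phi> t) - (\<lambda>x. f (H p t x)) - ((- \<beta>) *\<^sub>R (p' t - \<phi>' t) - (\<lambda>x. f (H p' t x))))"
        using P.Nemytskii_lipschitz[OF dt] unfolding d by simp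
    qed
  qed
qed

text \<open>With the base point fixed, the directional derivatives of f and of \<open>pos\<close>
  are Lipschitz in the direction, and \<open>H'_Volterra\<close> supplies the memory term.\<close>

lemma lipschitz_linearized_rhs:
  assumes q: "q \<in> car B" and \<phi>: "\<phi> \<in> car B"
  shows "lipschitz_rhs T rhs_const (linearized_rhs q \<phi>)"
  unfolding lipschitz_rhs_def
proof (intro conjI ballI rhs_const_nonneg linearized_rhs_B q \<phi>; assumption?)
  fix p \<psi> p' \<psi>' assume c: "p \<in> car B" "\<psi> \<in> car B" "p' \<in> car B" "\<psi>' \<in> car B"
  show "AE t in time T. nrm X (linearized_rhs q \<phi> p \<psi> t - linearized_rhs q \<phi> p' \<psi>' t)
    \<le> rhs_const * (nrm X (p t - p' t) + nrm X (\<psi> t - \<psi>' t) + (LINT s|time t. nrm X (p s - p' s)))"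
    using H'_Volterra[OF q c(1,3)] AE_space
  proof eventually_elim
    case (elim t)
    then have t: "0 < t" "t < T" by auto
    note ct = L.bochner_L2D(4)[OF c(1) t] L.bochner_L2D(4)[OF c(3) t] L.bochner_L2D(4)[OF c(2) t] L.bochner_L2D(4)[OF c(4) t]
    note Ht = L2_onD(1)[OF L.bochner_L2D(4)[OF H_B[OF q] t]]
    note H't = L.bochner_L2D(4)[OF H'_B[OF q c(1)] t] L.bochner_L2D(4)[OF H'_B[OF q c(3)] t]
    note dt = L2_onD(1)[OF L.bochner_L2D(4)[OF driving_force_B[OF q \<phi>] t]]
    note ft = L.bochner_L2D(4)[OF force_derivative_B[OF q c(1,2)] t] L.bochner_L2D(4)[OF force_derivative_B[OF q c(3,4)] t]
    let ?r = "(\<lambda>x. dir_deriv pos (driving_force \<beta> H f q \<phi> t x) (force_derivative q p \<psi> t x))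
      - (\<lambda>x. dir_deriv pos (driving_force \<beta> H f q \<phi> t x) (force_derivative q p' \<psi>' t x))"
    have e: "linearized_rhs q \<phi> p \<psi> t - linearized_rhs q \<phi> p' \<psi>' t = (1 / \<epsilon>) *\<^sub>R ?r"
      by (simp add: fun_eq_iff linearized_rhs_def right_diff_distrib diff_divide_distrib)
    have d: "force_derivative q r s t = (- \<beta>) *\<^sub>R (r t - s t) - (\<lambda>x. dir_deriv f (H q t x) (H' q r t x))" for r s
      by (simp add: force_derivative_eq)
    show ?case unfolding e
    proof (rule nrm_force_diff[OF ct F.dir_deriv_L2_on(1)[OF Ht H't(1)] F.dir_deriv_L2_on(1)[OF Ht H't(2)]])
      show "nrm X ((\<lambda>x. dir_deriv f (H q t x) (H' q p t x)) - (\<lambda>x. dir_deriv f (H q t x) (H' q p' t x)))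
        \<le> L\<^sub>f * (L\<^sub>H * (LINT s|time t. nrm X (p s - p' s)))"
        using F.dir_deriv_L2_on_lipschitz[OF Ht H't] mult_left_mono[OF elim(1) F.L_nonneg] by linarith
      show "0 \<le> (LINT s|time t. nrm X (p s - p' s))"
        using t L.nrm_integral_nonneg[OF L.bochner_L2_diff[OF c(1,3)]] by auto
      show "?r \<in> car X" by (intro L.diff_car P.dir_deriv_L2_on(1)[OF dt] ft)
      show "nrm X ?r \<le> nrm X ((- \<beta>) *\<^sub>R (p t - \<psi> t) - (\<lambda>x. dir_deriv f (H q t x) (H' q p t x))
          - ((- \<beta>) *\<^sub>R (p' t - \<psi>' t) - (\<lambda>x. dir_deriv f (H q t x) (H' q p' t x))))"
        using P.dir_deriv_L2_on_lipschitz[OF dt ft] unfolding d by simp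
    qed
  qed
qed

text \<open>The chain rule twice: for f, whose argument moves along the values of H, and then for
  \<open>pos\<close>, whose argument is the driving force. Neither argument moves along a ray in
  general.\<close>

lemma state_rhs_derivative:
  assumes q: "q \<in> car B" and \<phi>: "\<phi> \<in> car B" and p: "p \<in> car B" and \<psi>: "\<psi> \<in> car B"
    and \<tau>: "\<tau> \<longlonglongrightarrow> 0" "\<And>n. 0 < \<tau> n"
  shows "(\<lambda>n. nrm B ((1 / \<tau> n) *\<^sub>R (state_rhs (q + \<tau> n *\<^sub>R p) (\<phi> + \<tau> n *\<^sub>R \<psi>) - state_rhs q \<phi>) - linearized_rhs q \<phi> p \<psi>)) \<longlonglongrightarrow> 0"
proof -
  have qn: "q + \<tau> n *\<^sub>R p \<in> car B" "\<phi> + \<tau> n *\<^sub>R \<psi> \<in> car B" for n using q p \<phi> \<psi> by blast+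
  let ?z = "driving_force \<beta> H f q \<phi>" and ?zn = "\<lambda>n. driving_force \<beta> H f (q + \<tau> n *\<^sub>R p) (\<phi> + \<tau> n *\<^sub>R \<psi>)"
  let ?\<zeta> = "force_derivative q p \<psi>"
  let ?h = "\<lambda>n. (1 / \<tau> n) *\<^sub>R ((\<lambda>t x. f (H (q + \<tau> n *\<^sub>R p) t x)) - (\<lambda>t x. f (H q t x))) - (\<lambda>t x. dir_deriv f (H q t x) (H' q p t x))"
  have h: "(\<lambda>n. nrm B (?h n)) \<longlonglongrightarrow> 0"
    by (rule F.chain_rule[OF finite_domain H_B[OF q] H'_B[OF q p] H_B[OF qn(1)] \<tau> H'_quotient[OF q p \<tau>]])
  have hB: "?h n \<in> car B" for n
    by (intro B.diff_car B.scale_car F.Nemytskii_bochner_L2[OF finite_domain] F.dir_deriv_bochner_L2(1)[OF finite_domain] H_B H'_B q p qn)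
  \<comment> \<open>The driving force is linear in q and \<phi> apart from the term with f, so only
    that term contributes to the error.\<close>
  have eq: "(1 / \<tau> n) *\<^sub>R (?zn n - ?z) - ?\<zeta> = - ?h n" for n
    using \<tau>(2)[of n] by (simp add: fun_eq_iff driving_force_def force_derivative_def field_simps)
  have "(\<lambda>n. nrm B ((1 / \<tau> n) *\<^sub>R (?zn n - ?z) - ?\<zeta>)) \<longlonglongrightarrow> 0"
    unfolding eq B.nrm_minus[OF hB] by (rule h)
  note c = P.chain_rule[OF finite_domain driving_force_B[OF q \<phi>] force_derivative_B[OF q p \<psi>] driving_force_B[OF qn] \<tau> this]
  let ?g = "\<lambda>n. (1 / \<tau> n) *\<^sub>R ((\<lambda>t x. pos (?zn n t x)) - (\<lambda>t x. pos (?z t x))) - (\<lambda>t x. dir_deriv pos (?z t x) (?\<zeta> t x))"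
  have gB: "?g n \<in> car B" for n
    by (intro B.diff_car B.scale_car P.Nemytskii_bochner_L2[OF finite_domain] P.dir_deriv_bochner_L2(1)[OF finite_domain]
        driving_force_B force_derivative_B q \<phi> p \<psi> qn)
  have "(1 / \<tau> n) *\<^sub>R (state_rhs (q + \<tau> n *\<^sub>R p) (\<phi> + \<tau> n *\<^sub>R \<psi>) - state_rhs q \<phi>) - linearized_rhs q \<phi> p \<psi> = (1 / \<epsilon>) *\<^sub>R ?g n" for n
    unfolding state_rhs_eq linearized_rhs_eq by (simp add: scaleR_diff_right mult.commute)
  then show ?thesis
    using tendsto_mult_right_zero[OF c, of "1 / \<epsilon>"] \<epsilon> by (simp add: B.nrm_scale[OF gB])
qed

end

section \<open>The solution operator and its directional derivative\<close>

context state_system begin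

lemma coupled_space_eq: "coupled_space T = state_space T \<Omega>"
  by (simp add: coupled_space_def L2_eq_L2_on)

text \<open>Connects the pointwise formulation of the equations in time and space with the seminorm
  formulation of the abstract theory.\<close>

lemma AE_eq_iff_nrm_zero:
  assumes "u \<in> car B" "v \<in> car B"
  shows "(AE t in time T. AE x in M. u t x = v t x) \<longleftrightarrow> (AE t in time T. nrm X (u t - v t) = 0)"
proof (rule AE_cong)
  fix t assume "t \<in> space (time T)"
  then have "u t - v t \<in> car X" using L.bochner_L2D(4) assms by auto
  from nrm_L2_on_eq_0_iff[OF this] show "(AE x in M. u t x = v t x) \<longleftrightarrow> nrm X (u t - v t) = 0" by simp
qed

lemma solves_state_iff: "solves_state T \<Omega> \<alpha> \<beta> \<epsilon> H f l y \<longleftrightarrow> coupled_solution T \<alpha> \<beta> state_rhs l y"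
proof (cases "y \<in> car (coupled_space T)")
  case True
  obtain q \<phi> where y: "y = (q, \<phi>)" by force
  have q: "q \<in> car (bochner_H10 T X)" and \<phi>: "\<phi> \<in> car (bochner_L2 T (H1 \<Omega>))"
    using True by (simp_all add: y car_coupled_space)
  have "(AE t in time T. AE x in M. tderiv T X q t x = state_rhs q \<phi> t x) \<longleftrightarrow>
      (AE t in time T. nrm X (tderiv T X q t - state_rhs q \<phi> t) = 0)"
    by (rule AE_eq_iff_nrm_zero[OF L.bochner_H10D(4)[OF q] state_rhs_B[OF L.bochner_H10D(1)[OF q] H1_bochner_L2[OF \<phi>]]])
  then show ?thesis
    using True unfolding solves_state_def coupled_solution_def coupled_space_eq y prod.case
    by (simp add: L2_eq_L2_on state_rhs_def)
qed (simp add: solves_state_def coupled_solution_def coupled_space_eq)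

lemma solves_linearized_iff:
  assumes "q \<in> car B" "\<phi> \<in> car B"
  shows "solves_linearized T \<Omega> \<alpha> \<beta> \<epsilon> H H' f (q, \<phi>) l y \<longleftrightarrow> coupled_solution T \<alpha> \<beta> (linearized_rhs q \<phi>) l y"
proof (cases "y \<in> car (coupled_space T)")
  case True
  obtain p \<psi> where y: "y = (p, \<psi>)" by force
  have p: "p \<in> car (bochner_H10 T X)" and \<psi>: "\<psi> \<in> car (bochner_L2 T (H1 \<Omega>))"
    using True by (simp_all add: y car_coupled_space)
  have "(AE t in time T. AE x in M. tderiv T X p t x = linearized_rhs q \<phi> p \<psi> t x) \<longleftrightarrow>
      (AE t in time T. nrm X (tderiv T X p t - linearized_rhs q \<phi> p \<psi> t) = 0)"
    by (rule AE_eq_iff_nrm_zero[OF L.bochner_H10D(4)[OF p]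
        linearized_rhs_B[OF assms L.bochner_H10D(1)[OF p] H1_bochner_L2[OF \<psi>]]])
  then show ?thesis
    using True unfolding solves_linearized_def coupled_solution_def coupled_space_eq y prod.case
    by (simp add: L2_eq_L2_on linearized_rhs_def force_derivative_def)
qed (simp add: solves_linearized_def coupled_solution_def coupled_space_eq)

context
  fixes \<alpha> :: real
  assumes \<alpha>: "0 < \<alpha>"
begin

abbreviation S where "S \<equiv> solution_operator T \<Omega> \<alpha> \<beta> \<epsilon> H f"

lemma S_solution:
  assumes "l \<in> car (load_space T \<Omega>)"
  shows "coupled_solution T \<alpha> \<beta> state_rhs l (S l)"
  using someI_ex[OF coupled_existence[OF T \<alpha> \<beta> lipschitz_state_rhs assms]]
  by (simp add: solution_operator_def solves_state_iff)

lemma S_unique: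
  assumes "l \<in> car (load_space T \<Omega>)" "l' \<in> car (load_space T \<Omega>)" "eq_in (load_space T \<Omega>) l l'"
    "coupled_solution T \<alpha> \<beta> state_rhs l y"
  shows "eq_in (state_space T \<Omega>) y (S l')"
  using coupled_uniqueness[OF T \<alpha> \<beta> lipschitz_state_rhs assms S_solution[OF assms(2)]]
  by (simp add: coupled_space_eq)

lemma S_component:
  assumes "l \<in> car (load_space T \<Omega>)"
  obtains q \<phi> where "S l = (q, \<phi>)" "coupled_solution T \<alpha> \<beta> state_rhs l (q, \<phi>)" "q \<in> car B" "\<phi> \<in> car B"
proof -
  obtain q \<phi> where e: "S l = (q, \<phi>)" by force
  note s = S_solution[OF assms, unfolded e]
  show ?thesis
    by (rule that[OF e s L.bochner_H10D(1)[OF coupled_solutionD(1)[OF s]] H1_bochner_L2[OF coupled_solutionD(2)[OF s]]])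
qed

lemma S_derivative:
  assumes l: "l \<in> car (load_space T \<Omega>)" and \<delta>l: "\<delta>l \<in> car (load_space T \<Omega>)"
    and \<delta>y: "solves_linearized T \<Omega> \<alpha> \<beta> \<epsilon> H H' f (S l) \<delta>l \<delta>y"
  shows "has_dir_derivative (state_space T \<Omega>) S l \<delta>l \<delta>y"
proof -
  interpret W: seminormed "load_space T \<Omega>" by (rule seminormed.seminormed_bochner_L2[OF V.seminormed_dual])
  obtain q \<phi> where S: "S l = (q, \<phi>)" and y: "coupled_solution T \<alpha> \<beta> state_rhs l (q, \<phi>)" and c: "q \<in> car B" "\<phi> \<in> car B"
    using S_component[OF l] .
  obtain p \<psi> where \<delta>: "\<delta>y = (p, \<psi>)" by force
  have lin: "coupled_solution T \<alpha> \<beta> (linearized_rhs q \<phi>) \<delta>l (p, \<psi>)"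
    using \<delta>y unfolding S \<delta> solves_linearized_iff[OF c] .
  have pB: "p \<in> car B" "\<psi> \<in> car B"
    using L.bochner_H10D(1)[OF coupled_solutionD(1)[OF lin]] H1_bochner_L2[OF coupled_solutionD(2)[OF lin]] .
  have "((\<lambda>\<tau>. nrm (coupled_space T) ((1 / \<tau>) *\<^sub>R (S (l + \<tau> *\<^sub>R \<delta>l) - (q, \<phi>)) - (p, \<psi>))) \<longlongrightarrow> 0) (at_right 0)"
  proof (rule coupled_differentiability[where R=state_rhs and R'="linearized_rhs q \<phi>", OF T \<alpha> \<beta> lipschitz_state_rhs l \<delta>l y])
    show "coupled_solution T \<alpha> \<beta> state_rhs (l + \<tau> *\<^sub>R \<delta>l) (S (l + \<tau> *\<^sub>R \<delta>l))" for \<tau>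
      using l \<delta>l by (intro S_solution) blast
    show "coupled_solution T \<alpha> \<beta> (linearized_rhs q \<phi>) \<delta>l (p, \<psi>)" by (rule lin)
    show "linearized_rhs q \<phi> p \<psi> \<in> car B" by (rule linearized_rhs_B[OF c pB])
    fix \<tau> :: "nat \<Rightarrow> real" assume "\<tau> \<longlonglongrightarrow> 0" "\<And>n. 0 < \<tau> n"
    then show "(\<lambda>n. nrm B ((1 / \<tau> n) *\<^sub>R (state_rhs (q + \<tau> n *\<^sub>R p) (\<phi> + \<tau> n *\<^sub>R \<psi>) - state_rhs q \<phi>) - linearized_rhs q \<phi> p \<psi>)) \<longlonglongrightarrow> 0"
      by (rule state_rhs_derivative[OF c pB])
  qed
  then show ?thesis
    using lin unfolding has_dir_derivative_def S \<delta> coupled_space_eq by (simp add: coupled_solution_def coupled_space_eq)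
qed

lemma linearized_existence:
  assumes "l \<in> car (load_space T \<Omega>)" "\<delta>l \<in> car (load_space T \<Omega>)"
  shows "\<exists>\<delta>y. solves_linearized T \<Omega> \<alpha> \<beta> \<epsilon> H H' f (S l) \<delta>l \<delta>y"
proof -
  obtain q \<phi> where S: "S l = (q, \<phi>)" and c: "q \<in> car B" "\<phi> \<in> car B" using S_component[OF assms(1)] .
  show ?thesis unfolding S solves_linearized_iff[OF c]
    by (rule coupled_existence[OF T \<alpha> \<beta> lipschitz_linearized_rhs[OF c] assms(2)])
qed

lemma linearized_unique:
  assumes l: "l \<in> car (load_space T \<Omega>)" and \<delta>l: "\<delta>l \<in> car (load_space T \<Omega>)"
    and y: "solves_linearized T \<Omega> \<alpha> \<beta> \<epsilon> H H' f (S l) \<delta>l \<delta>y" "solves_linearized T \<Omega> \<alpha> \<beta> \<epsilon> H H' f (S l) \<delta>l \<delta>y'"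
  shows "eq_in (state_space T \<Omega>) \<delta>y \<delta>y'"
proof -
  interpret W: seminormed "load_space T \<Omega>" by (rule seminormed.seminormed_bochner_L2[OF V.seminormed_dual])
  obtain q \<phi> where S: "S l = (q, \<phi>)" and c: "q \<in> car B" "\<phi> \<in> car B" using S_component[OF l] .
  have "eq_in (load_space T \<Omega>) \<delta>l \<delta>l" by (simp add: eq_in_def)
  then show ?thesis
    using coupled_uniqueness[OF T \<alpha> \<beta> lipschitz_linearized_rhs[OF c] \<delta>l \<delta>l] y
    unfolding S solves_linearized_iff[OF c] coupled_space_eq by blast
qed

text \<open>The difference quotients also converge to a solution of the linearized system, by
  \<open>linearized_existence\<close> and \<open>S_derivative\<close>. Limits agree up to seminorm
  zero, and \<open>coupled_solution_cong\<close> carries the system over to the given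
  derivative.\<close>

lemma derivative_solves_linearized:
  assumes l: "l \<in> car (load_space T \<Omega>)" and \<delta>l: "\<delta>l \<in> car (load_space T \<Omega>)"
    and d: "has_dir_derivative (state_space T \<Omega>) S l \<delta>l \<delta>y"
  shows "solves_linearized T \<Omega> \<alpha> \<beta> \<epsilon> H H' f (S l) \<delta>l \<delta>y"
proof -
  interpret W: seminormed "load_space T \<Omega>" by (rule seminormed.seminormed_bochner_L2[OF V.seminormed_dual])
  interpret Z: seminormed "state_space T \<Omega>" using seminormed_coupled_space[OF T] unfolding coupled_space_eq .
  obtain q \<phi> where S: "S l = (q, \<phi>)" and c: "q \<in> car B" "\<phi> \<in> car B" using S_component[OF l] .
  obtain y0 where y0: "solves_linearized T \<Omega> \<alpha> \<beta> \<epsilon> H H' f (S l) \<delta>l y0" using linearized_existence[OF l \<delta>l] by blast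
  note d0 = S_derivative[OF l \<delta>l y0]
  let ?Q = "\<lambda>\<tau>. (1 / \<tau>) *\<^sub>R (S (l + \<tau> *\<^sub>R \<delta>l) - S l)"
  have yc: "\<delta>y \<in> car (state_space T \<Omega>)" "y0 \<in> car (state_space T \<Omega>)"
    using d d0 by (simp_all add: has_dir_derivative_def)
  have Sc: "S k \<in> car (state_space T \<Omega>)" if "k \<in> car (load_space T \<Omega>)" for k
    using S_solution[OF that] by (simp add: coupled_solution_def coupled_space_eq)
  have Q: "?Q \<tau> \<in> car (state_space T \<Omega>)" for \<tau>
    using l \<delta>l by (intro Z.scale_car Z.diff_car Sc) blast+
  have "((\<lambda>\<tau>. nrm (state_space T \<Omega>) (?Q \<tau> - \<delta>y) + nrm (state_space T \<Omega>) (?Q \<tau> - y0)) \<longlongrightarrow> 0 + 0) (at_right 0)"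
    using d d0 unfolding has_dir_derivative_def by (intro tendsto_add) blast+
  moreover have "nrm (state_space T \<Omega>) (\<delta>y - y0) \<le> nrm (state_space T \<Omega>) (?Q \<tau> - \<delta>y) + nrm (state_space T \<Omega>) (?Q \<tau> - y0)" for \<tau>
    using Z.nrm_diff_trans[OF yc(1) Q yc(2)] Z.nrm_diff_commute[OF yc(1) Q] by simp
  ultimately have "nrm (state_space T \<Omega>) (\<delta>y - y0) \<le> 0"
    by (intro tendsto_lowerbound[where F="at_right (0::real)"]) auto
  then have "nrm (coupled_space T) (\<delta>y - y0) = 0"
    using Z.nrm_nonneg[OF Z.diff_car[OF yc]] unfolding coupled_space_eq by simp
  from coupled_solution_cong[OF T \<alpha> \<beta> lipschitz_linearized_rhs[OF c] _ _ this] show ?thesis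
    using y0 yc(1) unfolding S solves_linearized_iff[OF c] coupled_space_eq by blast
qed

end

end

theorem proposition2p6:
  fixes T \<alpha> \<beta> \<epsilon> L\<^sub>H L\<^sub>f :: real
    and \<Omega> :: "(real^'n) set"
    and H :: "'n evol \<Rightarrow> 'n evol"
    and H' :: "'n evol \<Rightarrow> 'n evol \<Rightarrow> 'n evol"
    and f :: "real \<Rightarrow> real"
  assumes "T > 0" and "\<alpha> > 0" and "\<beta> > 0" and "\<epsilon> > 0"
    and "CARD('n) = 2 \<or> CARD('n) = 3"
    and "bounded_lipschitz_domain \<Omega>"
    and "H \<in> car (bochner_L2 T (L2 \<Omega>)) \<rightarrow> car (bochner_L2 T (L2 \<Omega>))"
    and "L\<^sub>H > 0"
    and "\<And>q1 q2. q1 \<in> car (bochner_L2 T (L2 \<Omega>)) \<Longrightarrow> q2 \<in> car (bochner_L2 T (L2 \<Omega>)) \<Longrightarrow>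
      AE t in time T. nrm (L2 \<Omega>) (H q1 t - H q2 t)
        \<le> L\<^sub>H * (LINT s|lebesgue_on {0<..<t}. nrm (L2 \<Omega>) (q1 s - q2 s))"
    and "has_gateaux_derivative (bochner_L2 T (L2 \<Omega>)) (bochner_L2 T (L2 \<Omega>)) H H'"
    and "continuous_between (bochner_H1 T (L2 \<Omega>))
      (bounded_ops (bochner_L2 T (L2 \<Omega>)) (bochner_L2 T (L2 \<Omega>))) H'"
    and "L\<^sub>f > 0" and "L\<^sub>f-lipschitz_on UNIV f" and "dir_diff_real f"
  shows "let S = solution_operator T \<Omega> \<alpha> \<beta> \<epsilon> H f in
    (\<forall>l\<in>car (load_space T \<Omega>).
      solves_state T \<Omega> \<alpha> \<beta> \<epsilon> H f l (S l) \<and>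
      (\<forall>y. solves_state T \<Omega> \<alpha> \<beta> \<epsilon> H f l y \<longrightarrow> eq_in (state_space T \<Omega>) y (S l))) \<and>
    operator_between (load_space T \<Omega>) (state_space T \<Omega>) S \<and>
    directionally_differentiable (load_space T \<Omega>) (state_space T \<Omega>) S \<and>
    (\<forall>l\<in>car (load_space T \<Omega>). \<forall>\<delta>l\<in>car (load_space T \<Omega>). \<forall>\<delta>y.
      has_dir_derivative (state_space T \<Omega>) S l \<delta>l \<delta>y \<longrightarrow>
        solves_linearized T \<Omega> \<alpha> \<beta> \<epsilon> H H' f (S l) \<delta>l \<delta>y \<and>
        (\<forall>\<delta>y'. solves_linearized T \<Omega> \<alpha> \<beta> \<epsilon> H H' f (S l) \<delta>l \<delta>y' \<longrightarrow>
          eq_in (state_space T \<Omega>) \<delta>y' \<delta>y))"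
proof -
  interpret state_system \<Omega> f L\<^sub>f T \<beta> \<epsilon> L\<^sub>H H H'
    using assms by unfold_locales (simp_all add: bounded_lipschitz_domain_def L2_eq_L2_on)
  interpret W: seminormed "load_space T \<Omega>" by (rule seminormed.seminormed_bochner_L2[OF V.seminormed_dual])
  show ?thesis unfolding Let_def
  proof (intro conjI ballI allI impI)
    fix l assume l: "l \<in> car (load_space T \<Omega>)"
    show "solves_state T \<Omega> \<alpha> \<beta> \<epsilon> H f l (S \<alpha> l)"
      unfolding solves_state_iff by (rule S_solution[OF assms(2) l])
    show "eq_in (state_space T \<Omega>) y (S \<alpha> l)" if "solves_state T \<Omega> \<alpha> \<beta> \<epsilon> H f l y" for y
      using that l by (intro S_unique[OF assms(2), of l]) (simp_all add: solves_state_iff eq_in_def)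
  next
    have "S \<alpha> l \<in> car (state_space T \<Omega>)" if "l \<in> car (load_space T \<Omega>)" for l
      using S_solution[OF assms(2) that] by (simp add: coupled_solution_def coupled_space_eq)
    moreover have "eq_in (state_space T \<Omega>) (S \<alpha> l) (S \<alpha> l')"
      if "l \<in> car (load_space T \<Omega>)" "l' \<in> car (load_space T \<Omega>)" "eq_in (load_space T \<Omega>) l l'" for l l'
      by (rule S_unique[OF assms(2) that S_solution[OF assms(2) that(1)]])
    ultimately show "operator_between (load_space T \<Omega>) (state_space T \<Omega>) (S \<alpha>)"
      unfolding operator_between_def by simp
  next
    show "directionally_differentiable (load_space T \<Omega>) (state_space T \<Omega>) (S \<alpha>)"
      unfolding directionally_differentiable_def
    proof (intro ballI)
      fix l \<delta>l assume l: "l \<in> car (load_space T \<Omega>)" "\<delta>l \<in> car (load_space T \<Omega>)"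
      obtain \<delta>y where "solves_linearized T \<Omega> \<alpha> \<beta> \<epsilon> H H' f (S \<alpha> l) \<delta>l \<delta>y"
        using linearized_existence[OF assms(2) l] by blast
      from S_derivative[OF assms(2) l this] show "\<exists>d. has_dir_derivative (state_space T \<Omega>) (S \<alpha>) l \<delta>l d" by blast
    qed
  next
    fix l \<delta>l \<delta>y assume l: "l \<in> car (load_space T \<Omega>)" "\<delta>l \<in> car (load_space T \<Omega>)"
      and d: "has_dir_derivative (state_space T \<Omega>) (S \<alpha>) l \<delta>l \<delta>y"
    show s: "solves_linearized T \<Omega> \<alpha> \<beta> \<epsilon> H H' f (S \<alpha> l) \<delta>l \<delta>y"
      by (rule derivative_solves_linearized[OF assms(2) l d])
    show "eq_in (state_space T \<Omega>) \<delta>y' \<delta>y"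
      if "solves_linearized T \<Omega> \<alpha> \<beta> \<epsilon> H H' f (S \<alpha> l) \<delta>l \<delta>y'" for \<delta>y'
      by (rule linearized_unique[OF assms(2) l that s])
  qed
qed

end
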